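(* The centralizer $C_{\rm p}=\{u\in G_2:\operatorname{Ad}_uK_{\rm p}=K_{\rm p}\}$ is a two-dimensional torus. Let $Z\in\mathfrak g_2$ be a nonzero element with principal spectrum, and fix $c\neq0$ and $g\in G_2$ with $Z=c\operatorname{Ad}_gK_{\rm p}$ (such $c,g$ exist). Then $$\mathscr P_Z=\{g\,uT_\theta u^{-1}g^{-1}:u\in C_{\rm p},\ 0<\theta<\pi/2\}.$$ Every reflection in this set arises from a unique pair $(u,\theta)\in C_{\rm p}\times(0,\pi/2)$, and this parametrization is a real-analytic diffeomorphism of $C_{\rm p}\times(0,\pi/2)$ onto $\mathscr P_Z$ with the subspace topology inherited from $\mathscr C$. Hence $\mathscr P_Z$ is an embedded real-analytic submanifold of dimension three and codimension five in the eight-dimensional manifold $\mathscr C$. If $Z\in\mathfrak k_A$, then every $T\in\mathscr P_Z$ satisfies $T(H_A)\neq H_A$.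
   Context: Octonions: $\mathbb O$ has real basis $1,e_1,\dots,e_7$ with $1$ the identity, $e_i^2=-1$, and multiplication given by the oriented triples $(123),(145),(176),(246),(257),(347),(365)$: for a triple $(abc)$, $e_ae_b=e_c$, $e_be_c=e_a$, $e_ce_a=e_b$, and reversing the order changes the sign. The inner product makes $1,e_1,\dots,e_7$ orthonormal; $V=\operatorname{Im}\mathbb O$. $G_2=\operatorname{Aut}(\mathbb O)$, $\mathfrak g_2=\operatorname{Der}(\mathbb O)$ are identified with their faithful actions on $V$; $\operatorname{Ad}_gZ=gZg^{-1}$. $D_{ij}=D_{e_i,e_j}\in\mathfrak g_2$ with $D_{a,b}(x)=[[a,b],x]-3[a,b,x]$, $[a,b]=ab-ba$, $[a,b,x]=(ab)x-a(bx)$. $\operatorname{Lie}\{U,W\}$ is the smallest real Lie subalgebra containing $U,W$. A quaternionic context is a unital subalgebra $H\subset\mathbb O$ isomorphic to the quaternions; the quaternionic reflection $\sigma_H\in G_2$ is $+1$ on $H$ and $-1$ on $H^\perp$. $\mathscr C=\{\sigma_H\}=\{T\in G_2:T^2=I,\operatorname{tr}_VT=-1\}$, a compact connected real-analytic manifold identified with $G_2/SO(4)$, of dimension $8$. $H_A=\operatorname{span}\{1,e_1,e_2,e_3\}$, $\mathfrak k_A=\{Z\in\mathfrak g_2:Z(H_A)\subseteq H_A\}$. A principal $\mathfrak{su}(2)$ is a Lie subalgebra of $\mathfrak g_2$ isomorphic to $\mathfrak{su}(2)$ acting irreducibly on $V$. $Z$ has principal spectrum if its complex spectrum on $V$ is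 $0,\pm i\lambda,\pm2i\lambda,\pm3i\lambda$ for some $\lambda>0$. $\mathscr P_Z=\{T\in\mathscr C:\operatorname{Lie}\{Z,TZT\}\text{ is a principal }\mathfrak{su}(2)\}$. Set $K_{\rm p}=\tfrac56D_{23}+\tfrac23D_{45}$, $\quad P_{\rm p}=\tfrac{\sqrt6}{4}D_{14}+\tfrac{\sqrt{10}}6\bigl(\tfrac12D_{17}+D_{24}\bigr)$, and $T_\theta=\exp\bigl(\pi(\cos\theta\,K_{\rm p}+\sin\theta\,P_{\rm p})\bigr)$, which is a quaternionic reflection for every $\theta\in\mathbb R$. *)

theory Defs
  imports "HOL-Analysis.Analysis"
begin

text \<open>
  An octonion is a pair of its real part and its imaginary part, so the imaginary octonions \<open>V\<close>
  are \<open>real^7\<close>, and the product inner product makes \<open>1, e\<^sub>1, ..., e\<^sub>7\<close> orthonormal.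
  The index type \<open>7\<close> is arithmetic modulo \<open>7\<close>; the numerals \<open>1, ..., 7\<close> denote its seven
  distinct elements (with \<open>7 = 0\<close>), so \<open>e 7\<close> is a genuine seventh basis vector.
\<close>

type_synonym octonion = "real \<times> (real^7)"

definition e :: "7 \<Rightarrow> octonion" where
  "e i = (0, axis i 1)"

definition oriented_triples :: "(7 \<times> 7 \<times> 7) set" where
  "oriented_triples = {(1,2,3), (1,4,5), (1,7,6), (2,4,6), (2,5,7), (3,4,7), (3,6,5)}"

text \<open>\<open>oct_eps i j k\<close> is the coefficient of \<open>e k\<close> in \<open>e i \<cdot> e j\<close> for \<open>i \<noteq> j\<close>.\<close>

definition oct_eps :: "7 \<Rightarrow> 7 \<Rightarrow> 7 \<Rightarrow> real" where
  "oct_eps i j k =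
    (if {(i,j,k), (j,k,i), (k,i,j)} \<inter> oriented_triples \<noteq> {} then 1
     else if {(j,i,k), (i,k,j), (k,j,i)} \<inter> oriented_triples \<noteq> {} then -1
     else 0)"

definition imag_product :: "real^7 \<Rightarrow> real^7 \<Rightarrow> real^7" where
  "imag_product u v = (\<chi> k. \<Sum>i\<in>UNIV. \<Sum>j\<in>UNIV. oct_eps i j k * u$i * v$j)"

definition oct_mult :: "octonion \<Rightarrow> octonion \<Rightarrow> octonion" (infixl \<open>\<odot>\<close> 70) where
  "x \<odot> y = (fst x * fst y - snd x \<bullet> snd y,
             fst x *\<^sub>R snd y + fst y *\<^sub>R snd x + imag_product (snd x) (snd y))"

definition oct_one :: octonion where
  "oct_one = (1, 0)"

definition oct_commutator :: "octonion \<Rightarrow> octonion \<Rightarrow> octonion" where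
  "oct_commutator a b = a \<odot> b - b \<odot> a"

definition oct_associator :: "octonion \<Rightarrow> octonion \<Rightarrow> octonion \<Rightarrow> octonion" where
  "oct_associator a b x = (a \<odot> b) \<odot> x - a \<odot> (b \<odot> x)"

definition octonion_automorphism :: "(octonion \<Rightarrow> octonion) \<Rightarrow> bool" where
  "octonion_automorphism \<phi> \<longleftrightarrow> linear \<phi> \<and> bij \<phi> \<and> (\<forall>x y. \<phi> (x \<odot> y) = \<phi> x \<odot> \<phi> y)"

definition octonion_derivation :: "(octonion \<Rightarrow> octonion) \<Rightarrow> bool" where
  "octonion_derivation \<delta> \<longleftrightarrow> linear \<delta> \<and> (\<forall>x y. \<delta> (x \<odot> y) = \<delta> x \<odot> y + x \<odot> \<delta> y)"

text \<open>
  Automorphisms fix \<open>1\<close> and preserve \<open>V\<close>; derivations kill \<open>1\<close> and preserve \<open>V\<close>.  Both are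
  identified with the matrix of their action on \<open>V\<close>.  The next two maps recover the action on
  all octonions from that matrix.
\<close>

definition aut_action :: "real^7^7 \<Rightarrow> octonion \<Rightarrow> octonion" where
  "aut_action A x = (fst x, A *v snd x)"

definition der_action :: "real^7^7 \<Rightarrow> octonion \<Rightarrow> octonion" where
  "der_action Z x = (0, Z *v snd x)"

definition G2 :: "(real^7^7) set" where
  "G2 = {A. octonion_automorphism (aut_action A)}"

definition g2 :: "(real^7^7) set" where
  "g2 = {Z. octonion_derivation (der_action Z)}"

definition Ad :: "real^7^7 \<Rightarrow> real^7^7 \<Rightarrow> real^7^7" where
  "Ad g Z = g ** Z ** matrix_inv g"

definition oct_D :: "octonion \<Rightarrow> octonion \<Rightarrow> octonion \<Rightarrow> octonion" where
  "oct_D a b x = oct_commutator (oct_commutator a b) x - 3 *\<^sub>R oct_associator a b x"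

definition D :: "7 \<Rightarrow> 7 \<Rightarrow> real^7^7" where
  "D i j = matrix (\<lambda>v. snd (oct_D (e i) (e j) (0, v)))"

definition lie_bracket :: "'a::ring_1^'n^'n \<Rightarrow> 'a^'n^'n \<Rightarrow> 'a^'n^'n" where
  "lie_bracket X Y = X ** Y - Y ** X"

definition lie_subalgebra :: "(real^'n^'n) set \<Rightarrow> bool" where
  "lie_subalgebra L \<longleftrightarrow> subspace L \<and> (\<forall>X\<in>L. \<forall>Y\<in>L. lie_bracket X Y \<in> L)"

definition generated_lie_algebra :: "real^'n^'n \<Rightarrow> real^'n^'n \<Rightarrow> (real^'n^'n) set" where
  "generated_lie_algebra U W = lie_subalgebra hull {U, W}"

definition su2 :: "(complex^2^2) set" where
  "su2 = {X. (\<forall>i j. X$j$i = - cnj (X$i$j)) \<and> trace X = 0}"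

text \<open>A real-linear map on the subspace \<open>su2\<close> is represented by a real-linear extension to all
  matrices; only its values on \<open>su2\<close> matter.\<close>

definition isomorphic_to_su2 :: "(real^'n^'n) set \<Rightarrow> bool" where
  "isomorphic_to_su2 L \<longleftrightarrow>
    (\<exists>\<phi> :: complex^2^2 \<Rightarrow> real^'n^'n. linear \<phi> \<and> bij_betw \<phi> su2 L \<and>
      (\<forall>X\<in>su2. \<forall>Y\<in>su2. \<phi> (lie_bracket X Y) = lie_bracket (\<phi> X) (\<phi> Y)))"

definition acts_irreducibly :: "(real^'n^'n) set \<Rightarrow> bool" where
  "acts_irreducibly L \<longleftrightarrow>
    (\<forall>W :: (real^'n) set. subspace W \<and> (\<forall>X\<in>L. \<forall>w\<in>W. X *v w \<in> W) \<longrightarrow> W = {0} \<or> W = UNIV)"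

definition principal_su2 :: "(real^7^7) set \<Rightarrow> bool" where
  "principal_su2 L \<longleftrightarrow> lie_subalgebra L \<and> L \<subseteq> g2 \<and> isomorphic_to_su2 L \<and> acts_irreducibly L"

definition complex_spectrum :: "real^'n^'n \<Rightarrow> complex set" where
  "complex_spectrum A =
    {\<mu>. \<exists>v :: complex^'n. v \<noteq> 0 \<and> (\<chi> i j. complex_of_real (A$i$j)) *v v = \<mu> *s v}"

text \<open>The seven listed eigenvalues are distinct, so on the seven-dimensional space \<open>V\<close> equality
  of sets already forces all of them to be simple.\<close>

definition principal_spectrum :: "real^7^7 \<Rightarrow> bool" where
  "principal_spectrum Z \<longleftrightarrow>
    (\<exists>l>0. complex_spectrum Z =
      {0, \<i> * of_real l, - (\<i> * of_real l), 2 * \<i> * of_real l, - (2 * \<i> * of_real l),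
       3 * \<i> * of_real l, - (3 * \<i> * of_real l)})"

type_synonym quaternion = "real \<times> (real^3)"

definition quat_mult :: "quaternion \<Rightarrow> quaternion \<Rightarrow> quaternion" where
  "quat_mult p q = (fst p * fst q - snd p \<bullet> snd q,
                    fst p *\<^sub>R snd q + fst q *\<^sub>R snd p + cross3 (snd p) (snd q))"

definition quaternionic_context :: "octonion set \<Rightarrow> bool" where
  "quaternionic_context H \<longleftrightarrow>
    subspace H \<and> oct_one \<in> H \<and> (\<forall>x\<in>H. \<forall>y\<in>H. x \<odot> y \<in> H) \<and>
    (\<exists>\<phi> :: quaternion \<Rightarrow> octonion. linear \<phi> \<and> bij_betw \<phi> UNIV H \<and> \<phi> (1, 0) = oct_one \<and>
      (\<forall>p q. \<phi> (quat_mult p q) = \<phi> p \<odot> \<phi> q))"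

definition is_quaternionic_reflection :: "octonion set \<Rightarrow> real^7^7 \<Rightarrow> bool" where
  "is_quaternionic_reflection H T \<longleftrightarrow>
    T \<in> G2 \<and> (\<forall>x\<in>H. aut_action T x = x) \<and>
    (\<forall>x. (\<forall>h\<in>H. orthogonal x h) \<longrightarrow> aut_action T x = - x)"

definition reflections :: "(real^7^7) set" where
  "reflections = {T. \<exists>H. quaternionic_context H \<and> is_quaternionic_reflection H T}"

definition H_A :: "octonion set" where
  "H_A = span {oct_one, e 1, e 2, e 3}"

definition k_A :: "(real^7^7) set" where
  "k_A = {Z \<in> g2. der_action Z ` H_A \<subseteq> H_A}"

definition principal_partners :: "real^7^7 \<Rightarrow> (real^7^7) set" where
  "principal_partners Z = {T \<in> reflections. principal_su2 (generated_lie_algebra Z (T ** Z ** T))}"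

definition mat_exp :: "real^'n^'n \<Rightarrow> real^'n^'n" where
  "mat_exp A = (\<Sum>n. (1 / fact n) *\<^sub>R (((**) A ^^ n) (mat 1)))"

definition K_p :: "real^7^7" where
  "K_p = (5/6) *\<^sub>R D 2 3 + (2/3) *\<^sub>R D 4 5"

definition P_p :: "real^7^7" where
  "P_p = (sqrt 6 / 4) *\<^sub>R D 1 4 + (sqrt 10 / 6) *\<^sub>R ((1/2) *\<^sub>R D 1 7 + D 2 4)"

definition T_refl :: "real \<Rightarrow> real^7^7" where
  "T_refl \<theta> = mat_exp (pi *\<^sub>R (cos \<theta> *\<^sub>R K_p + sin \<theta> *\<^sub>R P_p))"

definition C_p :: "(real^7^7) set" where
  "C_p = {u \<in> G2. Ad u K_p = K_p}"

definition conjugate_reflection :: "real^7^7 \<Rightarrow> real^7^7 \<Rightarrow> real \<Rightarrow> real^7^7" where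
  "conjugate_reflection g u \<theta> = g ** u ** T_refl \<theta> ** matrix_inv u ** matrix_inv g"

text \<open>
  Convergent power series expansion about \<open>a\<close> in the coordinates of a Euclidean space; the
  multi-indices are the functions from \<open>Basis\<close> to the natural numbers.
\<close>

definition real_analytic_at :: "('a::euclidean_space \<Rightarrow> 'b::euclidean_space) \<Rightarrow> 'a \<Rightarrow> bool" where
  "real_analytic_at f a \<longleftrightarrow>
    (\<exists>r>0. \<exists>c :: ('a \<Rightarrow> nat) \<Rightarrow> 'b. \<forall>x\<in>ball a r.
      ((\<lambda>\<alpha>. (\<Prod>b\<in>Basis. ((x - a) \<bullet> b) ^ \<alpha> b) *\<^sub>R c \<alpha>) has_sum f x) (Basis \<rightarrow>\<^sub>E UNIV))"

text \<open>
  All manifolds involved are embedded in Euclidean spaces (of matrices, of complex vectors, and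
  products of these with the reals) and carry the induced topology and analytic structure.  A map
  between subsets of Euclidean spaces is analytic if near every point of its domain it extends to
  an analytic map on an open set of the ambient space.
\<close>

definition real_analytic_on :: "('a::euclidean_space \<Rightarrow> 'b::euclidean_space) \<Rightarrow> 'a set \<Rightarrow> bool" where
  "real_analytic_on f S \<longleftrightarrow>
    (\<forall>a\<in>S. \<exists>U F. open U \<and> a \<in> U \<and> (\<forall>x\<in>U. real_analytic_at F x) \<and> (\<forall>x\<in>U \<inter> S. F x = f x))"

definition analytic_diffeomorphism ::
    "('a::euclidean_space \<Rightarrow> 'b::euclidean_space) \<Rightarrow> 'a set \<Rightarrow> 'b set \<Rightarrow> bool" where
  "analytic_diffeomorphism f S T \<longleftrightarrow>
    (\<exists>h. homeomorphism S T f h \<and> real_analytic_on f S \<and> real_analytic_on h T)"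

text \<open>Analytic submanifold of a Euclidean space, modelled on the Euclidean space \<open>'m\<close>, whose
  dimension is its dimension.\<close>

definition analytic_manifold :: "'m::euclidean_space itself \<Rightarrow> 'a::euclidean_space set \<Rightarrow> bool" where
  "analytic_manifold _ M \<longleftrightarrow>
    (\<forall>p\<in>M. \<exists>U (V :: 'm set) f. openin (top_of_set M) U \<and> p \<in> U \<and> open V \<and>
      analytic_diffeomorphism f U V)"

text \<open>\<open>S\<close> is an embedded analytic submanifold of dimension \<open>k\<close> and codimension \<open>l\<close> in the analytic
  manifold \<open>M\<close>, expressed by slice charts.\<close>

definition embedded_analytic_submanifold ::
    "'m::euclidean_space itself \<Rightarrow> nat \<Rightarrow> nat \<Rightarrow> 'a::euclidean_space set \<Rightarrow> 'a set \<Rightarrow> bool" where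
  "embedded_analytic_submanifold _ k l M S \<longleftrightarrow>
    analytic_manifold TYPE('m) M \<and> DIM('m) = k + l \<and> S \<subseteq> M \<and>
    (\<forall>p\<in>S. \<exists>U (V :: 'm set) f W. openin (top_of_set M) U \<and> p \<in> U \<and> open V \<and>
      analytic_diffeomorphism f U V \<and> subspace W \<and> dim W = k \<and> f ` (U \<inter> S) = V \<inter> W)"

text \<open>A matrix group that is a torus of dimension two: it is isomorphic as a Lie group to the
  product of two circles, on which \<open>z * w\<close> is the componentwise product.\<close>

definition two_dim_torus :: "(real^'n^'n) set \<Rightarrow> bool" where
  "two_dim_torus C \<longleftrightarrow>
    (\<exists>\<phi> :: complex^2 \<Rightarrow> real^'n^'n.
      analytic_diffeomorphism \<phi> {z. \<forall>i. cmod (z$i) = 1} C \<and>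
      (\<forall>z w. (\<forall>i. cmod (z$i) = 1) \<and> (\<forall>i. cmod (w$i) = 1) \<longrightarrow> \<phi> (z * w) = \<phi> z ** \<phi> w))"

end

theory Submission
  imports Defs "HOL-Complex_Analysis.Cauchy_Integral_Formula"
begin

text \<open>
  \<open>K_p\<close> acts on \<open>V\<close> with weights \<open>0, \<plusminus>1, \<plusminus>2, \<plusminus>3\<close>, so its centralizer is a maximal torus.  If \<open>K_p\<close> and
  \<open>T K_p T = a K_p + Y\<close>, with \<open>Y\<close> orthogonal to \<open>K_p\<close>, generate a principal \<open>su(2)\<close>, then \<open>ad K_p\<close> squares to
  \<open>- \<kappa>\<^sup>2\<close> on \<open>Y\<close>; irreducibility forces \<open>\<kappa> = 1\<close>, and the bracket of \<open>Y\<close> with \<open>[K_p, Y]\<close> fixes the ratio of the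
  moduli of the two simple root components of \<open>Y\<close>.  The torus acts simply transitively on their arguments, so
  \<open>T K_p T = cos (2\<theta>) K_p + sin (2\<theta>) Ad\<^sub>u P_p\<close> for a unique \<open>u\<close> in the torus, which is also the conjugate of
  \<open>K_p\<close> by \<open>u T\<^sub>\<theta> u\<inverse>\<close>.  Only the identity commutes with both \<open>K_p\<close> and \<open>Ad\<^sub>u P_p\<close>, hence \<open>T = u T\<^sub>\<theta> u\<inverse>\<close>, and
  \<open>(u, \<theta>)\<close> is read off analytically from the entries of \<open>T K_p T\<close>.  For a general \<open>Z\<close>, the eigenvectors of its
  principal spectrum provide an orthonormal triple generating the octonions and thereby \<open>g\<close> with \<open>Z = c Ad\<^sub>g K_p\<close>.
\<close>

section \<open>Absolutely convergent power series in several variables\<close>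

text \<open>A principal su(2) has integral weights on \<open>V\<close> in the scaling of
  \<open>K_p\<close>, and the relation \<open>[P, [K_p, P]] = K_p\<close> then forces the squared
  moduli 3/2 and 5/2 of the root components: hence the roots of 6 and 10 in \<open>P_p\<close>. With
  \<open>Q_p = [K_p, P_p]\<close>, the exponent of \<open>T_refl \<theta>\<close> is \<pi> times the
  conjugate of \<open>K_p\<close> by \<open>exp (\<theta> Q_p)\<close>, so
  \<open>T_refl \<theta>\<close> is a conjugate of \<open>exp (\<pi> K_p)\<close>, the reflection of
  \<open>H_A\<close>. It mirrors the plane of \<open>K_p\<close> and \<open>P_p\<close> in the line
  at angle \<theta>; this is why angles double and why positivity of the sine selects the interval
  from 0 to \<pi>/2. The analytic half is shaped by the definition of analyticity through
  unconditionally convergent series in several variables: composition and the inverse function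
  theorem behind slice charts are proved in a norm on such series. Dimension 8 arises because a
  reflection is determined by two vectors of its fixed three-space, the third being their product;
  near a base point these have 4 + 4 free coordinates. The last claim is irreducibility again, since
  a common invariant \<open>H_A\<close> would give an invariant three-space.\<close>

definition multi_indices :: "('a::euclidean_space \<Rightarrow> nat) set" where
  "multi_indices = (Basis \<rightarrow>\<^sub>E UNIV)"

definition mdeg :: "('a::euclidean_space \<Rightarrow> nat) \<Rightarrow> nat" where
  "mdeg \<alpha> = (\<Sum>b\<in>Basis. \<alpha> b)"

definition mmono :: "('a::euclidean_space \<Rightarrow> nat) \<Rightarrow> 'a \<Rightarrow> real" where
  "mmono \<alpha> h = (\<Prod>b\<in>Basis. (h \<bullet> b) ^ \<alpha> b)"

text \<open>Sup-norm balls, because there every monomial of degree n is bounded by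
  \<open>r ^ n\<close>, so one weighted sum of coefficients controls the whole series.\<close>

definition cube :: "'a::euclidean_space \<Rightarrow> real \<Rightarrow> 'a set" where
  "cube a r = {x. \<forall>b\<in>Basis. \<bar>(x - a) \<bullet> b\<bar> \<le> r}"

text \<open>The least such \<open>M\<close> is an \<open>\<ell>\<^sup>1\<close>-norm, for which the power series at radius \<open>r\<close> form a Banach algebra.\<close>

definition majorized :: "('a::euclidean_space \<Rightarrow> real) \<Rightarrow> 'a \<Rightarrow> real \<Rightarrow> real \<Rightarrow> bool" where
  "majorized f a r M \<longleftrightarrow> (\<exists>c S. S \<le> M \<and>
     ((\<lambda>\<alpha>. \<bar>c \<alpha>\<bar> * r ^ mdeg \<alpha>) has_sum S) multi_indices \<and>
     (\<forall>x\<in>cube a r. ((\<lambda>\<alpha>. mmono \<alpha> (x - a) * c \<alpha>) has_sum f x) multi_indices))"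

lemma mmono_add: "mmono (\<lambda>b. \<alpha> b + \<beta> b) h = mmono \<alpha> h * mmono \<beta> h"
  by (simp add: mmono_def power_add prod.distrib)

lemma mdeg_add: "mdeg (\<lambda>b. \<alpha> b + \<beta> b) = mdeg \<alpha> + mdeg \<beta>"
  by (simp add: mdeg_def sum.distrib)

lemma mmono_restrict [simp]: "mmono (restrict \<alpha> Basis) h = mmono \<alpha> h"
  by (simp add: mmono_def)

lemma mdeg_restrict [simp]: "mdeg (restrict \<alpha> Basis) = mdeg \<alpha>"
  by (simp add: mdeg_def)

lemma restrict_multi_indices [simp]: "restrict \<alpha> Basis \<in> multi_indices"
  by (simp add: multi_indices_def)

lemma mmono_bound:
  assumes "x \<in> cube a r" "0 \<le> r"
  shows "\<bar>mmono \<alpha> (x - a)\<bar> \<le> r ^ mdeg \<alpha>"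
proof -
  have "\<bar>mmono \<alpha> (x - a)\<bar> = (\<Prod>b\<in>Basis. \<bar>(x - a) \<bullet> b\<bar> ^ \<alpha> b)"
    by (simp add: mmono_def abs_prod power_abs)
  also have "\<dots> \<le> (\<Prod>b\<in>Basis. r ^ \<alpha> b)"
    using assms by (intro prod_mono) (auto simp: cube_def intro!: power_mono)
  finally show ?thesis by (simp add: mdeg_def power_sum)
qed

lemma cube_mono: "s \<le> r \<Longrightarrow> cube a s \<subseteq> cube a r"
  by (force simp: cube_def)

lemma center_in_cube [simp]: "0 \<le> r \<Longrightarrow> a \<in> cube a r"
  by (simp add: cube_def)

lemma ball_subset_cube: "ball a r \<subseteq> cube a r"
proof
  fix x assume "x \<in> ball a r"
  then have "norm (x - a) < r" by (simp add: dist_norm norm_minus_commute)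
  then show "x \<in> cube a r"
    unfolding cube_def by (smt (verit) Basis_le_norm mem_Collect_eq)
qed

lemma cube_subset_ball:
  assumes "0 < r" shows "cube a (r / (2 * DIM('a))) \<subseteq> ball (a::'a::euclidean_space) r"
proof
  fix x assume x: "x \<in> cube a (r / (2 * DIM('a)))"
  have "norm (x - a) \<le> (\<Sum>b\<in>Basis. \<bar>(x - a) \<bullet> b\<bar>)" by (rule norm_le_l1)
  also have "\<dots> \<le> (\<Sum>b\<in>(Basis::'a set). r / (2 * DIM('a)))"
    using x by (intro sum_mono) (auto simp: cube_def)
  also have "\<dots> = r / 2" by simp
  finally show "x \<in> ball a r" using assms by (simp add: dist_norm norm_minus_commute)
qed

text \<open>Intermediate series come indexed by pairs or by sums of indices, so one monomial may
  occur many times. Collecting equal monomials is legitimate by absolute summability, and the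
  triangle inequality keeps the norm from growing.\<close>

lemma majorizedI_family:
  fixes c :: "'i \<Rightarrow> real" and \<beta> :: "'i \<Rightarrow> 'a::euclidean_space \<Rightarrow> nat"
  assumes r: "0 < r"
    and S: "((\<lambda>j. \<bar>c j\<bar> * r ^ mdeg (\<beta> j)) has_sum S) J" "S \<le> M"
    and f: "\<And>x. x \<in> cube a r \<Longrightarrow> ((\<lambda>j. mmono (\<beta> j) (x - a) * c j) has_sum f x) J"
  shows "majorized f a r M"
proof -
  \<comment> \<open>Multi-indices are extensional outside \<open>Basis\<close>; exponents are
    restricted so that equal monomials land in the same fibre \<open>B \<alpha>\<close>.\<close>
  define \<gamma> where "\<gamma> j = restrict (\<beta> j) Basis" for j
  define B where "B \<alpha> = {j\<in>J. \<gamma> j = \<alpha>}" for \<alpha>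
  define C where "C \<alpha> = infsum c (B \<alpha>)" for \<alpha>
  have bij: "bij_betw (\<lambda>j. (\<gamma> j, j)) J (Sigma multi_indices B)"
    by (rule bij_betwI[where g=snd]) (auto simp: B_def \<gamma>_def)
  have sig: "((\<lambda>p. g (snd p)) has_sum s) (Sigma multi_indices B)" if "(g has_sum s) J" for g and s :: real
    using has_sum_reindex_bij_betw[OF bij, of "\<lambda>p. g (snd p)" s] that by simp
  have sub: "B \<alpha> \<subseteq> J" for \<alpha> by (auto simp: B_def)
  have mB: "mmono (\<beta> j) h = mmono \<alpha> h" "mdeg (\<beta> j) = mdeg \<alpha>" if "j \<in> B \<alpha>" for j \<alpha> h
    using that mmono_restrict[of "\<beta> j"] mdeg_restrict[of "\<beta> j"] by (auto simp: B_def \<gamma>_def)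
  have abs: "(\<lambda>j. \<bar>c j\<bar>) summable_on B \<alpha>" for \<alpha>
  proof -
    have "(\<lambda>j. \<bar>c j\<bar> * r ^ mdeg (\<beta> j)) summable_on B \<alpha>"
      by (rule summable_on_subset[OF has_sum_imp_summable[OF S(1)] sub])
    then have "(\<lambda>j. \<bar>c j\<bar> * r ^ mdeg \<alpha>) summable_on B \<alpha>"
      by (rule summable_on_cong[THEN iffD1, rotated]) (simp add: mB)
    then show ?thesis using r by (simp add: summable_on_cmult_left')
  qed
  have Csum: "(c has_sum C \<alpha>) (B \<alpha>)" for \<alpha>
    unfolding C_def using abs[of \<alpha>] by (simp add: abs_summable_summable)
  have 1: "((\<lambda>\<alpha>. infsum (\<lambda>j. \<bar>c j\<bar>) (B \<alpha>) * r ^ mdeg \<alpha>) has_sum S) multi_indices"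
  proof (rule has_sum_SigmaD[OF sig[OF S(1)]])
    fix \<alpha>
    have "((\<lambda>j. \<bar>c j\<bar> * r ^ mdeg \<alpha>) has_sum infsum (\<lambda>j. \<bar>c j\<bar>) (B \<alpha>) * r ^ mdeg \<alpha>) (B \<alpha>)"
      by (intro has_sum_cmult_left has_sum_infsum abs)
    then show "((\<lambda>y. \<bar>c (snd (\<alpha>, y))\<bar> * r ^ mdeg (\<beta> (snd (\<alpha>, y)))) has_sum
         infsum (\<lambda>j. \<bar>c j\<bar>) (B \<alpha>) * r ^ mdeg \<alpha>) (B \<alpha>)"
      by (rule has_sum_cong[THEN iffD1, rotated]) (simp add: mB)
  qed
  have le: "\<bar>C \<alpha>\<bar> * r ^ mdeg \<alpha> \<le> infsum (\<lambda>j. \<bar>c j\<bar>) (B \<alpha>) * r ^ mdeg \<alpha>" for \<alpha>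
    using norm_infsum_bound[of c "B \<alpha>"] abs[of \<alpha>] r by (auto intro!: mult_right_mono simp: C_def)
  have 2: "(\<lambda>\<alpha>. \<bar>C \<alpha>\<bar> * r ^ mdeg \<alpha>) summable_on multi_indices"
    by (rule summable_on_comparison_test[OF has_sum_imp_summable[OF 1] le]) (use r in auto)
  then have 3: "((\<lambda>\<alpha>. \<bar>C \<alpha>\<bar> * r ^ mdeg \<alpha>) has_sum infsum (\<lambda>\<alpha>. \<bar>C \<alpha>\<bar> * r ^ mdeg \<alpha>) multi_indices) multi_indices"
    by simp
  have "((\<lambda>\<alpha>. mmono \<alpha> (x - a) * C \<alpha>) has_sum f x) multi_indices" if "x \<in> cube a r" for x
  proof (rule has_sum_SigmaD[OF sig[OF f[OF that]]])
    fix \<alpha>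
    have "((\<lambda>j. mmono \<alpha> (x - a) * c j) has_sum mmono \<alpha> (x - a) * C \<alpha>) (B \<alpha>)"
      by (intro has_sum_cmult_right Csum)
    then show "((\<lambda>y. mmono (\<beta> (snd (\<alpha>, y))) (x - a) * c (snd (\<alpha>, y))) has_sum mmono \<alpha> (x - a) * C \<alpha>) (B \<alpha>)"
      by (rule has_sum_cong[THEN iffD1, rotated]) (simp add: mB)
  qed
  then show ?thesis
    unfolding majorized_def using has_sum_mono[OF 3 1 le] S(2) 3 by (meson order_trans)
qed

lemma majorized_nonneg:
  assumes "majorized f a r M" "0 < r" shows "0 \<le> M"
proof -
  obtain c S where S: "S \<le> M" "((\<lambda>\<alpha>. \<bar>c \<alpha>\<bar> * r ^ mdeg \<alpha>) has_sum S) (multi_indices::('a\<Rightarrow>nat) set)"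
    using assms(1) unfolding majorized_def by auto
  have "0 \<le> S" by (rule has_sum_nonneg[OF S(2)]) (use assms in auto)
  then show ?thesis using S by simp
qed

lemma majorized_weaken: "majorized f a r M \<Longrightarrow> M \<le> N \<Longrightarrow> majorized f a r N"
  unfolding majorized_def by (meson order_trans)

lemma majorized_bound:
  assumes "majorized f a r M" "0 < r" "x \<in> cube a r" shows "\<bar>f x\<bar> \<le> M"
proof -
  obtain c S where S: "S \<le> M" "((\<lambda>\<alpha>. \<bar>c \<alpha>\<bar> * r ^ mdeg \<alpha>) has_sum S) multi_indices"
    and f: "((\<lambda>\<alpha>. mmono \<alpha> (x - a) * c \<alpha>) has_sum f x) multi_indices"
    using assms unfolding majorized_def by blast
  have le: "\<bar>mmono \<alpha> (x - a) * c \<alpha>\<bar> \<le> \<bar>c \<alpha>\<bar> * r ^ mdeg \<alpha>" for \<alpha>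
    using mmono_bound[OF assms(3), of \<alpha>] assms(2) by (simp add: abs_mult mult.commute mult_left_mono)
  have "f x \<le> S" by (rule has_sum_mono[OF f S(2)]) (meson abs_le_D1 le)
  moreover have "- f x \<le> S"
    by (rule has_sum_mono[OF has_sum_uminusI[OF f] S(2)]) (meson abs_le_D2 le)
  ultimately show ?thesis using S(1) by linarith
qed

lemma majorized_shrink:
  assumes "majorized f a r M" "0 < s" "s \<le> r" shows "majorized f a s M"
proof -
  obtain c S where S: "S \<le> M" "((\<lambda>\<alpha>. \<bar>c \<alpha>\<bar> * r ^ mdeg \<alpha>) has_sum S) multi_indices"
    and f: "\<And>x. x \<in> cube a r \<Longrightarrow> ((\<lambda>\<alpha>. mmono \<alpha> (x - a) * c \<alpha>) has_sum f x) multi_indices"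
    using assms unfolding majorized_def by blast
  have le: "\<bar>c \<alpha>\<bar> * s ^ mdeg \<alpha> \<le> \<bar>c \<alpha>\<bar> * r ^ mdeg \<alpha>" for \<alpha>
    using assms by (intro mult_left_mono power_mono) auto
  have "(\<lambda>\<alpha>. \<bar>c \<alpha>\<bar> * s ^ mdeg \<alpha>) summable_on multi_indices"
    by (rule summable_on_comparison_test[OF has_sum_imp_summable[OF S(2)] le]) (use assms in auto)
  then have *: "((\<lambda>\<alpha>. \<bar>c \<alpha>\<bar> * s ^ mdeg \<alpha>) has_sum infsum (\<lambda>\<alpha>. \<bar>c \<alpha>\<bar> * s ^ mdeg \<alpha>) multi_indices) multi_indices"
    by simp
  show ?thesis
    using has_sum_mono[OF * S(2) le] S(1) * f cube_mono[OF assms(3)]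
    unfolding majorized_def by (meson order_trans subsetD)
qed

text \<open>Without a constant term every monomial has degree at least one, so shrinking the radius
  by \<open>t\<close> gains a full factor \<open>t\<close> in the norm. Composition uses this to fit
  the inner series into the outer radius.\<close>

lemma majorized_scale:
  assumes "majorized f a r M" "0 < r" "0 < t" "t \<le> 1" "f a = 0" shows "majorized f a (t * r) (t * M)"
proof -
  obtain c S where S: "S \<le> M" "((\<lambda>\<alpha>. \<bar>c \<alpha>\<bar> * r ^ mdeg \<alpha>) has_sum S) multi_indices"
    and f: "\<And>x. x \<in> cube a r \<Longrightarrow> ((\<lambda>\<alpha>. mmono \<alpha> (x - a) * c \<alpha>) has_sum f x) multi_indices"
    using assms unfolding majorized_def by blast
  define z :: "'a \<Rightarrow> nat" where "z = restrict (\<lambda>_. 0) Basis"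
  have z: "z \<in> multi_indices" by (simp add: z_def)
  have m0: "mmono \<alpha> 0 = 0" if "\<alpha> \<in> multi_indices" "\<alpha> \<noteq> z" for \<alpha>
  proof -
    have "\<exists>b\<in>Basis. \<alpha> b \<noteq> 0"
    proof (rule ccontr)
      assume "\<not> ?thesis"
      then have "\<alpha> = z" using that(1) unfolding z_def multi_indices_def PiE_def extensional_def
        by (auto simp: fun_eq_iff)
      then show False using that by simp
    qed
    then show ?thesis by (auto simp: mmono_def)
  qed
  have "((\<lambda>\<alpha>. mmono \<alpha> (a - a) * c \<alpha>) has_sum c z) multi_indices"
    by (rule has_sum_finite_neutralI[of "{z}"]) (use z m0 in \<open>auto simp: mmono_def z_def\<close>)
  moreover have "((\<lambda>\<alpha>. mmono \<alpha> (a - a) * c \<alpha>) has_sum 0) multi_indices"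
    using f[of a] assms by simp
  ultimately have cz: "c z = 0" using has_sum_unique by blast
  have le: "\<bar>c \<alpha>\<bar> * (t * r) ^ mdeg \<alpha> \<le> t * (\<bar>c \<alpha>\<bar> * r ^ mdeg \<alpha>)" if "\<alpha> \<in> multi_indices" for \<alpha>
  proof (cases "\<alpha> = z")
    case False
    then have "\<exists>b\<in>Basis. \<alpha> b \<noteq> 0" using m0[OF that] by (auto simp: mmono_def)
    then have "1 \<le> mdeg \<alpha>" unfolding mdeg_def
      by (metis One_nat_def Suc_leI bot_nat_0.not_eq_extremum finite_Basis sum_eq_0_iff)
    then have "t ^ mdeg \<alpha> \<le> t ^ 1" using assms by (intro power_decreasing) auto
    then have "(\<bar>c \<alpha>\<bar> * r ^ mdeg \<alpha>) * t ^ mdeg \<alpha> \<le> (\<bar>c \<alpha>\<bar> * r ^ mdeg \<alpha>) * t"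
      using assms by (intro mult_left_mono) auto
    then show ?thesis by (simp add: power_mult_distrib mult_ac)
  qed (simp add: cz)
  have 1: "((\<lambda>\<alpha>. t * (\<bar>c \<alpha>\<bar> * r ^ mdeg \<alpha>)) has_sum t * S) multi_indices"
    by (intro has_sum_cmult_right S)
  have "(\<lambda>\<alpha>. \<bar>c \<alpha>\<bar> * (t * r) ^ mdeg \<alpha>) summable_on multi_indices"
    by (rule summable_on_comparison_test[OF has_sum_imp_summable[OF 1] le]) (use assms in auto)
  then have *: "((\<lambda>\<alpha>. \<bar>c \<alpha>\<bar> * (t * r) ^ mdeg \<alpha>) has_sum infsum (\<lambda>\<alpha>. \<bar>c \<alpha>\<bar> * (t * r) ^ mdeg \<alpha>) multi_indices) multi_indices"
    by simp
  have "t * r \<le> r" using assms by simp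
  then have "cube a (t * r) \<subseteq> cube a r" by (rule cube_mono)
  moreover have "infsum (\<lambda>\<alpha>. \<bar>c \<alpha>\<bar> * (t * r) ^ mdeg \<alpha>) multi_indices \<le> t * M"
    using has_sum_mono[OF * 1 le] S(1) assms(3) by (meson mult_left_mono less_imp_le order_trans)
  ultimately show ?thesis
    using * f unfolding majorized_def by blast
qed

text \<open>Completeness of the space of series: if the norms are summable, the double family of all
  coefficients is absolutely summable and may be summed in either order.\<close>

lemma majorized_infsum:
  assumes r: "0 < r" and f: "\<And>k. k \<in> J \<Longrightarrow> majorized (f k) a r (M k)"
    and M: "(M has_sum S) J" "S \<le> N"
    and F: "\<And>x. x \<in> cube a r \<Longrightarrow> ((\<lambda>k. f k x) has_sum F x) J"
  shows "majorized F a r N"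
proof -
  have "\<forall>k\<in>J. \<exists>cs. snd cs \<le> M k \<and> ((\<lambda>\<alpha>. \<bar>fst cs \<alpha>\<bar> * r ^ mdeg \<alpha>) has_sum snd cs) multi_indices \<and>
     (\<forall>x\<in>cube a r. ((\<lambda>\<alpha>. mmono \<alpha> (x - a) * fst cs \<alpha>) has_sum f k x) multi_indices)"
    using f unfolding majorized_def by fastforce
  from bchoice[OF this] obtain cs where cs: "\<forall>k\<in>J. snd (cs k) \<le> M k \<and> ((\<lambda>\<alpha>. \<bar>fst (cs k) \<alpha>\<bar> * r ^ mdeg \<alpha>) has_sum snd (cs k)) multi_indices \<and>
     (\<forall>x\<in>cube a r. ((\<lambda>\<alpha>. mmono \<alpha> (x - a) * fst (cs k) \<alpha>) has_sum f k x) multi_indices)" ..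
  define c where "c k = fst (cs k)" for k
  define s where "s k = snd (cs k)" for k
  from cs have s: "\<And>k. k \<in> J \<Longrightarrow> s k \<le> M k"
    and c: "\<And>k. k \<in> J \<Longrightarrow> ((\<lambda>\<alpha>. \<bar>c k \<alpha>\<bar> * r ^ mdeg \<alpha>) has_sum s k) multi_indices"
    and fc: "\<And>k x. k \<in> J \<Longrightarrow> x \<in> cube a r \<Longrightarrow> ((\<lambda>\<alpha>. mmono \<alpha> (x - a) * c k \<alpha>) has_sum f k x) multi_indices"
    by (auto simp: c_def s_def)
  have s0: "0 \<le> s k" if "k \<in> J" for k
    by (rule has_sum_nonneg[OF c[OF that]]) (use r in auto)
  have ssum: "s summable_on J"
    by (rule summable_on_comparison_test[OF has_sum_imp_summable[OF M(1)]]) (use s s0 in auto)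
  then have ss: "(s has_sum infsum s J) J" by simp
  have sS: "infsum s J \<le> N" using has_sum_mono[OF ss M(1)] s M(2) by force
  let ?g = "\<lambda>(k,\<alpha>). \<bar>c k \<alpha>\<bar> * r ^ mdeg \<alpha>"
  have gsum: "?g summable_on Sigma J (\<lambda>_. multi_indices)"
    by (rule summable_on_SigmaI[where g=s]) (use c ssum r in auto)
  have g: "(?g has_sum infsum s J) (Sigma J (\<lambda>_. multi_indices))"
    by (rule has_sum_SigmaI[where g=s]) (use c ss gsum in auto)
  show ?thesis
  proof (rule majorizedI_family[where J="Sigma J (\<lambda>_. multi_indices)" and c="\<lambda>(k,\<alpha>). c k \<alpha>" and \<beta>=snd])
    show "((\<lambda>j. \<bar>case j of (k, \<alpha>) \<Rightarrow> c k \<alpha>\<bar> * r ^ mdeg (snd j)) has_sum infsum s J) (Sigma J (\<lambda>_. multi_indices))"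
      using g by (simp add: case_prod_unfold)
  next
    fix x assume x: "x \<in> cube a r"
    let ?h = "\<lambda>j. mmono (snd j) (x - a) * (case j of (k, \<alpha>) \<Rightarrow> c k \<alpha>)"
    have "(\<lambda>p. norm (?h p)) summable_on (Sigma J (\<lambda>_. multi_indices))"
    proof (rule Infinite_Sum.abs_summable_on_comparison_test)
      show "(\<lambda>p. norm (?g p)) summable_on Sigma J (\<lambda>_. multi_indices)"
        using gsum r by (simp add: case_prod_unfold abs_mult)
      show "norm (?h p) \<le> norm (?g p)" for p
        using mult_left_mono[OF mmono_bound[OF x less_imp_le[OF r], of "snd p"], of "\<bar>c (fst p) (snd p)\<bar>"] r
        by (simp add: abs_mult case_prod_unfold mult.commute)
    qed
    then have h: "(?h has_sum infsum ?h (Sigma J (\<lambda>_. multi_indices))) (Sigma J (\<lambda>_. multi_indices))"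
      by (simp add: abs_summable_summable)
    have "((\<lambda>k. f k x) has_sum infsum ?h (Sigma J (\<lambda>_. multi_indices))) J"
      by (rule has_sum_SigmaD[OF h]) (use fc x in auto)
    then have "infsum ?h (Sigma J (\<lambda>_. multi_indices)) = F x" using F[OF x] has_sum_unique by blast
    then show "(?h has_sum F x) (Sigma J (\<lambda>_. multi_indices))" using h by simp
  qed (use r sS in auto)
qed

lemma majorized_const: "0 < r \<Longrightarrow> majorized (\<lambda>_. k) a r \<bar>k\<bar>"
  by (rule majorizedI_family[where J="{()}" and c="\<lambda>_. k" and \<beta>="\<lambda>_ _. 0" and S="\<bar>k\<bar>"])
     (auto simp: mdeg_def mmono_def intro!: has_sum_finiteI)

lemma majorized_add:
  assumes "0 < r" "majorized f a r M" "majorized g a r N"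
  shows "majorized (\<lambda>x. f x + g x) a r (M + N)"
proof (rule majorized_infsum[where J="UNIV::bool set" and f="\<lambda>i. if i then f else g" and M="\<lambda>i. if i then M else N"])
  show "((\<lambda>i. if i then M else N) has_sum M + N) UNIV"
    by (rule has_sum_finiteI) (auto simp: UNIV_bool)
  show "((\<lambda>k. (if k then f else g) x) has_sum f x + g x) UNIV" for x
    by (rule has_sum_finiteI) (auto simp: UNIV_bool)
qed (use assms in auto)

text \<open>Only the first factor is expanded: each of its monomials times the second series is a
  shifted series, and \<open>majorized_infsum\<close> adds these up. This replaces a Cauchy
  product.\<close>

lemma majorized_mult:
  assumes r: "0 < r" and f: "majorized f a r M" and g: "majorized g a r N"
  shows "majorized (\<lambda>x. f x * g x) a r (M * N)"
proof -
  have N: "0 \<le> N" using majorized_nonneg g r by blast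
  obtain c S where S: "S \<le> M" "((\<lambda>\<alpha>. \<bar>c \<alpha>\<bar> * r ^ mdeg \<alpha>) has_sum S) multi_indices"
    and f: "\<And>x. x \<in> cube a r \<Longrightarrow> ((\<lambda>\<alpha>. mmono \<alpha> (x - a) * c \<alpha>) has_sum f x) multi_indices"
    using f unfolding majorized_def by blast
  obtain d T where T: "T \<le> N" "((\<lambda>\<alpha>. \<bar>d \<alpha>\<bar> * r ^ mdeg \<alpha>) has_sum T) multi_indices"
    and g: "\<And>x. x \<in> cube a r \<Longrightarrow> ((\<lambda>\<alpha>. mmono \<alpha> (x - a) * d \<alpha>) has_sum g x) multi_indices"
    using g unfolding majorized_def by blast
  show ?thesis
  proof (rule majorized_infsum[where J=multi_indices and f="\<lambda>\<alpha> x. mmono \<alpha> (x - a) * c \<alpha> * g x"])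
    show "((\<lambda>\<alpha>. (\<bar>c \<alpha>\<bar> * r ^ mdeg \<alpha>) * N) has_sum S * N) multi_indices"
      by (intro has_sum_cmult_left S)
    show "S * N \<le> M * N" using S N by (intro mult_right_mono)
    show "((\<lambda>\<alpha>. mmono \<alpha> (x - a) * c \<alpha> * g x) has_sum f x * g x) multi_indices" if "x \<in> cube a r" for x
      by (intro has_sum_cmult_left f that)
    fix \<alpha> :: "'a \<Rightarrow> nat"
    show "majorized (\<lambda>x. mmono \<alpha> (x - a) * c \<alpha> * g x) a r (\<bar>c \<alpha>\<bar> * r ^ mdeg \<alpha> * N)"
    proof (rule majorizedI_family[where J=multi_indices and c="\<lambda>\<beta>. c \<alpha> * d \<beta>" and \<beta>="\<lambda>\<beta> b. \<alpha> b + \<beta> b"])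
      have "((\<lambda>j. (\<bar>c \<alpha>\<bar> * r ^ mdeg \<alpha>) * (\<bar>d j\<bar> * r ^ mdeg j)) has_sum (\<bar>c \<alpha>\<bar> * r ^ mdeg \<alpha>) * T) multi_indices"
        by (intro has_sum_cmult_right T)
      then show "((\<lambda>j. \<bar>c \<alpha> * d j\<bar> * r ^ mdeg (\<lambda>b. \<alpha> b + j b)) has_sum (\<bar>c \<alpha>\<bar> * r ^ mdeg \<alpha>) * T) multi_indices"
        by (simp add: mdeg_add abs_mult power_add mult_ac)
      show "\<bar>c \<alpha>\<bar> * r ^ mdeg \<alpha> * T \<le> \<bar>c \<alpha>\<bar> * r ^ mdeg \<alpha> * N" using T r by (intro mult_left_mono) auto
      fix x assume "x \<in> cube a r"
      then have "((\<lambda>j. (mmono \<alpha> (x - a) * c \<alpha>) * (mmono j (x - a) * d j)) has_sum (mmono \<alpha> (x - a) * c \<alpha>) * g x) multi_indices"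
        by (intro has_sum_cmult_right g)
      then show "((\<lambda>j. mmono (\<lambda>b. \<alpha> b + j b) (x - a) * (c \<alpha> * d j)) has_sum mmono \<alpha> (x - a) * c \<alpha> * g x) multi_indices"
        by (simp add: mmono_add mult_ac)
    qed (use r in auto)
  qed (use r in auto)
qed

lemma majorized_cmult: "0 < r \<Longrightarrow> majorized f a r M \<Longrightarrow> majorized (\<lambda>x. k * f x) a r (\<bar>k\<bar> * M)"
  by (intro majorized_mult majorized_const)

lemma majorized_prod:
  assumes "0 < r" "finite A" "\<And>i. i \<in> A \<Longrightarrow> majorized (f i) a r (M i)"
  shows "majorized (\<lambda>x. \<Prod>i\<in>A. f i x) a r (\<Prod>i\<in>A. M i)"
  using assms(2,3)
  by (induction A rule: finite_induct) (use majorized_const[of r 1] assms(1) in \<open>auto intro: majorized_mult\<close>)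

lemma majorized_power:
  assumes "0 < r" "majorized f a r M"
  shows "majorized (\<lambda>x. f x ^ n) a r (M ^ n)"
  by (induction n) (use majorized_const[of r 1] assms in \<open>auto intro: majorized_mult\<close>)

lemma majorized_coord:
  assumes "0 < r" "b \<in> Basis"
  shows "majorized (\<lambda>x. (x - a) \<bullet> b) a r r"
proof (rule majorizedI_family[where J="{()}" and c="\<lambda>_. 1" and \<beta>="\<lambda>_ i. if i = b then 1 else 0" and S=r])
  have eq: "(\<Prod>i\<in>Basis. g i ^ (if i = b then 1 else 0)) = g b" for g :: "'a \<Rightarrow> real"
    using assms(2) by (simp add: if_distrib[of "power _"] prod.delta cong: if_cong)
  show "((\<lambda>j. mmono (\<lambda>i. if i = b then 1 else 0) (x - a) * 1) has_sum (x - a) \<bullet> b) {()}" for x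
    by (rule has_sum_finiteI) (auto simp: mmono_def eq)
  show "((\<lambda>j. \<bar>1\<bar> * r ^ mdeg (\<lambda>i. if i = b then 1 else 0)) has_sum r) {()}"
    by (rule has_sum_finiteI) (use assms in \<open>auto simp: mdeg_def sum.delta\<close>)
qed (use assms in auto)

text \<open>About the new centre each coordinate difference is a constant of size at most
  \<open>r / 2\<close> plus a coordinate of norm \<open>r / 2\<close>, so its norm is still at most
  \<open>r\<close>; monomials, and then the whole series, keep their bounds.\<close>

lemma majorized_recenter:
  assumes r: "0 < r" and f: "majorized f a r M" and a': "a' \<in> cube a (r / 2)"
  shows "majorized f a' (r / 2) M"
proof -
  obtain c S where S: "S \<le> M" "((\<lambda>\<alpha>. \<bar>c \<alpha>\<bar> * r ^ mdeg \<alpha>) has_sum S) multi_indices"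
    and f: "\<And>x. x \<in> cube a r \<Longrightarrow> ((\<lambda>\<alpha>. mmono \<alpha> (x - a) * c \<alpha>) has_sum f x) multi_indices"
    using f unfolding majorized_def by blast
  have sub: "cube a' (r / 2) \<subseteq> cube a r"
  proof
    fix x assume x: "x \<in> cube a' (r / 2)"
    have "\<bar>(x - a) \<bullet> b\<bar> \<le> r" if "b \<in> Basis" for b
    proof -
      have "(x - a) \<bullet> b = (x - a') \<bullet> b + (a' - a) \<bullet> b" by (simp add: inner_diff_left)
      moreover have "\<bar>(x - a') \<bullet> b\<bar> \<le> r/2" "\<bar>(a' - a) \<bullet> b\<bar> \<le> r/2" using that x a' by (auto simp: cube_def)
      ultimately show ?thesis by linarith
    qed
    then show "x \<in> cube a r" by (simp add: cube_def)
  qed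
  show ?thesis
  proof (rule majorized_infsum[where f="\<lambda>\<alpha> x. mmono \<alpha> (x - a) * c \<alpha>", OF _ _ S(2) S(1)])
    fix \<alpha> :: "'a \<Rightarrow> nat"
    have 1: "majorized (\<lambda>x. (x - a) \<bullet> b) a' (r/2) r" if "b \<in> Basis" for b
    proof -
      have "majorized (\<lambda>x. (x - a') \<bullet> b + (a' - a) \<bullet> b) a' (r/2) (r/2 + \<bar>(a' - a) \<bullet> b\<bar>)"
        using r that by (intro majorized_add majorized_coord majorized_const) auto
      moreover have "\<bar>(a' - a) \<bullet> b\<bar> \<le> r/2" using a' that by (simp add: cube_def)
      ultimately show ?thesis
        by (auto simp: inner_diff_left elim: majorized_weaken)
    qed
    have "majorized (\<lambda>x. c \<alpha> * mmono \<alpha> (x - a)) a' (r/2) (\<bar>c \<alpha>\<bar> * (\<Prod>b\<in>Basis. r ^ \<alpha> b))"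
      unfolding mmono_def using r by (intro majorized_cmult majorized_prod majorized_power 1) auto
    then show "majorized (\<lambda>x. mmono \<alpha> (x - a) * c \<alpha>) a' (r/2) (\<bar>c \<alpha>\<bar> * r ^ mdeg \<alpha>)"
      by (simp add: mdeg_def power_sum mult.commute)
  qed (use r f sub in auto)
qed

text \<open>\<open>has_sum\<close> is unconditional summation, which for reals is absolute.
  Evaluation at a corner of a small cube, where every monomial equals
  \<open>r ^ mdeg \<alpha>\<close>, turns plain convergence on a ball into the norm bound.\<close>

lemma real_analytic_at_iff_majorized:
  fixes f :: "'a::euclidean_space \<Rightarrow> real"
  shows "real_analytic_at f a \<longleftrightarrow> (\<exists>r>0. \<exists>M. majorized f a r M)"
proof
  assume "real_analytic_at f a"
  then obtain R c where R: "R > 0"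
    and f0: "\<forall>x\<in>ball a R. ((\<lambda>\<alpha>. (\<Prod>b\<in>Basis. ((x - a) \<bullet> b) ^ \<alpha> b) *\<^sub>R c \<alpha>) has_sum f x) (Basis \<rightarrow>\<^sub>E UNIV)"
    unfolding real_analytic_at_def by blast
  have f: "((\<lambda>\<alpha>. mmono \<alpha> (x - a) * c \<alpha>) has_sum f x) multi_indices" if "x \<in> ball a R" for x
    using bspec[OF f0 that] by (simp add: mmono_def multi_indices_def)
  define r where "r = R / (2 * DIM('a))"
  have r: "r > 0" using R by (simp add: r_def)
  have sub: "cube a r \<subseteq> ball a R" unfolding r_def by (rule cube_subset_ball[OF R])
  define x where "x = a + r *\<^sub>R (\<Sum>b\<in>Basis. b)"
  have xb: "(x - a) \<bullet> b = r" if "b \<in> Basis" for b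
    using that by (simp add: x_def inner_sum_left inner_Basis if_distrib sum.delta cong: if_cong)
  have "x \<in> cube a r" using r by (simp add: cube_def xb)
  then have "((\<lambda>\<alpha>. mmono \<alpha> (x - a) * c \<alpha>) has_sum f x) multi_indices" using f sub by blast
  moreover have "mmono \<alpha> (x - a) = r ^ mdeg \<alpha>" for \<alpha> :: "'a \<Rightarrow> nat"
    by (simp add: mmono_def mdeg_def power_sum xb)
  ultimately have "(\<lambda>\<alpha>. r ^ mdeg \<alpha> * c \<alpha>) summable_on multi_indices"
    by (simp add: has_sum_imp_summable)
  then have "(\<lambda>\<alpha>. norm (r ^ mdeg \<alpha> * c \<alpha>)) summable_on multi_indices"
    by (rule summable_on_iff_abs_summable_on_real[THEN iffD1])
  then have "(\<lambda>\<alpha>. \<bar>c \<alpha>\<bar> * r ^ mdeg \<alpha>) summable_on multi_indices"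
    using r by (simp add: abs_mult mult.commute)
  then have "majorized f a r (infsum (\<lambda>\<alpha>. \<bar>c \<alpha>\<bar> * r ^ mdeg \<alpha>) multi_indices)"
    unfolding majorized_def using f sub
    by (intro exI[of _ c] exI[of _ "infsum (\<lambda>\<alpha>. \<bar>c \<alpha>\<bar> * r ^ mdeg \<alpha>) multi_indices"] conjI ballI) auto
  then show "\<exists>r>0. \<exists>M. majorized f a r M" using r by blast
next
  assume "\<exists>r>0. \<exists>M. majorized f a r M"
  then obtain r M where r: "r > 0" "majorized f a r M" by blast
  then obtain c where "\<forall>x\<in>cube a r. ((\<lambda>\<alpha>. mmono \<alpha> (x - a) * c \<alpha>) has_sum f x) multi_indices"
    unfolding majorized_def by blast
  then show "real_analytic_at f a"
    unfolding real_analytic_at_def mmono_def multi_indices_def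
    using r(1) ball_subset_cube[of a r] by (intro exI[of _ r] conjI exI[of _ c]) auto
qed

lemma has_sum_sum:
  fixes f :: "'i \<Rightarrow> 'j \<Rightarrow> 'b::topological_comm_monoid_add"
  assumes "finite A" "\<And>i. i \<in> A \<Longrightarrow> (f i has_sum s i) J"
  shows "((\<lambda>j. \<Sum>i\<in>A. f i j) has_sum (\<Sum>i\<in>A. s i)) J"
  using assms by (induction A rule: finite_induct) (auto intro: has_sum_add)

text \<open>Coefficients may be vectors, so finitely many scalar expansions on a common ball combine
  into one; the estimates can then be made for real-valued functions.\<close>

lemma real_analytic_at_componentwise:
  fixes f :: "'a::euclidean_space \<Rightarrow> 'b::euclidean_space"
  shows "real_analytic_at f a \<longleftrightarrow> (\<forall>i\<in>Basis. real_analytic_at (\<lambda>x. f x \<bullet> i) a)"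
proof
  assume "real_analytic_at f a"
  then obtain r c where r: "r > 0" "\<And>x. x \<in> ball a r \<Longrightarrow>
      ((\<lambda>\<alpha>. (\<Prod>b\<in>Basis. ((x - a) \<bullet> b) ^ \<alpha> b) *\<^sub>R c \<alpha>) has_sum f x) (Basis \<rightarrow>\<^sub>E UNIV)"
    unfolding real_analytic_at_def by blast
  show "\<forall>i\<in>Basis. real_analytic_at (\<lambda>x. f x \<bullet> i) a"
    unfolding real_analytic_at_def
  proof (intro ballI exI[of _ r] conjI exI)
    fix i :: 'b and x assume "x \<in> ball a r"
    from has_sum_bounded_linear[OF bounded_linear_inner_left r(2)[OF this], of i]
    show "((\<lambda>\<alpha>. (\<Prod>b\<in>Basis. ((x - a) \<bullet> b) ^ \<alpha> b) *\<^sub>R (c \<alpha> \<bullet> i)) has_sum f x \<bullet> i) (Basis \<rightarrow>\<^sub>E UNIV)"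
      by simp
  qed (rule r)
next
  assume "\<forall>i\<in>Basis. real_analytic_at (\<lambda>x. f x \<bullet> i) a"
  then have "\<forall>i\<in>Basis. \<exists>rc. 0 < fst rc \<and> (\<forall>x\<in>ball a (fst rc).
      ((\<lambda>\<alpha>. (\<Prod>b\<in>Basis. ((x - a) \<bullet> b) ^ \<alpha> b) *\<^sub>R snd rc \<alpha>) has_sum f x \<bullet> i) (Basis \<rightarrow>\<^sub>E UNIV))"
    unfolding real_analytic_at_def by fastforce
  from bchoice[OF this] obtain rc where rc: "\<forall>i\<in>Basis. 0 < fst (rc i) \<and> (\<forall>x\<in>ball a (fst (rc i)).
      ((\<lambda>\<alpha>. (\<Prod>b\<in>Basis. ((x - a) \<bullet> b) ^ \<alpha> b) *\<^sub>R snd (rc i) \<alpha>) has_sum f x \<bullet> i) (Basis \<rightarrow>\<^sub>E UNIV))" ..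
  define r where "r = Min ((fst \<circ> rc) ` (Basis :: 'b set))"
  have r: "0 < r" "\<And>i. i \<in> Basis \<Longrightarrow> r \<le> fst (rc i)"
    using rc by (auto simp: r_def)
  show "real_analytic_at f a"
    unfolding real_analytic_at_def
  proof (intro exI[of _ r] conjI exI ballI r)
    fix x assume x: "x \<in> ball a r"
    have "((\<lambda>\<alpha>. \<Sum>i\<in>Basis. ((\<Prod>b\<in>Basis. ((x - a) \<bullet> b) ^ \<alpha> b) *\<^sub>R snd (rc i) \<alpha>) *\<^sub>R i) has_sum (\<Sum>i\<in>Basis. (f x \<bullet> i) *\<^sub>R i)) (Basis \<rightarrow>\<^sub>E UNIV)"
    proof (rule has_sum_sum)
      fix i :: 'b assume i: "i \<in> Basis"
      then have "x \<in> ball a (fst (rc i))" using x r(2)[OF i] by auto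
      with i rc have "((\<lambda>\<alpha>. (\<Prod>b\<in>Basis. ((x - a) \<bullet> b) ^ \<alpha> b) *\<^sub>R snd (rc i) \<alpha>) has_sum f x \<bullet> i) (Basis \<rightarrow>\<^sub>E UNIV)"
        by blast
      from has_sum_bounded_linear[OF bounded_linear_scaleR_left this, of i]
      show "((\<lambda>\<alpha>. ((\<Prod>b\<in>Basis. ((x - a) \<bullet> b) ^ \<alpha> b) *\<^sub>R snd (rc i) \<alpha>) *\<^sub>R i) has_sum (f x \<bullet> i) *\<^sub>R i) (Basis \<rightarrow>\<^sub>E UNIV)" .
    qed simp
    then show "((\<lambda>\<alpha>. (\<Prod>b\<in>Basis. ((x - a) \<bullet> b) ^ \<alpha> b) *\<^sub>R (\<Sum>i\<in>Basis. snd (rc i) \<alpha> *\<^sub>R i)) has_sum f x) (Basis \<rightarrow>\<^sub>E UNIV)"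
      by (simp add: scaleR_sum_right euclidean_representation)
  qed
qed

lemma finite_common_radius:
  assumes "finite A" "\<And>i. i \<in> A \<Longrightarrow> \<exists>r>0. \<exists>M. majorized (f i) a r M"
  shows "\<exists>r>0. \<exists>M. \<forall>i\<in>A. majorized (f i) a r (M i)"
proof -
  have "\<forall>i\<in>A. \<exists>rM. 0 < fst rM \<and> majorized (f i) a (fst rM) (snd rM)"
    by (metis assms(2) fst_conv snd_conv)
  from bchoice[OF this] obtain rM where rM: "\<forall>i\<in>A. 0 < fst (rM i) \<and> majorized (f i) a (fst (rM i)) (snd (rM i))" ..
  define r where "r = Min (insert 1 ((fst \<circ> rM) ` A))"
  have r: "0 < r" "\<And>i. i \<in> A \<Longrightarrow> r \<le> fst (rM i)"
    using rM assms(1) by (auto simp: r_def)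
  then have "\<forall>i\<in>A. majorized (f i) a r (snd (rM i))"
    using rM by (auto intro: majorized_shrink)
  then show ?thesis using r(1) by (intro exI[of _ r] conjI exI[of _ "\<lambda>i. snd (rM i)"])
qed

section \<open>Closure properties of analytic maps\<close>

lemma real_analytic_at_const [simp]: "real_analytic_at (\<lambda>_. k) a"
proof -
  have "real_analytic_at (\<lambda>_. k \<bullet> i) a" for i
    unfolding real_analytic_at_iff_majorized using majorized_const[OF zero_less_one] zero_less_one by blast
  then show ?thesis by (subst real_analytic_at_componentwise) simp
qed

lemma real_analytic_at_add_real:
  fixes f g :: "'a::euclidean_space \<Rightarrow> real"
  assumes "real_analytic_at f a" "real_analytic_at g a"
  shows "real_analytic_at (\<lambda>x. f x + g x) a" "real_analytic_at (\<lambda>x. f x * g x) a"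
proof -
  have "\<exists>r>0. \<exists>M. \<forall>i\<in>UNIV. majorized (if i then f else g) a r (M i)"
    by (rule finite_common_radius) (use assms in \<open>auto simp: real_analytic_at_iff_majorized\<close>)
  then obtain r M where "0 < r" "\<forall>i\<in>UNIV. majorized (if i then f else g) a r (M i)" by blast
  then have r: "0 < r" "majorized f a r (M True)" "majorized g a r (M False)"
    by (metis UNIV_I)+
  show "real_analytic_at (\<lambda>x. f x + g x) a" "real_analytic_at (\<lambda>x. f x * g x) a"
    unfolding real_analytic_at_iff_majorized
    using majorized_add[OF r] majorized_mult[OF r] r(1) by blast+
qed

lemmas real_analytic_at_mult_real = real_analytic_at_add_real(2)

lemma real_analytic_at_add:
  fixes f g :: "'a::euclidean_space \<Rightarrow> 'b::euclidean_space"
  assumes "real_analytic_at f a" "real_analytic_at g a"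
  shows "real_analytic_at (\<lambda>x. f x + g x) a"
  using assms unfolding real_analytic_at_componentwise[of f] real_analytic_at_componentwise[of g]
    real_analytic_at_componentwise[of "\<lambda>x. f x + g x"]
  by (auto simp: inner_add_left intro: real_analytic_at_add_real)

lemma real_analytic_at_sum:
  fixes f :: "'i \<Rightarrow> 'a::euclidean_space \<Rightarrow> 'b::euclidean_space"
  assumes "\<And>i. i \<in> A \<Longrightarrow> real_analytic_at (f i) a"
  shows "real_analytic_at (\<lambda>x. \<Sum>i\<in>A. f i x) a"
  using assms by (induction A rule: infinite_finite_induct) (auto intro: real_analytic_at_add)

lemma real_analytic_at_prod:
  fixes f :: "'i \<Rightarrow> 'a::euclidean_space \<Rightarrow> real"
  assumes "\<And>i. i \<in> A \<Longrightarrow> real_analytic_at (f i) a"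
  shows "real_analytic_at (\<lambda>x. \<Prod>i\<in>A. f i x) a"
  using assms by (induction A rule: infinite_finite_induct) (auto intro: real_analytic_at_mult_real)

lemma real_analytic_at_cong:
  assumes "real_analytic_at f a" "open U" "a \<in> U" "\<And>x. x \<in> U \<Longrightarrow> f x = g x"
  shows "real_analytic_at g a"
proof -
  obtain r c where r: "r > 0" and f: "\<forall>x\<in>ball a r.
      ((\<lambda>\<alpha>. (\<Prod>b\<in>Basis. ((x - a) \<bullet> b) ^ \<alpha> b) *\<^sub>R c \<alpha>) has_sum f x) (Basis \<rightarrow>\<^sub>E UNIV)"
    using assms(1) unfolding real_analytic_at_def by blast
  obtain s where s: "s > 0" "ball a s \<subseteq> U" using assms openE by blast
  have "((\<lambda>\<alpha>. (\<Prod>b\<in>Basis. ((x - a) \<bullet> b) ^ \<alpha> b) *\<^sub>R c \<alpha>) has_sum g x) (Basis \<rightarrow>\<^sub>E UNIV)" if "x \<in> ball a (min r s)" for x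
  proof -
    have "x \<in> U" "x \<in> ball a r" using that s(2) by auto
    then show ?thesis using bspec[OF f, of x] assms(4)[of x] by simp
  qed
  then show ?thesis unfolding real_analytic_at_def using r s(1)
    by (intro exI[of _ "min r s"] conjI exI[of _ c]) auto
qed

lemma real_analytic_at_coord: "b \<in> Basis \<Longrightarrow> real_analytic_at (\<lambda>x. x \<bullet> b) a"
proof -
  assume b: "b \<in> Basis"
  have "real_analytic_at (\<lambda>x. (x - a) \<bullet> b) a"
    unfolding real_analytic_at_iff_majorized using majorized_coord[OF zero_less_one b] zero_less_one by blast
  from real_analytic_at_add[OF this real_analytic_at_const, of "a \<bullet> b"]
  show ?thesis by (simp add: inner_diff_left)
qed

lemma real_analytic_at_scaleR:
  fixes f :: "'a::euclidean_space \<Rightarrow> real" and g :: "'a \<Rightarrow> 'b::euclidean_space"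
  assumes "real_analytic_at f a" "real_analytic_at g a"
  shows "real_analytic_at (\<lambda>x. f x *\<^sub>R g x) a"
  using assms unfolding real_analytic_at_componentwise[of g]
    real_analytic_at_componentwise[of "\<lambda>x. f x *\<^sub>R g x"]
  by (auto intro: real_analytic_at_mult_real)

lemma real_analytic_at_linear_compose:
  fixes g :: "'a::euclidean_space \<Rightarrow> 'b::euclidean_space" and h :: "'b \<Rightarrow> 'c::euclidean_space"
  assumes "linear h" "real_analytic_at g a"
  shows "real_analytic_at (\<lambda>x. h (g x)) a"
proof -
  have "h (g x) = (\<Sum>i\<in>Basis. (g x \<bullet> i) *\<^sub>R h i)" for x
    by (subst euclidean_representation[symmetric, of "g x"])
       (simp only: linear_sum[OF assms(1)] linear_scale[OF assms(1)])
  moreover have "real_analytic_at (\<lambda>x. \<Sum>i\<in>Basis. (g x \<bullet> i) *\<^sub>R h i) a"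
    using assms(2) by (intro real_analytic_at_sum real_analytic_at_scaleR real_analytic_at_const)
      (auto simp: real_analytic_at_componentwise[of g])
  ultimately show ?thesis by presburger
qed

lemma real_analytic_at_ident [simp]: "real_analytic_at (\<lambda>x. x) a"
  by (subst real_analytic_at_componentwise) (auto intro: real_analytic_at_coord)

lemma real_analytic_at_linear: "linear h \<Longrightarrow> real_analytic_at h a"
  using real_analytic_at_linear_compose[of h "\<lambda>x. x" a] by simp

lemma real_analytic_at_bilinear:
  fixes f :: "'a::euclidean_space \<Rightarrow> 'b::euclidean_space" and g :: "'a \<Rightarrow> 'c::euclidean_space"
    and h :: "'b \<Rightarrow> 'c \<Rightarrow> 'd::euclidean_space"
  assumes h: "bilinear h" and f: "real_analytic_at f a" and g: "real_analytic_at g a"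
  shows "real_analytic_at (\<lambda>x. h (f x) (g x)) a"
proof -
  have h1: "linear (\<lambda>x. h x y)" and h2: "linear (h y')" for y y'
    using h by (auto simp: bilinear_def)
  have "h (f x) (g x) = (\<Sum>i\<in>Basis. (f x \<bullet> i) *\<^sub>R h i (g x))" for x
    by (subst euclidean_representation[symmetric, of "f x"])
       (simp only: linear_sum[OF h1] linear_scale[OF h1])
  moreover have "real_analytic_at (\<lambda>x. \<Sum>i\<in>Basis. (f x \<bullet> i) *\<^sub>R h i (g x)) a"
    using f by (intro real_analytic_at_sum real_analytic_at_scaleR real_analytic_at_linear_compose[OF h2 g])
      (auto simp: real_analytic_at_componentwise[of f])
  ultimately show ?thesis by presburger
qed

lemma real_analytic_at_diff:
  fixes f g :: "'a::euclidean_space \<Rightarrow> 'b::euclidean_space"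
  assumes "real_analytic_at f a" "real_analytic_at g a"
  shows "real_analytic_at (\<lambda>x. f x - g x) a"
  using real_analytic_at_add[OF assms(1) real_analytic_at_scaleR[OF real_analytic_at_const assms(2)], of "-1"]
  by simp

lemma real_analytic_at_inner:
  assumes "real_analytic_at f a" "real_analytic_at g a"
  shows "real_analytic_at (\<lambda>x. f x \<bullet> g x) a"
  using assms by (intro real_analytic_at_bilinear[of inner] bilinear_conv_bounded_bilinear[THEN iffD2] bounded_bilinear_inner)

lemma real_analytic_at_Pair:
  fixes f :: "'a::euclidean_space \<Rightarrow> 'b::euclidean_space" and g :: "'a \<Rightarrow> 'c::euclidean_space"
  assumes "real_analytic_at f a" "real_analytic_at g a"
  shows "real_analytic_at (\<lambda>x. (f x, g x)) a"
  using assms unfolding real_analytic_at_componentwise[of f] real_analytic_at_componentwise[of g]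
    real_analytic_at_componentwise[of "\<lambda>x. (f x, g x)"]
  by (auto simp: Basis_prod_def)

lemma real_analytic_at_fst_snd:
  fixes f :: "'a::euclidean_space \<Rightarrow> 'b::euclidean_space \<times> 'c::euclidean_space"
  assumes "real_analytic_at f a"
  shows "real_analytic_at (\<lambda>x. fst (f x)) a" "real_analytic_at (\<lambda>x. snd (f x)) a"
  by (rule real_analytic_at_linear_compose[OF linear_fst assms], rule real_analytic_at_linear_compose[OF linear_snd assms])

text \<open>Expansions can be recentred, so analyticity at one point spreads to a neighbourhood, as
  \<open>real_analytic_on\<close> demands.\<close>

lemma real_analytic_at_eventually:
  assumes "real_analytic_at f a"
  shows "\<forall>\<^sub>F x in nhds a. real_analytic_at f x"
proof -
  have "\<forall>i\<in>Basis. \<forall>\<^sub>F x in nhds a. real_analytic_at (\<lambda>x. f x \<bullet> i) x"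
  proof
    fix i :: 'b assume "i \<in> Basis"
    then have "real_analytic_at (\<lambda>x. f x \<bullet> i) a" using assms real_analytic_at_componentwise by blast
    then obtain r M where r: "r > 0" "majorized (\<lambda>x. f x \<bullet> i) a r M"
      by (auto simp: real_analytic_at_iff_majorized)
    have "real_analytic_at (\<lambda>x. f x \<bullet> i) x" if "x \<in> ball a (r/2)" for x
      using majorized_recenter[OF r] that ball_subset_cube r(1) half_gt_zero
      unfolding real_analytic_at_iff_majorized by blast
    then show "\<forall>\<^sub>F x in nhds a. real_analytic_at (\<lambda>x. f x \<bullet> i) x"
      using r(1) unfolding eventually_nhds by (intro exI[of _ "ball a (r/2)"]) auto
  qed
  then have "\<forall>\<^sub>F x in nhds a. \<forall>i\<in>Basis. real_analytic_at (\<lambda>x. f x \<bullet> i) x"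
    by (simp add: eventually_ball_finite)
  then show ?thesis by (simp add: real_analytic_at_componentwise[of f])
qed

text \<open>The shifted components of \<open>G\<close> vanish at \<open>a\<close>, so a smaller
  radius brings their norms down to the radius \<open>R\<close> of the outer series; substituting
  series for the variables then keeps the outer norm.\<close>

lemma real_analytic_at_compose:
  fixes G :: "'a::euclidean_space \<Rightarrow> 'b::euclidean_space" and g :: "'b \<Rightarrow> 'c::euclidean_space"
  assumes "real_analytic_at G a" "real_analytic_at g (G a)"
  shows "real_analytic_at (\<lambda>x. g (G x)) a"
proof -
  have "real_analytic_at (\<lambda>x. h (G x)) a" if h: "real_analytic_at h (G a)" for h :: "'b \<Rightarrow> real"
  proof -
    obtain R M where R: "R > 0" "majorized h (G a) R M"
      using h by (auto simp: real_analytic_at_iff_majorized)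
    then obtain c S where S: "((\<lambda>\<alpha>. \<bar>c \<alpha>\<bar> * R ^ mdeg \<alpha>) has_sum S) multi_indices"
      and hc: "\<And>x. x \<in> cube (G a) R \<Longrightarrow> ((\<lambda>\<alpha>. mmono \<alpha> (x - G a) * c \<alpha>) has_sum h x) multi_indices"
      unfolding majorized_def by blast
    have "real_analytic_at (\<lambda>x. (G x - G a) \<bullet> i) a" for i
      using assms(1) by (intro real_analytic_at_inner real_analytic_at_diff) auto
    then have "\<exists>r>0. \<exists>N. \<forall>i\<in>Basis. majorized (\<lambda>x. (G x - G a) \<bullet> i) a r (N i)"
      by (intro finite_common_radius) (simp_all add: real_analytic_at_iff_majorized)
    then obtain r N where r: "r > 0" and N: "\<forall>i\<in>Basis. majorized (\<lambda>x. (G x - G a) \<bullet> i) a r (N i)"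
      by blast
    \<comment> \<open>Including \<open>R\<close> in the maximum keeps the factor \<open>t\<close> at
      most 1, as \<open>majorized_scale\<close> requires.\<close>
    define N' where "N' = Max (insert R (N ` Basis))"
    have N': "R \<le> N'" "\<And>i. i \<in> Basis \<Longrightarrow> N i \<le> N'"
      unfolding N'_def by (rule Max_ge; simp)+
    have N'0: "0 < N'" using R(1) N'(1) by linarith
    define t where "t = R / N'"
    have t: "0 < t" "t \<le> 1" "t * N' = R" using N'0 N'(1) R by (auto simp: t_def)
    have tr: "0 < t * r" using t r by simp
    have G: "majorized (\<lambda>x. (G x - G a) \<bullet> i) a (t * r) R" if "i \<in> Basis" for i
      using majorized_scale[OF majorized_weaken[OF bspec[OF N that] N'(2)[OF that]] r t(1,2)] t(3) by simp
    have "majorized (\<lambda>x. h (G x)) a (t * r) S"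
    proof (rule majorized_infsum[where f="\<lambda>\<alpha> x. mmono \<alpha> (G x - G a) * c \<alpha>", OF tr _ S order_refl])
      fix \<alpha> :: "'b \<Rightarrow> nat"
      have "majorized (\<lambda>x. c \<alpha> * mmono \<alpha> (G x - G a)) a (t * r) (\<bar>c \<alpha>\<bar> * (\<Prod>b\<in>Basis. R ^ \<alpha> b))"
        unfolding mmono_def using tr by (intro majorized_cmult majorized_prod majorized_power G) auto
      then show "majorized (\<lambda>x. mmono \<alpha> (G x - G a) * c \<alpha>) a (t * r) (\<bar>c \<alpha>\<bar> * R ^ mdeg \<alpha>)"
        by (simp add: mdeg_def power_sum mult.commute)
      fix x assume "x \<in> cube a (t * r)"
      then have "G x \<in> cube (G a) R" using majorized_bound[OF G tr] by (simp add: cube_def)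
      then show "((\<lambda>\<alpha>. mmono \<alpha> (G x - G a) * c \<alpha>) has_sum h (G x)) multi_indices" by (rule hc)
    qed
    then show ?thesis using tr real_analytic_at_iff_majorized by blast
  qed
  note * = this
  show ?thesis
    unfolding real_analytic_at_componentwise[of "\<lambda>x. g (G x)"]
    using assms(2) by (auto simp: real_analytic_at_componentwise[of g] intro!: *)
qed

section \<open>First-order Taylor expansion and differentiability\<close>

lemma finite_low_multi_indices:
  defines "\<delta> \<equiv> \<lambda>b. restrict (\<lambda>i. if i = b then 1 else 0::nat) (Basis :: 'a::euclidean_space set)"
  shows "{\<alpha> \<in> (multi_indices::('a \<Rightarrow> nat) set). mdeg \<alpha> < 2} = insert (restrict (\<lambda>_. 0) Basis) (\<delta> ` Basis)"
    (is "?L = ?R")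
proof
  have d: "mdeg (\<delta> b) = 1" if "b \<in> Basis" for b
    using that by (simp add: \<delta>_def mdeg_def sum.delta)
  show "?R \<subseteq> ?L"
    using d by (auto simp: \<delta>_def) (auto simp: mdeg_def)
  show "?L \<subseteq> ?R"
  proof
    fix \<alpha> assume a: "\<alpha> \<in> ?L"
    then have ext: "\<alpha> = restrict \<alpha> Basis" by (auto simp: multi_indices_def PiE_def extensional_restrict)
    from a have "mdeg \<alpha> = 0 \<or> mdeg \<alpha> = 1" by auto
    then show "\<alpha> \<in> ?R"
    proof
      assume "mdeg \<alpha> = 0"
      then have "restrict \<alpha> Basis = restrict (\<lambda>_. 0) Basis" by (auto simp: mdeg_def fun_eq_iff restrict_def)
      then show ?thesis using ext by simp
    next
      assume "mdeg \<alpha> = 1"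
      then obtain b where b: "b \<in> Basis" "\<alpha> b = 1" "\<forall>i\<in>Basis. b \<noteq> i \<longrightarrow> \<alpha> i = 0"
        using sum_eq_1_iff[OF finite_Basis, of \<alpha>] unfolding mdeg_def by metis
      then have "restrict \<alpha> Basis = \<delta> b" by (auto simp: \<delta>_def fun_eq_iff restrict_def)
      then show ?thesis using ext b by (metis image_eqI insertI2)
    qed
  qed
qed

lemma mmono_zero: "0 < mdeg \<alpha> \<Longrightarrow> mmono \<alpha> 0 = 0"
proof -
  assume "0 < mdeg \<alpha>"
  then have "\<exists>b\<in>Basis. \<alpha> b \<noteq> 0" using sum.neutral[of Basis \<alpha>] unfolding mdeg_def by fastforce
  then show ?thesis by (auto simp: mmono_def)
qed

text \<open>Remainders without constant and linear terms, described by coefficients rather than by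
  decay at 0, so that Lipschitz bounds follow monomial by monomial.\<close>

definition second_order :: "('a::euclidean_space \<Rightarrow> real) \<Rightarrow> real \<Rightarrow> real \<Rightarrow> bool" where
  "second_order g R M \<longleftrightarrow> (\<exists>c S. (\<forall>\<alpha>. mdeg \<alpha> < 2 \<longrightarrow> c \<alpha> = 0) \<and> S \<le> M \<and>
     ((\<lambda>\<alpha>. \<bar>c \<alpha>\<bar> * R ^ mdeg \<alpha>) has_sum S) multi_indices \<and>
     (\<forall>x\<in>cube 0 R. ((\<lambda>\<alpha>. mmono \<alpha> x * c \<alpha>) has_sum g x) multi_indices))"

lemma second_order_weaken: "second_order g R M \<Longrightarrow> M \<le> N \<Longrightarrow> second_order g R N"
  unfolding second_order_def by (meson order_trans)

lemma second_order_shrink: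
  assumes "second_order f r M" "0 < s" "s \<le> r" shows "second_order f s M"
proof -
  obtain c S where S: "S \<le> M" "((\<lambda>\<alpha>. \<bar>c \<alpha>\<bar> * r ^ mdeg \<alpha>) has_sum S) multi_indices"
    and c: "\<forall>\<alpha>. mdeg \<alpha> < 2 \<longrightarrow> c \<alpha> = 0"
    and f: "\<forall>x\<in>cube 0 r. ((\<lambda>\<alpha>. mmono \<alpha> x * c \<alpha>) has_sum f x) multi_indices"
    using assms unfolding second_order_def by blast
  have le: "\<bar>c \<alpha>\<bar> * s ^ mdeg \<alpha> \<le> \<bar>c \<alpha>\<bar> * r ^ mdeg \<alpha>" for \<alpha>
    using assms by (intro mult_left_mono power_mono) auto
  have "(\<lambda>\<alpha>. \<bar>c \<alpha>\<bar> * s ^ mdeg \<alpha>) summable_on multi_indices"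
    by (rule summable_on_comparison_test[OF has_sum_imp_summable[OF S(2)] le]) (use assms in auto)
  then have *: "((\<lambda>\<alpha>. \<bar>c \<alpha>\<bar> * s ^ mdeg \<alpha>) has_sum infsum (\<lambda>\<alpha>. \<bar>c \<alpha>\<bar> * s ^ mdeg \<alpha>) multi_indices) multi_indices"
    by simp
  have "infsum (\<lambda>\<alpha>. \<bar>c \<alpha>\<bar> * s ^ mdeg \<alpha>) multi_indices \<le> M"
    using has_sum_mono[OF * S(2) le] S(1) by linarith
  then show ?thesis
    unfolding second_order_def using * f c cube_mono[OF assms(3), of "0::'a"]
    by (intro exI[of _ c] exI[of _ "infsum (\<lambda>\<alpha>. \<bar>c \<alpha>\<bar> * s ^ mdeg \<alpha>) multi_indices"]) auto
qed

lemma real_analytic_at_expand: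
  fixes f :: "'a::euclidean_space \<Rightarrow> real"
  assumes "real_analytic_at f a"
  obtains L R M where "linear L" "0 < R" "second_order (\<lambda>h. f (a + h) - f a - L h) R M"
proof -
  obtain R M where R: "0 < R" "majorized f a R M"
    using assms by (auto simp: real_analytic_at_iff_majorized)
  then obtain c S where S: "S \<le> M" "((\<lambda>\<alpha>. \<bar>c \<alpha>\<bar> * R ^ mdeg \<alpha>) has_sum S) multi_indices"
    and f: "\<And>x. x \<in> cube a R \<Longrightarrow> ((\<lambda>\<alpha>. mmono \<alpha> (x - a) * c \<alpha>) has_sum f x) multi_indices"
    unfolding majorized_def by blast
  define \<delta> where "\<delta> b = restrict (\<lambda>i. if i = b then 1 else 0::nat) (Basis :: 'a set)" for b
  define z where "z = restrict (\<lambda>_. 0::nat) (Basis :: 'a set)"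
  define L where "L h = (\<Sum>b\<in>Basis. (h \<bullet> b) * c (\<delta> b))" for h
  define d where "d \<alpha> = (if mdeg \<alpha> < 2 then 0 else c \<alpha>)" for \<alpha>
  have low: "{\<alpha> \<in> multi_indices. mdeg \<alpha> < 2} = insert z (\<delta> ` Basis)"
    unfolding z_def \<delta>_def[abs_def] by (rule finite_low_multi_indices)
  have \<delta>1: "\<delta> b b = 1" "b' \<in> Basis \<Longrightarrow> b \<noteq> b' \<Longrightarrow> \<delta> b b' = 0" if "b \<in> Basis" for b b'
    using that by (auto simp: \<delta>_def)
  have inj: "inj_on \<delta> Basis"
    by (rule inj_onI) (metis \<delta>1 zero_neq_one)
  have zn: "z \<notin> \<delta> ` Basis"
  proof
    assume "z \<in> \<delta> ` Basis"
    then obtain b where "b \<in> Basis" "z b = \<delta> b b" by auto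
    then show False using \<delta>1(1)[of b] by (simp add: z_def)
  qed
  have m\<delta>: "mmono (\<delta> b) h = h \<bullet> b" if "b \<in> Basis" for b h
  proof -
    have "mmono (\<delta> b) h = (\<Prod>i\<in>Basis. if i = b then h \<bullet> i else 1)"
      unfolding mmono_def by (rule prod.cong) (auto simp: \<delta>_def)
    then show ?thesis using that by (simp add: prod.delta)
  qed
  have lin: "linear L"
    unfolding L_def by (auto intro!: linearI simp: inner_add_left algebra_simps sum.distrib sum_distrib_left)
  have sum_low: "((\<lambda>\<alpha>. if mdeg \<alpha> < 2 then mmono \<alpha> h * c \<alpha> else 0) has_sum (c z + L h)) multi_indices" for h
  proof (rule has_sum_finite_neutralI[of "insert z (\<delta> ` Basis)"])
    show "c z + L h = (\<Sum>\<alpha>\<in>insert z (\<delta> ` Basis). if mdeg \<alpha> < 2 then mmono \<alpha> h * c \<alpha> else 0)"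
    proof -
      have "(\<Sum>\<alpha>\<in>insert z (\<delta> ` Basis). if mdeg \<alpha> < 2 then mmono \<alpha> h * c \<alpha> else 0) = (\<Sum>\<alpha>\<in>insert z (\<delta> ` Basis). mmono \<alpha> h * c \<alpha>)"
        by (rule sum.cong[OF refl]) (use low in auto)
      also have "\<dots> = mmono z h * c z + (\<Sum>b\<in>Basis. mmono (\<delta> b) h * c (\<delta> b))"
        using zn by (simp add: sum.reindex[OF inj])
      also have "\<dots> = c z + L h" by (simp add: L_def m\<delta> z_def) (simp add: mmono_def)
      finally show ?thesis by simp
    qed
  qed (use low in auto)
  have rest: "((\<lambda>\<alpha>. mmono \<alpha> h * d \<alpha>) has_sum (f (a + h) - c z - L h)) multi_indices" if "h \<in> cube 0 R" for h
  proof -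
    have "a + h \<in> cube a R" using that by (simp add: cube_def)
    from has_sum_add[OF f[OF this] has_sum_uminusI[OF sum_low[of h]]]
    have "((\<lambda>\<alpha>. mmono \<alpha> h * c \<alpha> + - (if mdeg \<alpha> < 2 then mmono \<alpha> h * c \<alpha> else 0)) has_sum (f (a + h) + - (c z + L h))) multi_indices"
      by simp
    moreover have "mmono \<alpha> h * c \<alpha> + - (if mdeg \<alpha> < 2 then mmono \<alpha> h * c \<alpha> else 0) = mmono \<alpha> h * d \<alpha>" for \<alpha>
      by (simp add: d_def)
    ultimately show ?thesis by (simp add: algebra_simps)
  qed
  have m0: "mmono \<alpha> 0 * d \<alpha> = 0" for \<alpha> :: "'a \<Rightarrow> nat"
  proof (cases "mdeg \<alpha> < 2")
    case False
    then show ?thesis by (simp add: mmono_zero)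
  qed (simp add: d_def)
  have "((\<lambda>\<alpha>. mmono \<alpha> 0 * d \<alpha>) has_sum (f a - c z)) multi_indices"
    using rest[of 0] R(1) linear_0[OF lin] by simp
  from has_sum_unique[OF this has_sum_0[OF m0]] have cz: "f a = c z" by simp
  have le: "\<bar>d \<alpha>\<bar> * R ^ mdeg \<alpha> \<le> \<bar>c \<alpha>\<bar> * R ^ mdeg \<alpha>" for \<alpha>
    using R by (auto simp: d_def)
  have "(\<lambda>\<alpha>. \<bar>d \<alpha>\<bar> * R ^ mdeg \<alpha>) summable_on multi_indices"
    by (rule summable_on_comparison_test[OF has_sum_imp_summable[OF S(2)] le]) (use R in auto)
  then have *: "((\<lambda>\<alpha>. \<bar>d \<alpha>\<bar> * R ^ mdeg \<alpha>) has_sum infsum (\<lambda>\<alpha>. \<bar>d \<alpha>\<bar> * R ^ mdeg \<alpha>) multi_indices) multi_indices"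
    by simp
  have "second_order (\<lambda>h. f (a + h) - f a - L h) R (infsum (\<lambda>\<alpha>. \<bar>d \<alpha>\<bar> * R ^ mdeg \<alpha>) multi_indices)"
    unfolding second_order_def using * rest cz
    by (intro exI[of _ d] exI[of _ "infsum (\<lambda>\<alpha>. \<bar>d \<alpha>\<bar> * R ^ mdeg \<alpha>) multi_indices"]) (auto simp: d_def)
  then show ?thesis using that lin R(1) by blast
qed

text \<open>The mean value bound \<open>n * \<rho> ^ (n - 1) * \<delta>\<close>, written with a
  quotient so that \<open>n = 0\<close> involves no truncated subtraction.\<close>

lemma majorized_power_diff:
  assumes s: "0 < s" and \<rho>: "0 < \<rho>" and u: "majorized u y s \<rho>" and v: "majorized v y s \<rho>"
    and uv: "majorized (\<lambda>x. u x - v x) y s \<delta>"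
  shows "majorized (\<lambda>x. u x ^ n - v x ^ n) y s (n * \<rho> ^ n * (\<delta> / \<rho>))"
proof (induction n)
  case 0 then show ?case using majorized_const[OF s, of 0 y] by simp
next
  case (Suc n)
  have "majorized (\<lambda>x. (u x - v x) * u x ^ n + v x * (u x ^ n - v x ^ n)) y s (\<delta> * \<rho> ^ n + \<rho> * (n * \<rho> ^ n * (\<delta> / \<rho>)))"
    by (intro majorized_add majorized_mult majorized_power s uv u v Suc)
  moreover have "(u x - v x) * u x ^ n + v x * (u x ^ n - v x ^ n) = u x ^ Suc n - v x ^ Suc n" for x
    by (simp add: algebra_simps)
  moreover have "\<delta> * \<rho> ^ n + \<rho> * (n * \<rho> ^ n * (\<delta> / \<rho>)) = Suc n * \<rho> ^ Suc n * (\<delta> / \<rho>)"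
    using \<rho> by (simp add: field_simps)
  ultimately show ?case by simp
qed

text \<open>A product rule over the coordinates: the difference of one power times the remaining
  powers of \<open>u\<close>, plus one power of \<open>v\<close> times the remaining
  difference.\<close>

lemma majorized_mmono_diff:
  assumes s: "0 < s" and \<rho>: "0 < \<rho>" and A: "finite A"
    and u: "\<And>b. b \<in> A \<Longrightarrow> majorized (\<lambda>x. u x b) y s \<rho>" and v: "\<And>b. b \<in> A \<Longrightarrow> majorized (\<lambda>x. v x b) y s \<rho>"
    and uv: "\<And>b. b \<in> A \<Longrightarrow> majorized (\<lambda>x. u x b - v x b) y s \<delta>"
  shows "majorized (\<lambda>x. (\<Prod>b\<in>A. u x b ^ \<alpha> b) - (\<Prod>b\<in>A. v x b ^ \<alpha> b)) y s (real (sum \<alpha> A) * \<rho> ^ sum \<alpha> A * (\<delta> / \<rho>))"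
  using A u v uv
proof (induction A rule: finite_induct)
  case empty then show ?case using majorized_const[OF s, of 0 y] by simp
next
  case (insert i A)
  let ?n = "\<alpha> i" and ?N = "sum \<alpha> A"
  have "majorized (\<lambda>x. (u x i ^ ?n - v x i ^ ?n) * (\<Prod>b\<in>A. u x b ^ \<alpha> b) + v x i ^ ?n * ((\<Prod>b\<in>A. u x b ^ \<alpha> b) - (\<Prod>b\<in>A. v x b ^ \<alpha> b))) y s
    ((?n * \<rho> ^ ?n * (\<delta> / \<rho>)) * (\<Prod>b\<in>A. \<rho> ^ \<alpha> b) + \<rho> ^ ?n * (?N * \<rho> ^ ?N * (\<delta> / \<rho>)))"
    by (intro majorized_add majorized_mult majorized_power majorized_prod majorized_power_diff s \<rho> insert) (use insert in auto)
  moreover have "(u x i ^ ?n - v x i ^ ?n) * (\<Prod>b\<in>A. u x b ^ \<alpha> b) + v x i ^ ?n * ((\<Prod>b\<in>A. u x b ^ \<alpha> b) - (\<Prod>b\<in>A. v x b ^ \<alpha> b))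
     = (\<Prod>b\<in>insert i A. u x b ^ \<alpha> b) - (\<Prod>b\<in>insert i A. v x b ^ \<alpha> b)" for x
    using insert by (simp add: algebra_simps)
  moreover have "(?n * \<rho> ^ ?n * (\<delta> / \<rho>)) * (\<Prod>b\<in>A. \<rho> ^ \<alpha> b) + \<rho> ^ ?n * (?N * \<rho> ^ ?N * (\<delta> / \<rho>))
     = real (sum \<alpha> (insert i A)) * \<rho> ^ sum \<alpha> (insert i A) * (\<delta> / \<rho>)"
    using insert by (simp add: power_sum[symmetric] power_add algebra_simps add_divide_distrib)
  ultimately show ?case by simp
qed

text \<open>Degree two is the worst case: passing from \<open>n\<close> to \<open>n + 1\<close>
  multiplies the left side by at most \<open>4 * t\<close>, which is at most 1.\<close>

lemma second_order_power_bound: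
  fixes t :: real assumes "0 < t" "t \<le> 1/4" "2 \<le> n" shows "n * t ^ n \<le> 2 * t * t"
  using assms(3)
proof (induction n rule: dec_induct)
  case (step n)
  have "real (Suc n) \<le> 4 * n" using step by simp
  then have "Suc n * t ^ Suc n \<le> (4 * n) * t ^ Suc n" using assms by (intro mult_right_mono) auto
  also have "\<dots> = (4 * t) * (n * t ^ n)" by simp
  also have "\<dots> \<le> 1 * (n * t ^ n)" using assms by (intro mult_right_mono) auto
  finally show ?case using step by simp
qed (simp add: power2_eq_square)

text \<open>All terms have degree at least two, so the Lipschitz constant is proportional to the
  relative radius \<open>t\<close> and can be made small. The arguments are maps \<open>u\<close>
  and \<open>v\<close> rather than points, because the contraction is needed for series.\<close>

lemma second_order_lipschitz:
  fixes g :: "'a::euclidean_space \<Rightarrow> real" and u v :: "'b::euclidean_space \<Rightarrow> 'a"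
  assumes g: "second_order g R M" and R: "0 < R" and t: "0 < t" "t \<le> 1/4" and s: "0 < s"
    and u: "\<And>b. b \<in> Basis \<Longrightarrow> majorized (\<lambda>x. u x \<bullet> b) y s (t * R)"
    and v: "\<And>b. b \<in> Basis \<Longrightarrow> majorized (\<lambda>x. v x \<bullet> b) y s (t * R)"
    and uv: "\<And>b. b \<in> Basis \<Longrightarrow> majorized (\<lambda>x. u x \<bullet> b - v x \<bullet> b) y s \<delta>"
  shows "majorized (\<lambda>x. g (u x) - g (v x)) y s (M * (2 * t * \<delta> / R))"
proof -
  obtain c S where S: "S \<le> M" "((\<lambda>\<alpha>. \<bar>c \<alpha>\<bar> * R ^ mdeg \<alpha>) has_sum S) multi_indices"
    and c: "\<forall>\<alpha>. mdeg \<alpha> < 2 \<longrightarrow> c \<alpha> = 0"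
    and gc: "\<And>x. x \<in> cube 0 R \<Longrightarrow> ((\<lambda>\<alpha>. mmono \<alpha> x * c \<alpha>) has_sum g x) multi_indices"
    using g unfolding second_order_def by blast
  obtain b0 :: 'a where b0: "b0 \<in> Basis" using nonempty_Basis by blast
  have \<delta>: "0 \<le> \<delta>" using majorized_nonneg[OF uv[OF b0] s] .
  have tR: "0 < t * R" "t * R \<le> R" using t R by auto
  show ?thesis
  proof (rule majorized_infsum[where f="\<lambda>\<alpha> x. (mmono \<alpha> (u x) - mmono \<alpha> (v x)) * c \<alpha>" and J=multi_indices, OF s])
    show "((\<lambda>\<alpha>. (\<bar>c \<alpha>\<bar> * R ^ mdeg \<alpha>) * (2 * t * \<delta> / R)) has_sum S * (2 * t * \<delta> / R)) multi_indices"
      by (intro has_sum_cmult_left S)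
    show "S * (2 * t * \<delta> / R) \<le> M * (2 * t * \<delta> / R)"
      using S(1) t \<delta> R by (intro mult_right_mono) auto
    fix x assume x: "x \<in> cube y s"
    have "u x \<in> cube 0 R" "v x \<in> cube 0 R"
      using majorized_bound[OF u s x] majorized_bound[OF v s x] tR(2) by (force simp: cube_def)+
    from has_sum_add[OF gc[OF this(1)] has_sum_uminusI[OF gc[OF this(2)]]]
    show "((\<lambda>\<alpha>. (mmono \<alpha> (u x) - mmono \<alpha> (v x)) * c \<alpha>) has_sum g (u x) - g (v x)) multi_indices"
      by (simp add: algebra_simps)
  next
    fix \<alpha> :: "'a \<Rightarrow> nat"
    let ?N = "mdeg \<alpha>"
    have 1: "majorized (\<lambda>x. mmono \<alpha> (u x) - mmono \<alpha> (v x)) y s (?N * (t * R) ^ ?N * (\<delta> / (t * R)))"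
      unfolding mmono_def mdeg_def by (intro majorized_mmono_diff s tR u v uv) auto
    show "majorized (\<lambda>x. (mmono \<alpha> (u x) - mmono \<alpha> (v x)) * c \<alpha>) y s (\<bar>c \<alpha>\<bar> * R ^ mdeg \<alpha> * (2 * t * \<delta> / R))"
    proof (cases "?N < 2")
      case True then show ?thesis using majorized_const[OF s, of 0 y] c by simp
    next
      case False
      then have "?N * t ^ ?N \<le> 2 * t * t" by (intro second_order_power_bound t) auto
      then have "(?N * t ^ ?N) * (R ^ ?N * \<delta> / (t * R)) \<le> (2 * t * t) * (R ^ ?N * \<delta> / (t * R))"
        using \<delta> tR R by (intro mult_right_mono) auto
      then have "?N * (t * R) ^ ?N * (\<delta> / (t * R)) \<le> R ^ ?N * (2 * t * \<delta> / R)"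
        using t R by (simp add: power_mult_distrib field_simps)
      from majorized_cmult[OF s majorized_weaken[OF 1 this], of "c \<alpha>"]
      show ?thesis by (simp add: mult_ac)
    qed
  qed
qed

lemma second_order_lipschitz_pointwise:
  fixes g :: "'a::euclidean_space \<Rightarrow> real"
  assumes "second_order g R M" "0 < R" "0 < t" "t \<le> 1/4" "x \<in> cube 0 (t * R)" "x' \<in> cube 0 (t * R)"
    "\<And>b. b \<in> Basis \<Longrightarrow> \<bar>(x - x') \<bullet> b\<bar> \<le> \<delta>"
  shows "\<bar>g x - g x'\<bar> \<le> M * (2 * t * \<delta> / R)"
proof -
  \<comment> \<open>The point estimate is the series estimate for constant maps on a dummy
    domain.\<close>
  have "majorized (\<lambda>_::real. g x - g x') 0 1 (M * (2 * t * \<delta> / R))"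
    by (rule second_order_lipschitz[OF assms(1-4), where u="\<lambda>_. x" and v="\<lambda>_. x'"])
      (use assms(5-7) in \<open>auto intro!: majorized_weaken[OF majorized_const] simp: cube_def inner_diff_left\<close>)
  from majorized_bound[OF this, of 0] show ?thesis by simp
qed

lemma second_order_zero:
  assumes "second_order g R M" "0 < R" shows "g 0 = 0"
proof -
  obtain c where c: "\<forall>\<alpha>. mdeg \<alpha> < 2 \<longrightarrow> c \<alpha> = 0"
    and "\<forall>x\<in>cube 0 R. ((\<lambda>\<alpha>. mmono \<alpha> x * c \<alpha>) has_sum g x) multi_indices"
    using assms(1) unfolding second_order_def by blast
  then have gc: "((\<lambda>\<alpha>. mmono \<alpha> 0 * c \<alpha>) has_sum g 0) multi_indices" using assms(2) by simp
  have "mmono \<alpha> 0 * c \<alpha> = 0" for \<alpha> :: "'a \<Rightarrow> nat"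
  proof (cases "mdeg \<alpha> < 2")
    case False
    then show ?thesis by (simp add: mmono_zero)
  qed (simp add: c)
  then show ?thesis by (intro has_sum_unique[OF gc] has_sum_0)
qed

lemma real_analytic_at_expand_derivative:
  fixes f :: "'a::euclidean_space \<Rightarrow> real"
  assumes L: "linear L" and R: "0 < R" and so: "second_order (\<lambda>h. f (a + h) - f a - L h) R M"
  shows "(f has_derivative L) (at a)"
  unfolding has_derivative_at_alt
proof (intro conjI allI impI)
  show "bounded_linear L" using L linear_conv_bounded_linear by blast
  fix e :: real assume e: "0 < e"
  define g where "g h = f (a + h) - f a - L h" for h
  have so: "second_order g R M" using so by (simp add: g_def[abs_def])
  \<comment> \<open>The first bound keeps \<open>t\<close> within 1/4; the second makes the
    quadratic remainder \<open>(2 * \<bar>M\<bar> * n / R\<^sup>2) * n\<close> at most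
    \<open>e * n\<close>.\<close>
  define d where "d = min (R / 4) (e * R\<^sup>2 / (2 * \<bar>M\<bar> + 1))"
  have d: "0 < d" using R e by (simp add: d_def)
  have "norm (f y - f a - L (y - a)) \<le> e * norm (y - a)" if "norm (y - a) < d" for y
  proof (cases "y = a")
    case True then show ?thesis using linear_0[OF L] by simp
  next
    case False
    define n where "n = norm (y - a)"
    have n: "0 < n" "n < d" using False that by (auto simp: n_def)
    define t where "t = n / R"
    have t: "0 < t" "t \<le> 1/4" "t * R = n" using n R by (auto simp: t_def d_def)
    have b: "\<bar>(y - a) \<bullet> b\<bar> \<le> n" if "b \<in> Basis" for b
      using Basis_le_norm[OF that, of "y - a"] by (simp add: n_def)
    have "\<bar>g (y - a) - g 0\<bar> \<le> M * (2 * t * n / R)"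
      using b n(1) by (intro second_order_lipschitz_pointwise[OF so R t(1,2)]) (auto simp: t(3) cube_def)
    also have "\<dots> \<le> \<bar>M\<bar> * (2 * t * n / R)" using n t R by (intro mult_right_mono) auto
    also have "\<dots> = (2 * \<bar>M\<bar> * n / R\<^sup>2) * n" by (simp add: t_def power2_eq_square)
    also have "\<dots> \<le> e * n"
    proof (rule mult_right_mono)
      have "n * (2 * \<bar>M\<bar> + 1) \<le> e * R\<^sup>2"
        using n(2) by (simp add: d_def field_simps add_pos_nonneg)
      then have "2 * \<bar>M\<bar> * n \<le> e * R\<^sup>2" using n(1) by (simp add: algebra_simps)
      then show "2 * \<bar>M\<bar> * n / R\<^sup>2 \<le> e" using R by (simp add: divide_le_eq)
    qed (use n in auto)
    finally show ?thesis using second_order_zero[OF so R] by (simp add: g_def n_def)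
  qed
  then show "\<exists>d>0. \<forall>y. norm (y - a) < d \<longrightarrow> norm (f y - f a - L (y - a)) \<le> e * norm (y - a)"
    using d by blast
qed

lemma real_analytic_at_imp_has_derivative:
  fixes f :: "'a::euclidean_space \<Rightarrow> 'b::euclidean_space"
  assumes "real_analytic_at f a"
  obtains f' where "(f has_derivative f') (at a)"
proof -
  have "\<exists>L. ((\<lambda>x. f x \<bullet> i) has_derivative L) (at a)" if "i \<in> Basis" for i
  proof -
    have "real_analytic_at (\<lambda>x. f x \<bullet> i) a" using assms that real_analytic_at_componentwise by blast
    then obtain L R M where "linear L" "0 < R" "second_order (\<lambda>h. f (a + h) \<bullet> i - f a \<bullet> i - L h) R M"
      by (rule real_analytic_at_expand)
    then show ?thesis by (blast intro: real_analytic_at_expand_derivative)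
  qed
  then have "f differentiable at a"
    unfolding differentiable_componentwise_within[of f] by (auto simp: differentiable_def)
  then show ?thesis using that by (auto simp: differentiable_def)
qed

lemma real_analytic_at_imp_continuous:
  "real_analytic_at f a \<Longrightarrow> isCont f a"
  by (metis real_analytic_at_imp_has_derivative has_derivative_continuous)

lemma open_real_analytic_at: "open {x. real_analytic_at f x}"
proof (subst open_subopen, intro ballI)
  fix a assume "a \<in> {x. real_analytic_at f x}"
  then obtain S where "open S" "a \<in> S" "\<forall>x\<in>S. real_analytic_at f x"
    using real_analytic_at_eventually[of f a] unfolding eventually_nhds by blast
  then show "\<exists>T. open T \<and> a \<in> T \<and> T \<subseteq> {x. real_analytic_at f x}" by blast
qed

section \<open>Analytic inverse functions and slice charts\<close>

text \<open>The inverse is the limit of \<open>G\<^sub>n\<^sub>+\<^sub>1(y) = y - g(G\<^sub>n(y))\<close>, where \<open>f(a + h) = f(a) + h + g(h)\<close>;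
  by the second order estimate this iteration contracts in the norm of absolutely convergent
  power series, so its limit is again a power series.\<close>

lemma analytic_fixed_point:
  fixes g :: "'a::euclidean_space \<Rightarrow> 'a"
  assumes g: "\<And>i. i \<in> Basis \<Longrightarrow> second_order (\<lambda>h. g h \<bullet> i) R M" and R: "0 < R"
  obtains \<rho> s G where "0 < \<rho>" "0 < s" "real_analytic_at G 0"
    "\<And>y. y \<in> cube 0 s \<Longrightarrow> G y \<in> cube 0 \<rho> \<and> G y + g (G y) = y"
    "\<And>h h'. h \<in> cube 0 \<rho> \<Longrightarrow> h' \<in> cube 0 \<rho> \<Longrightarrow> h + g h = h' + g h' \<Longrightarrow> h = h'"
proof -
  \<comment> \<open>The first bound is the range of the Lipschitz estimate; the second makes its
    factor \<open>2 * M * t / R\<close> at most 1/2.\<close>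
  define t where "t = min (1/4) (R / (4 * (\<bar>M\<bar> + 1)))"
  have "0 < t" using R by (simp add: t_def add_nonneg_pos)
  moreover have "t \<le> 1/4" unfolding t_def by (rule min.cobounded1)
  ultimately have t: "0 < t" "t \<le> 1/4" .
  have "t * (4 * (\<bar>M\<bar> + 1)) \<le> R"
  proof -
    have "t \<le> R / (4 * (\<bar>M\<bar> + 1))" by (simp add: t_def)
    then show ?thesis by (simp add: pos_le_divide_eq)
  qed
  moreover have "t * (4 * M) \<le> t * (4 * (\<bar>M\<bar> + 1))" using t(1) by (intro mult_left_mono) auto
  ultimately have "4 * t * M \<le> R" by (simp add: mult_ac)
  then have half: "M * (2 * t * \<delta> / R) \<le> \<delta> / 2" if "0 \<le> \<delta>" for \<delta>
    using mult_right_mono[of "4 * t * M" R \<delta>] that R by (simp add: field_simps)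
  define \<rho> where "\<rho> = t * R"
  \<comment> \<open>The increments of the iteration have norms at most \<open>s\<close>,
    \<open>s / 2\<close>, \<open>s / 4\<close> and so on; their sum \<open>2 * s\<close> is exactly
    the radius \<rho> on which the contraction holds.\<close>
  define s where "s = \<rho> / 2"
  have \<rho>: "0 < \<rho>" and s: "0 < s" using t R by (auto simp: \<rho>_def s_def)
  have le: "2 * s * (1 - (1/2) ^ k) \<le> t * R" for k :: nat
  proof -
    have "2 * s * (1 - (1/2) ^ k) \<le> 2 * s * 1" using s by (intro mult_left_mono) auto
    then show ?thesis by (simp add: s_def \<rho>_def)
  qed
  have lip: "\<bar>(g x - g x') \<bullet> i\<bar> \<le> \<delta> / 2"
    if "x \<in> cube 0 \<rho>" "x' \<in> cube 0 \<rho>" "\<And>b. b \<in> Basis \<Longrightarrow> \<bar>(x - x') \<bullet> b\<bar> \<le> \<delta>" "0 \<le> \<delta>" "i \<in> Basis" for x x' \<delta> i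
    using second_order_lipschitz_pointwise[OF g[OF that(5)] R t, of x x' \<delta>] that half[of \<delta>]
    by (auto simp: \<rho>_def inner_diff_left)
  have g0: "g 0 = 0" using second_order_zero[OF g R] by (auto intro: euclidean_eqI)
  define G where "G n = ((\<lambda>F y. y - g (F y)) ^^ n) (\<lambda>_. 0)" for n :: nat
  have G0: "G 0 = (\<lambda>_. 0)" and GS: "G (Suc n) = (\<lambda>y. y - g (G n y))" for n by (auto simp: G_def)
  have step: "(\<forall>i\<in>Basis. majorized (\<lambda>y. G n y \<bullet> i) 0 s (2 * s * (1 - (1/2) ^ n))) \<and>
              (\<forall>i\<in>Basis. majorized (\<lambda>y. G (Suc n) y \<bullet> i - G n y \<bullet> i) 0 s (s * (1/2) ^ n))" for n
  proof (induction n)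
    case 0
    show ?case using majorized_const[OF s, of 0 0] majorized_coord[OF s, of _ 0] by (auto simp: G0 GS g0)
  next
    case (Suc n)
    have a: "majorized (\<lambda>y. G (Suc n) y \<bullet> i) 0 s (2 * s * (1 - (1/2) ^ Suc n))" if "i \<in> Basis" for i
      using majorized_add[OF s Suc[THEN conjunct1, rule_format, OF that] Suc[THEN conjunct2, rule_format, OF that]]
      by (simp add: algebra_simps)
    have "majorized (\<lambda>y. G (Suc (Suc n)) y \<bullet> i - G (Suc n) y \<bullet> i) 0 s (s * (1/2) ^ Suc n)" if i: "i \<in> Basis" for i
    proof -
      have "majorized (\<lambda>y. g (G (Suc n) y) \<bullet> i - g (G n y) \<bullet> i) 0 s (M * (2 * t * (s * (1/2) ^ n) / R))"
        by (rule second_order_lipschitz[OF g[OF i] R t s])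
          (use Suc majorized_weaken[OF a le] in \<open>auto intro: majorized_weaken[OF _ le]\<close>)
      from majorized_cmult[OF s majorized_weaken[OF this half], of "-1"] s
      show ?thesis by (simp add: GS inner_diff_left)
    qed
    with a show ?case by blast
  qed
  define d where "d n i y = G (Suc n) y \<bullet> i - G n y \<bullet> i" for n i y
  have geo: "((\<lambda>n. s * (1/2) ^ n) has_sum 2 * s) UNIV"
    using s geometric_sums[of "1/2::real"]
    by (intro norm_summable_imp_has_sum) (auto intro: sums_mult[of _ _ s, simplified mult.commute[of s]] simp: mult.commute sums_mult summable_geometric summable_mult power_abs)
  have dmaj: "majorized (d n i) 0 s (s * (1/2) ^ n)" if "i \<in> Basis" for n i
    using step that by (simp add: d_def[abs_def])
  define H where "H y = (\<Sum>i\<in>Basis. infsum (\<lambda>n. d n i y) UNIV *\<^sub>R i)" for y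
  have Hi: "((\<lambda>n. d n i y) has_sum H y \<bullet> i) UNIV" if "i \<in> Basis" "y \<in> cube 0 s" for i y
  proof -
    have "(\<lambda>n. norm (d n i y)) summable_on UNIV"
      by (rule summable_on_comparison_test[OF has_sum_imp_summable[OF geo]])
        (use majorized_bound[OF dmaj[OF that(1)] s that(2)] in auto)
    then have "(\<lambda>n. d n i y) summable_on UNIV" by (rule abs_summable_summable)
    then show ?thesis using that(1) by (simp add: H_def)
  qed
  have Hmaj: "majorized (\<lambda>y. H y \<bullet> i) 0 s (2 * s)" if "i \<in> Basis" for i
    by (rule majorized_infsum[OF s dmaj[OF that] geo order_refl Hi[OF that]])
  have lim: "(\<lambda>n. G n y) \<longlonglongrightarrow> H y" if y: "y \<in> cube 0 s" for y
  proof (subst tendsto_componentwise_iff, intro ballI)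
    fix i :: 'a assume i: "i \<in> Basis"
    have "(\<Sum>k<n. d k i y) = G n y \<bullet> i" for n
      using sum_lessThan_telescope[of "\<lambda>n. G n y \<bullet> i" n] by (simp add: d_def G0)
    then show "(\<lambda>n. G n y \<bullet> i) \<longlonglongrightarrow> H y \<bullet> i"
      using has_sum_imp_sums[OF Hi[OF i y]] by (simp add: sums_def)
  qed
  have cG: "G n y \<in> cube 0 \<rho>" if "y \<in> cube 0 s" for n y
  proof -
    have "\<bar>G n y \<bullet> i\<bar> \<le> \<rho>" if "i \<in> Basis" for i
    proof -
      have "2 * s * (1 - (1/2) ^ n) \<le> \<rho>" using le by (simp add: \<rho>_def)
      then show ?thesis using majorized_bound[OF step[THEN conjunct1, rule_format, OF that] s \<open>y \<in> cube 0 s\<close>, of n] by linarith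
    qed
    then show ?thesis by (simp add: cube_def)
  qed
  have cH: "H y \<in> cube 0 \<rho>" if "y \<in> cube 0 s" for y
    using majorized_bound[OF Hmaj s that] by (simp add: cube_def s_def)
  show ?thesis
  proof (rule that[OF \<rho> s])
    show "real_analytic_at H 0"
      unfolding real_analytic_at_componentwise[of H] real_analytic_at_iff_majorized using Hmaj s by blast
  next
    fix y :: 'a assume y: "y \<in> cube 0 s"
    have "(\<lambda>n. g (G n y)) \<longlonglongrightarrow> g (H y)"
    proof (subst tendsto_componentwise_iff, intro ballI)
      fix i :: 'a assume i: "i \<in> Basis"
      have A: "(\<lambda>n. norm (G n y - H y) / 2) \<longlonglongrightarrow> 0"
        using lim[OF y] by (intro tendsto_divide_zero tendsto_norm_zero) (simp add: LIM_zero_iff)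
      have B: "norm (g (G n y) \<bullet> i - g (H y) \<bullet> i) \<le> norm (G n y - H y) / 2" for n
        using lip[where \<delta>="norm (G n y - H y)" and i=i, OF cG[OF y, of n] cH[OF y] Basis_le_norm] i by (simp add: inner_diff_left)
      have "(\<lambda>n. g (G n y) \<bullet> i - g (H y) \<bullet> i) \<longlonglongrightarrow> 0"
        by (rule Lim_null_comparison[OF always_eventually[OF allI[OF B]] A])
      then show "(\<lambda>n. g (G n y) \<bullet> i) \<longlonglongrightarrow> g (H y) \<bullet> i" by (simp add: LIM_zero_iff)
    qed
    then have "(\<lambda>n. G (Suc n) y) \<longlonglongrightarrow> y - g (H y)" unfolding GS by (intro tendsto_intros)
    moreover have "(\<lambda>n. G (Suc n) y) \<longlonglongrightarrow> H y" using lim[OF y] by (rule LIMSEQ_Suc)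
    ultimately have "H y = y - g (H y)" using LIMSEQ_unique by blast
    then show "H y \<in> cube 0 \<rho> \<and> H y + g (H y) = y" using cH[OF y] by (simp add: algebra_simps)
  next
    fix h h' :: 'a assume h: "h \<in> cube 0 \<rho>" "h' \<in> cube 0 \<rho>" and eq: "h + g h = h' + g h'"
    \<comment> \<open>The largest coordinate difference is attained at some \<open>b\<close>, and
      the contraction bounds it by half of itself.\<close>
    define \<delta> where "\<delta> = Max ((\<lambda>b. \<bar>(h - h') \<bullet> b\<bar>) ` Basis)"
    have \<delta>: "\<bar>(h - h') \<bullet> b\<bar> \<le> \<delta>" if "b \<in> Basis" for b using that by (auto simp: \<delta>_def)
    have "\<delta> \<in> (\<lambda>b. \<bar>(h - h') \<bullet> b\<bar>) ` Basis" unfolding \<delta>_def by (rule Max_in) auto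
    then obtain b where b: "b \<in> Basis" "\<delta> = \<bar>(h - h') \<bullet> b\<bar>" by blast
    have "h - h' = g h' - g h" using eq by (simp add: algebra_simps)
    moreover have "\<bar>(g h' - g h) \<bullet> b\<bar> \<le> \<delta> / 2"
      using \<delta> b by (intro lip[OF h(2,1)]) (auto simp: abs_minus_commute inner_diff_left)
    ultimately have "\<delta> \<le> \<delta> / 2" using b(2) by simp
    then have \<delta>0: "\<delta> = 0" using b(2) by simp
    have "(h - h') \<bullet> b = 0 \<bullet> b" if "b \<in> Basis" for b
      using \<delta>[OF that] \<delta>0 by simp
    then have "h - h' = 0" by (rule euclidean_eqI)
    then show "h = h'" by simp
  qed
qed

text \<open>The identity derivative is the normalization that the slice charts provide; it leaves
  \<open>g\<close> without linear terms, as the fixed point lemma requires.\<close>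

theorem analytic_inverse_function:
  fixes F :: "'a::euclidean_space \<Rightarrow> 'a"
  assumes F: "real_analytic_at F a" and d: "(F has_derivative (\<lambda>h. h)) (at a)" and X: "open X" "a \<in> X"
  obtains U V G where "open U" "a \<in> U" "U \<subseteq> X" "open V"
    "\<And>x. x \<in> U \<Longrightarrow> F x \<in> V \<and> G (F x) = x \<and> real_analytic_at F x"
    "\<And>y. y \<in> V \<Longrightarrow> G y \<in> U \<and> F (G y) = y \<and> real_analytic_at G y"
proof -
  define g where "g h = F (a + h) - F a - h" for h
  have "\<exists>RM. 0 < fst RM \<and> second_order (\<lambda>h. g h \<bullet> i) (fst RM) (snd RM)" if i: "i \<in> Basis" for i
  proof -
    have "real_analytic_at (\<lambda>x. F x \<bullet> i) a" using F i real_analytic_at_componentwise by blast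
    then obtain L R M where L: "linear L" "0 < R" and so: "second_order (\<lambda>h. F (a + h) \<bullet> i - F a \<bullet> i - L h) R M"
      by (rule real_analytic_at_expand)
    have "((\<lambda>x. F x \<bullet> i) has_derivative L) (at a)" by (rule real_analytic_at_expand_derivative[OF L so])
    moreover have "((\<lambda>x. F x \<bullet> i) has_derivative (\<lambda>h. h \<bullet> i)) (at a)"
      using d by (rule has_derivative_inner_left)
    ultimately have "L = (\<lambda>h. h \<bullet> i)" by (rule has_derivative_unique)
    then show ?thesis using so L(2) by (intro exI[of _ "(R, M)"]) (simp add: g_def inner_diff_left)
  qed
  then have "\<forall>i\<in>Basis. \<exists>RM. 0 < fst RM \<and> second_order (\<lambda>h. g h \<bullet> i) (fst RM) (snd RM)" by blast
  from bchoice[OF this] obtain RM where RM: "\<forall>i\<in>Basis. 0 < fst (RM i) \<and> second_order (\<lambda>h. g h \<bullet> i) (fst (RM i)) (snd (RM i))" ..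
  define R where "R = Min ((fst \<circ> RM) ` Basis)"
  define M where "M = Max ((snd \<circ> RM) ` Basis)"
  have R: "0 < R" "\<And>i. i \<in> Basis \<Longrightarrow> R \<le> fst (RM i)" using RM by (auto simp: R_def)
  have M: "\<And>i. i \<in> Basis \<Longrightarrow> snd (RM i) \<le> M" by (auto simp: M_def)
  have "second_order (\<lambda>h. g h \<bullet> i) R M" if "i \<in> Basis" for i
    using RM that R M second_order_weaken second_order_shrink by metis
  then obtain \<rho> s G where \<rho>: "0 < \<rho>" and s: "0 < s" and G: "real_analytic_at G 0"
    and GF: "\<And>y. y \<in> cube 0 s \<Longrightarrow> G y \<in> cube 0 \<rho> \<and> G y + g (G y) = y"
    and inj: "\<And>h h'. h \<in> cube 0 \<rho> \<Longrightarrow> h' \<in> cube 0 \<rho> \<Longrightarrow> h + g h = h' + g h' \<Longrightarrow> h = h'"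
    using R(1) by (rule analytic_fixed_point) blast+
  define I where "I z = a + G (z - F a)" for z
  have cI: "I z \<in> cube a \<rho>" and FI: "F (I z) = z" if "z \<in> cube (F a) s" for z
  proof -
    have "z - F a \<in> cube 0 s" using that by (simp add: cube_def)
    from GF[OF this] show "I z \<in> cube a \<rho>" "F (I z) = z"
      by (auto simp: I_def g_def cube_def algebra_simps)
  qed
  have injF: "x = x'" if "x \<in> cube a \<rho>" "x' \<in> cube a \<rho>" "F x = F x'" for x x'
    using inj[of "x - a" "x' - a"] that by (auto simp: cube_def g_def)
  have "real_analytic_at (\<lambda>z. z - F a) (F a)"
    by (rule real_analytic_at_diff[OF real_analytic_at_ident real_analytic_at_const])
  then have "real_analytic_at (\<lambda>z. G (z - F a)) (F a)"
    by (rule real_analytic_at_compose) (simp add: G)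
  then have Ian: "real_analytic_at I (F a)"
    unfolding I_def[abs_def] by (rule real_analytic_at_add[OF real_analytic_at_const])
  define U0 where "U0 = X \<inter> ball a \<rho> \<inter> {x. real_analytic_at F x}"
  define V0 where "V0 = ball (F a) s \<inter> {y. real_analytic_at I y}"
  have o: "open U0" "open V0" using X(1) unfolding U0_def V0_def by (intro open_Int open_ball open_real_analytic_at; simp)+
  have U0c: "U0 \<subseteq> cube a \<rho>" and V0c: "V0 \<subseteq> cube (F a) s"
    using ball_subset_cube by (fastforce simp: U0_def V0_def)+
  have Fc: "continuous_on U0 F" and Ic: "continuous_on V0 I"
    by (auto intro!: continuous_at_imp_continuous_on real_analytic_at_imp_continuous simp: U0_def V0_def)
  have IFa: "I (F a) = a"
    using cI[of "F a"] FI[of "F a"] s \<rho> injF[of "I (F a)" a] by simp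
  \<comment> \<open>Shrinking to points whose images return to the chosen neighbourhoods makes
    \<open>F\<close> and \<open>I\<close> inverse bijections between open sets on which both are
    analytic.\<close>
  define V where "V = V0 \<inter> I -` U0"
  define U where "U = U0 \<inter> F -` V"
  have oV: "open V" unfolding V_def by (rule continuous_open_preimage[OF Ic o(2,1)])
  have oU: "open U" unfolding U_def by (rule continuous_open_preimage[OF Fc o(1) oV])
  have aU0: "a \<in> U0" using X F \<rho> by (simp add: U0_def)
  have FaV: "F a \<in> V" using Ian s aU0 IFa by (simp add: V_def V0_def)
  have IF: "I (F x) = x" if "x \<in> U" for x

  proof -
    have "x \<in> U0" "F x \<in> V0" "I (F x) \<in> U0" using that by (auto simp: U_def V_def)
    then show ?thesis using U0c V0c injF[of "I (F x)" x] FI[of "F x"] by blast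
  qed
  show ?thesis
  proof (rule that[OF oU _ _ oV])
    show "a \<in> U" using aU0 FaV by (simp add: U_def)
    show "U \<subseteq> X" by (auto simp: U_def U0_def)
    show "F x \<in> V \<and> I (F x) = x \<and> real_analytic_at F x" if "x \<in> U" for x
      using that IF[OF that] by (auto simp: U_def U0_def)
    show "I y \<in> U \<and> F (I y) = y \<and> real_analytic_at I y" if "y \<in> V" for y
      using that FI[of y] V0c by (auto simp: U_def V_def V0_def)
  qed
qed

section \<open>Analytic functions of one real variable\<close>

lemma real_analytic_at_powser:
  fixes f :: "real \<Rightarrow> real"
  assumes r: "0 < r" and f: "\<And>x. \<bar>x - a\<bar> < r \<Longrightarrow> (\<lambda>n. c n * (x - a) ^ n) sums f x"
  shows "real_analytic_at f a"
proof -
  have abs: "summable (\<lambda>n. norm (c n * (r/2) ^ n))"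
  proof -
    \<comment> \<open>Distance \<open>3*r/4\<close> lies strictly between \<open>r / 2\<close> and
      \<open>r\<close>, so convergence there becomes absolute convergence at
      \<open>r / 2\<close>.\<close>
    have "summable (\<lambda>n. c n * (3*r/4) ^ n)" using f[of "a + 3*r/4"] r by (simp add: sums_iff)
    then show ?thesis by (rule powser_insidea) (use r in auto)
  qed
  have "majorized f a (r/2) (suminf (\<lambda>n. norm (c n * (r/2) ^ n)))"
  proof (rule majorizedI_family[where J=UNIV and c=c and \<beta>="\<lambda>n _. n"])
    show "0 < r / 2" using r by simp
    show "((\<lambda>n. \<bar>c n\<bar> * (r / 2) ^ mdeg (\<lambda>_::real. n)) has_sum suminf (\<lambda>n. norm (c n * (r/2) ^ n))) UNIV"
      using norm_summable_imp_has_sum[of "\<lambda>n. norm (c n * (r/2) ^ n)"] abs r summable_sums[OF abs]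
      by (simp add: mdeg_def abs_mult power_abs)
    fix x assume "x \<in> cube a (r / 2)"
    then have x: "\<bar>x - a\<bar> \<le> r / 2" by (simp add: cube_def)
    have "summable (\<lambda>n. norm (c n * (x - a) ^ n))"
    proof (rule summable_comparison_test'[OF abs])
      show "norm (norm (c n * (x - a) ^ n)) \<le> norm (c n * (r/2) ^ n)" for n
        using x r power_mono[OF x, of n] by (auto simp: abs_mult power_abs intro!: mult_left_mono)
    qed
    from norm_summable_imp_has_sum[OF this f] x r
    show "((\<lambda>n. mmono (\<lambda>_. n) (x - a) * c n) has_sum f x) UNIV"
      by (simp add: mmono_def mult.commute)
  qed auto
  then show ?thesis using r real_analytic_at_iff_majorized half_gt_zero by blast
qed

text \<open>Powers of a real difference are real, so the real parts of the complex Taylor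
  coefficients form a real expansion. Reciprocal, square root and arccosine are obtained from their
  holomorphic versions in this way.\<close>

lemma real_analytic_at_holomorphic:
  fixes f :: "real \<Rightarrow> real"
  assumes F: "F holomorphic_on X" "open X" "complex_of_real a \<in> X"
    and f: "\<And>x. complex_of_real x \<in> X \<Longrightarrow> f x = Re (F (of_real x))"
  shows "real_analytic_at f a"
proof -
  obtain r where r: "r > 0" "ball (complex_of_real a) r \<subseteq> X" using F openE by blast
  have hol: "F holomorphic_on ball (of_real a) r" using F(1) r(2) holomorphic_on_subset by blast
  show ?thesis
  proof (rule real_analytic_at_powser[OF r(1)])
    fix x assume x: "\<bar>x - a\<bar> < r"
    then have xb: "complex_of_real x \<in> ball (of_real a) r"
      by (simp add: dist_norm norm_minus_commute flip: of_real_diff)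
    have "(\<lambda>n. Re ((deriv ^^ n) F (of_real a) / fact n * (of_real x - of_real a) ^ n)) sums Re (F (of_real x))"
      by (rule sums_Re[OF holomorphic_power_series[OF hol xb]])
    moreover have "Re (c * (of_real x - of_real a) ^ n) = Re c * (x - a) ^ n" for c n
      by (simp flip: of_real_diff of_real_power)
    moreover have "f x = Re (F (of_real x))" using f[of x] xb r(2) by blast
    ultimately show "(\<lambda>n. Re ((deriv ^^ n) F (of_real a) / fact n) * (x - a) ^ n) sums f x"
      by (simp only:)
  qed
qed

lemma real_analytic_at_inverse:
  assumes "a \<noteq> 0" shows "real_analytic_at (inverse :: real \<Rightarrow> real) a"
proof (rule real_analytic_at_holomorphic)
  show "inverse holomorphic_on - {0::complex}" by (intro holomorphic_intros) auto
  show "inverse x = Re (inverse (complex_of_real x))" for x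
    by (metis Re_complex_of_real of_real_inverse)
qed (use assms in auto)

lemma real_analytic_at_sqrt:
  assumes "0 < a" shows "real_analytic_at sqrt a"
proof (rule real_analytic_at_holomorphic)
  show "csqrt holomorphic_on {z. 0 < Re z}"
    by (intro holomorphic_intros) (auto simp: complex_nonpos_Reals_iff)
  show "sqrt x = Re (csqrt (complex_of_real x))" if "complex_of_real x \<in> {z. 0 < Re z}" for x
    using that by simp
qed (use assms in \<open>auto simp: open_halfspace_Re_gt\<close>)

lemma real_analytic_at_arccos: "-1 < a \<Longrightarrow> a < 1 \<Longrightarrow> real_analytic_at arccos a"
proof (rule real_analytic_at_holomorphic[where F=Arccos and X="{z. \<bar>Re z\<bar> < 1}"])
  show "open {z. \<bar>Re z\<bar> < 1}"
    by (intro open_Collect_less continuous_intros)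
  show "Arccos holomorphic_on {z. \<bar>Re z\<bar> < 1}"
    by (rule holomorphic_on_Arccos) auto
  show "arccos x = Re (Arccos (complex_of_real x))" if "complex_of_real x \<in> {z. \<bar>Re z\<bar> < 1}" for x
    using that of_real_arccos[of x] by (metis Re_complex_of_real less_imp_le mem_Collect_eq)
qed auto

lemma real_analytic_at_divide:
  fixes f g :: "'a::euclidean_space \<Rightarrow> real"
  assumes "real_analytic_at f a" "real_analytic_at g a" "g a \<noteq> 0"
  shows "real_analytic_at (\<lambda>x. f x / g x) a"
  unfolding divide_inverse
  using assms by (intro real_analytic_at_mult_real real_analytic_at_compose[of g a inverse] real_analytic_at_inverse)

section \<open>Analytic maps between subsets of Euclidean spaces\<close>

lemma real_analytic_onI:
  assumes "\<And>a. a \<in> S \<Longrightarrow> \<exists>F U. real_analytic_at F a \<and> open U \<and> a \<in> U \<and> (\<forall>x\<in>U \<inter> S. F x = f x)"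
  shows "real_analytic_on f S"
  unfolding real_analytic_on_def
proof
  fix a assume "a \<in> S"
  then obtain F U where F: "real_analytic_at F a" "open U" "a \<in> U" "\<forall>x\<in>U \<inter> S. F x = f x"
    using assms by blast
  show "\<exists>U F. open U \<and> a \<in> U \<and> (\<forall>x\<in>U. real_analytic_at F x) \<and> (\<forall>x\<in>U \<inter> S. F x = f x)"
    by (rule exI[of _ "U \<inter> {x. real_analytic_at F x}"], rule exI[of _ F])
      (use F open_real_analytic_at[of F] in auto)
qed

lemma real_analytic_onD:
  assumes "real_analytic_on f S" "a \<in> S"
  obtains F U where "real_analytic_at F a" "open U" "a \<in> U" "\<And>x. x \<in> U \<Longrightarrow> x \<in> S \<Longrightarrow> F x = f x"
  using assms unfolding real_analytic_on_def by (metis IntI)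

lemma real_analytic_at_imp_on: "(\<And>a. a \<in> S \<Longrightarrow> real_analytic_at f a) \<Longrightarrow> real_analytic_on f S"
  by (rule real_analytic_onI) blast

lemma real_analytic_on_imp_at:
  assumes "real_analytic_on f S" "open S" "a \<in> S" shows "real_analytic_at f a"
proof -
  obtain F U where F: "real_analytic_at F a" "open U" "a \<in> U" "\<And>x. x \<in> U \<Longrightarrow> x \<in> S \<Longrightarrow> F x = f x"
    by (rule real_analytic_onD[OF assms(1,3)]) blast
  show ?thesis by (rule real_analytic_at_cong[OF F(1), of "U \<inter> S"]) (use F assms in auto)
qed

lemma real_analytic_on_subset: "real_analytic_on f S \<Longrightarrow> T \<subseteq> S \<Longrightarrow> real_analytic_on f T"
proof (rule real_analytic_onI)
  fix a assume f: "real_analytic_on f S" and T: "T \<subseteq> S" "a \<in> T"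
  then have "a \<in> S" by blast
  with f obtain F U where "real_analytic_at F a" "open U" "a \<in> U" "\<And>x. x \<in> U \<Longrightarrow> x \<in> S \<Longrightarrow> F x = f x"
    by (rule real_analytic_onD) blast
  then show "\<exists>F U. real_analytic_at F a \<and> open U \<and> a \<in> U \<and> (\<forall>x\<in>U \<inter> T. F x = f x)"
    using T(1) by (intro exI[of _ F] exI[of _ U]) auto
qed

lemma real_analytic_on_cong: "real_analytic_on f S \<Longrightarrow> (\<And>x. x \<in> S \<Longrightarrow> f x = g x) \<Longrightarrow> real_analytic_on g S"
  unfolding real_analytic_on_def by (metis IntD2)

lemma isCont_open_preimage:
  assumes "isCont f a" "open V" "f a \<in> V" obtains U where "open U" "a \<in> U" "\<And>x. x \<in> U \<Longrightarrow> f x \<in> V"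
proof -
  have "\<exists>S. open S \<and> a \<in> S \<and> (\<forall>x\<in>S. f x \<in> V)" using assms unfolding continuous_at_open by simp
  then show ?thesis using that by blast
qed

lemma real_analytic_on_compose:
  assumes f: "real_analytic_on f S" and g: "real_analytic_on g T" and fT: "\<And>x. x \<in> S \<Longrightarrow> f x \<in> T"
  shows "real_analytic_on (\<lambda>x. g (f x)) S"
proof (rule real_analytic_onI)
  fix a assume a: "a \<in> S"
  obtain F U where F: "real_analytic_at F a" "open U" "a \<in> U" "\<And>x. x \<in> U \<Longrightarrow> x \<in> S \<Longrightarrow> F x = f x"
    by (rule real_analytic_onD[OF f a]) blast
  obtain G V where G: "real_analytic_at G (f a)" "open V" "f a \<in> V" "\<And>x. x \<in> V \<Longrightarrow> x \<in> T \<Longrightarrow> G x = g x"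
    by (rule real_analytic_onD[OF g fT[OF a]]) blast
  have Fa: "F a = f a" using F a by blast
  obtain W where W: "open W" "a \<in> W" "\<And>x. x \<in> W \<Longrightarrow> F x \<in> V"
    using isCont_open_preimage[OF real_analytic_at_imp_continuous[OF F(1)] G(2)] G(3) Fa by metis
  have "real_analytic_at (\<lambda>x. G (F x)) a"
    by (rule real_analytic_at_compose[OF F(1)]) (use G(1) Fa in simp)
  moreover have "\<forall>x\<in>(U \<inter> W) \<inter> S. G (F x) = g (f x)" using F(4) W(3) G(4) fT by (metis IntE)
  moreover have "open (U \<inter> W)" "a \<in> U \<inter> W" using F W by auto
  ultimately show "\<exists>F U. real_analytic_at F a \<and> open U \<and> a \<in> U \<and> (\<forall>x\<in>U \<inter> S. F x = g (f x))"
    by (intro exI[of _ "\<lambda>x. G (F x)"] exI[of _ "U \<inter> W"] conjI)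
qed

lemma real_analytic_on_imp_continuous_on:
  assumes "real_analytic_on f S" shows "continuous_on S f"
  unfolding continuous_on_eq_continuous_within
proof
  fix a assume a: "a \<in> S"
  obtain F U where F: "real_analytic_at F a" "open U" "a \<in> U" "\<And>x. x \<in> U \<Longrightarrow> x \<in> S \<Longrightarrow> F x = f x"
    by (rule real_analytic_onD[OF assms a]) blast
  have "continuous (at a within S) F"
    using real_analytic_at_imp_continuous[OF F(1)] continuous_at_imp_continuous_at_within by blast
  moreover obtain e where e: "e > 0" "ball a e \<subseteq> U" using F openE by blast
  ultimately show "continuous (at a within S) f"
    using a F(4) by (auto intro: continuous_transform_within[of _ _ F e] simp: subset_iff dist_commute)
qed

lemma analytic_diffeomorphismI:
  assumes "real_analytic_on f S" "real_analytic_on h T"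
    "\<And>x. x \<in> S \<Longrightarrow> f x \<in> T \<and> h (f x) = x" "\<And>y. y \<in> T \<Longrightarrow> h y \<in> S \<and> f (h y) = y"
  shows "analytic_diffeomorphism f S T"
proof -
  have "homeomorphism S T f h"
    by (rule homeomorphismI) (use assms(3,4) real_analytic_on_imp_continuous_on[OF assms(1)]
      real_analytic_on_imp_continuous_on[OF assms(2)] in auto)
  then show ?thesis unfolding analytic_diffeomorphism_def using assms by blast
qed

lemma analytic_diffeomorphismE:
  assumes "analytic_diffeomorphism f S T"
  obtains h where "real_analytic_on f S" "real_analytic_on h T"
    "\<And>x. x \<in> S \<Longrightarrow> f x \<in> T \<and> h (f x) = x" "\<And>y. y \<in> T \<Longrightarrow> h y \<in> S \<and> f (h y) = y"
proof -
  obtain h where h: "homeomorphism S T f h" "real_analytic_on f S" "real_analytic_on h T"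
    using assms unfolding analytic_diffeomorphism_def by blast
  show ?thesis
  proof (rule that[OF h(2,3)])
    show "f x \<in> T \<and> h (f x) = x" if "x \<in> S" for x
      using homeomorphism_apply1[OF h(1) that] homeomorphism_image1[OF h(1)] that by blast
    show "h y \<in> S \<and> f (h y) = y" if "y \<in> T" for y
      using homeomorphism_apply2[OF h(1) that] homeomorphism_image2[OF h(1)] that by blast
  qed
qed

text \<open>With \<open>r = A \<circ> B\<close> the local retraction onto \<open>S\<close> read in the chart and \<open>D\<close> its derivative at the
  base point, the map \<open>x \<mapsto> D (r x) + (I - D) (x - r x)\<close> has identity derivative and flattens \<open>S\<close>.\<close>

lemma slice_chart:
  fixes M S :: "'a::euclidean_space set" and f :: "'a \<Rightarrow> 'm::euclidean_space"
    and A :: "'k::euclidean_space \<Rightarrow> 'a" and B :: "'a \<Rightarrow> 'k"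
  assumes U: "openin (top_of_set M) U" "p \<in> U" and V: "open V" and f: "analytic_diffeomorphism f U V"
    and SM: "S \<subseteq> M" and p: "p \<in> S" and O: "open O'" "p \<in> O'"
    and Bp: "real_analytic_at B p" and Ap: "real_analytic_at A (B p)" and N: "open N" "B p \<in> N"
    and AN: "\<And>s. s \<in> N \<Longrightarrow> A s \<in> S \<and> B (A s) = s"
    and AB: "\<And>T. T \<in> S \<Longrightarrow> T \<in> O' \<Longrightarrow> A (B T) = T"
  shows "\<exists>U (V :: 'm set) f W. openin (top_of_set M) U \<and> p \<in> U \<and> open V \<and>
      analytic_diffeomorphism f U V \<and> subspace W \<and> dim W = DIM('k) \<and> f ` (U \<inter> S) = V \<inter> W"
proof -
  obtain h where fa: "real_analytic_on f U" and ha: "real_analytic_on h V"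
    and fh: "\<And>x. x \<in> U \<Longrightarrow> f x \<in> V \<and> h (f x) = x" and hf: "\<And>y. y \<in> V \<Longrightarrow> h y \<in> U \<and> f (h y) = y"
    using f by (elim analytic_diffeomorphismE) blast
  obtain F X0 where F: "real_analytic_at F p" "open X0" "p \<in> X0" "\<And>x. x \<in> X0 \<Longrightarrow> x \<in> U \<Longrightarrow> F x = f x"
    by (rule real_analytic_onD[OF fa U(2)]) blast
  obtain X1 where X1: "open X1" "U = M \<inter> X1" using U(1) by (auto simp: openin_open)
  define x0 where "x0 = f p"
  have x0: "x0 \<in> V" "h x0 = p" using fh U by (auto simp: x0_def)
  define s0 where "s0 = B p"
  have As0: "A s0 = p" using AB p O by (simp add: s0_def)
  define a where "a s = F (A s)" for s
  define b where "b x = B (h x)" for x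
  have hat: "real_analytic_at h x0" using real_analytic_on_imp_at[OF ha V x0(1)] .
  have aat: "real_analytic_at a s0"
    unfolding a_def[abs_def] s0_def by (rule real_analytic_at_compose[OF Ap]) (use F As0 in \<open>simp add: s0_def\<close>)
  have bat: "real_analytic_at b x0"
    unfolding b_def[abs_def] by (rule real_analytic_at_compose[OF hat]) (simp add: x0 Bp)
  have a0: "a s0 = x0" using F U As0 by (simp add: a_def x0_def)
  have b0: "b x0 = s0" by (simp add: b_def x0 s0_def)
  have "isCont A s0" using Ap real_analytic_at_imp_continuous s0_def by blast
  then obtain N1 where N1: "open N1" "s0 \<in> N1" "\<And>s. s \<in> N1 \<Longrightarrow> A s \<in> X0 \<inter> X1"
    using F(2,3) X1 U(2) As0 by (elim isCont_open_preimage[where V="X0 \<inter> X1"]) auto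
  define N' where "N' = N \<inter> N1"
  have N': "open N'" "s0 \<in> N'" using N N1 by (auto simp: N'_def s0_def)
  have AU: "A s \<in> U" "a s = f (A s)" "a s \<in> V" "h (a s) = A s" "b (a s) = s" "A s \<in> S" if "s \<in> N'" for s
  proof -
    have s: "s \<in> N" "s \<in> N1" using that by (auto simp: N'_def)
    show 1: "A s \<in> S" using AN s by blast
    show 2: "A s \<in> U" using N1(3)[OF s(2)] 1 SM X1 by blast
    show 3: "a s = f (A s)" using F(4) N1(3)[OF s(2)] 2 by (simp add: a_def)
    show "a s \<in> V" "h (a s) = A s" using fh 2 3 by auto
    then show "b (a s) = s" using AN s by (simp add: b_def)
  qed
  obtain a' where a': "(a has_derivative a') (at s0)" using real_analytic_at_imp_has_derivative[OF aat] .
  obtain b' where b': "(b has_derivative b') (at x0)" using real_analytic_at_imp_has_derivative[OF bat] .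
  have la: "linear a'" and lb: "linear b'" using a' b' has_derivative_linear by blast+
  have ba: "b' (a' k) = k" for k
  proof -
    have "((\<lambda>s. b (a s)) has_derivative (\<lambda>k. b' (a' k))) (at s0)"
      using has_derivative_compose[OF a'] b' a0 by auto
    moreover have "((\<lambda>s. b (a s)) has_derivative (\<lambda>k. k)) (at s0)"
      by (rule has_derivative_transform_within_open[OF has_derivative_ident N']) (simp add: AU(5))
    ultimately have "(\<lambda>k. b' (a' k)) = (\<lambda>k. k)" by (rule has_derivative_unique)
    then show ?thesis by (rule fun_cong)
  qed
  \<comment> \<open>Since \<open>b\<close> after \<open>a\<close> is the identity near
    \<open>s0\<close>, \<open>D\<close> is a projection onto the tangent space \<open>W\<close>, the
    range of \<open>a'\<close>.\<close>
  define D where "D x = a' (b' x)" for x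
  have lD: "linear D" unfolding D_def using linear_compose[OF lb la] by (simp add: o_def)
  have DD: "D (D x) = D x" for x by (simp add: D_def ba)
  define W where "W = range a'"
  have sW: "subspace W" unfolding W_def using la by (simp add: linear_subspace_image)
  have "inj a'" using ba by (metis injI)
  then have dW: "dim W = DIM('k)" unfolding W_def using dim_image_eq[OF la, of UNIV] by simp
  have DW: "D x \<in> W" for x by (simp add: D_def W_def)
  have WD: "D w = w" if "w \<in> W" for w using that by (auto simp: W_def D_def ba)
  define r where "r x = a (b x)" for x
  have r0: "r x0 = x0" by (simp add: r_def a0 b0)
  have rat: "real_analytic_at r x0"
    unfolding r_def[abs_def] by (rule real_analytic_at_compose[OF bat]) (simp add: b0 aat)
  have r': "(r has_derivative D) (at x0)"
    unfolding r_def[abs_def] D_def[abs_def] using has_derivative_compose[OF b'] a' b0 by auto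
  define \<Phi> where "\<Phi> x = D (r x - x0) + ((x - r x) - D (x - r x))" for x
  have \<Phi>at: "real_analytic_at \<Phi> x0"
    unfolding \<Phi>_def[abs_def]
    by (intro real_analytic_at_add real_analytic_at_diff real_analytic_at_linear_compose[OF lD] rat real_analytic_at_const real_analytic_at_ident)
  have bD: "bounded_linear D" using lD linear_conv_bounded_linear by blast
  have "(\<Phi> has_derivative (\<lambda>k. D (D k - 0) + ((k - D k) - D (k - D k)))) (at x0)"
    unfolding \<Phi>_def[abs_def]
    by (intro has_derivative_add has_derivative_diff bounded_linear.has_derivative[OF bD] r' has_derivative_const has_derivative_ident)
  then have \<Phi>': "(\<Phi> has_derivative (\<lambda>k. k)) (at x0)"
    by (simp add: DD linear_diff[OF lD])
  obtain X2 where X2: "open X2" "x0 \<in> X2" "\<And>x. x \<in> X2 \<Longrightarrow> b x \<in> N'"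
    using isCont_open_preimage[OF real_analytic_at_imp_continuous[OF bat] N'(1)] N'(2) b0 by metis
  obtain X3 where X3: "open X3" "x0 \<in> X3" "\<And>x. x \<in> X3 \<Longrightarrow> h x \<in> O'"
    using isCont_open_preimage[OF real_analytic_at_imp_continuous[OF hat] O(1)] O(2) x0 by metis
  define X where "X = V \<inter> X2 \<inter> X3 \<inter> {x. real_analytic_at r x}"
  have "open X" unfolding X_def by (intro open_Int V X2(1) X3(1) open_real_analytic_at)
  moreover have "x0 \<in> X" using X2 X3 x0 rat by (simp add: X_def)
  ultimately obtain U1 V1 G where U1: "open U1" "x0 \<in> U1" "U1 \<subseteq> X" and V1: "open V1"
    and \<Phi>G: "\<And>x. x \<in> U1 \<Longrightarrow> \<Phi> x \<in> V1 \<and> G (\<Phi> x) = x \<and> real_analytic_at \<Phi> x"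
    and G\<Phi>: "\<And>y. y \<in> V1 \<Longrightarrow> G y \<in> U1 \<and> \<Phi> (G y) = y \<and> real_analytic_at G y"
    by (rule analytic_inverse_function[OF \<Phi>at \<Phi>']) blast+
  \<comment> \<open>\<open>r x\<close> must stay where \<Phi> is injective, because \<open>x\<close>
    and \<open>r x\<close> are compared through their images.\<close>
  define U2 where "U2 = U1 \<inter> r -` U1"
  define V2 where "V2 = V1 \<inter> G -` U2"
  have rc: "continuous_on U1 r"
    using U1(3) by (intro continuous_at_imp_continuous_on ballI real_analytic_at_imp_continuous) (auto simp: X_def)
  have oU2: "open U2" unfolding U2_def by (rule continuous_open_preimage[OF rc U1(1) U1(1)])
  have Gc: "continuous_on V1 G"
    using G\<Phi> by (intro continuous_at_imp_continuous_on ballI real_analytic_at_imp_continuous) auto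
  have oV2: "open V2" unfolding V2_def by (rule continuous_open_preimage[OF Gc V1 oU2])
  have x0U2: "x0 \<in> U2" using U1 r0 by (simp add: U2_def)
  have UX: "x \<in> V" "b x \<in> N'" "h x \<in> O'" if "x \<in> U1" for x using that U1(3) X2(3) X3(3) by (auto simp: X_def)
  \<comment> \<open>\<open>D\<close> annihilates the second summand of \<Phi>, so
    \<open>\<Phi> x \<in> W\<close> forces \<open>\<Phi> x = \<Phi> (r x)\<close>, and injectivity
    gives \<open>r x = x\<close>.\<close>
  have fixed: "\<Phi> x \<in> W \<longleftrightarrow> r x = x" if x: "x \<in> U2" for x
  proof
    assume w: "\<Phi> x \<in> W"
    have rU: "r x \<in> U1" "x \<in> U1" using x by (auto simp: U2_def)
    have rr: "r (r x) = r x" using AU(5)[OF UX(2)[OF rU(2)]] by (simp add: r_def)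
    have "D (\<Phi> x) = D (r x - x0)"
      by (simp add: \<Phi>_def linear_add[OF lD] linear_diff[OF lD] DD)
    then have "\<Phi> x = D (r x - x0)" using WD[OF w] by simp
    also have "\<dots> = \<Phi> (r x)" by (simp add: \<Phi>_def rr linear_0[OF lD])
    finally show "r x = x" using \<Phi>G rU by metis
  next
    assume "r x = x" then show "\<Phi> x \<in> W" by (simp add: \<Phi>_def linear_0[OF lD] DW)
  qed
  define U3 where "U3 = U \<inter> f -` U2"
  have oU3: "openin (top_of_set M) U3"
  proof -
    have "openin (top_of_set U) U3" unfolding U3_def
      by (rule continuous_openin_preimage_gen[OF real_analytic_on_imp_continuous_on[OF fa] oU2])
    then show ?thesis using U(1) openin_trans by blast
  qed
  have pU3: "p \<in> U3" using U x0U2 by (simp add: U3_def x0_def)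
  have iff: "r (f T) = f T \<longleftrightarrow> T \<in> S" if T: "T \<in> U3" for T
  proof -
    have fT: "f T \<in> U1" "T \<in> U" using T by (auto simp: U3_def U2_def)
    have hT: "h (f T) = T" and bT: "b (f T) = B T" using fh fT by (auto simp: b_def)
    have BN: "B T \<in> N'" and TO: "T \<in> O'" using UX[OF fT(1)] hT bT by auto
    show ?thesis
    proof
      assume "r (f T) = f T"
      then have "f (A (B T)) = f T" using AU(2)[OF BN] by (simp add: r_def bT)
      then have "A (B T) = T" using fh fT AU(1)[OF BN] by metis
      then show "T \<in> S" using AU(6)[OF BN] by simp
    next
      assume "T \<in> S"
      then show "r (f T) = f T" using AB TO AU(2)[OF BN] by (simp add: r_def bT)
    qed
  qed
  define f2 where "f2 T = \<Phi> (f T)" for T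
  have diff: "analytic_diffeomorphism f2 U3 V2"
  proof (rule analytic_diffeomorphismI[where h="\<lambda>y. h (G y)"])
    have "real_analytic_on f U3" by (rule real_analytic_on_subset[OF fa]) (auto simp: U3_def)
    moreover have "real_analytic_on \<Phi> U2" using \<Phi>G by (intro real_analytic_at_imp_on) (auto simp: U2_def)
    ultimately show "real_analytic_on f2 U3"
      unfolding f2_def[abs_def] by (rule real_analytic_on_compose) (auto simp: U3_def)
    have "real_analytic_on G V2" using G\<Phi> by (intro real_analytic_at_imp_on) (auto simp: V2_def)
    then show "real_analytic_on (\<lambda>y. h (G y)) V2"
      by (rule real_analytic_on_compose[OF _ ha]) (use UX in \<open>auto simp: V2_def U2_def\<close>)
    show "f2 T \<in> V2 \<and> h (G (f2 T)) = T" if "T \<in> U3" for T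
      using that \<Phi>G[of "f T"] fh[of T] by (auto simp: f2_def U3_def V2_def U2_def)
    show "h (G y) \<in> U3 \<and> f2 (h (G y)) = y" if "y \<in> V2" for y
      using that G\<Phi>[of y] UX[of "G y"] hf[of "G y"] by (auto simp: f2_def U3_def V2_def U2_def)
  qed
  have "f2 ` (U3 \<inter> S) = V2 \<inter> W"
  proof
    show "f2 ` (U3 \<inter> S) \<subseteq> V2 \<inter> W"
      using iff fixed \<Phi>G by (fastforce simp: f2_def V2_def U3_def U2_def)
    show "V2 \<inter> W \<subseteq> f2 ` (U3 \<inter> S)"
    proof
      fix y assume y: "y \<in> V2 \<inter> W"
      have G: "G y \<in> U2" "\<Phi> (G y) = y" "G y \<in> V" using y G\<Phi>[of y] UX by (auto simp: V2_def U2_def)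
      have T: "h (G y) \<in> U3" "f (h (G y)) = G y" using hf[OF G(3)] G(1) by (auto simp: U3_def)
      have "r (G y) = G y" using fixed[OF G(1)] G(2) y by simp
      then have "h (G y) \<in> S" using iff[OF T(1)] T(2) by simp
      then show "y \<in> f2 ` (U3 \<inter> S)" using T G(2) by (force simp: f2_def)
    qed
  qed
  then show ?thesis using oU3 pU3 oV2 diff sW dW by blast
qed

section \<open>The compact group of type \<open>G\<^sub>2\<close>\<close>

notation imag_product (infixl "\<star>" 70)

section \<open>Coordinates and the product on imaginary octonions\<close>

lemma UNIV_7: "(UNIV::7 set) = {1,2,3,4,5,6,7}"
proof -
  have "x \<in> {1,2,3,4,5,6,7}" for x :: 7
  proof (cases x rule: bit1_cases)
    case (of_int z)
    then have "z = 0 \<or> z = 1 \<or> z = 2 \<or> z = 3 \<or> z = 4 \<or> z = 5 \<or> z = 6" by auto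
    then show ?thesis using of_int(1) by auto
  qed
  then show ?thesis by auto
qed

lemma forall_7: "(\<forall>i::7. P i) \<longleftrightarrow> P 1 \<and> P 2 \<and> P 3 \<and> P 4 \<and> P 5 \<and> P 6 \<and> P 7"
  by (metis UNIV_7 UNIV_I empty_iff insert_iff)

lemma sum_7: "(\<Sum>i\<in>(UNIV::7 set). f i) = f 1 + f 2 + f 3 + f 4 + f 5 + f 6 + f 7"
  unfolding UNIV_7 by (simp add: add_ac)

lemma vec_eq_7: "(x = (y::'a^7)) \<longleftrightarrow> x$1=y$1 \<and> x$2=y$2 \<and> x$3=y$3 \<and> x$4=y$4 \<and> x$5=y$5 \<and> x$6=y$6 \<and> x$7=y$7"
  by (simp add: vec_eq_iff forall_7)

lemma inner_7: "(x::real^7) \<bullet> y = x$1*y$1 + x$2*y$2 + x$3*y$3 + x$4*y$4 + x$5*y$5 + x$6*y$6 + x$7*y$7"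
  by (simp add: inner_vec_def sum_7)

lemma mv_7: "((A::real^7^7) *v x)$k = A$k$1*x$1 + A$k$2*x$2 + A$k$3*x$3 + A$k$4*x$4 + A$k$5*x$5 + A$k$6*x$6 + A$k$7*x$7"
  by (simp add: matrix_vector_mult_def sum_7)

lemma imag_product_nth:
  "(u \<star> v)$1 = u$2 * v$3 - u$3 * v$2 + u$4 * v$5 - u$5 * v$4 + u$7 * v$6 - u$6 * v$7"
  "(u \<star> v)$2 = u$3 * v$1 - u$1 * v$3 + u$4 * v$6 - u$6 * v$4 + u$5 * v$7 - u$7 * v$5"
  "(u \<star> v)$3 = u$1 * v$2 - u$2 * v$1 + u$4 * v$7 - u$7 * v$4 + u$6 * v$5 - u$5 * v$6"
  "(u \<star> v)$4 = u$5 * v$1 - u$1 * v$5 + u$6 * v$2 - u$2 * v$6 + u$7 * v$3 - u$3 * v$7"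
  "(u \<star> v)$5 = u$1 * v$4 - u$4 * v$1 + u$7 * v$2 - u$2 * v$7 + u$3 * v$6 - u$6 * v$3"
  "(u \<star> v)$6 = u$1 * v$7 - u$7 * v$1 + u$2 * v$4 - u$4 * v$2 + u$5 * v$3 - u$3 * v$5"
  "(u \<star> v)$7 = u$6 * v$1 - u$1 * v$6 + u$2 * v$5 - u$5 * v$2 + u$3 * v$4 - u$4 * v$3"
  by (simp_all add: imag_product_def sum_7 oct_eps_def oriented_triples_def)

lemma bilinear_imag_product: "bilinear (\<star>)"
  unfolding bilinear_def
  by (intro conjI allI linearI) (simp_all add: vec_eq_7 imag_product_nth algebra_simps)

lemma imag_product_linear: "linear (\<lambda>x. x \<star> y)" "linear (\<lambda>y. x \<star> y)"
  using bilinear_imag_product unfolding bilinear_def by auto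

lemmas imag_product_simps =
  linear_add[OF imag_product_linear(1)] linear_add[OF imag_product_linear(2)]
  linear_diff[OF imag_product_linear(1)] linear_diff[OF imag_product_linear(2)]
  linear_scale[OF imag_product_linear(1)] linear_scale[OF imag_product_linear(2)]
  linear_neg[OF imag_product_linear(1)] linear_neg[OF imag_product_linear(2)]
  linear_0[OF imag_product_linear(1)] linear_0[OF imag_product_linear(2)]

lemma imag_product_anticommute: "u \<star> v = - (v \<star> u)"
  by (simp add: vec_eq_7 imag_product_nth)

lemma imag_product_self [simp]: "u \<star> u = 0"
  by (simp add: vec_eq_7 imag_product_nth)

lemma imag_product_inner: "(u \<star> v) \<bullet> w = u \<bullet> (v \<star> w)"
  by (simp add: inner_7 imag_product_nth algebra_simps)

lemma imag_product_inner_zero [simp]: "(u \<star> v) \<bullet> u = 0" "(u \<star> v) \<bullet> v = 0" "u \<bullet> (u \<star> v) = 0" "v \<bullet> (u \<star> v) = 0"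
  by (simp_all add: inner_7 imag_product_nth algebra_simps)

lemma imag_product_left: "u \<star> (u \<star> v) = (u \<bullet> v) *\<^sub>R u - (u \<bullet> u) *\<^sub>R v"
  by (simp add: vec_eq_7 imag_product_nth inner_7) (simp add: algebra_simps)

text \<open>Polarization of \<open>imag_product_left\<close>. In place of associativity it moves one
  factor past another, which drives the multiplication table in \<open>basic_triple\<close>.\<close>

lemma imag_product_polar:
  "u \<star> (v \<star> w) = - (v \<star> (u \<star> w)) + (u \<bullet> w) *\<^sub>R v + (v \<bullet> w) *\<^sub>R u - (2 * (u \<bullet> v)) *\<^sub>R w"
  using imag_product_left[of "u + v" w] imag_product_left[of u w] imag_product_left[of v w]
  by (simp add: imag_product_simps inner_add_left inner_add_right algebra_simps inner_commute scaleR_2 flip: scaleR_2)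

lemma imag_product_norm: "(u \<star> v) \<bullet> (u \<star> v) = (u \<bullet> u) * (v \<bullet> v) - (u \<bullet> v)\<^sup>2"
proof -
  have "(u \<star> v) \<bullet> (u \<star> v) = - ((v \<star> u) \<bullet> (u \<star> v))" by (subst imag_product_anticommute) simp
  also have "\<dots> = - (v \<bullet> (u \<star> (u \<star> v)))" by (simp add: imag_product_inner)
  finally show ?thesis by (simp add: imag_product_left inner_diff_right inner_commute power2_eq_square)
qed

section \<open>Automorphisms and derivations as matrices\<close>

lemma oct_mult_Pair: "(r, u) \<odot> (s, v) = (r * s - u \<bullet> v, r *\<^sub>R v + s *\<^sub>R u + u \<star> v)"
  by (simp add: oct_mult_def)

text \<open>The two conditions are the real and imaginary parts of multiplicativity on imaginary
  octonions; bijectivity is automatic for an isometry in finite dimension.\<close>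

lemma G2_iff:
  "A \<in> G2 \<longleftrightarrow> (\<forall>u v. (A *v u) \<bullet> (A *v v) = u \<bullet> v) \<and> (\<forall>u v. A *v (u \<star> v) = (A *v u) \<star> (A *v v))"
proof
  assume "A \<in> G2"
  then have m: "aut_action A (x \<odot> y) = aut_action A x \<odot> aut_action A y" for x y
    unfolding G2_def octonion_automorphism_def mem_Collect_eq by blast
  have "aut_action A ((0,u) \<odot> (0,v)) = aut_action A (0,u) \<odot> aut_action A (0,v)" for u v by (rule m)
  then show "(\<forall>u v. (A *v u) \<bullet> (A *v v) = u \<bullet> v) \<and> (\<forall>u v. A *v (u \<star> v) = (A *v u) \<star> (A *v v))"
    by (simp add: aut_action_def oct_mult_Pair)
next
  assume a: "(\<forall>u v. (A *v u) \<bullet> (A *v v) = u \<bullet> v) \<and> (\<forall>u v. A *v (u \<star> v) = (A *v u) \<star> (A *v v))"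
  have lin: "linear (aut_action A)"
    by (intro linearI) (auto simp: aut_action_def matrix_vector_right_distrib matrix_vector_mult_scaleR)
  have "inj ((*v) A)"
  proof (rule injI)
    fix x y assume "A *v x = A *v y"
    then have "A *v (x - y) = 0" by (simp add: matrix_vector_mult_diff_distrib)
    then have "(x - y) \<bullet> (x - y) = 0" using a by (metis inner_zero_left)
    then show "x = y" by simp
  qed
  then have "surj ((*v) A)" using linear_injective_imp_surjective[of "(*v) A"] by simp
  with \<open>inj ((*v) A)\<close> have "bij ((*v) A)" by (simp add: bij_def)
  then have "bij (aut_action A)"
    unfolding aut_action_def bij_def inj_def surj_def by (auto simp: prod_eq_iff)
  moreover have "aut_action A (x \<odot> y) = aut_action A x \<odot> aut_action A y" for x y
    using a by (cases x; cases y) (simp add: aut_action_def oct_mult_Pair matrix_vector_right_distrib matrix_vector_mult_scaleR)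
  ultimately show "A \<in> G2" unfolding G2_def octonion_automorphism_def using lin by blast
qed

lemma g2_iff:
  "Z \<in> g2 \<longleftrightarrow> (\<forall>u v. (Z *v u) \<bullet> v + u \<bullet> (Z *v v) = 0) \<and> (\<forall>u v. Z *v (u \<star> v) = (Z *v u) \<star> v + u \<star> (Z *v v))"
proof
  assume "Z \<in> g2"
  then have m: "der_action Z (x \<odot> y) = der_action Z x \<odot> y + x \<odot> der_action Z y" for x y
    unfolding g2_def octonion_derivation_def mem_Collect_eq by blast
  have "der_action Z ((0,u) \<odot> (0,v)) = der_action Z (0,u) \<odot> (0,v) + (0,u) \<odot> der_action Z (0,v)" for u v by (rule m)
  then show "(\<forall>u v. (Z *v u) \<bullet> v + u \<bullet> (Z *v v) = 0) \<and> (\<forall>u v. Z *v (u \<star> v) = (Z *v u) \<star> v + u \<star> (Z *v v))"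
    by (simp add: der_action_def oct_mult_Pair algebra_simps)
next
  assume a: "(\<forall>u v. (Z *v u) \<bullet> v + u \<bullet> (Z *v v) = 0) \<and> (\<forall>u v. Z *v (u \<star> v) = (Z *v u) \<star> v + u \<star> (Z *v v))"
  have lin: "linear (der_action Z)"
    by (intro linearI) (auto simp: der_action_def matrix_vector_right_distrib matrix_vector_mult_scaleR)
  moreover have "der_action Z (x \<odot> y) = der_action Z x \<odot> y + x \<odot> der_action Z y" for x y
  proof (cases x; cases y)
    fix r u s v assume "x = (r, u)" "y = (s, v)"
    moreover have "(Z *v u) \<bullet> v = - (u \<bullet> (Z *v v))" using a by (metis add_eq_0_iff2)
    moreover have "Z *v (u \<star> v) = (Z *v u) \<star> v + u \<star> (Z *v v)" using a by blast
    ultimately show ?thesis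
      by (simp add: der_action_def oct_mult_Pair matrix_vector_right_distrib matrix_vector_mult_scaleR algebra_simps)
  qed
  ultimately show "Z \<in> g2" unfolding g2_def octonion_derivation_def by blast
qed

declare transpose_matrix_vector [simp del]

lemma matrix_eqI: "(\<And>x. A *v x = B *v x) \<Longrightarrow> A = (B::real^'n^'m)"
  by (simp add: matrix_eq)

lemma G2_inner: "A \<in> G2 \<Longrightarrow> (A *v u) \<bullet> (A *v v) = u \<bullet> v"
  and G2_mult: "A \<in> G2 \<Longrightarrow> A *v (u \<star> v) = (A *v u) \<star> (A *v v)"
  by (auto simp: G2_iff)

lemma G2_transpose_left: assumes "A \<in> G2" shows "transpose A ** A = mat 1"
proof (rule matrix_eqI)
  fix x
  have "((transpose A ** A) *v x) \<bullet> y = x \<bullet> y" for y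
    using G2_inner[OF assms, of x y]
    by (simp add: transpose_matrix_vector dot_lmul_matrix flip: matrix_vector_mul_assoc)
  then have "(transpose A ** A) *v x = x" by (rule vector_eq_rdot[THEN iffD1, OF allI])
  then show "(transpose A ** A) *v x = mat 1 *v x" by simp
qed

lemma G2_transpose_right: assumes "A \<in> G2" shows "A ** transpose A = mat 1"
  using G2_transpose_left[OF assms] matrix_left_right_inverse by blast

lemma G2_matrix_inv: assumes "A \<in> G2" shows "matrix_inv A = transpose A"
  unfolding matrix_inv_def
proof (rule some_equality)
  fix B assume "A ** B = mat 1 \<and> B ** A = mat 1"
  then have "transpose A ** (A ** B) = transpose A" by simp
  then show "B = transpose A" by (simp add: matrix_mul_assoc G2_transpose_left[OF assms])
qed (use G2_transpose_left[OF assms] G2_transpose_right[OF assms] in auto)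

lemma G2_cancel:
  assumes "A \<in> G2"
  shows "transpose A *v (A *v x) = x" "A *v (transpose A *v x) = x"
    "transpose A ** (A ** B) = B" "A ** (transpose A ** B) = B"
  using G2_transpose_left[OF assms] G2_transpose_right[OF assms]
  by (simp_all add: matrix_vector_mul_assoc matrix_mul_assoc)

lemma G2_mult_closed: "A \<in> G2 \<Longrightarrow> B \<in> G2 \<Longrightarrow> A ** B \<in> G2"
  unfolding G2_iff by (simp flip: matrix_vector_mul_assoc)

lemma G2_one [simp]: "mat 1 \<in> G2"
  unfolding G2_iff by simp

lemma G2_transpose: assumes A: "A \<in> G2" shows "transpose A \<in> G2"
  unfolding G2_iff
proof (intro conjI allI)
  fix u v
  have "(A *v (transpose A *v u)) \<bullet> (A *v (transpose A *v v)) = (transpose A *v u) \<bullet> (transpose A *v v)"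
    by (rule G2_inner[OF A])
  then show "(transpose A *v u) \<bullet> (transpose A *v v) = u \<bullet> v" by (simp add: G2_cancel[OF A])
  have "A *v ((transpose A *v u) \<star> (transpose A *v v)) = u \<star> v"
    by (simp add: G2_mult[OF A] G2_cancel[OF A])
  then show "transpose A *v (u \<star> v) = (transpose A *v u) \<star> (transpose A *v v)"
    by (metis G2_cancel(1)[OF A])
qed

lemma g2_skew: "Z \<in> g2 \<Longrightarrow> (Z *v u) \<bullet> v = - (u \<bullet> (Z *v v))"
  unfolding g2_iff by (metis add.commute add_eq_0_iff)

lemma g2_der: "Z \<in> g2 \<Longrightarrow> Z *v (u \<star> v) = (Z *v u) \<star> v + u \<star> (Z *v v)"
  by (simp add: g2_iff)

lemma axis_product:
  "axis 1 1 \<star> axis 2 1 = axis 3 1" "axis 1 1 \<star> axis 3 1 = - axis 2 1" "axis 1 1 \<star> axis 4 1 = axis 5 1"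
  "axis 1 1 \<star> axis 5 1 = - axis 4 1" "axis 1 1 \<star> axis 6 1 = - axis 7 1" "axis 1 1 \<star> axis 7 1 = axis 6 1"
  "axis 2 1 \<star> axis 3 1 = axis 1 1" "axis 2 1 \<star> axis 4 1 = axis 6 1" "axis 2 1 \<star> axis 5 1 = axis 7 1"
  "axis 2 1 \<star> axis 6 1 = - axis 4 1" "axis 2 1 \<star> axis 7 1 = - axis 5 1"
  "axis 3 1 \<star> axis 4 1 = axis 7 1" "axis 3 1 \<star> axis 5 1 = - axis 6 1" "axis 3 1 \<star> axis 6 1 = axis 5 1"
  "axis 3 1 \<star> axis 7 1 = - axis 4 1"
  "axis 4 1 \<star> axis 5 1 = axis 1 1" "axis 4 1 \<star> axis 6 1 = axis 2 1" "axis 4 1 \<star> axis 7 1 = axis 3 1"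
  "axis 5 1 \<star> axis 6 1 = - axis 3 1" "axis 5 1 \<star> axis 7 1 = axis 2 1" "axis 6 1 \<star> axis 7 1 = - axis 1 1"
  by (simp_all add: vec_eq_7 imag_product_nth axis_def)

text \<open>Existence half of the simple transitivity of \<open>G2\<close> on basic triples:
  orthonormality, with \<open>d\<close> also orthogonal to \<open>a \<star> b\<close>, already
  forces the multiplication table of e1, e2, e4. This is the source of group elements with
  prescribed values.\<close>

lemma basic_triple:
  fixes a b d :: "real^7"
  assumes n: "a \<bullet> a = 1" "b \<bullet> b = 1" "d \<bullet> d = 1" and o: "a \<bullet> b = 0" "a \<bullet> d = 0" "b \<bullet> d = 0" "(a \<star> b) \<bullet> d = 0"
  obtains g where "g \<in> G2" "g *v axis 1 1 = a" "g *v axis 2 1 = b" "g *v axis 3 1 = a \<star> b" "g *v axis 4 1 = d"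
    "g *v axis 5 1 = a \<star> d" "g *v axis 6 1 = b \<star> d" "g *v axis 7 1 = (a \<star> b) \<star> d"
proof -
  define c where "c = a \<star> b"
  define f where "f i = (if i = 1 then a else if i = 2 then b else if i = 3 then c else if i = 4 then d
    else if i = 5 then a \<star> d else if i = 6 then b \<star> d else c \<star> d)" for i :: 7
  have f: "f 1 = a" "f 2 = b" "f 3 = c" "f 4 = d" "f 5 = a \<star> d" "f 6 = b \<star> d" "f 7 = c \<star> d"
    by (simp_all add: f_def)
  have cn: "c \<bullet> c = 1" "a \<bullet> c = 0" "b \<bullet> c = 0" "c \<bullet> d = 0"
    using n o by (simp_all add: c_def imag_product_norm)
  have sym: "b \<bullet> a = 0" "d \<bullet> a = 0" "d \<bullet> b = 0" "c \<bullet> a = 0" "c \<bullet> b = 0" "d \<bullet> c = 0"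
    using o cn by (simp_all add: inner_commute)
  note S = n o(1-3) cn sym
  have adb: "a \<bullet> (b \<star> d) = 0" "b \<bullet> (a \<star> d) = 0" "(b \<star> d) \<bullet> a = 0" "(a \<star> d) \<bullet> b = 0"
  proof -
    show 1: "a \<bullet> (b \<star> d) = 0" using o(4) by (simp add: imag_product_inner)
    have "b \<bullet> (a \<star> d) = (b \<star> a) \<bullet> d" by (simp add: imag_product_inner)
    also have "\<dots> = - ((a \<star> b) \<bullet> d)" by (subst imag_product_anticommute) simp
    finally show 2: "b \<bullet> (a \<star> d) = 0" using o(4) by simp
    show "(b \<star> d) \<bullet> a = 0" "(a \<star> d) \<bullet> b = 0" using 1 2 by (simp_all add: inner_commute)
  qed
  have p13: "a \<star> c = - b" by (simp add: c_def imag_product_left S)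
  have p15: "a \<star> (a \<star> d) = - d" by (simp add: imag_product_left S)
  have p26: "b \<star> (b \<star> d) = - d" by (simp add: imag_product_left S)
  have p37: "c \<star> (c \<star> d) = - d" by (simp add: imag_product_left S)
  have p16: "a \<star> (b \<star> d) = - (c \<star> d)"
  proof -
    have "c \<star> d = - (d \<star> (a \<star> b))" unfolding c_def by (rule imag_product_anticommute)
    also have "d \<star> (a \<star> b) = - (a \<star> (d \<star> b))" by (subst imag_product_polar) (simp add: S)
    also have "d \<star> b = - (b \<star> d)" by (rule imag_product_anticommute)
    finally show ?thesis by (simp add: imag_product_simps)
  qed
  have p17: "a \<star> (c \<star> d) = b \<star> d"
  proof -
    have "a \<star> (c \<star> d) = - (a \<star> (a \<star> (b \<star> d)))" using p16 by (simp add: imag_product_simps)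
    then show ?thesis by (simp add: imag_product_left S adb)
  qed
  have p23: "b \<star> c = a"
  proof -
    have "b \<star> c = - (b \<star> (b \<star> a))" unfolding c_def by (subst imag_product_anticommute[of a b]) (simp add: imag_product_simps)
    then show ?thesis by (simp add: imag_product_left S)
  qed
  have p25: "b \<star> (a \<star> d) = c \<star> d"
  proof -
    have "b \<star> (a \<star> d) = - (a \<star> (b \<star> d))" by (subst imag_product_polar) (simp add: S)
    then show ?thesis using p16 by simp
  qed
  have p27: "b \<star> (c \<star> d) = - (a \<star> d)"
    unfolding p25[symmetric] by (simp add: imag_product_left S adb)
  have p35: "c \<star> (a \<star> d) = - (b \<star> d)"
  proof -
    have "c \<star> (a \<star> d) = - (a \<star> (c \<star> d))" by (subst imag_product_polar) (simp add: S)
    then show ?thesis using p17 by simp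
  qed
  have p36: "c \<star> (b \<star> d) = a \<star> d"
  proof -
    have "c \<star> (b \<star> d) = - (b \<star> (c \<star> d))" by (subst imag_product_polar) (simp add: S)
    then show ?thesis using p27 by simp
  qed
  have p4: "d \<star> (x \<star> d) = x" if "d \<bullet> x = 0" for x
  proof -
    have "d \<star> (x \<star> d) = - (d \<star> (d \<star> x))" by (subst imag_product_anticommute[of x d]) (simp add: imag_product_simps)
    then show ?thesis using that by (simp add: imag_product_left S)
  qed
  have p5: "(x \<star> d) \<star> (y \<star> d) = y \<star> x" if "d \<bullet> x = 0" "d \<bullet> y = 0" "(x \<star> d) \<bullet> y = 0" for x y
  proof -
    have "(x \<star> d) \<star> (y \<star> d) = - (y \<star> ((x \<star> d) \<star> d))"
      using that by (subst imag_product_polar) (simp add: inner_commute)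
    also have "(x \<star> d) \<star> d = - x"
      using p4[OF that(1)] by (subst imag_product_anticommute) simp
    finally show ?thesis by (simp add: imag_product_simps)
  qed
  have p56: "(a \<star> d) \<star> (b \<star> d) = - c"
    using p5[of a b] by (simp add: S adb c_def imag_product_anticommute[of b a])
  have adc: "(a \<star> d) \<bullet> c = 0" "(b \<star> d) \<bullet> c = 0"
  proof -
    have "c \<bullet> (a \<star> d) = (c \<star> a) \<bullet> d" "c \<bullet> (b \<star> d) = (c \<star> b) \<bullet> d" by (simp_all add: imag_product_inner)
    then show "(a \<star> d) \<bullet> c = 0" "(b \<star> d) \<bullet> c = 0"
      using p13 p23 by (simp_all add: inner_commute[of _ c] imag_product_anticommute[of c] S)
  qed
  have p57: "(a \<star> d) \<star> (c \<star> d) = b"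
    using p5[of a c] p13 by (simp add: S adc imag_product_anticommute[of c a])
  have p67: "(b \<star> d) \<star> (c \<star> d) = - a"
    using p5[of b c] p23 by (simp add: S adc imag_product_anticommute[of c b])
  note table = p13 p15 p26 p37 p16 p17 p23 p25 p27 p35 p36 p56 p57 p67 p4
  define g where "g = (\<chi> i j. f j $ i)"
  have g: "g *v axis j 1 = f j" for j
    by (simp add: vec_eq_iff g_def matrix_vector_mult_basis column_def)
  have ff: "f 1 \<star> f 2 = f 3" "f 1 \<star> f 3 = - f 2" "f 1 \<star> f 4 = f 5" "f 1 \<star> f 5 = - f 4" "f 1 \<star> f 6 = - f 7" "f 1 \<star> f 7 = f 6"
    "f 2 \<star> f 3 = f 1" "f 2 \<star> f 4 = f 6" "f 2 \<star> f 5 = f 7" "f 2 \<star> f 6 = - f 4" "f 2 \<star> f 7 = - f 5"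
    "f 3 \<star> f 4 = f 7" "f 3 \<star> f 5 = - f 6" "f 3 \<star> f 6 = f 5" "f 3 \<star> f 7 = - f 4"
    "f 4 \<star> f 5 = f 1" "f 4 \<star> f 6 = f 2" "f 4 \<star> f 7 = f 3" "f 5 \<star> f 6 = - f 3" "f 5 \<star> f 7 = f 2" "f 6 \<star> f 7 = - f 1"
    unfolding f by (simp_all add: table S) (simp add: c_def)
  have lin: "linear ((*v) g)" by simp
  have basis: "g *v (axis i 1 \<star> axis j 1) = (g *v axis i 1) \<star> (g *v axis j 1)" for i j
  proof -
    \<comment> \<open>Both sides change sign when the factors are exchanged, so the pairs with
      \<open>i < j\<close> suffice.\<close>
    have anti: "g *v (axis j 1 \<star> axis i 1) = f j \<star> f i" if "g *v (axis i 1 \<star> axis j 1) = f i \<star> f j" for i j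
      using that by (subst (1 2) imag_product_anticommute) (simp add: linear_neg[OF lin])
    have "\<forall>i j. g *v (axis i 1 \<star> axis j 1) = f i \<star> f j"
      unfolding forall_7
      by (intro conjI; (simp add: axis_product ff linear_neg[OF lin] g; fail)?;
          rule anti; simp add: axis_product ff linear_neg[OF lin] g)
    then show ?thesis by (simp add: g)
  qed
  have mult: "g *v (u \<star> v) = (g *v u) \<star> (g *v v)" for u v
  proof -
    have b1: "bilinear (\<lambda>u v. g *v (u \<star> v))" "bilinear (\<lambda>u v. (g *v u) \<star> (g *v v))"
      unfolding bilinear_def
      by (auto intro!: linearI simp: imag_product_simps matrix_vector_right_distrib matrix_vector_mult_scaleR)
    have "(\<lambda>u v. g *v (u \<star> v)) = (\<lambda>u v. (g *v u) \<star> (g *v v))"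
      by (rule bilinear_eq_stdbasis[OF b1]) (auto simp: Basis_vec_def basis)
    then show ?thesis by meson
  qed
  have unit: "f i \<bullet> f i = 1" for i
  proof -
    have "\<forall>i. f i \<bullet> f i = 1" unfolding forall_7 f by (simp add: imag_product_norm S)
    then show ?thesis by blast
  qed
  \<comment> \<open>Orthogonality comes out of multiplicativity: transporting the standard identity
    gives \<open>f i \<star> (f i \<star> f j) = - f j\<close>, whereas the general identity has the
    additional term \<open>(f i \<bullet> f j) *\<^sub>R f i\<close>.\<close>
  have orth: "f i \<bullet> f j = 0" if "i \<noteq> j" for i j
  proof -
    have "f i \<star> (f i \<star> f j) = g *v (axis i 1 \<star> (axis i 1 \<star> axis j 1))" by (simp add: mult g)
    also have "\<dots> = - f j" using that
      by (simp add: imag_product_left inner_axis_axis matrix_vector_mult_diff_distrib matrix_vector_mult_scaleR g linear_neg[OF lin])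
    finally have "(f i \<bullet> f j) *\<^sub>R f i = 0" by (simp add: imag_product_left unit)
    then show ?thesis using unit[of i] by auto
  qed
  have "(g *v u) \<bullet> (g *v v) = u \<bullet> v" for u v
  proof -
    have b1: "bilinear (\<lambda>u v. (g *v u) \<bullet> (g *v v))" "bilinear (\<lambda>u v. u \<bullet> (v::real^7))"
      unfolding bilinear_def
      by (auto intro!: linearI simp: inner_add_left inner_add_right matrix_vector_right_distrib matrix_vector_mult_scaleR)
    have "(\<lambda>u v. (g *v u) \<bullet> (g *v v)) = (\<lambda>u v. u \<bullet> v)"
      by (rule bilinear_eq_stdbasis[OF b1]) (auto simp: Basis_vec_def g inner_axis_axis unit orth)
    then show ?thesis by meson
  qed
  then have "g \<in> G2" using mult by (simp add: G2_iff)
  then show ?thesis using that g f c_def by metis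
qed

section \<open>The manifold of quaternionic reflections\<close>

text \<open>The reflection of \<open>H_A\<close>, the base point of which all reflections are
  conjugates.\<close>

definition refl0 :: "real^7^7" where
  "refl0 = (\<chi> i j. if i = j then (if j = 1 \<or> j = 2 \<or> j = 3 then 1 else -1) else 0)"

lemma refl0_nth:
  "(refl0 *v x)$1 = x$1" "(refl0 *v x)$2 = x$2" "(refl0 *v x)$3 = x$3" "(refl0 *v x)$4 = - x$4"
  "(refl0 *v x)$5 = - x$5" "(refl0 *v x)$6 = - x$6" "(refl0 *v x)$7 = - x$7"
  by (simp_all add: mv_7 refl0_def)

lemma refl0_G2: "refl0 \<in> G2"
  unfolding G2_iff by (simp add: vec_eq_7 refl0_nth inner_7 imag_product_nth)

lemma refl0_square: "refl0 ** refl0 = mat 1"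
  by (rule matrix_eqI) (simp add: vec_eq_7 refl0_nth flip: matrix_vector_mul_assoc)

lemma G2_eqI:
  assumes g: "g \<in> G2" and eq: "\<And>i. A *v (g *v axis i 1) = B *v (g *v axis i 1)"
  shows "A = (B :: real^7^7)"
proof -
  have "A ** g = B ** g"
  proof (rule matrix_eqI)
    fix x
    have "linear ((*v) (A ** g))" "linear ((*v) (B ** g))" by auto
    then have "(*v) (A ** g) = (*v) (B ** g)"
      by (rule linear_eq_stdbasis) (use eq in \<open>auto simp: Basis_vec_def simp flip: matrix_vector_mul_assoc\<close>)
    then show "(A ** g) *v x = (B ** g) *v x" by simp
  qed
  then have "(A ** g) ** transpose g = (B ** g) ** transpose g" by simp
  then show ?thesis by (simp add: G2_transpose_right[OF g] flip: matrix_mul_assoc)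
qed

text \<open>A fixed unit vector orthogonal to \<open>a\<close>, \<open>b\<close> and
  \<open>a \<star> b\<close> would complete a basic triple of fixed vectors and force
  \<open>T = mat 1\<close>. So these three span the fixed space, and \<open>T\<close> is minus the
  identity on its complement.\<close>

lemma involution_sum_projections:
  assumes T: "T \<in> G2" "T ** T = mat 1" "T \<noteq> mat 1" and n: "a \<bullet> a = 1" "b \<bullet> b = 1" "a \<bullet> b = 0"
    and fx: "T *v a = a" "T *v b = b"
  shows "T *v v = 2 *\<^sub>R ((v \<bullet> a) *\<^sub>R a + (v \<bullet> b) *\<^sub>R b + (v \<bullet> (a \<star> b)) *\<^sub>R (a \<star> b)) - v"
proof -
  define c where "c = a \<star> b"
  have c: "c \<bullet> c = 1" "a \<bullet> c = 0" "b \<bullet> c = 0" "T *v c = c"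
    using n fx by (simp_all add: c_def imag_product_norm G2_mult[OF T(1)])
  define p where "p = (v \<bullet> a) *\<^sub>R a + (v \<bullet> b) *\<^sub>R b + (v \<bullet> c) *\<^sub>R c"
  \<comment> \<open>Twice the fixed part of \<open>v - p\<close>, the component orthogonal to the
    three known fixed vectors; it has to vanish.\<close>
  define w where "w = (v - p) + T *v (v - p)"
  have Tp: "T *v p = p"
    by (simp add: p_def matrix_vector_right_distrib matrix_vector_mult_scaleR fx c)
  have TT: "T *v (T *v x) = x" for x using T(2) by (simp add: matrix_vector_mul_assoc)
  have Tw: "T *v w = w" by (simp add: w_def matrix_vector_right_distrib TT)
  have perp: "x \<bullet> (v - p) = 0" if "x = a \<or> x = b \<or> x = c" for x
    using that n c by (auto simp: p_def inner_diff_right inner_add_right inner_commute)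
  have wperp: "x \<bullet> w = 0" if "x = a \<or> x = b \<or> x = c" for x
  proof -
    have "x \<bullet> (T *v (v - p)) = (T *v x) \<bullet> (T *v (v - p))" using that fx c by auto
    also have "\<dots> = 0" using perp[OF that] by (simp add: G2_inner[OF T(1)])
    finally show ?thesis using perp[OF that] by (simp add: w_def inner_add_right)
  qed
  have "w = 0"
  proof (rule ccontr)
    assume w: "w \<noteq> 0"
    define d where "d = (1 / norm w) *\<^sub>R w"
    have d: "d \<bullet> d = 1" "a \<bullet> d = 0" "b \<bullet> d = 0" "c \<bullet> d = 0" "T *v d = d"
      using w wperp Tw by (simp_all add: d_def matrix_vector_mult_scaleR dot_square_norm power2_eq_square)
    obtain g where g: "g \<in> G2" "g *v axis 1 1 = a" "g *v axis 2 1 = b" "g *v axis 3 1 = a \<star> b" "g *v axis 4 1 = d"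
      "g *v axis 5 1 = a \<star> d" "g *v axis 6 1 = b \<star> d" "g *v axis 7 1 = (a \<star> b) \<star> d"
      using basic_triple[OF n(1,2) d(1) n(3) d(2,3)] d(4) c_def by metis
    have "\<forall>i. T *v (g *v axis i 1) = mat 1 *v (g *v axis i 1)"
      unfolding forall_7 g by (simp add: G2_mult[OF T(1)] fx d)
    then have "T = mat 1" by (intro G2_eqI[OF g(1)]) simp
    then show False using T(3) by simp
  qed
  then have "v - p + (T *v v - p) = 0" by (simp add: w_def matrix_vector_mult_diff_distrib Tp)
  then have "T *v v = 2 *\<^sub>R p - v" by (simp add: algebra_simps scaleR_2)
  then show ?thesis by (simp add: p_def c_def)
qed

definition emb3 :: "real^3 \<Rightarrow> real^7" where
  "emb3 m = (\<chi> i. if i = 1 then m$1 else if i = 2 then m$2 else if i = 3 then m$3 else 0)"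

lemma emb3_nth:
  "emb3 m$1 = m$1" "emb3 m$2 = m$2" "emb3 m$3 = m$3" "emb3 m$4 = 0" "emb3 m$5 = 0" "emb3 m$6 = 0" "emb3 m$7 = 0"
  by (simp_all add: emb3_def)

lemma linear_emb3: "linear emb3"
  by (rule linearI) (simp_all add: vec_eq_7 emb3_nth)

lemma H_A_iff: "x \<in> H_A \<longleftrightarrow> snd x$4 = 0 \<and> snd x$5 = 0 \<and> snd x$6 = 0 \<and> snd x$7 = 0"
proof
  assume "x \<in> H_A"
  then show "snd x$4 = 0 \<and> snd x$5 = 0 \<and> snd x$6 = 0 \<and> snd x$7 = 0"
    unfolding H_A_def
  proof (induction rule: span_induct)
    case base
    show ?case by (rule subspaceI) auto
  next
    case (step x)
    then show ?case by (auto simp: oct_one_def e_def axis_def)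
  qed
next
  assume "snd x$4 = 0 \<and> snd x$5 = 0 \<and> snd x$6 = 0 \<and> snd x$7 = 0"
  then have "x = fst x *\<^sub>R oct_one + (snd x$1) *\<^sub>R e 1 + (snd x$2) *\<^sub>R e 2 + (snd x$3) *\<^sub>R e 3"
    by (simp add: prod_eq_iff oct_one_def e_def vec_eq_7 axis_def)
  moreover have "\<dots> \<in> H_A"
    unfolding H_A_def by (intro span_add span_mul) (auto intro: span_base)
  ultimately show "x \<in> H_A" by simp
qed

text \<open>The imaginary part of the square is a multiple of both the real and the imaginary part
  of \<open>x\<close>, so one of these vanishes; a real \<open>x\<close> is excluded because real
  squares are not -1.\<close>

lemma oct_square_minus_one:
  assumes "x \<odot> x = - oct_one" shows "fst x = 0" "snd x \<bullet> snd x = 1"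
proof -
  have 1: "fst x * fst x - snd x \<bullet> snd x = -1" and 2: "fst x *\<^sub>R snd x + fst x *\<^sub>R snd x = 0"
    using assms by (auto simp: oct_mult_def oct_one_def)
  have "fst x = 0 \<or> snd x = 0" using 2 by (metis scaleR_2 scaleR_eq_0_iff zero_neq_numeral)
  then show "fst x = 0"
  proof
    assume "snd x = 0"
    then have "fst x * fst x = -1" using 1 by simp
    then show ?thesis using zero_le_square[of "fst x"] by linarith
  qed
  then show "snd x \<bullet> snd x = 1" using 1 by simp
qed

text \<open>The images of two quaternion units and a unit vector orthogonal to the context form a
  basic triple, whose \<open>g\<close> carries the signs of \<open>refl0\<close> to those of
  \<open>T\<close>. Conversely \<open>g\<close> transports the standard quaternions.\<close>

lemma reflections_iff: "T \<in> reflections \<longleftrightarrow> (\<exists>g\<in>G2. T = g ** refl0 ** transpose g)"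
proof
  assume "T \<in> reflections"
  then obtain H where H: "quaternionic_context H" "is_quaternionic_reflection H T"
    unfolding reflections_def by blast
  then obtain \<phi> :: "quaternion \<Rightarrow> octonion" where lin: "linear \<phi>" and bij: "bij_betw \<phi> UNIV H"
    and one: "\<phi> (1, 0) = oct_one" and mult: "\<And>p q. \<phi> (quat_mult p q) = \<phi> p \<odot> \<phi> q"
    unfolding quaternionic_context_def by blast
  have T: "T \<in> G2" and TH: "\<And>x. x \<in> H \<Longrightarrow> aut_action T x = x"
    and Tp: "\<And>x. (\<And>h. h \<in> H \<Longrightarrow> orthogonal x h) \<Longrightarrow> aut_action T x = - x"
    using H(2) unfolding is_quaternionic_reflection_def by blast+
  \<comment> \<open>Squares equal to -1 make these images imaginary of length one; as the product of
    the first two is the third and hence imaginary too, the first two are orthogonal.\<close>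
  define p where "p i = \<phi> (0, axis i 1)" for i :: 3
  have m1: "\<phi> (-1, 0) = - oct_one" using linear_neg[OF lin, of "(1,0)"] one by simp
  have psq: "p i \<odot> p i = - oct_one" for i
    unfolding p_def mult[symmetric] by (simp add: quat_mult_def inner_axis_axis m1)
  have p12: "p 1 \<odot> p 2 = p 3"
    unfolding p_def mult[symmetric] by (simp add: quat_mult_def inner_axis_axis cross_basis)
  define a where "a = snd (p 1)"
  define b where "b = snd (p 2)"
  have pa: "p 1 = (0, a)" "p 2 = (0, b)"
    using oct_square_minus_one(1)[OF psq] by (simp_all add: a_def b_def prod_eq_iff)
  have n: "a \<bullet> a = 1" "b \<bullet> b = 1"
    using oct_square_minus_one(2)[OF psq] by (simp_all add: a_def b_def)
  have p3: "p 3 = (- (a \<bullet> b), a \<star> b)" using p12 by (simp add: pa oct_mult_Pair)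
  then have o: "a \<bullet> b = 0" using oct_square_minus_one(1)[OF psq[of 3]] by simp
  define c where "c = a \<star> b"
  have pc: "p 3 = (0, c)" using p3 o by (simp add: c_def)
  have inH: "\<phi> q \<in> H" for q using bij by (auto simp: bij_betw_def)
  have fixT: "T *v a = a" "T *v b = b"
    using TH[OF inH, of "(0, axis 1 1)"] TH[OF inH, of "(0, axis 2 1)"] pa by (simp_all add: p_def aut_action_def)
  have Hform: "h = (fst q, (snd q$1) *\<^sub>R a + (snd q$2) *\<^sub>R b + (snd q$3) *\<^sub>R c)" if "h = \<phi> q" for h q
  proof -
    have "q = fst q *\<^sub>R (1, 0) + (snd q$1) *\<^sub>R (0, axis 1 1) + (snd q$2) *\<^sub>R (0, axis 2 1) + (snd q$3) *\<^sub>R (0, axis 3 1)"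
      by (simp add: prod_eq_iff vec_eq_iff forall_3 axis_def)
    then have "\<phi> q = fst q *\<^sub>R \<phi> (1, 0) + (snd q$1) *\<^sub>R p 1 + (snd q$2) *\<^sub>R p 2 + (snd q$3) *\<^sub>R p 3"
      unfolding p_def linear_add[OF lin, symmetric] linear_scale[OF lin, symmetric] by simp
    then show ?thesis using that by (simp add: one oct_one_def pa pc)
  qed
  have "dim {a, b, c} \<le> card {a, b, c}" by (rule dim_le_card) (auto intro: span_base)
  also have "card {a, b, c} \<le> 3" by (simp add: card_insert_if)
  finally have "dim {a, b, c} < DIM(real^7)" by simp
  then obtain x where x: "x \<noteq> 0" "\<And>y. y \<in> span {a, b, c} \<Longrightarrow> orthogonal x y"
    by (rule orthogonal_to_subspace_exists) blast
  define d where "d = (1 / norm x) *\<^sub>R x"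
  have xo: "y \<bullet> x = 0" if "y \<in> {a, b, c}" for y
    using x(2)[OF span_base[OF that]] by (simp add: orthogonal_def inner_commute)
  have d: "d \<bullet> d = 1" "a \<bullet> d = 0" "b \<bullet> d = 0" "c \<bullet> d = 0"
    using x(1) xo by (simp_all add: d_def dot_square_norm power2_eq_square)
  have "aut_action T (0, d) = - (0, d)"
  proof (rule Tp)
    fix h assume "h \<in> H"
    then obtain q where "h = \<phi> q" using bij by (auto simp: bij_betw_def)
    from Hform[OF this] show "orthogonal (0, d) h"
      using d by (simp add: orthogonal_def inner_add_right inner_commute)
  qed
  then have Td: "T *v d = - d" by (simp add: aut_action_def)
  obtain g where g: "g \<in> G2" "g *v axis 1 1 = a" "g *v axis 2 1 = b" "g *v axis 3 1 = a \<star> b" "g *v axis 4 1 = d"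
      "g *v axis 5 1 = a \<star> d" "g *v axis 6 1 = b \<star> d" "g *v axis 7 1 = (a \<star> b) \<star> d"
    using basic_triple[OF n d(1) o d(2,3)] d(4) c_def by metis
  have "\<forall>i. refl0 *v axis i 1 = (if i = 1 \<or> i = 2 \<or> i = 3 then axis i 1 else - axis i 1)"
    unfolding forall_7 by (simp add: vec_eq_7 refl0_nth axis_def)
  then have r0: "refl0 *v axis i 1 = (if i = 1 \<or> i = 2 \<or> i = 3 then axis i 1 else - axis i 1)" for i
    by blast
  note gi = g(2-8)[THEN arg_cong[where f="(*v) (transpose g)"], unfolded G2_cancel[OF g(1)], symmetric]
  have "\<forall>i. T *v (g *v axis i 1) = (g ** refl0 ** transpose g) *v (g *v axis i 1)"
    unfolding forall_7
    by (simp add: gi r0 linear_neg g G2_mult[OF T] fixT Td imag_product_simps flip: matrix_vector_mul_assoc)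
  then have "T = g ** refl0 ** transpose g" by (intro G2_eqI[OF g(1)]) simp
  then show "\<exists>g\<in>G2. T = g ** refl0 ** transpose g" using g(1) by blast
next
  assume "\<exists>g\<in>G2. T = g ** refl0 ** transpose g"
  then obtain g where g: "g \<in> G2" and T: "T = g ** refl0 ** transpose g" by blast
  define \<phi> :: "quaternion \<Rightarrow> octonion" where "\<phi> q = (fst q, g *v emb3 (snd q))" for q
  have lin: "linear \<phi>"
    by (rule linearI) (simp_all add: \<phi>_def linear_add[OF linear_emb3] linear_scale[OF linear_emb3]
      matrix_vector_right_distrib matrix_vector_mult_scaleR)
  have mult: "\<phi> (quat_mult p q) = \<phi> p \<odot> \<phi> q" for p q
  proof -
    have "emb3 (cross3 u v) = emb3 u \<star> emb3 v" for u v
      by (simp add: vec_eq_7 emb3_nth imag_product_nth cross3_simps)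
    moreover have "u \<bullet> v = emb3 u \<bullet> emb3 v" for u v
      unfolding inner_7 emb3_nth by (simp add: inner_vec_def sum_3)
    ultimately show ?thesis
      by (simp add: \<phi>_def quat_mult_def oct_mult_def linear_add[OF linear_emb3] linear_scale[OF linear_emb3]
        matrix_vector_right_distrib matrix_vector_mult_scaleR G2_mult[OF g] G2_inner[OF g])
  qed
  have one: "\<phi> (1, 0) = oct_one" by (simp add: \<phi>_def oct_one_def linear_0[OF linear_emb3])
  have inj: "inj \<phi>"
  proof (rule injI)
    fix p q assume eq: "\<phi> p = \<phi> q"
    then have "transpose g *v (g *v emb3 (snd p)) = transpose g *v (g *v emb3 (snd q))" by (simp add: \<phi>_def)
    then have "emb3 (snd p) = emb3 (snd q)" by (simp add: G2_cancel[OF g])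
    then show "p = q" using eq by (simp add: \<phi>_def prod_eq_iff vec_eq_7 emb3_nth vec_eq_iff forall_3)
  qed
  have "quaternionic_context (range \<phi>)"
    unfolding quaternionic_context_def
  proof (intro conjI exI[of _ \<phi>] allI ballI)
    show "subspace (range \<phi>)" using lin by (simp add: linear_subspace_image)
    show "oct_one \<in> range \<phi>" using one by (metis rangeI)
    show "x \<odot> y \<in> range \<phi>" if "x \<in> range \<phi>" "y \<in> range \<phi>" for x y
      using that by (auto simp only: mult[symmetric])
    show "bij_betw \<phi> UNIV (range \<phi>)" using inj by (simp add: bij_betw_def)
  qed (simp_all add: lin one mult)
  moreover have "is_quaternionic_reflection (range \<phi>) T"
    unfolding is_quaternionic_reflection_def
  proof (intro conjI ballI allI impI)
    show "T \<in> G2" unfolding T by (intro G2_mult_closed G2_transpose g refl0_G2)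
    show "aut_action T x = x" if "x \<in> range \<phi>" for x
    proof -
      have "refl0 *v emb3 m = emb3 m" for m by (simp add: vec_eq_7 refl0_nth emb3_nth)
      then show ?thesis using that
        by (auto simp: \<phi>_def aut_action_def T G2_cancel[OF g] simp flip: matrix_vector_mul_assoc)
    qed
    fix x assume o: "\<forall>h\<in>range \<phi>. orthogonal x h"
    have "orthogonal x (\<phi> (1, 0))" using o by blast
    then have x0: "fst x = 0" unfolding one by (cases x) (simp add: orthogonal_def oct_one_def)
    define y where "y = transpose g *v snd x"
    have xy: "snd x = g *v y" by (simp add: y_def G2_cancel[OF g])
    have "y \<bullet> emb3 m = 0" for m
    proof -
      have "orthogonal x (\<phi> (0, m))" using o by blast
      then show ?thesis by (cases x) (use x0 xy in \<open>simp add: orthogonal_def \<phi>_def G2_inner[OF g]\<close>)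
    qed
    from this[of "axis 1 1"] this[of "axis 2 1"] this[of "axis 3 1"]
    have "y$1 = 0" "y$2 = 0" "y$3 = 0" by (simp_all add: inner_7 emb3_nth axis_def)
    then have "refl0 *v y = - y" by (simp add: vec_eq_7 refl0_nth)
    then have "T *v snd x = - snd x"
      by (simp add: T xy G2_cancel[OF g] linear_neg flip: matrix_vector_mul_assoc)
    then show "aut_action T x = - x" using x0 by (simp add: aut_action_def prod_eq_iff)
  qed
  ultimately show "T \<in> reflections" unfolding reflections_def by blast
qed

lemma transpose_refl0: "transpose refl0 = refl0"
  by (simp add: vec_eq_iff transpose_def refl0_def)

lemma reflection_conj: assumes "T \<in> reflections" "h \<in> G2" shows "h ** T ** transpose h \<in> reflections"
proof -
  obtain g where g: "g \<in> G2" "T = g ** refl0 ** transpose g" using assms reflections_iff by blast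
  then have "h ** T ** transpose h = (h ** g) ** refl0 ** transpose (h ** g)"
    by (simp add: matrix_transpose_mul matrix_mul_assoc)
  then show ?thesis unfolding reflections_iff using g assms G2_mult_closed by blast
qed

lemma reflectionD:
  assumes "T \<in> reflections"
  shows "T \<in> G2" "T ** T = mat 1" "T \<noteq> mat 1" "transpose T = T"
proof -
  obtain g where g: "g \<in> G2" and T: "T = g ** refl0 ** transpose g" using assms reflections_iff by blast
  show "T \<in> G2" unfolding T by (intro G2_mult_closed G2_transpose g refl0_G2)
  have "T ** T = g ** (refl0 ** (transpose g ** (g ** (refl0 ** transpose g))))" by (simp add: T matrix_mul_assoc)
  also have "\<dots> = g ** ((refl0 ** refl0) ** transpose g)"
    by (simp only: G2_cancel[OF g]) (simp only: matrix_mul_assoc)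
  finally show "T ** T = mat 1" by (simp add: refl0_square G2_transpose_right[OF g])
  show "transpose T = T" by (simp add: T matrix_transpose_mul transpose_refl0 matrix_mul_assoc transpose_transpose)
  show "T \<noteq> mat 1"
  proof
    assume "T = mat 1"
    then have "transpose g *v (T *v (g *v axis 4 1)) = axis 4 1" by (simp add: G2_cancel[OF g])
    then have "refl0 *v axis 4 1 = axis 4 1" by (simp add: T G2_cancel[OF g] flip: matrix_vector_mul_assoc)
    then have "(refl0 *v axis 4 1)$4 = (axis 4 1 :: real^7)$4" by simp
    then show False by (simp add: refl0_nth)
  qed
qed

section \<open>Analyticity of vector- and matrix-valued maps\<close>

lemma linear_vec_nth: "linear (\<lambda>x::real^'n. x $ k)"
  by (rule linearI) auto

lemma linear_vec_nth2: "linear (\<lambda>x::real^'n^'m. x $ k $ l)"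
  by (rule linearI) auto

lemma real_analytic_at_vec:
  fixes f :: "'a::euclidean_space \<Rightarrow> real^'n"
  assumes "\<And>k. real_analytic_at (\<lambda>x. f x $ k) a"
  shows "real_analytic_at f a"
  using assms by (subst real_analytic_at_componentwise) (auto simp: Basis_vec_def inner_axis)

lemma real_analytic_at_mat:
  fixes f :: "'a::euclidean_space \<Rightarrow> real^'n^'m"
  assumes "\<And>k l. real_analytic_at (\<lambda>x. f x $ k $ l) a"
  shows "real_analytic_at f a"
proof -
  have "real_analytic_at (\<lambda>x. f x $ k) a" for k
    using assms by (intro real_analytic_at_vec)
  then show ?thesis by (subst real_analytic_at_componentwise) (auto simp: Basis_vec_def inner_axis
     real_analytic_at_componentwise[of "\<lambda>x. f x $ _"])
qed

lemma real_analytic_at_nth: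
  fixes f :: "'a::euclidean_space \<Rightarrow> real^'n"
  shows "real_analytic_at f a \<Longrightarrow> real_analytic_at (\<lambda>x. f x $ k) a"
  by (rule real_analytic_at_linear_compose[OF linear_vec_nth])

lemma bilinear_matrix_mult: "bilinear ((**) :: real^'n^'m \<Rightarrow> real^'k^'n \<Rightarrow> real^'k^'m)"
  unfolding bilinear_def
  by (auto intro!: linearI simp: matrix_matrix_mult_def vec_eq_iff sum.distrib sum_distrib_left algebra_simps)

lemma bilinear_matrix_vector_mult: "bilinear ((*v) :: real^'n^'m \<Rightarrow> real^'n \<Rightarrow> real^'m)"
  unfolding bilinear_def
  by (auto intro!: linearI simp: matrix_vector_mult_def vec_eq_iff sum.distrib sum_distrib_left algebra_simps)

lemmas real_analytic_at_mm = real_analytic_at_bilinear[OF bilinear_matrix_mult]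
lemmas real_analytic_at_mv = real_analytic_at_bilinear[OF bilinear_matrix_vector_mult]

lemma linear_matrix_conj: "linear (\<lambda>T. (A::real^'n^'m) ** T ** (B::real^'k^'l))"
proof -
  have "linear (\<lambda>T. A ** T)" "linear (\<lambda>T. T ** B)" using bilinear_matrix_mult unfolding bilinear_def by blast+
  then show ?thesis using linear_compose[of "\<lambda>T. A ** T" "\<lambda>T. T ** B"] by (simp add: o_def)
qed

lemma linear_transpose: "linear (transpose :: real^'n^'m \<Rightarrow> real^'m^'n)"
  by (rule linearI) (auto simp: transpose_def vec_eq_iff)

lemma det_real_analytic_at:
  fixes A :: "'a::euclidean_space \<Rightarrow> real^'n^'n"
  assumes "\<And>k l. real_analytic_at (\<lambda>x. A x $ k $ l) a"
  shows "real_analytic_at (\<lambda>x. det (A x)) a"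
  unfolding det_def
  by (intro real_analytic_at_sum real_analytic_at_mult_real real_analytic_at_prod real_analytic_at_const assms)

text \<open>Twice the orthogonal projection onto the span of \<open>a\<close>, \<open>b\<close> and
  \<open>a \<star> b\<close>, minus the identity. Gram-Schmidt without normalization keeps the
  entries rational in \<open>a\<close> and \<open>b\<close>, hence analytic;
  \<open>a \<star> b\<close> is already orthogonal to both.\<close>

definition span_refl :: "real^7 \<Rightarrow> real^7 \<Rightarrow> real^7^7" where
  "span_refl a b = (let b' = b - ((a \<bullet> b) / (a \<bullet> a)) *\<^sub>R a; c = a \<star> b in
     (\<chi> i j. 2 * (a$i * a$j / (a \<bullet> a) + b'$i * b'$j / (b' \<bullet> b') + c$i * c$j / (c \<bullet> c)) - (if i = j then 1 else 0)))"

lemma span_refl_apply: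
  "span_refl a b *v v = (let b' = b - ((a \<bullet> b) / (a \<bullet> a)) *\<^sub>R a; c = a \<star> b in
     2 *\<^sub>R (((v \<bullet> a) / (a \<bullet> a)) *\<^sub>R a + ((v \<bullet> b') / (b' \<bullet> b')) *\<^sub>R b' + ((v \<bullet> c) / (c \<bullet> c)) *\<^sub>R c) - v)"
proof -
  have "(\<chi> i j. 2 * (a$i * a$j / p + b'$i * b'$j / q + c$i * c$j / r) - (if i = j then 1 else 0)) *v v =
     2 *\<^sub>R (((v \<bullet> a) / p) *\<^sub>R a + ((v \<bullet> b') / q) *\<^sub>R b' + ((v \<bullet> c) / r) *\<^sub>R c) - v"
    for p q r :: real and a b' c :: "real^7"
  proof -
    have "(\<Sum>j\<in>UNIV. (2 * (a$i * a$j / p + b'$i * b'$j / q + c$i * c$j / r) - (if i = j then 1 else 0)) * v$j)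
      = 2 * ((\<Sum>j\<in>UNIV. v$j * a$j) / p * a$i + (\<Sum>j\<in>UNIV. v$j * b'$j) / q * b'$i + (\<Sum>j\<in>UNIV. v$j * c$j) / r * c$i) - v$i" for i
    proof -
      have eq: "(2 * (a$i * a$j / p + b'$i * b'$j / q + c$i * c$j / r) - (if i = j then 1 else 0)) * v$j
        = v$j * a$j * (2 * a$i / p) + v$j * b'$j * (2 * b'$i / q) + v$j * c$j * (2 * c$i / r) - (if i = j then v$j else 0)" for j
        by (simp add: algebra_simps)
      have \<delta>: "(\<Sum>j\<in>UNIV. if i = j then v$j else 0) = v$i" by simp
      show ?thesis
        by (simp only: eq sum.distrib sum_subtractf sum_distrib_right[symmetric] \<delta>) (simp add: algebra_simps)
    qed
    then show ?thesis by (simp add: vec_eq_iff matrix_vector_mult_def inner_vec_def)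
  qed
  then show ?thesis unfolding span_refl_def Let_def .
qed

lemma gram_schmidt_pair:
  fixes a b :: "real^7"
  assumes "a \<noteq> 0" "b - ((a \<bullet> b) / (a \<bullet> a)) *\<^sub>R a \<noteq> 0"
  defines "b' \<equiv> b - ((a \<bullet> b) / (a \<bullet> a)) *\<^sub>R a"
  defines "a1 \<equiv> (1 / norm a) *\<^sub>R a" and "b1 \<equiv> (1 / norm b') *\<^sub>R b'"
  shows "a1 \<bullet> a1 = 1" "b1 \<bullet> b1 = 1" "a1 \<bullet> b1 = 0"
    "a1 \<star> b1 = (1 / (norm a * norm b')) *\<^sub>R (a \<star> b)" "(a \<star> b) \<bullet> (a \<star> b) = (norm a * norm b')\<^sup>2"
proof -
  have ab: "a \<bullet> b' = 0" using assms(1) by (simp add: b'_def inner_diff_right)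
  have c: "a \<star> b = a \<star> b'" by (simp add: b'_def imag_product_simps)
  show "a1 \<bullet> a1 = 1" "b1 \<bullet> b1 = 1" using assms by (simp_all add: a1_def b1_def dot_square_norm power2_eq_square)
  show "a1 \<bullet> b1 = 0" using ab by (simp add: a1_def b1_def)
  show "a1 \<star> b1 = (1 / (norm a * norm b')) *\<^sub>R (a \<star> b)" by (simp add: a1_def b1_def c imag_product_simps)
  show "(a \<star> b) \<bullet> (a \<star> b) = (norm a * norm b')\<^sup>2"
    unfolding c imag_product_norm by (simp add: ab dot_square_norm power_mult_distrib)
qed

lemma span_refl_eq:
  assumes T: "T \<in> G2" "T ** T = mat 1" "T \<noteq> mat 1" and ab: "a \<noteq> 0" "b - ((a \<bullet> b) / (a \<bullet> a)) *\<^sub>R a \<noteq> 0"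
    and fx: "T *v a = a" "T *v b = b"
  shows "T = span_refl a b"
proof (rule matrix_eqI)
  fix v
  define b' where "b' = b - ((a \<bullet> b) / (a \<bullet> a)) *\<^sub>R a"
  define a1 where "a1 = (1 / norm a) *\<^sub>R a"
  define b1 where "b1 = (1 / norm b') *\<^sub>R b'"
  note gs = gram_schmidt_pair[OF ab, folded b'_def, folded a1_def b1_def]
  have b': "b' \<noteq> 0" using ab by (simp add: b'_def)
  have fx1: "T *v a1 = a1" "T *v b1 = b1"
    by (simp_all add: a1_def b1_def b'_def matrix_vector_mult_scaleR matrix_vector_mult_diff_distrib fx)
  have sc: "(v \<bullet> ((1/n) *\<^sub>R x)) *\<^sub>R ((1/n) *\<^sub>R x) = ((v \<bullet> x) / m) *\<^sub>R x" if "m = n\<^sup>2" for n m and x :: "real^7"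
    using that by (simp add: power2_eq_square)
  show "T *v v = span_refl a b *v v"
    unfolding involution_sum_projections[OF T gs(1-3) fx1] span_refl_apply Let_def gs(4) b'_def[symmetric]
    unfolding a1_def b1_def sc[OF gs(5)] sc[OF dot_square_norm] by simp
qed

text \<open>No computation with the formula is made: a conjugate of \<open>refl0\<close> fixing
  \<open>a\<close> and \<open>b\<close> comes from a basic triple and equals
  \<open>span_refl a b\<close> by \<open>span_refl_eq\<close>.\<close>

lemma span_refl_reflection:
  assumes ab: "a \<noteq> 0" "b - ((a \<bullet> b) / (a \<bullet> a)) *\<^sub>R a \<noteq> 0"
  shows "span_refl a b \<in> reflections" "span_refl a b *v a = a" "span_refl a b *v b = b"
proof -
  define b' where "b' = b - ((a \<bullet> b) / (a \<bullet> a)) *\<^sub>R a"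
  define a1 where "a1 = (1 / norm a) *\<^sub>R a"
  define b1 where "b1 = (1 / norm b') *\<^sub>R b'"
  note gs = gram_schmidt_pair[OF ab, folded b'_def, folded a1_def b1_def]
  have b': "b' \<noteq> 0" using ab by (simp add: b'_def)
  have "dim {a1, b1, a1 \<star> b1} \<le> card {a1, b1, a1 \<star> b1}" by (rule dim_le_card) (auto intro: span_base)
  also have "\<dots> \<le> 3" by (simp add: card_insert_if)
  finally have "dim {a1, b1, a1 \<star> b1} < DIM(real^7)" by simp
  then obtain x where x: "x \<noteq> 0" "\<And>y. y \<in> span {a1, b1, a1 \<star> b1} \<Longrightarrow> orthogonal x y"
    by (rule orthogonal_to_subspace_exists) blast
  define d where "d = (1 / norm x) *\<^sub>R x"
  have xo: "y \<bullet> x = 0" if "y \<in> {a1, b1, a1 \<star> b1}" for y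
    using x(2)[OF span_base[OF that]] by (simp add: orthogonal_def inner_commute)
  have d: "d \<bullet> d = 1" "a1 \<bullet> d = 0" "b1 \<bullet> d = 0" "(a1 \<star> b1) \<bullet> d = 0"
    using x(1) xo by (simp_all add: d_def dot_square_norm power2_eq_square)
  obtain g where g: "g \<in> G2" "g *v axis 1 1 = a1" "g *v axis 2 1 = b1"
    using basic_triple[OF gs(1,2) d(1) gs(3) d(2,3,4)] by metis
  define T where "T = g ** refl0 ** transpose g"
  have T: "T \<in> reflections" unfolding T_def reflections_iff using g(1) by blast
  have r0: "refl0 *v axis 1 1 = axis 1 1" "refl0 *v axis 2 1 = axis 2 1"
    by (simp_all add: vec_eq_7 refl0_nth axis_def)
  have T1: "T *v a1 = a1" "T *v b1 = b1"
    unfolding g(2,3)[symmetric] T_def by (simp_all add: G2_cancel[OF g(1)] r0 flip: matrix_vector_mul_assoc)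
  have "a = norm a *\<^sub>R a1" "b' = norm b' *\<^sub>R b1" using ab(1) b' by (simp_all add: a1_def b1_def)
  then have Ta: "T *v a = a" and Tb': "T *v b' = b'" using T1 by (metis matrix_vector_mult_scaleR)+
  have "b = b' + ((a \<bullet> b) / (a \<bullet> a)) *\<^sub>R a" by (simp add: b'_def)
  then have Tb: "T *v b = b" using Ta Tb' by (metis matrix_vector_mult_scaleR matrix_vector_right_distrib)
  have "T = span_refl a b" by (rule span_refl_eq[OF reflectionD(1-3)[OF T] ab Ta Tb])
  then show "span_refl a b \<in> reflections" "span_refl a b *v a = a" "span_refl a b *v b = b"
    using T Ta Tb by auto
qed

lemma fixed_combination:
  assumes T: "T \<in> reflections" and ab: "a \<noteq> 0" "b - ((a \<bullet> b) / (a \<bullet> a)) *\<^sub>R a \<noteq> 0"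
    and fx: "T *v a = a" "T *v b = b" and v: "T *v v = v"
  obtains x y z where "v = x *\<^sub>R a + y *\<^sub>R b + z *\<^sub>R (a \<star> b)"
proof -
  define b' where "b' = b - ((a \<bullet> b) / (a \<bullet> a)) *\<^sub>R a"
  have "T = span_refl a b" by (rule span_refl_eq[OF reflectionD(1-3)[OF T] ab fx])
  then have "2 *\<^sub>R v = 2 *\<^sub>R (((v \<bullet> a) / (a \<bullet> a)) *\<^sub>R a + ((v \<bullet> b') / (b' \<bullet> b')) *\<^sub>R b' + ((v \<bullet> (a \<star> b)) / ((a \<star> b) \<bullet> (a \<star> b))) *\<^sub>R (a \<star> b))"
    using v span_refl_apply[of a b v] by (simp add: Let_def b'_def[symmetric] algebra_simps scaleR_2)
  then have "v = ((v \<bullet> a) / (a \<bullet> a)) *\<^sub>R a + ((v \<bullet> b') / (b' \<bullet> b')) *\<^sub>R b' + ((v \<bullet> (a \<star> b)) / ((a \<star> b) \<bullet> (a \<star> b))) *\<^sub>R (a \<star> b)"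
    by simp
  also have "\<dots> = ((v \<bullet> a) / (a \<bullet> a) - ((v \<bullet> b') / (b' \<bullet> b')) * ((a \<bullet> b) / (a \<bullet> a))) *\<^sub>R a
      + ((v \<bullet> b') / (b' \<bullet> b')) *\<^sub>R b + ((v \<bullet> (a \<star> b)) / ((a \<star> b) \<bullet> (a \<star> b))) *\<^sub>R (a \<star> b)"
    by (subst (2) b'_def) (simp add: scaleR_diff_right scaleR_diff_left)
  finally show ?thesis using that by blast
qed

text \<open>A fixed three-space near that of \<open>refl0\<close> is a graph over the span of e1,
  e2, e3. Its vectors over e1 and e2 have four free coordinates each, and their product supplies the
  third direction; hence a chart in \<open>real^8\<close>.\<close>

definition graph_a :: "real^8 \<Rightarrow> real^7" where
  "graph_a z = (\<chi> i. if i = 1 then 1 else if i = 4 then z$1 else if i = 5 then z$2 else if i = 6 then z$3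
     else if i = 7 then z$4 else 0)"

definition graph_b :: "real^8 \<Rightarrow> real^7" where
  "graph_b z = (\<chi> i. if i = 2 then 1 else if i = 4 then z$5 else if i = 5 then z$6 else if i = 6 then z$7
     else if i = 7 then z$8 else 0)"

lemma graph_nth:
  "graph_a z$1 = 1" "graph_a z$2 = 0" "graph_a z$3 = 0" "graph_a z$4 = z$1" "graph_a z$5 = z$2" "graph_a z$6 = z$3" "graph_a z$7 = z$4"
  "graph_b z$1 = 0" "graph_b z$2 = 1" "graph_b z$3 = 0" "graph_b z$4 = z$5" "graph_b z$5 = z$6" "graph_b z$6 = z$7" "graph_b z$7 = z$8"
  by (simp_all add: graph_a_def graph_b_def)

definition proj_fixed :: "real^7^7 \<Rightarrow> real^7 \<Rightarrow> real^7" where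
  "proj_fixed T v = (1/2) *\<^sub>R (v + T *v v)"

definition restr3 :: "real^7 \<Rightarrow> real^3" where
  "restr3 v = (\<chi> i. if i = 1 then v$1 else if i = 2 then v$2 else v$3)"

lemma restr3_nth: "restr3 v$1 = v$1" "restr3 v$2 = v$2" "restr3 v$3 = v$3"
  by (simp_all add: restr3_def)

text \<open>Compression to the span of e1, e2, e3 of the projection onto the fixed space; its
  determinant detects whether the fixed space is a graph over that span.\<close>

definition corner :: "real^7^7 \<Rightarrow> real^3^3" where
  "corner T = matrix (\<lambda>m. restr3 (proj_fixed T (emb3 m)))"

lemma corner_apply: "corner T *v m = restr3 (proj_fixed T (emb3 m))"
proof -
  have "linear restr3" by (rule linearI) (simp_all add: vec_eq_iff forall_3 restr3_nth)
  moreover have "linear (proj_fixed T)"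
    by (rule linearI) (simp_all add: proj_fixed_def matrix_vector_right_distrib matrix_vector_mult_scaleR algebra_simps)
  ultimately have "linear (\<lambda>m. restr3 (proj_fixed T (emb3 m)))"
    using linear_compose[OF linear_emb3, of "proj_fixed T"] linear_compose[of "\<lambda>m. proj_fixed T (emb3 m)" restr3]
    by (simp add: o_def)
  then show ?thesis by (simp add: corner_def)
qed

text \<open>Cramer's rule instead of a matrix inverse, so that analyticity reduces to determinants
  and quotients.\<close>

definition corner_solve :: "real^3 \<Rightarrow> real^7^7 \<Rightarrow> real^3" where
  "corner_solve w T = (\<chi> k. det (\<chi> i j. if j = k then w$i else corner T$i$j) / det (corner T))"

lemma corner_solve: "det (corner T) \<noteq> 0 \<Longrightarrow> restr3 (proj_fixed T (emb3 (corner_solve w T))) = w"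
  using cramer[of "corner T" "corner_solve w T" w] by (simp add: corner_solve_def corner_apply)

definition graph_coord :: "real^7^7 \<Rightarrow> real^8" where
  "graph_coord T = (let a = proj_fixed T (emb3 (corner_solve (axis 1 1) T)); b = proj_fixed T (emb3 (corner_solve (axis 2 1) T)) in
     (\<chi> k. if k = 1 then a$4 else if k = 2 then a$5 else if k = 3 then a$6 else if k = 4 then a$7
       else if k = 5 then b$4 else if k = 6 then b$5 else if k = 7 then b$6 else b$7))"

lemma UNIV_8: "(UNIV::8 set) = {1,2,3,4,5,6,7,8}"
proof -
  have "x \<in> {1,2,3,4,5,6,7,8}" for x :: 8
  proof (cases x rule: bit0_cases)
    case (of_int z)
    then have "z = 0 \<or> z = 1 \<or> z = 2 \<or> z = 3 \<or> z = 4 \<or> z = 5 \<or> z = 6 \<or> z = 7" by auto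
    then show ?thesis using of_int(1) by auto
  qed
  then show ?thesis by auto
qed

lemma forall_8: "(\<forall>i::8. P i) \<longleftrightarrow> P 1 \<and> P 2 \<and> P 3 \<and> P 4 \<and> P 5 \<and> P 6 \<and> P 7 \<and> P 8"
  by (metis UNIV_8 UNIV_I empty_iff insert_iff)

lemma graph_independent:
  "graph_a z \<noteq> 0" "graph_b z - ((graph_a z \<bullet> graph_b z) / (graph_a z \<bullet> graph_a z)) *\<^sub>R graph_a z \<noteq> 0"
proof -
  have "graph_a z$1 \<noteq> 0$1" by (simp add: graph_nth)
  then show "graph_a z \<noteq> 0" by metis
  have "(graph_b z - ((graph_a z \<bullet> graph_b z) / (graph_a z \<bullet> graph_a z)) *\<^sub>R graph_a z)$2 \<noteq> 0$2" by (simp add: graph_nth)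
  then show "graph_b z - ((graph_a z \<bullet> graph_b z) / (graph_a z \<bullet> graph_a z)) *\<^sub>R graph_a z \<noteq> 0" by metis
qed

definition graph_chart :: "real^8 \<Rightarrow> real^7^7" where
  "graph_chart z = span_refl (graph_a z) (graph_b z)"

lemma proj_fixed_fixed: "T ** T = mat 1 \<Longrightarrow> T *v proj_fixed T v = proj_fixed T v"
  by (simp add: proj_fixed_def matrix_vector_mult_scaleR matrix_vector_right_distrib matrix_vector_mul_assoc add.commute)

text \<open>In the first three coordinates \<open>a\<close>, \<open>b\<close> and
  \<open>a \<star> b\<close> are triangular with nonzero diagonal, so these coordinates determine a
  fixed vector. A kernel vector of the corner is therefore negated by \<open>T\<close>, hence
  orthogonal to the three, and triangularity makes it zero.\<close>

lemma graph_coord_chart: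
  assumes c3: "(graph_a z \<star> graph_b z)$3 \<noteq> 0"
  shows "graph_chart z \<in> reflections" "det (corner (graph_chart z)) \<noteq> 0" "graph_coord (graph_chart z) = z"
proof -
  define a where "a = graph_a z"
  define b where "b = graph_b z"
  define T where "T = graph_chart z"
  note ind = graph_independent[of z, folded a_def b_def]
  have T: "T \<in> reflections" and fx: "T *v a = a" "T *v b = b"
    using span_refl_reflection[OF ind] by (simp_all add: T_def graph_chart_def a_def b_def)
  show "graph_chart z \<in> reflections" using T by (simp add: T_def)
  have ab: "a$1 = 1" "a$2 = 0" "a$3 = 0" "b$1 = 0" "b$2 = 1" "b$3 = 0" by (simp_all add: a_def b_def graph_nth)
  have det_fx: "v = (restr3 v$1) *\<^sub>R a + (restr3 v$2) *\<^sub>R b" if Tv: "T *v v = v" and v3: "restr3 v$3 = 0" for v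
  proof -
    obtain x y w where v: "v = x *\<^sub>R a + y *\<^sub>R b + w *\<^sub>R (a \<star> b)" by (rule fixed_combination[OF T ind fx Tv]) blast
    then have "v$3 = w * (a \<star> b)$3" by (simp add: ab)
    then have "w = 0" using v3 c3 by (simp add: restr3_nth a_def b_def)
    then show ?thesis using v by (simp add: restr3_nth ab)
  qed
  have PT: "T *v proj_fixed T v = proj_fixed T v" for v by (rule proj_fixed_fixed[OF reflectionD(2)[OF T]])
  have "m = 0" if m: "corner T *v m = 0" for m
  proof -
    have r: "restr3 (proj_fixed T (emb3 m)) = 0" using m by (simp add: corner_apply)
    then have "proj_fixed T (emb3 m) = 0" using det_fx[OF PT, of "emb3 m"] by simp
    then have Tm: "T *v emb3 m = - emb3 m" by (simp add: proj_fixed_def add_eq_0_iff)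
    have perp: "emb3 m \<bullet> v = 0" if "T *v v = v" for v
    proof -
      have "(T *v emb3 m) \<bullet> (T *v v) = emb3 m \<bullet> v" by (rule G2_inner[OF reflectionD(1)[OF T]])
      then show ?thesis using Tm that by simp
    qed
    have m12: "m$1 = 0" "m$2 = 0" using perp[OF fx(1)] perp[OF fx(2)] by (simp_all add: inner_7 emb3_nth ab)
    have "T *v (a \<star> b) = a \<star> b" by (simp add: G2_mult[OF reflectionD(1)[OF T]] fx)
    from perp[OF this] have "m$3 = 0" using c3 by (simp add: inner_7 emb3_nth m12 a_def b_def)
    then show "m = 0" using m12 by (simp add: vec_eq_iff forall_3)
  qed
  then have "\<exists>B. B ** corner T = mat 1" using matrix_left_invertible_ker by blast
  then show det: "det (corner (graph_chart z)) \<noteq> 0"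
    unfolding T_def invertible_left_inverse[symmetric] invertible_det_nz .
  have s: "proj_fixed T (emb3 (corner_solve w T)) = (w$1) *\<^sub>R a + (w$2) *\<^sub>R b" if "w$3 = 0" for w
    using det_fx[OF PT, of "emb3 (corner_solve w T)"] corner_solve[of T w] det that by (simp add: T_def)
  have "proj_fixed T (emb3 (corner_solve (axis 1 1) T)) = a" "proj_fixed T (emb3 (corner_solve (axis 2 1) T)) = b"
    by (simp_all add: s axis_def)
  then show "graph_coord (graph_chart z) = z"
    by (simp add: graph_coord_def T_def[symmetric] Let_def vec_eq_iff forall_8 a_def b_def graph_nth)
qed

lemma graph_chart_coord:
  assumes T: "T \<in> reflections" and det: "det (corner T) \<noteq> 0"
  shows "(graph_a (graph_coord T) \<star> graph_b (graph_coord T))$3 \<noteq> 0" "graph_chart (graph_coord T) = T"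
proof -
  define z where "z = graph_coord T"
  define a where "a = proj_fixed T (emb3 (corner_solve (axis 1 1) T))"
  define b where "b = proj_fixed T (emb3 (corner_solve (axis 2 1) T))"
  have r: "restr3 a = axis 1 1" "restr3 b = axis 2 1" by (simp_all add: a_def b_def corner_solve[OF det])
  have r1: "a$1 = 1" "a$2 = 0" "a$3 = 0" using r(1) by (simp_all add: vec_eq_iff forall_3 restr3_nth axis_def)
  have r2: "b$1 = 0" "b$2 = 1" "b$3 = 0" using r(2) by (simp_all add: vec_eq_iff forall_3 restr3_nth axis_def)
  have ga: "graph_a z = a" and gb: "graph_b z = b"
    by (simp_all add: z_def graph_coord_def Let_def a_def[symmetric] b_def[symmetric] vec_eq_7 graph_nth r1 r2)
  note ind = graph_independent[of z, unfolded ga gb]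
  have PT: "T *v proj_fixed T v = proj_fixed T v" for v by (rule proj_fixed_fixed[OF reflectionD(2)[OF T]])
  have fx: "T *v a = a" "T *v b = b" by (simp_all add: a_def b_def PT)
  show "graph_chart (graph_coord T) = T"
    using span_refl_eq[OF reflectionD(1-3)[OF T] ind fx] unfolding z_def[symmetric] graph_chart_def ga gb by (rule sym)
  define v where "v = proj_fixed T (emb3 (corner_solve (axis 3 1) T))"
  have v3: "v$3 = 1"
    using arg_cong[OF corner_solve[OF det, of "axis 3 1", folded v_def], of "\<lambda>m. m$3"] by (simp add: restr3_nth)
  have "T *v v = v" by (simp add: v_def PT)
  then obtain x y w where v: "v = x *\<^sub>R a + y *\<^sub>R b + w *\<^sub>R (a \<star> b)"
    by (rule fixed_combination[OF T ind fx])
  have "1 = w * (a \<star> b)$3" using v3 unfolding v by (simp add: r1 r2)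
  then show "(graph_a (graph_coord T) \<star> graph_b (graph_coord T))$3 \<noteq> 0" by (auto simp: z_def[symmetric] ga gb)
qed

lemma real_analytic_at_proj_emb:
  fixes m :: "'a::euclidean_space \<Rightarrow> real^3"
  assumes "real_analytic_at T p" "real_analytic_at m p"
  shows "real_analytic_at (\<lambda>x. proj_fixed (T x) (emb3 (m x))) p"
  unfolding proj_fixed_def
  by (intro real_analytic_at_scaleR real_analytic_at_const real_analytic_at_add real_analytic_at_mv
      real_analytic_at_linear_compose[OF linear_emb3] assms)

lemma corner_nth_analytic: "real_analytic_at (\<lambda>T. corner T $ k $ l) p"
proof -
  have "corner T $ k $ l = restr3 (proj_fixed T (emb3 (axis l 1))) $ k" for T by (simp add: corner_def matrix_def)
  moreover have "real_analytic_at (\<lambda>T. restr3 (proj_fixed T (emb3 (axis l 1))) $ k) p"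
    by (intro real_analytic_at_nth real_analytic_at_linear_compose[of restr3] real_analytic_at_proj_emb real_analytic_at_ident real_analytic_at_const)
      (auto intro!: linearI simp: vec_eq_iff forall_3 restr3_nth)
  ultimately show ?thesis by simp
qed

lemma det_corner_analytic: "real_analytic_at (\<lambda>T. det (corner T)) p"
  by (intro det_real_analytic_at corner_nth_analytic)

lemma graph_coord_analytic:
  assumes "det (corner p) \<noteq> 0" shows "real_analytic_at graph_coord p"
proof -
  have s: "real_analytic_at (corner_solve w) p" for w
  proof (rule real_analytic_at_vec)
    fix k
    have "real_analytic_at (\<lambda>T. (\<chi> i j. if j = k then w$i else corner T$i$j) $ i $ j) p" for i j
      by (cases "j = k") (simp_all add: corner_nth_analytic)
    then have "real_analytic_at (\<lambda>T. det (\<chi> i j. if j = k then w$i else corner T$i$j) / det (corner T)) p"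
      by (intro real_analytic_at_divide det_real_analytic_at det_corner_analytic assms)
    then show "real_analytic_at (\<lambda>T. corner_solve w T $ k) p" by (simp add: corner_solve_def)
  qed
  have pe: "real_analytic_at (\<lambda>T. proj_fixed T (emb3 (corner_solve w T)) $ i) p" for w i
    by (intro real_analytic_at_nth real_analytic_at_proj_emb real_analytic_at_ident s)
  show ?thesis
  proof (rule real_analytic_at_vec)
    have "\<forall>k. real_analytic_at (\<lambda>T. graph_coord T $ k) p"
      unfolding forall_8 by (simp add: graph_coord_def Let_def pe)
    then show "real_analytic_at (\<lambda>T. graph_coord T $ k) p" for k by blast
  qed
qed

lemma graph_chart_analytic: "real_analytic_at graph_chart z"
proof -
  have c: "real_analytic_at (\<lambda>z::real^8. z $ k) z" for k by (rule real_analytic_at_linear[OF linear_vec_nth])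
  have a: "real_analytic_at graph_a z" and b: "real_analytic_at graph_b z"
  proof -
    have "\<forall>k. real_analytic_at (\<lambda>z. graph_a z $ k) z" "\<forall>k. real_analytic_at (\<lambda>z. graph_b z $ k) z"
      unfolding forall_7 by (simp_all add: graph_nth c)
    then show "real_analytic_at graph_a z" "real_analytic_at graph_b z" by (blast intro: real_analytic_at_vec)+
  qed
  have aa: "graph_a z \<bullet> graph_a z \<noteq> 0" using graph_independent(1) by simp
  define b' where "b' z = graph_b z - ((graph_a z \<bullet> graph_b z) / (graph_a z \<bullet> graph_a z)) *\<^sub>R graph_a z" for z
  have b': "real_analytic_at b' z" unfolding b'_def[abs_def]
    by (intro real_analytic_at_diff real_analytic_at_scaleR real_analytic_at_divide real_analytic_at_inner a b aa)
  have bb: "b' z \<bullet> b' z \<noteq> 0" using graph_independent(2) by (simp add: b'_def)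
  define c where "c z = graph_a z \<star> graph_b z" for z
  have c: "real_analytic_at c z" unfolding c_def[abs_def]
    by (intro real_analytic_at_bilinear[OF bilinear_imag_product] a b)
  have cc: "c z \<bullet> c z \<noteq> 0"
    using gram_schmidt_pair(5)[OF graph_independent, of z] graph_independent[of z] by (simp add: c_def)
  have "graph_chart = (\<lambda>z. \<chi> i j. 2 * (graph_a z$i * graph_a z$j / (graph_a z \<bullet> graph_a z) + b' z$i * b' z$j / (b' z \<bullet> b' z)
     + c z$i * c z$j / (c z \<bullet> c z)) - (if i = j then 1 else 0))"
    by (simp add: graph_chart_def span_refl_def Let_def b'_def c_def fun_eq_iff)
  moreover have "real_analytic_at (\<lambda>z. \<chi> i j. 2 * (graph_a z$i * graph_a z$j / (graph_a z \<bullet> graph_a z) + b' z$i * b' z$j / (b' z \<bullet> b' z)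
     + c z$i * c z$j / (c z \<bullet> c z)) - (if i = j then 1 else 0)) z"
    by (rule real_analytic_at_mat, simp only: vec_lambda_beta)
      (intro real_analytic_at_diff real_analytic_at_mult_real real_analytic_at_add real_analytic_at_divide
        real_analytic_at_inner real_analytic_at_nth real_analytic_at_const a b' c aa bb cc)
  ultimately show ?thesis by simp
qed

text \<open>The graph chart lives around \<open>refl0\<close>; conjugation by \<open>g\<close> is
  linear on matrices and carries it to any other reflection.\<close>

lemma reflections_chart:
  assumes p: "p \<in> reflections"
  shows "\<exists>U (V :: (real^8) set) f. openin (top_of_set reflections) U \<and> p \<in> U \<and> open V \<and> analytic_diffeomorphism f U V"
proof -
  obtain g where g: "g \<in> G2" and pg: "p = g ** refl0 ** transpose g" using p reflections_iff by blast
  define k where "k T = transpose g ** T ** g" for T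
  define k' where "k' T = g ** T ** transpose g" for T
  have kk: "k (k' T) = T" "k' (k T) = T" for T
  proof -
    have "k (k' T) = transpose g ** (g ** (T ** (transpose g ** g)))" by (simp add: k_def k'_def matrix_mul_assoc)
    then show "k (k' T) = T" by (simp add: G2_cancel[OF g] G2_transpose_left[OF g])
    have "k' (k T) = g ** (transpose g ** (T ** (g ** transpose g)))" by (simp add: k_def k'_def matrix_mul_assoc)
    then show "k' (k T) = T" by (simp add: G2_cancel[OF g] G2_transpose_right[OF g])
  qed
  have lin: "linear k" "linear k'" unfolding k_def k'_def by (rule linear_matrix_conj)+
  have kr: "k T \<in> reflections" "k' T \<in> reflections" if "T \<in> reflections" for T
    using reflection_conj[OF that G2_transpose[OF g]] reflection_conj[OF that g]
    by (simp_all add: k_def k'_def transpose_transpose)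
  define U where "U = reflections \<inter> {T. det (corner (k T)) \<noteq> 0}"
  define V where "V = {z. (graph_a z \<star> graph_b z)$3 \<noteq> 0}"
  have cont: "continuous_on UNIV (\<lambda>T. det (corner (k T)))"
    by (intro continuous_at_imp_continuous_on ballI real_analytic_at_imp_continuous real_analytic_at_compose[of k _ "\<lambda>T. det (corner T)"]
       det_corner_analytic real_analytic_at_linear lin)
  have "open {T. det (corner (k T)) \<noteq> 0}" by (rule open_Collect_neq[OF cont continuous_on_const])
  then have oU: "openin (top_of_set reflections) U" unfolding U_def by (simp add: openin_open_Int)
  have "continuous_on UNIV (\<lambda>z. (graph_a z \<star> graph_b z)$3)"
  proof -
    have "\<forall>k. continuous_on UNIV (\<lambda>z. graph_a z $ k) \<and> continuous_on UNIV (\<lambda>z. graph_b z $ k)"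
      unfolding forall_7 by (simp add: graph_nth continuous_on_component)
    then show ?thesis by (simp add: imag_product_nth continuous_on_diff continuous_on_add continuous_on_mult)
  qed
  then have oV: "open V" unfolding V_def by (rule open_Collect_neq[OF _ continuous_on_const])
  have "k p = refl0" using kk(1)[of refl0] by (simp add: pg k'_def)
  moreover have "corner refl0 = mat 1"
    by (rule matrix_eqI) (simp add: corner_apply vec_eq_iff forall_3 restr3_nth proj_fixed_def refl0_nth emb3_nth)
  ultimately have pU: "p \<in> U" using p by (simp add: U_def)
  have "analytic_diffeomorphism (\<lambda>T. graph_coord (k T)) U V"
  proof (rule analytic_diffeomorphismI[where h="\<lambda>z. k' (graph_chart z)"])
    show "real_analytic_on (\<lambda>T. graph_coord (k T)) U"
      by (intro real_analytic_at_imp_on real_analytic_at_compose[of k _ graph_coord] real_analytic_at_linear lin graph_coord_analytic)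
        (simp add: U_def)
    show "real_analytic_on (\<lambda>z. k' (graph_chart z)) V"
      by (rule real_analytic_at_imp_on) (rule real_analytic_at_linear_compose[OF lin(2) graph_chart_analytic])
    show "graph_coord (k T) \<in> V \<and> k' (graph_chart (graph_coord (k T))) = T" if "T \<in> U" for T
      using that graph_chart_coord[of "k T"] kr by (simp add: U_def V_def kk)
    show "k' (graph_chart z) \<in> U \<and> graph_coord (k (k' (graph_chart z))) = z" if "z \<in> V" for z
      using that graph_coord_chart[of z] kr by (simp add: U_def V_def kk)
  qed
  then show ?thesis using oU pU oV by blast
qed

lemma reflections_analytic_manifold: "analytic_manifold TYPE(real^8) reflections"
  unfolding analytic_manifold_def using reflections_chart by blast

section \<open>One-parameter groups\<close>

definition matpow :: "real^'n^'n \<Rightarrow> nat \<Rightarrow> real^'n^'n" where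
  "matpow A n = ((**) A ^^ n) (mat 1)"

lemma matpow_0 [simp]: "matpow A 0 = mat 1" and matpow_Suc: "matpow A (Suc n) = A ** matpow A n"
  by (simp_all add: matpow_def)

lemma bounded_bilinear_mm: "bounded_bilinear ((**) :: real^'n^'m \<Rightarrow> real^'k^'n \<Rightarrow> real^'k^'m)"
  using bilinear_matrix_mult bilinear_conv_bounded_bilinear by blast

lemma bounded_bilinear_mv: "bounded_bilinear ((*v) :: real^'n^'m \<Rightarrow> real^'n \<Rightarrow> real^'m)"
  using bilinear_matrix_vector_mult bilinear_conv_bounded_bilinear by blast

lemma matpow_scaleR: "matpow (t *\<^sub>R A) n = t ^ n *\<^sub>R matpow A n"
  by (induction n) (simp_all add: matpow_Suc bounded_bilinear.scaleR_left[OF bounded_bilinear_mm]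
      bounded_bilinear.scaleR_right[OF bounded_bilinear_mm] mult.commute)

lemma matpow_commute: "A ** matpow A n = matpow A n ** A"
  by (induction n) (simp_all add: matpow_Suc, simp add: matrix_mul_assoc)

lemma summable_mat_exp: "summable (\<lambda>n. (1 / fact n) *\<^sub>R matpow A n)" for A :: "real^'n^'n"
proof -
  \<comment> \<open>Submultiplicativity is taken up to a constant, which the scalar exponential
    series absorbs.\<close>
  obtain K where K: "0 < K" "\<And>(a::real^'n^'n) (b::real^'n^'n). norm (a ** b) \<le> norm a * norm b * K"
    using bounded_bilinear.pos_bounded[OF bounded_bilinear_mm] by blast
  have b: "norm (matpow A n) \<le> norm (mat 1 :: real^'n^'n) * (norm A * K) ^ n" for n
  proof (induction n)
    case (Suc n)
    have "norm (matpow A (Suc n)) \<le> norm A * norm (matpow A n) * K" unfolding matpow_Suc by (rule K(2))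
    also have "\<dots> \<le> norm A * (norm (mat 1 :: real^'n^'n) * (norm A * K) ^ n) * K"
      using K(1) Suc by (intro mult_right_mono mult_left_mono) auto
    finally show ?case by (simp add: mult_ac)
  qed simp
  show ?thesis
  proof (rule summable_comparison_test')
    show "summable (\<lambda>n. norm (mat 1 :: real^'n^'n) * (inverse (fact n) * (norm A * K) ^ n))"
      by (intro summable_mult summable_exp)
    show "norm ((1 / fact n) *\<^sub>R matpow A n) \<le> norm (mat 1 :: real^'n^'n) * (inverse (fact n) * (norm A * K) ^ n)" for n
      using mult_left_mono[OF b[of n], of "inverse (fact n)"] by (simp add: divide_inverse mult_ac)
  qed
qed

lemma mat_exp_eq: "mat_exp A = (\<Sum>n. (1 / fact n) *\<^sub>R matpow A n)"
  by (simp add: mat_exp_def matpow_def)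

lemma mat_exp_entry_sums:
  "(\<lambda>n. (matpow A n $ i $ j / fact n) * t ^ n) sums (mat_exp (t *\<^sub>R A) $ i $ j)"
proof -
  have "(\<lambda>n. ((1 / fact n) *\<^sub>R matpow (t *\<^sub>R A) n) $ i $ j) sums (mat_exp (t *\<^sub>R A) $ i $ j)"
    unfolding mat_exp_eq
    by (rule bounded_linear.sums[OF _ summable_sums[OF summable_mat_exp]])
      (simp add: linear_vec_nth2 flip: linear_conv_bounded_linear)
  then show ?thesis by (simp add: matpow_scaleR mult_ac)
qed

lemma mat_exp_commute: "A ** mat_exp (t *\<^sub>R A) = mat_exp (t *\<^sub>R A) ** (A :: real^'n^'n)"
proof -
  have "A ** matpow (t *\<^sub>R A) n = matpow (t *\<^sub>R A) n ** A" for n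
    by (simp add: matpow_scaleR bounded_bilinear.scaleR_left[OF bounded_bilinear_mm]
      bounded_bilinear.scaleR_right[OF bounded_bilinear_mm] matpow_commute)
  then have eq: "A ** ((1 / fact n) *\<^sub>R matpow (t *\<^sub>R A) n) = ((1 / fact n) *\<^sub>R matpow (t *\<^sub>R A) n) ** A" for n
    by (simp add: bounded_bilinear.scaleR_left[OF bounded_bilinear_mm] bounded_bilinear.scaleR_right[OF bounded_bilinear_mm])
  show ?thesis
    unfolding mat_exp_eq
    by (simp only: bounded_linear.suminf[OF bounded_bilinear.bounded_linear_right[OF bounded_bilinear_mm] summable_mat_exp]
        bounded_linear.suminf[OF bounded_bilinear.bounded_linear_left[OF bounded_bilinear_mm] summable_mat_exp] eq)
qed

lemma mat_exp_zero: "mat_exp (0 *\<^sub>R A) = mat 1" for A :: "real^'n^'n"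
proof -
  have "mat_exp (0 *\<^sub>R A) $ i $ j = (mat 1 :: real^'n^'n) $ i $ j" for i j
  proof -
    have "(\<lambda>n. (matpow A n $ i $ j / fact n) * 0 ^ n) sums (matpow A 0 $ i $ j / fact 0)"
      using powser_sums_zero[of "\<lambda>n. matpow A n $ i $ j / fact n"] by simp
    from sums_unique2[OF mat_exp_entry_sums this] show ?thesis by simp
  qed
  then show ?thesis by (simp add: vec_eq_iff)
qed

lemma mat_has_vector_derivative:
  fixes f :: "real \<Rightarrow> real^'n^'m"
  assumes "\<And>i j. ((\<lambda>t. f t $ i $ j) has_real_derivative f' $ i $ j) (at t)"
  shows "(f has_vector_derivative f') (at t)"
  unfolding has_vector_derivative_def
proof (subst has_derivative_componentwise_within, intro ballI)
  fix b :: "real^'n^'m" assume "b \<in> Basis"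
  then obtain i j where b: "b = axis i (axis j 1)" by (auto simp: Basis_vec_def)
  show "((\<lambda>x. f x \<bullet> b) has_derivative (\<lambda>x. (x *\<^sub>R f') \<bullet> b)) (at t)"
  proof -
    have "(\<lambda>x. x * f' $ i $ j) = (*) (f' $ i $ j)" by (simp add: fun_eq_iff mult.commute)
    then show ?thesis using assms[of i j] by (simp add: b inner_axis has_field_derivative_def)
  qed
qed

lemma mat_exp_has_vector_derivative:
  fixes A :: "real^'n^'n"
  shows "((\<lambda>t. mat_exp (t *\<^sub>R A)) has_vector_derivative A ** mat_exp (t *\<^sub>R A)) (at t)"
proof (rule mat_has_vector_derivative)
  fix i j
  define c where "c n = matpow A n $ i $ j / fact n" for n
  have s: "(\<lambda>n. c n * x ^ n) sums (mat_exp (x *\<^sub>R A) $ i $ j)" for x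
    unfolding c_def by (rule mat_exp_entry_sums)
  have "DERIV (\<lambda>x. \<Sum>n. c n * x ^ n) t :> (\<Sum>n. diffs c n * t ^ n)"
    using s by (intro termdiffs_strong_converges_everywhere) (auto simp: sums_iff)
  moreover have "(\<lambda>n. diffs c n * t ^ n) sums ((A ** mat_exp (t *\<^sub>R A)) $ i $ j)"
  proof -
    have "diffs c n = (\<Sum>k\<in>UNIV. A$i$k * (matpow A n $ k $ j / fact n))" for n
    proof -
      have "diffs c n = matpow A (Suc n) $ i $ j / fact n"
        by (simp add: diffs_def c_def divide_simps)
      then show ?thesis by (simp add: matpow_Suc matrix_matrix_mult_def sum_divide_distrib)
    qed
    then have "diffs c n * t ^ n = (\<Sum>k\<in>UNIV. A$i$k * ((matpow A n $ k $ j / fact n) * t ^ n))" for n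
      by (simp add: sum_distrib_right mult.assoc)
    moreover have "(\<lambda>n. \<Sum>k\<in>UNIV. A$i$k * ((matpow A n $ k $ j / fact n) * t ^ n)) sums (\<Sum>k\<in>UNIV. A$i$k * mat_exp (t *\<^sub>R A) $ k $ j)"
      by (intro sums_sum sums_mult mat_exp_entry_sums)
    ultimately show ?thesis by (simp add: matrix_matrix_mult_def)
  qed
  ultimately show "((\<lambda>t. mat_exp (t *\<^sub>R A) $ i $ j) has_real_derivative (A ** mat_exp (t *\<^sub>R A)) $ i $ j) (at t)"
    using s by (simp add: sums_iff)
qed

lemma zero_vector_derivative_const:
  fixes f :: "real \<Rightarrow> 'a::real_normed_vector"
  assumes "\<And>t. (f has_vector_derivative 0) (at t)" shows "f t = f 0"
proof -
  obtain c where "\<And>x. x \<in> UNIV \<Longrightarrow> f x = c"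
    by (rule has_vector_derivative_zero_constant[of UNIV f]) (use assms in auto)
  then show ?thesis by simp
qed

lemmas mm_has_vector_derivative = bounded_bilinear.has_vector_derivative[OF bounded_bilinear_mm]
lemmas mv_has_vector_derivative = bounded_bilinear.has_vector_derivative[OF bounded_bilinear_mv]

lemma mm_minus: "(- A) ** B = - (A ** B)" "A ** (- B) = - (A ** B)" for A :: "real^'n^'m" and B :: "real^'k^'n"
  by (rule bounded_bilinear.minus_left[OF bounded_bilinear_mm], rule bounded_bilinear.minus_right[OF bounded_bilinear_mm])

lemma mat_exp_inverse: "mat_exp (t *\<^sub>R - A) ** mat_exp (t *\<^sub>R A) = mat 1" for A :: "real^'n^'n"
proof -
  have "(\<lambda>t. mat_exp (t *\<^sub>R - A) ** mat_exp (t *\<^sub>R A)) t = mat_exp (0 *\<^sub>R - A) ** mat_exp (0 *\<^sub>R A)"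
  proof (rule zero_vector_derivative_const)
    fix t
    have "- A ** mat_exp (t *\<^sub>R - A) = mat_exp (t *\<^sub>R - A) ** - A" by (rule mat_exp_commute)
    then have "mat_exp (t *\<^sub>R - A) ** (A ** mat_exp (t *\<^sub>R A)) + (- A ** mat_exp (t *\<^sub>R - A)) ** mat_exp (t *\<^sub>R A) = 0"
      by (simp add: mm_minus matrix_mul_assoc)
    then show "((\<lambda>t. mat_exp (t *\<^sub>R - A) ** mat_exp (t *\<^sub>R A)) has_vector_derivative 0) (at t)"
      using mm_has_vector_derivative[OF mat_exp_has_vector_derivative[of "- A" t] mat_exp_has_vector_derivative[of A t]] by simp
  qed
  then show ?thesis by (simp add: mat_exp_zero[simplified])
qed

lemma mat_exp_inverse': "mat_exp (t *\<^sub>R A) ** mat_exp (t *\<^sub>R - A) = mat 1" for A :: "real^'n^'n"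
  using mat_exp_inverse[of t A] matrix_left_right_inverse by blast

text \<open>Multiplying a solution by \<open>mat_exp (t *\<^sub>R - A)\<close> gives a constant.
  Conjugation, addition of parameters and the explicit torus formula are later obtained by checking
  this one differential equation.\<close>

lemma mat_exp_unique:
  fixes A :: "real^'n^'n"
  assumes Y: "\<And>t. (Y has_vector_derivative A ** Y t) (at t)" and Y0: "Y 0 = mat 1"
  shows "Y t = mat_exp (t *\<^sub>R A)"
proof -
  have "(\<lambda>t. mat_exp (t *\<^sub>R - A) ** Y t) t = mat_exp (0 *\<^sub>R - A) ** Y 0"
  proof (rule zero_vector_derivative_const)
    fix t
    have "- A ** mat_exp (t *\<^sub>R - A) = mat_exp (t *\<^sub>R - A) ** - A" by (rule mat_exp_commute)
    then have "mat_exp (t *\<^sub>R - A) ** (A ** Y t) + (- A ** mat_exp (t *\<^sub>R - A)) ** Y t = 0"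
      by (simp add: mm_minus matrix_mul_assoc)
    then show "((\<lambda>t. mat_exp (t *\<^sub>R - A) ** Y t) has_vector_derivative 0) (at t)"
      using mm_has_vector_derivative[OF mat_exp_has_vector_derivative[of "- A" t] Y[of t]] by simp
  qed
  then have "mat_exp (t *\<^sub>R - A) ** Y t = mat 1" using mat_exp_zero[of "- A"] Y0 by simp
  then have "mat_exp (t *\<^sub>R A) ** (mat_exp (t *\<^sub>R - A) ** Y t) = mat_exp (t *\<^sub>R A)" by simp
  then show ?thesis by (simp only: matrix_mul_assoc mat_exp_inverse' matrix_mul_lid)
qed

lemma mat_exp_conj:
  fixes A :: "real^7^7"
  assumes g: "g \<in> G2"
  shows "mat_exp (t *\<^sub>R (g ** A ** transpose g)) = g ** mat_exp (t *\<^sub>R A) ** transpose g"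
proof (rule mat_exp_unique[symmetric])
  fix t
  have lin: "bounded_linear (\<lambda>T. g ** T ** transpose g)"
    using linear_matrix_conj linear_conv_bounded_linear by blast
  have "g ** (A ** mat_exp (t *\<^sub>R A)) ** transpose g = (g ** A ** transpose g) ** (g ** mat_exp (t *\<^sub>R A) ** transpose g)"
    by (simp only: matrix_mul_assoc[symmetric] G2_cancel(3)[OF g])
  then show "((\<lambda>t. g ** mat_exp (t *\<^sub>R A) ** transpose g) has_vector_derivative (g ** A ** transpose g) ** (g ** mat_exp (t *\<^sub>R A) ** transpose g)) (at t)"
    using bounded_linear.has_vector_derivative[OF lin mat_exp_has_vector_derivative[of A t]] by simp
  show "g ** mat_exp (0 *\<^sub>R A) ** transpose g = mat 1"
    unfolding mat_exp_zero by (simp add: G2_transpose_right[OF g])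
qed

lemma mat_exp_add: "mat_exp ((s + t) *\<^sub>R A) = mat_exp (t *\<^sub>R A) ** mat_exp (s *\<^sub>R A)" for A :: "real^'n^'n"
proof -
  have "(\<lambda>t. mat_exp ((s + t) *\<^sub>R A) ** mat_exp (s *\<^sub>R - A)) t = mat_exp (t *\<^sub>R A)"
  proof (rule mat_exp_unique)
    fix t
    have "((\<lambda>t. s + t) has_vector_derivative 1) (at t)" by (auto intro!: derivative_eq_intros)
    from vector_diff_chain_at[OF this mat_exp_has_vector_derivative]
    have "((\<lambda>t. mat_exp ((s + t) *\<^sub>R A)) has_vector_derivative A ** mat_exp ((s + t) *\<^sub>R A)) (at t)"
      by (simp add: o_def)
    from mm_has_vector_derivative[OF this has_vector_derivative_const[of "mat_exp (s *\<^sub>R - A)"]]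
    show "((\<lambda>t. mat_exp ((s + t) *\<^sub>R A) ** mat_exp (s *\<^sub>R - A)) has_vector_derivative A ** (mat_exp ((s + t) *\<^sub>R A) ** mat_exp (s *\<^sub>R - A))) (at t)"
      by (simp add: matrix_mul_assoc bounded_bilinear.zero_right[OF bounded_bilinear_mm])
  qed (use mat_exp_inverse'[of s A] in simp)
  then have "mat_exp ((s + t) *\<^sub>R A) ** (mat_exp (s *\<^sub>R - A) ** mat_exp (s *\<^sub>R A)) = mat_exp (t *\<^sub>R A) ** mat_exp (s *\<^sub>R A)"
    by (simp add: matrix_mul_assoc)
  then show ?thesis by (simp add: mat_exp_inverse[simplified])
qed

text \<open>Skewness makes the inner product of two moving vectors constant; the derivation law
  makes their product, pulled back by the inverse flow, constant.\<close>

lemma mat_exp_G2: assumes Z: "Z \<in> g2" shows "mat_exp (t *\<^sub>R Z) \<in> G2"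
  unfolding G2_iff
proof (intro conjI allI)
  fix x y :: "real^7"
  have d: "((\<lambda>t. mat_exp (t *\<^sub>R Z) *v x) has_vector_derivative Z *v (mat_exp (t *\<^sub>R Z) *v x)) (at t)" for x t
    using mv_has_vector_derivative[OF mat_exp_has_vector_derivative[of Z t] has_vector_derivative_const[of x]]
    by (simp add: matrix_vector_mul_assoc bounded_bilinear.zero_right[OF bounded_bilinear_mv])
  have d': "((\<lambda>t. mat_exp (t *\<^sub>R - Z)) has_vector_derivative - (mat_exp (t *\<^sub>R - Z) ** Z)) (at t)" for t
    using mat_exp_has_vector_derivative[of "- Z" t] mat_exp_commute[of "- Z" t] by (simp add: mm_minus)
  have "(\<lambda>t. (mat_exp (t *\<^sub>R Z) *v x) \<bullet> (mat_exp (t *\<^sub>R Z) *v y)) t = (mat_exp (0 *\<^sub>R Z) *v x) \<bullet> (mat_exp (0 *\<^sub>R Z) *v y)"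
    by (rule zero_vector_derivative_const)
      (use bounded_bilinear.has_vector_derivative[OF bounded_bilinear_inner d d] in \<open>simp add: g2_skew[OF Z]\<close>)
  then show "(mat_exp (t *\<^sub>R Z) *v x) \<bullet> (mat_exp (t *\<^sub>R Z) *v y) = x \<bullet> y" unfolding mat_exp_zero by simp
  have bb: "bounded_bilinear (\<star>)" using bilinear_imag_product bilinear_conv_bounded_bilinear by blast
  have "(\<lambda>t. mat_exp (t *\<^sub>R - Z) *v ((mat_exp (t *\<^sub>R Z) *v x) \<star> (mat_exp (t *\<^sub>R Z) *v y))) t
     = mat_exp (0 *\<^sub>R - Z) *v ((mat_exp (0 *\<^sub>R Z) *v x) \<star> (mat_exp (0 *\<^sub>R Z) *v y))"
  proof (rule zero_vector_derivative_const)
    fix t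
    show "((\<lambda>t. mat_exp (t *\<^sub>R - Z) *v ((mat_exp (t *\<^sub>R Z) *v x) \<star> (mat_exp (t *\<^sub>R Z) *v y))) has_vector_derivative 0) (at t)"
      using mv_has_vector_derivative[OF d'[of t] bounded_bilinear.has_vector_derivative[OF bb d[of x t] d[of y t]]]
      by (simp add: g2_der[OF Z] bounded_bilinear.minus_left[OF bounded_bilinear_mv] matrix_vector_right_distrib flip: matrix_vector_mul_assoc)
  qed
  then have "mat_exp (t *\<^sub>R - Z) *v ((mat_exp (t *\<^sub>R Z) *v x) \<star> (mat_exp (t *\<^sub>R Z) *v y)) = x \<star> y"
    unfolding mat_exp_zero by simp
  then have "mat_exp (t *\<^sub>R Z) *v (mat_exp (t *\<^sub>R - Z) *v ((mat_exp (t *\<^sub>R Z) *v x) \<star> (mat_exp (t *\<^sub>R Z) *v y))) = mat_exp (t *\<^sub>R Z) *v (x \<star> y)"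
    by simp
  then show "mat_exp (t *\<^sub>R Z) *v (x \<star> y) = (mat_exp (t *\<^sub>R Z) *v x) \<star> (mat_exp (t *\<^sub>R Z) *v y)"
    by (simp add: matrix_vector_mul_assoc mat_exp_inverse'[simplified])
qed

text \<open>When \<open>ad X\<close> squares to -1 on \<open>Y\<close>, the adjoint flow is a
  rotation of the plane of \<open>Y\<close> and \<open>[X, Y]\<close>; the rotated vector,
  conjugated back, has derivative zero.\<close>

lemma mat_exp_adjoint:
  fixes X Y :: "real^'n^'n"
  assumes "lie_bracket X (lie_bracket X Y) = - Y"
  shows "mat_exp (t *\<^sub>R X) ** Y ** mat_exp (t *\<^sub>R - X) = cos t *\<^sub>R Y + sin t *\<^sub>R lie_bracket X Y"
proof -
  define Q where "Q = lie_bracket X Y"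
  have XQ: "X ** Q = Q ** X - Y" using assms by (simp add: Q_def[symmetric]) (simp add: lie_bracket_def algebra_simps)
  have XY: "X ** Y = Q + Y ** X" by (simp add: Q_def lie_bracket_def)
  define R where "R t = cos t *\<^sub>R Y + sin t *\<^sub>R Q" for t
  have R': "(R has_vector_derivative (- sin t) *\<^sub>R Y + cos t *\<^sub>R Q) (at t)" for t
    unfolding R_def[abs_def] by (auto intro!: derivative_eq_intros)
  have d': "((\<lambda>t. mat_exp (t *\<^sub>R - X)) has_vector_derivative - (mat_exp (t *\<^sub>R - X) ** X)) (at t)" for t
    using mat_exp_has_vector_derivative[of "- X" t] mat_exp_commute[of "- X" t] by (simp add: mm_minus)
  have "(\<lambda>t. mat_exp (t *\<^sub>R - X) ** (R t ** mat_exp (t *\<^sub>R X))) t = mat_exp (0 *\<^sub>R - X) ** (R 0 ** mat_exp (0 *\<^sub>R X))"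
  proof (rule zero_vector_derivative_const)
    fix t
    let ?E = "mat_exp (t *\<^sub>R X)" and ?F = "mat_exp (t *\<^sub>R - X)"
    have XR: "X ** R t = R t ** X + ((- sin t) *\<^sub>R Y + cos t *\<^sub>R Q)"
      by (simp add: R_def matrix_add_ldistrib bounded_bilinear.scaleR_right[OF bounded_bilinear_mm]
        bounded_bilinear.scaleR_left[OF bounded_bilinear_mm] bounded_bilinear.add_left[OF bounded_bilinear_mm] XQ XY algebra_simps)
    have "?F ** (R t ** (X ** ?E) + ((- sin t) *\<^sub>R Y + cos t *\<^sub>R Q) ** ?E) + - (?F ** X) ** (R t ** ?E)
      = ?F ** ((R t ** X + ((- sin t) *\<^sub>R Y + cos t *\<^sub>R Q)) ** ?E) - ?F ** ((X ** R t) ** ?E)"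
      by (simp only: mm_minus bounded_bilinear.add_left[OF bounded_bilinear_mm] matrix_mul_assoc) simp
    also have "\<dots> = 0" unfolding XR by simp
    finally show "((\<lambda>t. mat_exp (t *\<^sub>R - X) ** (R t ** mat_exp (t *\<^sub>R X))) has_vector_derivative 0) (at t)"
      using mm_has_vector_derivative[OF d'[of t] mm_has_vector_derivative[OF R'[of t] mat_exp_has_vector_derivative[of X t]]] by simp
  qed
  then have "mat_exp (t *\<^sub>R - X) ** (R t ** mat_exp (t *\<^sub>R X)) = Y" unfolding mat_exp_zero by (simp add: R_def)
  then have "mat_exp (t *\<^sub>R X) ** (mat_exp (t *\<^sub>R - X) ** (R t ** mat_exp (t *\<^sub>R X))) ** mat_exp (t *\<^sub>R - X)
     = mat_exp (t *\<^sub>R X) ** Y ** mat_exp (t *\<^sub>R - X)" by simp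
  moreover have "mat_exp (t *\<^sub>R X) ** (mat_exp (t *\<^sub>R - X) ** (R t ** mat_exp (t *\<^sub>R X))) ** mat_exp (t *\<^sub>R - X)
     = (mat_exp (t *\<^sub>R X) ** mat_exp (t *\<^sub>R - X)) ** R t ** (mat_exp (t *\<^sub>R X) ** mat_exp (t *\<^sub>R - X))"
    by (simp only: matrix_mul_assoc)
  ultimately show ?thesis by (simp add: mat_exp_inverse'[simplified] R_def Q_def)
qed

text \<open>The defining series is an expansion at 0; the addition law moves it to every other
  point.\<close>

lemma mat_exp_analytic: "real_analytic_at (\<lambda>t. mat_exp (t *\<^sub>R A)) a" for A :: "real^'n^'n"
proof -
  have 0: "real_analytic_at (\<lambda>t. mat_exp (t *\<^sub>R A)) 0"
  proof (rule real_analytic_at_mat)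
    show "real_analytic_at (\<lambda>t. mat_exp (t *\<^sub>R A) $ k $ l) 0" for k l
      by (rule real_analytic_at_powser[where r=1 and c="\<lambda>n. matpow A n $ k $ l / fact n"])
        (use mat_exp_entry_sums[of A k l] in simp_all)
  qed
  have s: "real_analytic_at (\<lambda>t. t - a) a" by (intro real_analytic_at_diff) auto
  have "real_analytic_at (\<lambda>t. mat_exp ((t - a) *\<^sub>R A)) a"
    by (rule real_analytic_at_compose[OF s]) (use 0 in simp)
  then have "real_analytic_at (\<lambda>t. mat_exp ((t - a) *\<^sub>R A) ** mat_exp (a *\<^sub>R A)) a"
    by (intro real_analytic_at_mm real_analytic_at_const)
  then show ?thesis by (simp flip: mat_exp_add)
qed

section \<open>The maximal torus\<close>

text \<open>The double commutator contributes four times \<open>(a \<star> b) \<star> x\<close>, of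
  which the tripled associator removes three; its remaining terms make up the rest.\<close>

lemma D_apply:
  "D i j *v x = (axis i 1 \<star> axis j 1) \<star> x + (3 * (axis i 1 \<bullet> (axis j 1 :: real^7))) *\<^sub>R x
     - (3 * (axis j 1 \<bullet> x)) *\<^sub>R axis i 1 + 3 *\<^sub>R (axis i 1 \<star> (axis j 1 \<star> x))"
proof -
  have eq: "snd (oct_D (e i) (e j) (0, v)) = (axis i 1 \<star> axis j 1) \<star> v + (3 * (axis i 1 \<bullet> (axis j 1 :: real^7))) *\<^sub>R v
     - (3 * (axis j 1 \<bullet> v)) *\<^sub>R axis i 1 + 3 *\<^sub>R (axis i 1 \<star> (axis j 1 \<star> v))" for v
  proof -
    have c: "oct_commutator (0, a) (0, b) = (0, 2 *\<^sub>R (a \<star> b))" for a b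
      by (simp add: oct_commutator_def oct_mult_Pair inner_commute imag_product_anticommute[of b a] scaleR_2)
    show ?thesis
      by (simp add: oct_D_def c oct_associator_def e_def oct_mult_Pair imag_product_simps)
        (simp add: vec_eq_iff algebra_simps)
  qed
  have "linear (\<lambda>v. snd (oct_D (e i) (e j) (0, v)))"
    unfolding eq by (rule linearI) (simp_all add: imag_product_simps inner_add_right algebra_simps)
  then show ?thesis by (simp add: D_def eq)
qed

text \<open>Opaque names, so that simplification treats the two roots as atoms governed by their
  squares.\<close>

definition sqrt6 :: real where "sqrt6 = sqrt 6"
definition sqrt10 :: real where "sqrt10 = sqrt 10"

lemma sqrt6_10: "sqrt6 * sqrt6 = 6" "sqrt10 * sqrt10 = 10" "0 < sqrt6" "0 < sqrt10"
  by (simp_all add: sqrt6_def sqrt10_def)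

lemma sqrt6_10': "sqrt6 * (sqrt6 * y) = 6 * y" "sqrt10 * (sqrt10 * y) = 10 * y"
  using sqrt6_10 by (simp_all flip: mult.assoc)

lemma D_sum_apply: "(A + B) *v x = A *v x + B *v x" "(c *\<^sub>R A) *v x = c *\<^sub>R (A *v x)" for A B :: "real^7^7"
  by (rule bounded_bilinear.add_left[OF bounded_bilinear_mv], rule bounded_bilinear.scaleR_left[OF bounded_bilinear_mv])

lemma K_p_nth:
  "(K_p *v x)$1 = 0" "(K_p *v x)$2 = - 2 * x$3" "(K_p *v x)$3 = 2 * x$2" "(K_p *v x)$4 = - x$5"
  "(K_p *v x)$5 = x$4" "(K_p *v x)$6 = - 3 * x$7" "(K_p *v x)$7 = 3 * x$6"
  unfolding K_p_def D_sum_apply D_apply inner_axis_axis inner_axis' axis_product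
  by (simp_all add: imag_product_nth axis_def)

text \<open>The eigenspaces of \<open>K_p\<close> give \<open>V\<close> the complex coordinates \<open>x\<^sub>1\<close>, \<open>x\<^sub>4 + i x\<^sub>5\<close>, \<open>x\<^sub>2 + i x\<^sub>3\<close>,
  \<open>x\<^sub>6 + i x\<^sub>7\<close> of weights \<open>0, 1, 2, 3\<close>.  The weight one part of \<open>g2\<close> is parametrized by
  \<open>p = p1 + i p2\<close> (short simple root) and \<open>q = q1 + i q2\<close> (long simple root).\<close>

definition wt1 :: "real \<Rightarrow> real \<Rightarrow> real \<Rightarrow> real \<Rightarrow> real^7^7" where
  "wt1 p1 p2 q1 q2 = matrix (\<lambda>x. \<chi> i.
     if i = 1 then - 2 * (p1 * x$4 + p2 * x$5)
     else if i = 2 then - q1 * x$4 + q2 * x$5 + p2 * x$6 - p1 * x$7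
     else if i = 3 then - q2 * x$4 - q1 * x$5 + p1 * x$6 + p2 * x$7
     else if i = 4 then 2 * p1 * x$1 + q1 * x$2 + q2 * x$3
     else if i = 5 then 2 * p2 * x$1 + q1 * x$3 - q2 * x$2
     else if i = 6 then - p2 * x$2 - p1 * x$3
     else p1 * x$2 - p2 * x$3)"

lemma wt1_nth:
  "(wt1 p1 p2 q1 q2 *v x)$1 = - 2 * (p1 * x$4 + p2 * x$5)"
  "(wt1 p1 p2 q1 q2 *v x)$2 = - q1 * x$4 + q2 * x$5 + p2 * x$6 - p1 * x$7"
  "(wt1 p1 p2 q1 q2 *v x)$3 = - q2 * x$4 - q1 * x$5 + p1 * x$6 + p2 * x$7"
  "(wt1 p1 p2 q1 q2 *v x)$4 = 2 * p1 * x$1 + q1 * x$2 + q2 * x$3"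
  "(wt1 p1 p2 q1 q2 *v x)$5 = 2 * p2 * x$1 + q1 * x$3 - q2 * x$2"
  "(wt1 p1 p2 q1 q2 *v x)$6 = - p2 * x$2 - p1 * x$3"
  "(wt1 p1 p2 q1 q2 *v x)$7 = p1 * x$2 - p2 * x$3"
proof -
  have "linear (\<lambda>x::real^7. \<chi> i::7.
     if i = 1 then - 2 * (p1 * x$4 + p2 * x$5)
     else if i = 2 then - q1 * x$4 + q2 * x$5 + p2 * x$6 - p1 * x$7
     else if i = 3 then - q2 * x$4 - q1 * x$5 + p1 * x$6 + p2 * x$7
     else if i = 4 then 2 * p1 * x$1 + q1 * x$2 + q2 * x$3
     else if i = 5 then 2 * p2 * x$1 + q1 * x$3 - q2 * x$2
     else if i = 6 then - p2 * x$2 - p1 * x$3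
     else p1 * x$2 - p2 * x$3)"
    by (rule linearI) (simp_all add: vec_eq_7 algebra_simps)
  then show
  "(wt1 p1 p2 q1 q2 *v x)$1 = - 2 * (p1 * x$4 + p2 * x$5)"
  "(wt1 p1 p2 q1 q2 *v x)$2 = - q1 * x$4 + q2 * x$5 + p2 * x$6 - p1 * x$7"
  "(wt1 p1 p2 q1 q2 *v x)$3 = - q2 * x$4 - q1 * x$5 + p1 * x$6 + p2 * x$7"
  "(wt1 p1 p2 q1 q2 *v x)$4 = 2 * p1 * x$1 + q1 * x$2 + q2 * x$3"
  "(wt1 p1 p2 q1 q2 *v x)$5 = 2 * p2 * x$1 + q1 * x$3 - q2 * x$2"
  "(wt1 p1 p2 q1 q2 *v x)$6 = - p2 * x$2 - p1 * x$3"
  "(wt1 p1 p2 q1 q2 *v x)$7 = p1 * x$2 - p2 * x$3"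
    by (simp_all add: wt1_def)
qed

lemma P_p_eq: "P_p = wt1 (sqrt6/2) 0 (sqrt10/2) 0"
proof (rule matrix_eqI)
  fix x
  show "P_p *v x = wt1 (sqrt6/2) 0 (sqrt10/2) 0 *v x"
    unfolding P_p_def D_sum_apply D_apply inner_axis_axis inner_axis' axis_product sqrt6_def[symmetric] sqrt10_def[symmetric]
    by (simp add: vec_eq_7 wt1_nth imag_product_nth axis_def algebra_simps)
qed

lemma lie_bracket_apply: "lie_bracket X Y *v x = X *v (Y *v x) - Y *v (X *v x)" for X Y :: "real^'n^'n"
  by (simp add: lie_bracket_def matrix_vector_mult_diff_rdistrib matrix_vector_mul_assoc)

lemma K_p_wt1: "lie_bracket K_p (wt1 p1 p2 q1 q2) = wt1 (- p2) p1 (- q2) q1"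
  by (rule matrix_eqI) (simp add: vec_eq_7 lie_bracket_apply K_p_nth wt1_nth algebra_simps)

lemma wt1_minus: "- wt1 p1 p2 q1 q2 = wt1 (- p1) (- p2) (- q1) (- q2)"
  by (rule matrix_eqI) (simp add: vec_eq_7 wt1_nth bounded_bilinear.minus_left[OF bounded_bilinear_mv] algebra_simps)

lemma wt1_eq_iff: "wt1 p1 p2 q1 q2 = wt1 p1' p2' q1' q2' \<longleftrightarrow> p1 = p1' \<and> p2 = p2' \<and> q1 = q1' \<and> q2 = q2'"
proof
  assume eq: "wt1 p1 p2 q1 q2 = wt1 p1' p2' q1' q2'"
  then have "(wt1 p1 p2 q1 q2 *v axis 1 1)$k = (wt1 p1' p2' q1' q2' *v axis 1 1)$k"
    "(wt1 p1 p2 q1 q2 *v axis 2 1)$k = (wt1 p1' p2' q1' q2' *v axis 2 1)$k" for k by simp_all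
  from this(1)[of 4] this(1)[of 5] this(2)[of 4] this(2)[of 5]
  show "p1 = p1' \<and> p2 = p2' \<and> q1 = q1' \<and> q2 = q2'" by (simp add: wt1_nth axis_def)
qed simp

text \<open>On the weight 3 plane the relation reads \<open>2 * |p|^2 = 3\<close>, on the weight 1
  plane \<open>4 * |p|^2 - 2 * |q|^2 = 1\<close>; \<open>P_p\<close> is built with these
  moduli.\<close>

lemma wt1_bracket_K_p:
  assumes "lie_bracket (wt1 p1 p2 q1 q2) (lie_bracket K_p (wt1 p1 p2 q1 q2)) = K_p"
  shows "p1\<^sup>2 + p2\<^sup>2 = 3/2" "q1\<^sup>2 + q2\<^sup>2 = 5/2"
proof -
  have "(lie_bracket (wt1 p1 p2 q1 q2) (wt1 (- p2) p1 (- q2) q1) *v x)$k = (K_p *v x)$k" for x k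
    using assms by (simp add: K_p_wt1)
  from this[of "axis 6 1" 7] this[of "axis 4 1" 5]
  show "p1\<^sup>2 + p2\<^sup>2 = 3/2" "q1\<^sup>2 + q2\<^sup>2 = 5/2"
    by (simp_all add: lie_bracket_apply wt1_nth K_p_nth axis_def power2_eq_square)
qed

lemma P_p_bracket: "lie_bracket K_p (lie_bracket K_p P_p) = - P_p" "lie_bracket P_p (lie_bracket K_p P_p) = K_p"
proof -
  show "lie_bracket K_p (lie_bracket K_p P_p) = - P_p"
    by (simp add: P_p_eq K_p_wt1 wt1_minus)
  show "lie_bracket P_p (lie_bracket K_p P_p) = K_p"
    unfolding P_p_eq K_p_wt1
    by (rule matrix_eqI) (simp add: vec_eq_7 lie_bracket_apply K_p_nth wt1_nth sqrt6_10' algebra_simps)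
qed

text \<open>In complex coordinates: z = a + i b acts on x4 + i x5, w = c + i d on x2 + i x3, and z w
  on x6 + i x7, the last being forced by e6 = e2 e4 and e7 = e3 e4.\<close>

definition tor :: "real \<Rightarrow> real \<Rightarrow> real \<Rightarrow> real \<Rightarrow> real^7^7" where
  "tor a b c d = matrix (\<lambda>x. \<chi> i.
     if i = 1 then x$1
     else if i = 2 then c * x$2 - d * x$3
     else if i = 3 then d * x$2 + c * x$3
     else if i = 4 then a * x$4 - b * x$5
     else if i = 5 then b * x$4 + a * x$5
     else if i = 6 then (a * c - b * d) * x$6 - (a * d + b * c) * x$7
     else (a * d + b * c) * x$6 + (a * c - b * d) * x$7)"

lemma tor_nth:
  "(tor a b c d *v x)$1 = x$1"
  "(tor a b c d *v x)$2 = c * x$2 - d * x$3"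
  "(tor a b c d *v x)$3 = d * x$2 + c * x$3"
  "(tor a b c d *v x)$4 = a * x$4 - b * x$5"
  "(tor a b c d *v x)$5 = b * x$4 + a * x$5"
  "(tor a b c d *v x)$6 = (a * c - b * d) * x$6 - (a * d + b * c) * x$7"
  "(tor a b c d *v x)$7 = (a * d + b * c) * x$6 + (a * c - b * d) * x$7"
proof -
  have "linear (\<lambda>x::real^7. \<chi> i::7.
     if i = 1 then x$1
     else if i = 2 then c * x$2 - d * x$3
     else if i = 3 then d * x$2 + c * x$3
     else if i = 4 then a * x$4 - b * x$5
     else if i = 5 then b * x$4 + a * x$5
     else if i = 6 then (a * c - b * d) * x$6 - (a * d + b * c) * x$7
     else (a * d + b * c) * x$6 + (a * c - b * d) * x$7)"
    by (rule linearI) (simp_all add: vec_eq_7 algebra_simps)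
  then show
  "(tor a b c d *v x)$1 = x$1"
  "(tor a b c d *v x)$2 = c * x$2 - d * x$3"
  "(tor a b c d *v x)$3 = d * x$2 + c * x$3"
  "(tor a b c d *v x)$4 = a * x$4 - b * x$5"
  "(tor a b c d *v x)$5 = b * x$4 + a * x$5"
  "(tor a b c d *v x)$6 = (a * c - b * d) * x$6 - (a * d + b * c) * x$7"
  "(tor a b c d *v x)$7 = (a * d + b * c) * x$6 + (a * c - b * d) * x$7"
    by (simp_all add: tor_def)
qed

lemma axis_generate:
  "axis 3 (1::real) = axis 1 1 \<star> axis 2 1" "axis 5 (1::real) = axis 1 1 \<star> axis 4 1"
  "axis 6 (1::real) = axis 2 1 \<star> axis 4 1" "axis 7 (1::real) = (axis 1 1 \<star> axis 2 1) \<star> axis 4 1"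
  by (simp_all add: axis_product)

lemma G2_determined:
  assumes "g \<in> G2" "h \<in> G2" "\<And>i. i \<in> {1,2,4} \<Longrightarrow> g *v axis i 1 = h *v axis i 1"
  shows "g = h"
proof -
  have "\<forall>i. g *v (mat 1 *v axis i 1) = h *v (mat 1 *v axis i 1)"
    unfolding forall_7 using assms(3) by (simp add: axis_generate G2_mult[OF assms(1)] G2_mult[OF assms(2)])
  then show ?thesis by (intro G2_eqI[OF G2_one]) simp
qed

lemma g2_determined:
  assumes "X \<in> g2" "Y \<in> g2" "\<And>i. i \<in> {1,2,4} \<Longrightarrow> X *v axis i 1 = Y *v axis i 1"
  shows "X = Y"
proof -
  have "\<forall>i. X *v (mat 1 *v axis i 1) = Y *v (mat 1 *v axis i 1)"
    unfolding forall_7 using assms(3) by (simp add: axis_generate g2_der[OF assms(1)] g2_der[OF assms(2)])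
  then show ?thesis by (intro G2_eqI[OF G2_one]) simp
qed

lemma tor_G2:
  assumes "a\<^sup>2 + b\<^sup>2 = 1" "c\<^sup>2 + d\<^sup>2 = 1" shows "tor a b c d \<in> G2"
proof -
  define u where "u = tor a b c d *v axis 1 1"
  define v where "v = tor a b c d *v axis 2 1"
  define w where "w = tor a b c d *v axis 4 1"
  have "u \<bullet> u = 1" "v \<bullet> v = 1" "w \<bullet> w = 1" "u \<bullet> v = 0" "u \<bullet> w = 0" "v \<bullet> w = 0" "(u \<star> v) \<bullet> w = 0"
    using assms by (simp_all add: u_def v_def w_def inner_7 imag_product_nth tor_nth axis_def power2_eq_square add.commute)
  then obtain g where g: "g \<in> G2" "g *v axis 1 1 = u" "g *v axis 2 1 = v" "g *v axis 3 1 = u \<star> v" "g *v axis 4 1 = w"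
    "g *v axis 5 1 = u \<star> w" "g *v axis 6 1 = v \<star> w" "g *v axis 7 1 = (u \<star> v) \<star> w"
    by (rule basic_triple)
  have "\<forall>i. tor a b c d *v (mat 1 *v axis i 1) = g *v (mat 1 *v axis i 1)"
    unfolding forall_7 matrix_vector_mul_lid g
    by (simp add: vec_eq_7 u_def v_def w_def imag_product_nth tor_nth axis_def algebra_simps)
  then have "tor a b c d = g" by (intro G2_eqI[OF G2_one]) simp
  then show ?thesis using g by simp
qed

lemma K_p_square_nth:
  "(K_p *v (K_p *v x))$1 = 0" "(K_p *v (K_p *v x))$2 = - 4 * x$2" "(K_p *v (K_p *v x))$3 = - 4 * x$3"
  "(K_p *v (K_p *v x))$4 = - x$4" "(K_p *v (K_p *v x))$5 = - x$5" "(K_p *v (K_p *v x))$6 = - 9 * x$6" "(K_p *v (K_p *v x))$7 = - 9 * x$7"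
  by (simp_all add: K_p_nth)

lemma K_p_axis: "K_p *v axis 1 1 = 0" "K_p *v axis 2 1 = 2 *\<^sub>R axis 3 1" "K_p *v axis 3 1 = - 2 *\<^sub>R axis 2 1"
  "K_p *v axis 4 1 = axis 5 1" "K_p *v axis 5 1 = - axis 4 1"
  by (simp_all add: vec_eq_7 K_p_nth axis_def)

lemma commute_iff_Ad:
  assumes "u \<in> G2" shows "Ad u X = X \<longleftrightarrow> u ** X = X ** u"
proof -
  have "Ad u X = u ** X ** transpose u" by (simp add: Ad_def G2_matrix_inv[OF assms])
  moreover have "u ** X ** transpose u = X \<longleftrightarrow> u ** X = X ** u"
    by (metis G2_transpose_left G2_transpose_right assms matrix_mul_assoc matrix_mul_rid)
  ultimately show ?thesis by simp
qed

text \<open>An element commuting with \<open>K_p\<close> preserves its weight spaces, so it rotates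
  the planes of weights 2 and 1 and acts on e1 by a sign. The relation e1 = e2 e3 excludes -1, and
  e1, e2, e4 determine everything else.\<close>

lemma C_p_eq: "u \<in> C_p \<longleftrightarrow> (\<exists>a b c d. a\<^sup>2 + b\<^sup>2 = 1 \<and> c\<^sup>2 + d\<^sup>2 = 1 \<and> u = tor a b c d)"
proof
  assume "u \<in> C_p"
  then have u: "u \<in> G2" and "u ** K_p = K_p ** u" by (auto simp: C_p_def commute_iff_Ad)
  then have uK: "u *v (K_p *v x) = K_p *v (u *v x)" for x by (metis matrix_vector_mul_assoc)
  have n: "(u *v axis i 1) \<bullet> (u *v axis i 1) = 1" for i by (simp add: G2_inner[OF u] inner_axis_axis)
  have k1: "K_p *v (u *v axis 1 1) = 0" using uK[of "axis 1 1"] by (simp add: K_p_axis)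
  have u1: "u *v axis 1 1 = ((u *v axis 1 1)$1) *\<^sub>R axis 1 1"
    using arg_cong[OF k1, of "\<lambda>v. v$2"] arg_cong[OF k1, of "\<lambda>v. v$3"] arg_cong[OF k1, of "\<lambda>v. v$4"]
      arg_cong[OF k1, of "\<lambda>v. v$5"] arg_cong[OF k1, of "\<lambda>v. v$6"] arg_cong[OF k1, of "\<lambda>v. v$7"]
    by (simp add: vec_eq_7 K_p_nth axis_def)
  have k2: "K_p *v (K_p *v (u *v axis 2 1)) = - 4 *\<^sub>R (u *v axis 2 1)"
    by (simp add: uK[symmetric] K_p_axis matrix_vector_mult_scaleR linear_neg)
  define c where "c = (u *v axis 2 1)$2"
  define d where "d = (u *v axis 2 1)$3"
  have u2: "u *v axis 2 1 = c *\<^sub>R axis 2 1 + d *\<^sub>R axis 3 1"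
    using arg_cong[OF k2, of "\<lambda>v. v$1"] arg_cong[OF k2, of "\<lambda>v. v$4"]
      arg_cong[OF k2, of "\<lambda>v. v$5"] arg_cong[OF k2, of "\<lambda>v. v$6"] arg_cong[OF k2, of "\<lambda>v. v$7"]
    by (simp add: vec_eq_7 K_p_square_nth axis_def c_def d_def)
  have k4: "K_p *v (K_p *v (u *v axis 4 1)) = - (u *v axis 4 1)"
    by (simp add: uK[symmetric] K_p_axis matrix_vector_mult_scaleR linear_neg)
  define a where "a = (u *v axis 4 1)$4"
  define b where "b = (u *v axis 4 1)$5"
  have u4: "u *v axis 4 1 = a *\<^sub>R axis 4 1 + b *\<^sub>R axis 5 1"
    using arg_cong[OF k4, of "\<lambda>v. v$1"] arg_cong[OF k4, of "\<lambda>v. v$2"]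
      arg_cong[OF k4, of "\<lambda>v. v$3"] arg_cong[OF k4, of "\<lambda>v. v$6"] arg_cong[OF k4, of "\<lambda>v. v$7"]
    by (simp add: vec_eq_7 K_p_square_nth axis_def a_def b_def)
  have cd: "c\<^sup>2 + d\<^sup>2 = 1" using n[of 2] unfolding u2 by (simp add: inner_7 axis_def power2_eq_square)
  have ab: "a\<^sup>2 + b\<^sup>2 = 1" using n[of 4] unfolding u4 by (simp add: inner_7 axis_def power2_eq_square)
  have "2 *\<^sub>R (u *v axis 3 1) = K_p *v (u *v axis 2 1)" by (simp add: uK[symmetric] K_p_axis matrix_vector_mult_scaleR)
  then have "2 *\<^sub>R (u *v axis 3 1) = 2 *\<^sub>R (c *\<^sub>R axis 3 1 - d *\<^sub>R axis 2 1)"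
    unfolding u2 by (simp add: vec_eq_7 K_p_nth axis_def)
  then have u3: "u *v axis 3 1 = c *\<^sub>R axis 3 1 - d *\<^sub>R axis 2 1" by simp
  have "u *v axis 1 1 = u *v (axis 2 1 \<star> axis 3 1)" by (simp add: axis_product)
  also have "\<dots> = (c\<^sup>2 + d\<^sup>2) *\<^sub>R axis 1 1"
    unfolding G2_mult[OF u] u2 u3 by (simp add: vec_eq_7 imag_product_nth axis_def power2_eq_square)
  finally have u1': "u *v axis 1 1 = axis 1 1" using cd by simp
  have "u = tor a b c d"
    by (rule G2_determined[OF u tor_G2[OF ab cd]])
      (auto simp: u1' u2 u4, simp_all add: vec_eq_7 tor_nth axis_def)
  then show "\<exists>a b c d. a\<^sup>2 + b\<^sup>2 = 1 \<and> c\<^sup>2 + d\<^sup>2 = 1 \<and> u = tor a b c d" using ab cd by blast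
next
  assume "\<exists>a b c d. a\<^sup>2 + b\<^sup>2 = 1 \<and> c\<^sup>2 + d\<^sup>2 = 1 \<and> u = tor a b c d"
  then obtain a b c d where *: "a\<^sup>2 + b\<^sup>2 = 1" "c\<^sup>2 + d\<^sup>2 = 1" "u = tor a b c d" by blast
  then have u: "u \<in> G2" using tor_G2 by simp
  have "u ** K_p = K_p ** u"
    by (rule matrix_eqI) (simp add: vec_eq_7 K_p_nth tor_nth *(3) algebra_simps flip: matrix_vector_mul_assoc)
  then show "u \<in> C_p" using u by (simp add: C_p_def commute_iff_Ad)
qed

text \<open>The torus acts on the simple root components \<open>p\<close> and \<open>q\<close>
  through the characters z and w times the conjugate of z. These characters are coordinates on the
  torus, which is the source of simple transitivity.\<close>

lemma tor_wt1:
  assumes "a\<^sup>2 + b\<^sup>2 = 1" "c\<^sup>2 + d\<^sup>2 = 1"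
  shows "tor a b c d ** wt1 p1 p2 q1 q2 ** transpose (tor a b c d) =
    wt1 (a * p1 - b * p2) (a * p2 + b * p1) ((a * c + b * d) * q1 - (a * d - b * c) * q2) ((a * c + b * d) * q2 + (a * d - b * c) * q1)"
    (is "?u ** ?X ** transpose ?u = ?Y")
proof -
  have ab: "b * b = 1 - a * a" "d * d = 1 - c * c" using assms by (simp_all add: power2_eq_square)
  have "?u ** ?X = ?Y ** ?u"
  proof (rule matrix_eqI)
    fix x
    have 2: "b * (b * y) = y - a * (a * y)" "d * (d * y) = y - c * (c * y)" for y
      using ab by (simp_all add: mult.assoc[symmetric] left_diff_distrib)
    show "(?u ** ?X) *v x = (?Y ** ?u) *v x"
      by (simp add: vec_eq_7 wt1_nth tor_nth algebra_simps 2 flip: matrix_vector_mul_assoc)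
  qed
  then have "?u ** ?X ** transpose ?u = ?Y ** (?u ** transpose ?u)" by (simp add: matrix_mul_assoc)
  then show ?thesis by (simp add: G2_transpose_right[OF tor_G2[OF assms]])
qed

text \<open>Column by column, the weight equation kills or pairs entries; skewness and the
  derivation law for e3 = e1 e2 then leave four free ones, in rows 4 and 5 of columns 1 and
  2.\<close>

lemma weight_one:
  assumes X: "X \<in> g2" and w: "lie_bracket K_p (lie_bracket K_p X) = - X"
  obtains p1 p2 q1 q2 where "X = wt1 p1 p2 q1 q2"
proof -
  have eq: "K_p *v (K_p *v (X *v x)) - 2 *\<^sub>R (K_p *v (X *v (K_p *v x))) + X *v (K_p *v (K_p *v x)) = - (X *v x)" for x
  proof -
    have "lie_bracket K_p (lie_bracket K_p X) *v x = - (X *v x)"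
      unfolding w by (rule bounded_bilinear.minus_left[OF bounded_bilinear_mv])
    then show ?thesis by (simp add: lie_bracket_apply matrix_vector_mult_diff_distrib algebra_simps scaleR_2)
  qed
  define M where "M j = X *v axis j 1" for j
  have e1: "K_p *v (K_p *v M 1) = - M 1" using eq[of "axis 1 1"] by (simp add: K_p_axis M_def)
  have e2: "K_p *v (K_p *v M 2) - 4 *\<^sub>R (K_p *v M 3) - 4 *\<^sub>R M 2 = - M 2"
    using eq[of "axis 2 1"] by (simp add: K_p_axis M_def matrix_vector_mult_scaleR linear_neg)
  have e3: "K_p *v (K_p *v M 3) + 4 *\<^sub>R (K_p *v M 2) - 4 *\<^sub>R M 3 = - M 3"
    using eq[of "axis 3 1"] by (simp add: K_p_axis M_def matrix_vector_mult_scaleR linear_neg)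
  have e4: "K_p *v (K_p *v M 4) - 2 *\<^sub>R (K_p *v M 5) - M 4 = - M 4"
    using eq[of "axis 4 1"] by (simp add: K_p_axis M_def matrix_vector_mult_scaleR linear_neg)
  have e5: "K_p *v (K_p *v M 5) + 2 *\<^sub>R (K_p *v M 4) - M 5 = - M 5"
    using eq[of "axis 5 1"] by (simp add: K_p_axis M_def matrix_vector_mult_scaleR linear_neg)
  have sk: "M i $ j = - M j $ i" for i j
    using g2_skew[OF X, of "axis i 1" "axis j 1"] by (simp add: M_def inner_axis inner_axis')
  have d3: "M 3 = M 1 \<star> axis 2 1 + axis 1 1 \<star> M 2"
    using g2_der[OF X, of "axis 1 1" "axis 2 1"] by (simp add: M_def axis_product)
  have s0: "M i $ i = 0" for i using sk[of i i] by simp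
  have m1: "M 1 $ 2 = 0" "M 1 $ 3 = 0" "M 1 $ 6 = 0" "M 1 $ 7 = 0"
    using arg_cong[OF e1, of "\<lambda>v. v$2"] arg_cong[OF e1, of "\<lambda>v. v$3"] arg_cong[OF e1, of "\<lambda>v. v$6"] arg_cong[OF e1, of "\<lambda>v. v$7"]
    by (simp_all add: K_p_square_nth)
  have m2: "M 2 $ 3 = 0" "M 2 $ 7 = - M 3 $ 6" "M 2 $ 6 = M 3 $ 7" "M 3 $ 4 = - M 2 $ 5" "M 3 $ 5 = M 2 $ 4"
    using arg_cong[OF e2, of "\<lambda>v. v$3"] arg_cong[OF e2, of "\<lambda>v. v$6"] arg_cong[OF e2, of "\<lambda>v. v$7"]
      arg_cong[OF e2, of "\<lambda>v. v$4"] arg_cong[OF e2, of "\<lambda>v. v$5"]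
      arg_cong[OF e3, of "\<lambda>v. v$6"] arg_cong[OF e3, of "\<lambda>v. v$7"] arg_cong[OF e3, of "\<lambda>v. v$4"] arg_cong[OF e3, of "\<lambda>v. v$5"]
      sk[of 2 3] s0[of 2] s0[of 3]
    by (simp_all add: K_p_square_nth K_p_nth)
  have m4: "M 4 $ 5 = 0" "M 4 $ 6 = 0" "M 4 $ 7 = 0"
    using arg_cong[OF e4, of "\<lambda>v. v$5"] arg_cong[OF e4, of "\<lambda>v. v$6"] arg_cong[OF e4, of "\<lambda>v. v$7"]
      arg_cong[OF e5, of "\<lambda>v. v$6"] arg_cong[OF e5, of "\<lambda>v. v$7"] arg_cong[OF e5, of "\<lambda>v. v$4"] sk[of 4 5] s0
    by (simp_all add: K_p_square_nth K_p_nth)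
  have m3: "M 3 $ 6 = - M 1 $ 4 + M 2 $ 7" "M 3 $ 7 = - M 1 $ 5 - M 2 $ 6"
    unfolding d3 by (simp_all add: imag_product_nth axis_def)
  define Y where "Y = wt1 (M 1 $ 4 / 2) (M 1 $ 5 / 2) (M 2 $ 4) (- M 2 $ 5)"
  have M: "M 1 = Y *v axis 1 1" "M 2 = Y *v axis 2 1" "M 4 = Y *v axis 4 1"
    using m1 m2 m3 m4 s0[of 1] s0[of 2] s0[of 4] sk[of 2 1] sk[of 4 1] sk[of 4 2] sk[of 4 3]
    by (simp_all add: vec_eq_7 Y_def wt1_nth axis_def)
  have "M 5 = M 1 \<star> axis 4 1 + axis 1 1 \<star> M 4" "M 6 = M 2 \<star> axis 4 1 + axis 2 1 \<star> M 4"
    "M 7 = M 3 \<star> axis 4 1 + axis 3 1 \<star> M 4"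
    using g2_der[OF X, of "axis 1 1" "axis 4 1"] g2_der[OF X, of "axis 2 1" "axis 4 1"] g2_der[OF X, of "axis 3 1" "axis 4 1"]
    by (simp_all add: M_def axis_product)
  then have "\<forall>i. M i = Y *v axis i 1"
    unfolding forall_7 d3 M by (simp add: vec_eq_7 Y_def wt1_nth imag_product_nth axis_def)
  then have "\<forall>i. X *v (mat 1 *v axis i 1) = Y *v (mat 1 *v axis i 1)" by (simp add: M_def)
  then have "X = Y" by (intro G2_eqI[OF G2_one]) simp
  then show ?thesis using that Y_def by blast
qed

section \<open>Principal subalgebras containing \<open>K_p\<close>\<close>

lemma subspace_g2: "subspace g2"
proof (rule subspaceI)
  show "0 \<in> g2" unfolding g2_iff by (simp add: imag_product_simps)
  show "X + Y \<in> g2" if "X \<in> g2" "Y \<in> g2" for X Y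
    unfolding g2_iff
    by (simp add: D_sum_apply inner_add_left inner_add_right g2_skew[OF that(1)] g2_skew[OF that(2)]
        g2_der[OF that(1)] g2_der[OF that(2)] imag_product_simps)
  show "c *\<^sub>R X \<in> g2" if "X \<in> g2" for c X
    unfolding g2_iff by (simp add: D_sum_apply g2_skew[OF that] g2_der[OF that] imag_product_simps scaleR_add_right)
qed

lemma g2_lie_bracket: "X \<in> g2 \<Longrightarrow> Y \<in> g2 \<Longrightarrow> lie_bracket X Y \<in> g2"
  unfolding g2_iff[of "lie_bracket X Y"]
  by (simp add: lie_bracket_apply inner_diff_left inner_diff_right g2_skew g2_der matrix_vector_right_distrib imag_product_simps)

lemma g2_conj: assumes "g \<in> G2" "Z \<in> g2" shows "g ** Z ** transpose g \<in> g2"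
proof -
  have "(g *v (Z *v (transpose g *v u))) \<bullet> v = (Z *v (transpose g *v u)) \<bullet> (transpose g *v v)" for u v
    using G2_inner[OF assms(1), of "Z *v (transpose g *v u)" "transpose g *v v"] by (simp add: G2_cancel[OF assms(1)])
  moreover have "u \<bullet> (g *v (Z *v (transpose g *v v))) = (transpose g *v u) \<bullet> (Z *v (transpose g *v v))" for u v
    using G2_inner[OF assms(1), of "transpose g *v u" "Z *v (transpose g *v v)"] by (simp add: G2_cancel[OF assms(1)])
  ultimately show ?thesis unfolding g2_iff
    by (simp add: g2_skew[OF assms(2)] g2_der[OF assms(2)] G2_mult[OF assms(1)] G2_mult[OF G2_transpose[OF assms(1)]]
        matrix_vector_right_distrib G2_cancel[OF assms(1)] flip: matrix_vector_mul_assoc)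
qed

lemma K_p_g2: "K_p \<in> g2"
  unfolding g2_iff by (simp add: inner_7 vec_eq_7 K_p_nth imag_product_nth algebra_simps)

lemma wt1_g2: "wt1 p1 p2 q1 q2 \<in> g2"
  unfolding g2_iff by (simp add: inner_7 vec_eq_7 wt1_nth imag_product_nth algebra_simps)

lemma P_p_g2: "P_p \<in> g2"
  by (simp add: P_p_eq wt1_g2)

section \<open>Generated Lie subalgebras and conjugation\<close>

lemma lie_bracket_bilinear: "bilinear (lie_bracket :: real^'n^'n \<Rightarrow> _)"
  unfolding bilinear_def lie_bracket_def
  by (auto intro!: linearI simp: bounded_bilinear.add_left[OF bounded_bilinear_mm] bounded_bilinear.add_right[OF bounded_bilinear_mm]
    bounded_bilinear.scaleR_left[OF bounded_bilinear_mm] bounded_bilinear.scaleR_right[OF bounded_bilinear_mm] algebra_simps)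

lemma lie_bracket_linear: "linear (\<lambda>X. lie_bracket X (Y::real^'n^'n))" "linear (lie_bracket (X::real^'n^'n))"
  using lie_bracket_bilinear unfolding bilinear_def by auto

lemmas lie_bracket_simps =
  linear_add[OF lie_bracket_linear(1)] linear_add[OF lie_bracket_linear(2)]
  linear_diff[OF lie_bracket_linear(1)] linear_diff[OF lie_bracket_linear(2)]
  linear_scale[OF lie_bracket_linear(1)] linear_scale[OF lie_bracket_linear(2)]
  linear_neg[OF lie_bracket_linear(1)] linear_neg[OF lie_bracket_linear(2)]
  linear_0[OF lie_bracket_linear(1)] linear_0[OF lie_bracket_linear(2)]

lemma lie_bracket_self [simp]: "lie_bracket X X = 0"
  by (simp add: lie_bracket_def)

lemma lie_bracket_anticommute: "lie_bracket X Y = - lie_bracket Y X" for X Y :: "real^'n^'n"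
  by (simp add: lie_bracket_def)

lemma generated_lie_algebra_props:
  "lie_subalgebra (generated_lie_algebra U W)" "U \<in> generated_lie_algebra U W" "W \<in> generated_lie_algebra U W"
  "lie_subalgebra L \<Longrightarrow> U \<in> L \<Longrightarrow> W \<in> L \<Longrightarrow> generated_lie_algebra U W \<subseteq> L"
proof -
  show "lie_subalgebra (generated_lie_algebra U W)"
    unfolding generated_lie_algebra_def
    by (rule hull_in) (auto simp: lie_subalgebra_def intro: subspace_Inter)
  show "U \<in> generated_lie_algebra U W" "W \<in> generated_lie_algebra U W"
    unfolding generated_lie_algebra_def by (auto intro: hull_inc)
  show "lie_subalgebra L \<Longrightarrow> U \<in> L \<Longrightarrow> W \<in> L \<Longrightarrow> generated_lie_algebra U W \<subseteq> L"
    unfolding generated_lie_algebra_def by (rule hull_minimal) auto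
qed

lemma lie_subalgebraD:
  assumes "lie_subalgebra L" "X \<in> L" "Y \<in> L"
  shows "lie_bracket X Y \<in> L" "X + Y \<in> L" "X - Y \<in> L" "c *\<^sub>R X \<in> L" "- X \<in> L"
  using assms unfolding lie_subalgebra_def by (auto intro: subspace_add subspace_diff subspace_scale subspace_neg)

text \<open>With minimality of the generated algebra, a subspace invariant under both generators is
  invariant under all of it; this is how irreducibility is tested on generators.\<close>

lemma stabilizer_lie_subalgebra:
  fixes W :: "(real^'n) set"
  assumes "subspace W" shows "lie_subalgebra {X. \<forall>w\<in>W. X *v w \<in> W}"
  unfolding lie_subalgebra_def
proof (intro conjI ballI)
  show "subspace {X. \<forall>w\<in>W. X *v w \<in> W}"
    by (rule subspaceI) (use assms in \<open>auto simp: bounded_bilinear.add_left[OF bounded_bilinear_mv]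
       bounded_bilinear.scaleR_left[OF bounded_bilinear_mv] subspace_0 subspace_add subspace_scale\<close>)
  show "lie_bracket X Y \<in> {X. \<forall>w\<in>W. X *v w \<in> W}" if "X \<in> {X. \<forall>w\<in>W. X *v w \<in> W}" "Y \<in> {X. \<forall>w\<in>W. X *v w \<in> W}" for X Y
    using that assms by (auto simp: lie_bracket_apply subspace_diff)
qed

lemma transpose_conj_cancel:
  assumes g: "g \<in> G2"
  shows "transpose g ** (g ** X ** transpose g) ** g = X" "g ** (transpose g ** X ** g) ** transpose g = X"
proof -
  have "transpose g ** (g ** X ** transpose g) ** g = transpose g ** (g ** (X ** (transpose g ** g)))" by (simp only: matrix_mul_assoc)
  then show "transpose g ** (g ** X ** transpose g) ** g = X" by (simp add: G2_cancel[OF g] G2_transpose_left[OF g])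
  have "g ** (transpose g ** X ** g) ** transpose g = g ** (transpose g ** (X ** (g ** transpose g)))" by (simp only: matrix_mul_assoc)
  then show "g ** (transpose g ** X ** g) ** transpose g = X" by (simp add: G2_cancel[OF g] G2_transpose_right[OF g])
qed

lemma conj_mult: assumes "g \<in> G2" shows "(g ** X ** transpose g) ** (g ** Y ** transpose g) = g ** (X ** Y) ** transpose g"
proof -
  have "(g ** X ** transpose g) ** (g ** Y ** transpose g) = g ** (X ** (transpose g ** (g ** (Y ** transpose g))))"
    by (simp only: matrix_mul_assoc)
  also have "\<dots> = g ** (X ** (Y ** transpose g))" by (simp only: G2_cancel[OF assms])
  finally show ?thesis by (simp only: matrix_mul_assoc)
qed

lemma conj_lie_bracket:
  assumes "g \<in> G2"
  shows "lie_bracket (g ** X ** transpose g) (g ** Y ** transpose g) = g ** lie_bracket X Y ** transpose g"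
  using linear_diff[OF linear_matrix_conj[of g "transpose g"]] by (simp add: lie_bracket_def conj_mult[OF assms])

lemma lie_subalgebra_conj:
  assumes g: "g \<in> G2" and L: "lie_subalgebra L" shows "lie_subalgebra ((\<lambda>X. g ** X ** transpose g) ` L)"
  unfolding lie_subalgebra_def
proof (intro conjI ballI)
  show "subspace ((\<lambda>X. g ** X ** transpose g) ` L)"
    using L linear_subspace_image[OF linear_matrix_conj] by (auto simp: lie_subalgebra_def)
  show "lie_bracket X Y \<in> (\<lambda>X. g ** X ** transpose g) ` L"
    if "X \<in> (\<lambda>X. g ** X ** transpose g) ` L" "Y \<in> (\<lambda>X. g ** X ** transpose g) ` L" for X Y
    using that L by (auto simp: conj_lie_bracket[OF g] lie_subalgebra_def)
qed

lemma generated_lie_algebra_conj: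
  assumes g: "g \<in> G2"
  shows "generated_lie_algebra (g ** U ** transpose g) (g ** W ** transpose g) = (\<lambda>X. g ** X ** transpose g) ` generated_lie_algebra U W"
proof
  show "generated_lie_algebra (g ** U ** transpose g) (g ** W ** transpose g) \<subseteq> (\<lambda>X. g ** X ** transpose g) ` generated_lie_algebra U W"
    by (intro generated_lie_algebra_props(4) lie_subalgebra_conj g generated_lie_algebra_props(1) imageI generated_lie_algebra_props(2,3))
  have "lie_subalgebra ((\<lambda>X. transpose g ** X ** g) ` generated_lie_algebra (g ** U ** transpose g) (g ** W ** transpose g))"
    using lie_subalgebra_conj[OF G2_transpose[OF g] generated_lie_algebra_props(1)] by (simp add: transpose_transpose)
  then have "generated_lie_algebra U W \<subseteq> (\<lambda>X. transpose g ** X ** g) ` generated_lie_algebra (g ** U ** transpose g) (g ** W ** transpose g)"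
  proof (rule generated_lie_algebra_props(4))
    show "U \<in> (\<lambda>X. transpose g ** X ** g) ` generated_lie_algebra (g ** U ** transpose g) (g ** W ** transpose g)"
      by (rule image_eqI[OF _ generated_lie_algebra_props(2)]) (simp only: transpose_conj_cancel(1)[OF g])
    show "W \<in> (\<lambda>X. transpose g ** X ** g) ` generated_lie_algebra (g ** U ** transpose g) (g ** W ** transpose g)"
      by (rule image_eqI[OF _ generated_lie_algebra_props(3)]) (simp only: transpose_conj_cancel(1)[OF g])
  qed
  then show "(\<lambda>X. g ** X ** transpose g) ` generated_lie_algebra U W \<subseteq> generated_lie_algebra (g ** U ** transpose g) (g ** W ** transpose g)"
  proof (intro image_subsetI)
    fix X assume sub: "generated_lie_algebra U W \<subseteq> (\<lambda>X. transpose g ** X ** g) ` generated_lie_algebra (g ** U ** transpose g) (g ** W ** transpose g)"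
      and "X \<in> generated_lie_algebra U W"
    then obtain X' where "X' \<in> generated_lie_algebra (g ** U ** transpose g) (g ** W ** transpose g)" "X = transpose g ** X' ** g" by blast
    then show "g ** X ** transpose g \<in> generated_lie_algebra (g ** U ** transpose g) (g ** W ** transpose g)"
      by (simp only: transpose_conj_cancel(2)[OF g])
  qed
qed

lemma generated_lie_algebra_scale:
  assumes c: "c \<noteq> 0"
  shows "generated_lie_algebra (c *\<^sub>R U) (c *\<^sub>R W) = generated_lie_algebra U W"
proof
  show "generated_lie_algebra (c *\<^sub>R U) (c *\<^sub>R W) \<subseteq> generated_lie_algebra U W"
    by (intro generated_lie_algebra_props(4))
      (rule generated_lie_algebra_props(1), rule lie_subalgebraD(4)[OF generated_lie_algebra_props(1,2,2)],
        rule lie_subalgebraD(4)[OF generated_lie_algebra_props(1,3,3)])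
  let ?L = "generated_lie_algebra (c *\<^sub>R U) (c *\<^sub>R W)"
  have L: "lie_subalgebra ?L" "c *\<^sub>R U \<in> ?L" "c *\<^sub>R W \<in> ?L" by (rule generated_lie_algebra_props)+
  have "(1/c) *\<^sub>R (c *\<^sub>R U) \<in> ?L" "(1/c) *\<^sub>R (c *\<^sub>R W) \<in> ?L" by (rule lie_subalgebraD[OF L(1) L(2) L(2)], rule lie_subalgebraD[OF L(1) L(3) L(3)])
  then show "generated_lie_algebra U W \<subseteq> ?L" using c by (intro generated_lie_algebra_props(4) L) auto
qed

lemma principal_su2_conj:
  assumes g: "g \<in> G2" and L: "principal_su2 L"
  shows "principal_su2 ((\<lambda>X. g ** X ** transpose g) ` L)"
  unfolding principal_su2_def
proof (intro conjI)
  let ?k = "\<lambda>X. g ** X ** transpose g"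
  show "lie_subalgebra (?k ` L)" using L lie_subalgebra_conj[OF g] by (auto simp: principal_su2_def)
  show "?k ` L \<subseteq> g2" using L g2_conj[OF g] by (auto simp: principal_su2_def)
  have inj: "inj_on ?k A" for A by (rule inj_onI) (metis transpose_conj_cancel(1)[OF g])
  from L obtain \<phi> :: "complex^2^2 \<Rightarrow> real^7^7" where \<phi>: "linear \<phi>" "bij_betw \<phi> su2 L"
    "\<forall>X\<in>su2. \<forall>Y\<in>su2. \<phi> (lie_bracket X Y) = lie_bracket (\<phi> X) (\<phi> Y)"
    unfolding principal_su2_def isomorphic_to_su2_def by blast
  have "bij_betw (\<lambda>X. ?k (\<phi> X)) su2 (?k ` L)"
    using bij_betw_trans[OF \<phi>(2) inj_on_imp_bij_betw[OF inj]] by (simp add: o_def)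
  moreover have "linear (\<lambda>X. ?k (\<phi> X))" using linear_compose[OF \<phi>(1) linear_matrix_conj] by (simp add: o_def)
  ultimately show "isomorphic_to_su2 (?k ` L)"
    unfolding isomorphic_to_su2_def using \<phi>(3) by (intro exI[of _ "\<lambda>X. ?k (\<phi> X)"]) (simp add: conj_lie_bracket[OF g])
  show "acts_irreducibly (?k ` L)"
    unfolding acts_irreducibly_def
  proof (intro allI impI)
    fix W :: "(real^7) set" assume W: "subspace W \<and> (\<forall>X\<in>?k ` L. \<forall>w\<in>W. X *v w \<in> W)"
    let ?W = "(*v) (transpose g) ` W"
    have "subspace ?W" using W by (intro linear_subspace_image) auto
    moreover have "X *v w \<in> ?W" if "X \<in> L" "w \<in> ?W" for X w
    proof -
      from that(2) obtain v where v: "v \<in> W" "w = transpose g *v v" by blast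
      then have "?k X *v v \<in> W" using W that(1) by blast
      then have "transpose g *v (?k X *v v) \<in> ?W" by blast
      then show ?thesis by (simp add: v G2_cancel[OF g] flip: matrix_vector_mul_assoc)
    qed
    ultimately have cases: "?W = {0} \<or> ?W = UNIV"
      using L[unfolded principal_su2_def acts_irreducibly_def, THEN conjunct2, THEN conjunct2, THEN conjunct2, rule_format, of ?W] by blast
    have gW: "(*v) g ` ?W = W" by (auto simp: image_image G2_cancel[OF g])
    from cases show "W = {0} \<or> W = UNIV"
    proof
      assume "?W = {0}" with gW have "(*v) g ` {0} = W" by (simp only:)
      then show ?thesis by auto
    next
      assume "?W = UNIV" with gW have "range ((*v) g) = W" by (simp only:)
      moreover have "v \<in> range ((*v) g)" for v using G2_cancel(2)[OF g, of v] by (metis rangeI)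
      ultimately show ?thesis by blast
    qed
  qed
qed

text \<open>Coordinates on \<open>su2\<close> in which the bracket is twice the cross product, so
  that identities for \<open>cross3\<close> replace matrix computations.\<close>

definition psi :: "real^3 \<Rightarrow> complex^2^2" where
  "psi x = (\<chi> i j. if i = 1 then (if j = 1 then Complex 0 (x$1) else Complex (x$2) (x$3))
     else (if j = 1 then Complex (- x$2) (x$3) else Complex 0 (- x$1)))"

lemma psi_linear: "linear psi"
  by (rule linearI) (simp_all add: psi_def vec_eq_iff forall_2 complex_eq_iff)

lemma psi_su2: "psi x \<in> su2"
  by (simp add: su2_def psi_def forall_2 complex_eq_iff trace_def sum_2)

lemma psi_surj:
  assumes "X \<in> su2" shows "X = psi (vector [Im (X$1$1), Re (X$1$2), Im (X$1$2)])"
proof -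
  have X: "X$j$i = - cnj (X$i$j)" "trace X = 0" for i j using assms unfolding su2_def by blast+
  have "Re (X$1$1) = 0" using arg_cong[OF X(1)[of 1 1], of Re] by simp
  moreover have "X$2$2 = - X$1$1" using X(2) by (simp add: trace_def sum_2 add_eq_0_iff)
  moreover have "Re (X$2$1) = - Re (X$1$2)" "Im (X$2$1) = Im (X$1$2)"
    using arg_cong[OF X(1)[of 2 1], of Re] arg_cong[OF X(1)[of 2 1], of Im] by simp_all
  ultimately show ?thesis
    by (simp add: psi_def vec_eq_iff[of X] vec_eq_iff[of "X$_"] forall_2 complex_eq_iff vector_3)
qed

lemma psi_bracket: "lie_bracket (psi x) (psi y) = 2 *\<^sub>R psi (cross3 x y)"
  by (simp add: lie_bracket_def psi_def vec_eq_iff forall_2 matrix_matrix_mult_def sum_2 complex_eq_iff cross3_simps algebra_simps)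

lemma psi_inj: "psi x = psi y \<Longrightarrow> x = y"
  by (simp add: psi_def vec_eq_iff forall_2 forall_3 complex_eq_iff)

lemma su2_frame:
  assumes "isomorphic_to_su2 L"
  obtains \<Phi> :: "real^3 \<Rightarrow> real^'n^'n" where "linear \<Phi>" "inj \<Phi>" "range \<Phi> = L"
    "\<And>x y. lie_bracket (\<Phi> x) (\<Phi> y) = 2 *\<^sub>R \<Phi> (cross3 x y)"
proof -
  obtain \<phi> :: "complex^2^2 \<Rightarrow> real^'n^'n" where \<phi>: "linear \<phi>" "bij_betw \<phi> su2 L"
    "\<And>X Y. X\<in>su2 \<Longrightarrow> Y\<in>su2 \<Longrightarrow> \<phi> (lie_bracket X Y) = lie_bracket (\<phi> X) (\<phi> Y)"
    using assms unfolding isomorphic_to_su2_def by blast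
  show ?thesis
  proof (rule that[of "\<lambda>x. \<phi> (psi x)"])
    show "linear (\<lambda>x. \<phi> (psi x))" using linear_compose[OF psi_linear \<phi>(1)] by (simp add: o_def)
    show "inj (\<lambda>x. \<phi> (psi x))"
      by (rule injI) (metis \<phi>(2) bij_betw_imp_inj_on inj_onD psi_inj psi_su2)
    have "range psi = su2" using psi_su2 psi_surj by blast
    then show "range (\<lambda>x. \<phi> (psi x)) = L" using \<phi>(2) by (metis bij_betw_imp_surj_on image_image)
    show "lie_bracket (\<phi> (psi x)) (\<phi> (psi y)) = 2 *\<^sub>R \<phi> (psi (cross3 x y))" for x y
      using \<phi>(3)[OF psi_su2 psi_su2, of x y] by (simp add: psi_bracket linear_scale[OF \<phi>(1)])
  qed
qed

text \<open>In the cross product model \<open>Y\<close> is the part of the second generator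
  orthogonal to the first, and both relations are triple product expansions. \<open>Y\<close> is
  nonzero, since otherwise a line would be all of su(2).\<close>

lemma su2_decompose:
  fixes K K' :: "real^'n^'n"
  assumes iso: "isomorphic_to_su2 L" and L: "L = generated_lie_algebra K K'" and K: "K \<noteq> 0"
  obtains a \<kappa> \<eta> Y where "K' = a *\<^sub>R K + Y" "0 < \<kappa>" "0 < \<eta>"
    "lie_bracket K (lie_bracket K Y) = - (\<kappa>\<^sup>2 *\<^sub>R Y)" "lie_bracket Y (lie_bracket K Y) = \<eta>\<^sup>2 *\<^sub>R K"
proof -
  obtain \<Phi> :: "real^3 \<Rightarrow> real^'n^'n" where lin: "linear \<Phi>" and inj: "inj \<Phi>" and ran: "range \<Phi> = L"
    and br: "\<And>x y. lie_bracket (\<Phi> x) (\<Phi> y) = 2 *\<^sub>R \<Phi> (cross3 x y)" using su2_frame[OF iso] by blast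
  have "K \<in> L" "K' \<in> L" unfolding L by (rule generated_lie_algebra_props)+
  then obtain k k' where k: "K = \<Phi> k" "K' = \<Phi> k'" using ran by blast
  have k0: "k \<noteq> 0" using K k linear_0[OF lin] by auto
  define a where "a = (k' \<bullet> k) / (k \<bullet> k)"
  define y where "y = k' - a *\<^sub>R k"
  have ky: "k \<bullet> y = 0" using k0 by (simp add: y_def a_def inner_diff_right inner_commute)
  have K': "K' = a *\<^sub>R K + \<Phi> y" by (simp add: k y_def linear_diff[OF lin] linear_scale[OF lin])
  have y0: "y \<noteq> 0"
  proof
    assume "y = 0"
    then have K'K: "K' = a *\<^sub>R K" using K' linear_0[OF lin] by simp
    have "lie_subalgebra (range (\<lambda>c. c *\<^sub>R K))"
      unfolding lie_subalgebra_def
    proof (intro conjI ballI)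
      show "subspace (range (\<lambda>c. c *\<^sub>R K))" by (intro linear_subspace_image linearI) (auto simp: scaleR_add_left)
      show "lie_bracket X Y \<in> range (\<lambda>c. c *\<^sub>R K)" if "X \<in> range (\<lambda>c. c *\<^sub>R K)" "Y \<in> range (\<lambda>c. c *\<^sub>R K)" for X Y
        using that by (auto simp: lie_bracket_simps intro: rev_image_eqI[of 0])
    qed
    moreover have "K \<in> range (\<lambda>c. c *\<^sub>R K)" by (rule range_eqI[of _ _ 1]) simp
    moreover have "K' \<in> range (\<lambda>c. c *\<^sub>R K)" using K'K by blast
    ultimately have "L \<subseteq> range (\<lambda>c. c *\<^sub>R K)" unfolding L by (rule generated_lie_algebra_props(4))
    then obtain r s where "\<Phi> (axis 1 1) = r *\<^sub>R K" "\<Phi> (axis 2 1) = s *\<^sub>R K" using ran by blast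
    then have "lie_bracket (\<Phi> (axis 1 1)) (\<Phi> (axis 2 1)) = 0" by (simp add: lie_bracket_simps)
    then have "\<Phi> (axis 3 1) = \<Phi> 0" using br[of "axis 1 1" "axis 2 1"] linear_0[OF lin] by (simp add: cross_basis)
    then have "axis 3 1 = (0::real^3)" using inj by (simp add: inj_eq)
    then show False by (simp add: axis_eq_0_iff)
  qed
  show ?thesis
  proof (rule that[OF K'])
    \<comment> \<open>The factor 2 stems from the bracket being twice the cross product.\<close>
    show "0 < 2 * norm k" "0 < 2 * norm y" using k0 y0 by auto
    have "cross3 k (cross3 k y) = - ((norm k)\<^sup>2 *\<^sub>R y)" by (simp add: Lagrange ky dot_square_norm)
    then show "lie_bracket K (lie_bracket K (\<Phi> y)) = - ((2 * norm k)\<^sup>2 *\<^sub>R \<Phi> y)"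
      by (simp add: k br lie_bracket_simps linear_scale[OF lin] linear_neg[OF lin] power_mult_distrib)
    have "cross3 y (cross3 k y) = (norm y)\<^sup>2 *\<^sub>R k" by (simp add: Lagrange ky inner_commute[of y k] dot_square_norm)
    then show "lie_bracket (\<Phi> y) (lie_bracket K (\<Phi> y)) = (2 * norm y)\<^sup>2 *\<^sub>R K"
      by (simp add: k br lie_bracket_simps linear_scale[OF lin] power_mult_distrib)
  qed
qed

text \<open>Third vector of the frame of the model subalgebra; its exponential rotates
  \<open>K_p\<close> towards \<open>P_p\<close>.\<close>

definition Q_p :: "real^7^7" where "Q_p = lie_bracket K_p P_p"

lemma Q_p_brackets: "lie_bracket Q_p K_p = P_p" "lie_bracket Q_p (lie_bracket Q_p K_p) = - K_p"
  "lie_bracket K_p P_p = Q_p" "lie_bracket P_p Q_p = K_p" "lie_bracket K_p Q_p = - P_p"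
proof -
  show 1: "lie_bracket K_p P_p = Q_p" "lie_bracket P_p Q_p = K_p" "lie_bracket K_p Q_p = - P_p"
    using P_p_bracket by (simp_all add: Q_p_def)
  show 2: "lie_bracket Q_p K_p = P_p" using 1(3) lie_bracket_anticommute[of Q_p K_p] by simp
  show "lie_bracket Q_p (lie_bracket Q_p K_p) = - K_p"
    unfolding 2 using 1(2) lie_bracket_anticommute[of Q_p P_p] by simp
qed

definition R_p :: "real \<Rightarrow> real^7^7" where "R_p t = mat_exp (t *\<^sub>R Q_p)"

lemma R_p_G2: "R_p t \<in> G2"
  unfolding R_p_def Q_p_def by (intro mat_exp_G2 g2_lie_bracket K_p_g2 P_p_g2)

lemma R_p_transpose: "transpose (R_p t) = R_p (- t)"
proof -
  have "R_p t ** R_p (- t) = mat 1" using mat_exp_inverse'[of t Q_p] by (simp add: R_p_def)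
  then have "transpose (R_p t) ** (R_p t ** R_p (- t)) = transpose (R_p t)" by simp
  then show ?thesis by (simp add: G2_cancel[OF R_p_G2])
qed

lemma R_p_add: "R_p s ** R_p t = R_p (s + t)"
  using mat_exp_add[of t s Q_p] by (simp add: R_p_def add.commute)

lemma R_p_conj_K: "R_p t ** K_p ** R_p (- t) = cos t *\<^sub>R K_p + sin t *\<^sub>R P_p"
  using mat_exp_adjoint[OF Q_p_brackets(2), of t] by (simp add: R_p_def Q_p_brackets)

lemma mat_exp_K_p: "mat_exp (t *\<^sub>R K_p) = tor (cos t) (sin t) (cos (2 * t)) (sin (2 * t))"
proof (rule mat_exp_unique[symmetric])
  have tor_entry: "tor a b c d $ i $ j = (tor a b c d *v axis j 1) $ i"
    "(K_p ** tor a b c d) $ i $ j = (K_p *v (tor a b c d *v axis j 1)) $ i" for a b c d i j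
    by (simp_all add: matrix_vector_mul_assoc, simp_all add: matrix_vector_mult_basis column_def)
  fix t
  show "((\<lambda>t. tor (cos t) (sin t) (cos (2 * t)) (sin (2 * t))) has_vector_derivative
      K_p ** tor (cos t) (sin t) (cos (2 * t)) (sin (2 * t))) (at t)"
  proof (rule mat_has_vector_derivative)
    have "\<forall>i j. ((\<lambda>t. tor (cos t) (sin t) (cos (2 * t)) (sin (2 * t)) $ i $ j) has_real_derivative
      (K_p ** tor (cos t) (sin t) (cos (2 * t)) (sin (2 * t))) $ i $ j) (at t)"
      unfolding forall_7 tor_entry tor_nth K_p_nth axis_def
      by (simp, intro conjI; auto intro!: derivative_eq_intros simp: algebra_simps)
    then show "((\<lambda>t. tor (cos t) (sin t) (cos (2 * t)) (sin (2 * t)) $ i $ j) has_real_derivative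
      (K_p ** tor (cos t) (sin t) (cos (2 * t)) (sin (2 * t))) $ i $ j) (at t)" for i j by blast
  qed
  show "tor (cos 0) (sin 0) (cos (2 * 0)) (sin (2 * 0)) = mat 1"
    by (rule matrix_eqI) (simp add: vec_eq_7 tor_nth)
qed

text \<open>Angle \<pi> negates the planes of odd weights 1 and 3 and fixes weights 0 and 2, that is
  e1, e2, e3.\<close>

lemma mat_exp_pi_K_p: "mat_exp (pi *\<^sub>R K_p) = refl0"
  unfolding mat_exp_K_p by (rule matrix_eqI) (simp add: vec_eq_7 tor_nth refl0_nth)

text \<open>The exponent is \<pi> times a rotated copy of \<open>K_p\<close>, and exponentials
  respect conjugation.\<close>

lemma T_refl_eq: "T_refl \<theta> = R_p \<theta> ** refl0 ** R_p (- \<theta>)"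
proof -
  have "T_refl \<theta> = mat_exp (pi *\<^sub>R (R_p \<theta> ** K_p ** transpose (R_p \<theta>)))"
    by (simp add: T_refl_def R_p_transpose R_p_conj_K)
  then show ?thesis
    by (simp add: mat_exp_conj[OF R_p_G2] mat_exp_pi_K_p) (simp add: R_p_transpose)
qed

lemma T_refl_reflection: "T_refl \<theta> \<in> reflections"
  unfolding reflections_iff using R_p_G2[of \<theta>]
  by (intro bexI[of _ "R_p \<theta>"]) (simp_all add: T_refl_eq R_p_transpose)

text \<open>\<open>refl0\<close> fixes \<open>K_p\<close> and negates \<open>P_p\<close>, so
  \<open>T_refl \<theta>\<close> mirrors their plane in the line at angle \<theta>, and the image of
  \<open>K_p\<close> lies at twice that angle.\<close>

lemma T_refl_conj_K: "T_refl \<theta> ** K_p ** T_refl \<theta> = cos (2 * \<theta>) *\<^sub>R K_p + sin (2 * \<theta>) *\<^sub>R P_p"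
proof -
  have K: "refl0 ** K_p ** refl0 = K_p"
    by (rule matrix_eqI) (simp add: vec_eq_7 refl0_nth K_p_nth flip: matrix_vector_mul_assoc)
  have P: "refl0 ** P_p ** refl0 = - P_p"
    by (rule matrix_eqI) (simp add: vec_eq_7 refl0_nth P_p_eq wt1_minus wt1_nth flip: matrix_vector_mul_assoc)
  have "T_refl \<theta> ** K_p ** T_refl \<theta> = R_p \<theta> ** (refl0 ** (R_p (- \<theta>) ** K_p ** R_p \<theta>) ** refl0) ** R_p (- \<theta>)"
    by (simp only: T_refl_eq matrix_mul_assoc)
  also have "R_p (- \<theta>) ** K_p ** R_p \<theta> = cos \<theta> *\<^sub>R K_p - sin \<theta> *\<^sub>R P_p"
    using R_p_conj_K[of "- \<theta>"] by simp
  also have "refl0 ** (cos \<theta> *\<^sub>R K_p - sin \<theta> *\<^sub>R P_p) ** refl0 = cos \<theta> *\<^sub>R K_p + sin \<theta> *\<^sub>R P_p"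
    by (simp add: linear_diff[OF linear_matrix_conj] linear_scale[OF linear_matrix_conj] K P)
  also have "\<dots> = R_p \<theta> ** K_p ** R_p (- \<theta>)" by (simp add: R_p_conj_K)
  also have "R_p \<theta> ** (R_p \<theta> ** K_p ** R_p (- \<theta>)) ** R_p (- \<theta>) = (R_p \<theta> ** R_p \<theta>) ** K_p ** (R_p (- \<theta>) ** R_p (- \<theta>))"
    by (simp only: matrix_mul_assoc)
  also have "\<dots> = cos (2 * \<theta>) *\<^sub>R K_p + sin (2 * \<theta>) *\<^sub>R P_p"
    using R_p_conj_K[of "2 * \<theta>"] by (simp add: R_p_add)
  finally show ?thesis .
qed

lemma T_refl_analytic: "real_analytic_at T_refl t"
proof -
  have R: "real_analytic_at R_p t" for t unfolding R_p_def[abs_def] by (rule mat_exp_analytic)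
  have "real_analytic_at (\<lambda>t. R_p t ** refl0 ** transpose (R_p t)) t"
    by (rule real_analytic_at_mm[OF real_analytic_at_mm[OF R real_analytic_at_const] real_analytic_at_linear_compose[OF linear_transpose R]])
  then show ?thesis by (simp add: T_refl_eq[abs_def] R_p_transpose)
qed

text \<open>The square of \<open>K_p\<close> has eigenvalues 0, -1, -4, -9; the numerical
  coefficients are those of the Lagrange polynomials projecting onto the eigenspaces.\<close>

lemma weight_components:
  fixes W :: "(real^7) set"
  assumes W: "subspace W" and K: "\<And>w. w \<in> W \<Longrightarrow> K_p *v w \<in> W" and w: "w \<in> W"
  shows "(w$1) *\<^sub>R axis 1 1 \<in> W" "(w$4) *\<^sub>R axis 4 1 + (w$5) *\<^sub>R axis 5 1 \<in> W"
    "(w$2) *\<^sub>R axis 2 1 + (w$3) *\<^sub>R axis 3 1 \<in> W" "(w$6) *\<^sub>R axis 6 1 + (w$7) *\<^sub>R axis 7 1 \<in> W"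
proof -
  define S where "S v = K_p *v (K_p *v v)" for v
  have in_W: "x *\<^sub>R w + y *\<^sub>R S w + z *\<^sub>R S (S w) + u *\<^sub>R S (S (S w)) \<in> W" for x y z u
    unfolding S_def using W K w by (intro subspace_add subspace_scale) auto
  have S: "S v$1 = 0" "S v$2 = - 4 * v$2" "S v$3 = - 4 * v$3" "S v$4 = - v$4" "S v$5 = - v$5" "S v$6 = - 9 * v$6" "S v$7 = - 9 * v$7" for v
    by (simp_all add: S_def K_p_square_nth)
  have "(w$1) *\<^sub>R axis 1 1 = 1 *\<^sub>R w + (49/36) *\<^sub>R S w + (14/36) *\<^sub>R S (S w) + (1/36) *\<^sub>R S (S (S w))"
    by (simp add: vec_eq_7 S axis_def)
  then show "(w$1) *\<^sub>R axis 1 1 \<in> W" using in_W by metis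
  have "(w$4) *\<^sub>R axis 4 1 + (w$5) *\<^sub>R axis 5 1 = 0 *\<^sub>R w + (- 36/24) *\<^sub>R S w + (- 13/24) *\<^sub>R S (S w) + (- 1/24) *\<^sub>R S (S (S w))"
    by (simp add: vec_eq_7 S axis_def)
  then show "(w$4) *\<^sub>R axis 4 1 + (w$5) *\<^sub>R axis 5 1 \<in> W" using in_W by metis
  have "(w$2) *\<^sub>R axis 2 1 + (w$3) *\<^sub>R axis 3 1 = 0 *\<^sub>R w + (9/60) *\<^sub>R S w + (10/60) *\<^sub>R S (S w) + (1/60) *\<^sub>R S (S (S w))"
    by (simp add: vec_eq_7 S axis_def)
  then show "(w$2) *\<^sub>R axis 2 1 + (w$3) *\<^sub>R axis 3 1 \<in> W" using in_W by metis
  have "(w$6) *\<^sub>R axis 6 1 + (w$7) *\<^sub>R axis 7 1 = 0 *\<^sub>R w + (- 4/360) *\<^sub>R S w + (- 5/360) *\<^sub>R S (S w) + (- 1/360) *\<^sub>R S (S (S w))"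
    by (simp add: vec_eq_7 S axis_def)
  then show "(w$6) *\<^sub>R axis 6 1 + (w$7) *\<^sub>R axis 7 1 \<in> W" using in_W by metis
qed

lemma P_p_axis:
  "P_p *v axis 1 1 = sqrt6 *\<^sub>R axis 4 1" "P_p *v axis 2 1 = (sqrt10/2) *\<^sub>R axis 4 1 + (sqrt6/2) *\<^sub>R axis 7 1"
  "P_p *v axis 4 1 = - sqrt6 *\<^sub>R axis 1 1 - (sqrt10/2) *\<^sub>R axis 2 1" "P_p *v axis 6 1 = (sqrt6/2) *\<^sub>R axis 3 1"
  by (simp_all add: vec_eq_7 P_p_eq wt1_nth axis_def)

lemma plane_from_vector:
  fixes W :: "(real^7) set"
  assumes W: "subspace W" and w: "x *\<^sub>R u + y *\<^sub>R v \<in> W" "x *\<^sub>R v - y *\<^sub>R u \<in> W" and n: "x \<noteq> 0 \<or> y \<noteq> 0"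
  shows "u \<in> W" "v \<in> W"
proof -
  have p: "x * x + y * y \<noteq> 0" using n by (metis add_nonneg_eq_0_iff mult_eq_0_iff zero_le_square)
  have "x *\<^sub>R (x *\<^sub>R u + y *\<^sub>R v) - y *\<^sub>R (x *\<^sub>R v - y *\<^sub>R u) \<in> W" "y *\<^sub>R (x *\<^sub>R u + y *\<^sub>R v) + x *\<^sub>R (x *\<^sub>R v - y *\<^sub>R u) \<in> W"
    using subspace_diff[OF W subspace_scale[OF W w(1), of x] subspace_scale[OF W w(2), of y]]
      subspace_add[OF W subspace_scale[OF W w(1), of y] subspace_scale[OF W w(2), of x]] by blast+
  then have "(x * x + y * y) *\<^sub>R u \<in> W" "(x * x + y * y) *\<^sub>R v \<in> W" by (simp_all add: algebra_simps)
  then have "inverse (x * x + y * y) *\<^sub>R ((x * x + y * y) *\<^sub>R u) \<in> W" "inverse (x * x + y * y) *\<^sub>R ((x * x + y * y) *\<^sub>R v) \<in> W"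
    using W by (auto intro: subspace_scale simp del: scaleR_scaleR)
  then show "u \<in> W" "v \<in> W" using p by simp_all
qed

text \<open>Invariance under \<open>K_p\<close> splits \<open>W\<close> into full weight spaces, and
  \<open>P_p\<close> connects neighbours: from any weight down to 0, and from 0 back up through 1, 2
  and 3.\<close>

lemma K_P_irreducible:
  fixes W :: "(real^7) set"
  assumes W: "subspace W" and K: "\<And>w. w \<in> W \<Longrightarrow> K_p *v w \<in> W" and P: "\<And>w. w \<in> W \<Longrightarrow> P_p *v w \<in> W"
  shows "W = {0} \<or> W = UNIV"
proof (cases "W = {0}")
  case False
  then obtain w where w: "w \<in> W" "w \<noteq> 0" using subspace_0[OF W] by blast
  have sc: "v \<in> W" if "c *\<^sub>R v \<in> W" "c \<noteq> 0" for c v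
    using subspace_scale[OF W that(1), of "1/c"] that(2) by simp
  have V1: "axis 4 1 \<in> W \<and> axis 5 1 \<in> W" if "v \<in> W" "v$4 \<noteq> 0 \<or> v$5 \<noteq> 0" for v
  proof -
    have 1: "(v$4) *\<^sub>R axis 4 1 + (v$5) *\<^sub>R axis 5 1 \<in> W" using weight_components(2)[OF W K that(1)] .
    have "K_p *v ((v$4) *\<^sub>R axis 4 1 + (v$5) *\<^sub>R axis 5 1) = (v$4) *\<^sub>R axis 5 1 - (v$5) *\<^sub>R axis 4 1"
      by (simp add: vec_eq_7 K_p_nth axis_def)
    then have "(v$4) *\<^sub>R axis 5 1 - (v$5) *\<^sub>R axis 4 1 \<in> W" using K[OF 1] by simp
    then show ?thesis using plane_from_vector[OF W 1 _ that(2)] by blast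
  qed
  have V2: "axis 2 1 \<in> W \<and> axis 3 1 \<in> W" if "v \<in> W" "v$2 \<noteq> 0 \<or> v$3 \<noteq> 0" for v
  proof -
    have 1: "(v$2) *\<^sub>R axis 2 1 + (v$3) *\<^sub>R axis 3 1 \<in> W" using weight_components(3)[OF W K that(1)] .
    have "K_p *v ((v$2) *\<^sub>R axis 2 1 + (v$3) *\<^sub>R axis 3 1) = 2 *\<^sub>R ((v$2) *\<^sub>R axis 3 1 - (v$3) *\<^sub>R axis 2 1)"
      by (simp add: vec_eq_7 K_p_nth axis_def)
    then have "(v$2) *\<^sub>R axis 3 1 - (v$3) *\<^sub>R axis 2 1 \<in> W" using K[OF 1] sc[of 2] by simp
    then show ?thesis using plane_from_vector[OF W 1 _ that(2)] by blast
  qed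
  have V3: "axis 6 1 \<in> W \<and> axis 7 1 \<in> W" if "v \<in> W" "v$6 \<noteq> 0 \<or> v$7 \<noteq> 0" for v
  proof -
    have 1: "(v$6) *\<^sub>R axis 6 1 + (v$7) *\<^sub>R axis 7 1 \<in> W" using weight_components(4)[OF W K that(1)] .
    have "K_p *v ((v$6) *\<^sub>R axis 6 1 + (v$7) *\<^sub>R axis 7 1) = 3 *\<^sub>R ((v$6) *\<^sub>R axis 7 1 - (v$7) *\<^sub>R axis 6 1)"
      by (simp add: vec_eq_7 K_p_nth axis_def)
    then have "(v$6) *\<^sub>R axis 7 1 - (v$7) *\<^sub>R axis 6 1 \<in> W" using K[OF 1] sc[of 3] by simp
    then show ?thesis using plane_from_vector[OF W 1 _ that(2)] by blast
  qed
  have s: "sqrt6 \<noteq> 0" "sqrt10 \<noteq> 0" using sqrt6_10(3,4) by auto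
  have e1_of_V1: "axis 1 1 \<in> W" if "axis 4 1 \<in> W"
  proof -
    have "(- sqrt6) *\<^sub>R axis 1 1 \<in> W" using weight_components(1)[OF W K P[OF that]] unfolding P_p_axis by (simp add: axis_def)
    then show ?thesis using sc[of "- sqrt6"] s by simp
  qed
  have Pn: "(P_p *v axis 2 1)$4 = sqrt10/2" "(P_p *v axis 6 1)$3 = sqrt6/2" "(P_p *v axis 4 1)$2 = - sqrt10/2" "(P_p *v axis 2 1)$7 = sqrt6/2"
    by (simp_all add: P_p_eq wt1_nth axis_def)
  have e4_of_V2: "axis 4 1 \<in> W" if "axis 2 1 \<in> W"
    using V1[OF P[OF that]] s by (simp add: Pn)
  have e2_of_V3: "axis 2 1 \<in> W" if "axis 6 1 \<in> W"
    using V2[OF P[OF that]] s by (simp add: Pn)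
  have "w$1 \<noteq> 0 \<or> (w$4 \<noteq> 0 \<or> w$5 \<noteq> 0) \<or> (w$2 \<noteq> 0 \<or> w$3 \<noteq> 0) \<or> (w$6 \<noteq> 0 \<or> w$7 \<noteq> 0)"
    using w(2) by (auto simp: vec_eq_7)
  then have e1: "axis 1 1 \<in> W"
  proof (elim disjE)
    assume "w$1 \<noteq> 0" then show ?thesis using weight_components(1)[OF W K w(1)] sc by blast
  qed (use V1[OF w(1)] V2[OF w(1)] V3[OF w(1)] e1_of_V1 e4_of_V2 e2_of_V3 in blast)+
  have e4: "axis 4 1 \<in> W" using P[OF e1] sc[OF _ s(1)] by (simp add: P_p_axis)
  then have e5: "axis 5 1 \<in> W" using V1[OF e4] by (simp add: axis_def)
  have e23: "axis 2 1 \<in> W \<and> axis 3 1 \<in> W" by (rule V2[OF P[OF e4]]) (use s in \<open>simp add: Pn\<close>)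
  have e67: "axis 6 1 \<in> W \<and> axis 7 1 \<in> W" by (rule V3[OF P[of "axis 2 1"]]) (use s e23 in \<open>simp_all add: Pn\<close>)
  have "v \<in> W" for v
  proof -
    have "v = (v$1) *\<^sub>R axis 1 1 + (v$2) *\<^sub>R axis 2 1 + (v$3) *\<^sub>R axis 3 1 + (v$4) *\<^sub>R axis 4 1 + (v$5) *\<^sub>R axis 5 1
      + (v$6) *\<^sub>R axis 6 1 + (v$7) *\<^sub>R axis 7 1" by (simp add: vec_eq_7 axis_def)
    also have "\<dots> \<in> W" using W e1 e4 e5 e23 e67 by (intro subspace_add subspace_scale) auto
    finally show ?thesis .
  qed
  then show ?thesis by blast
qed simp

text \<open>For \<open>\<kappa> \<noteq> 1\<close> the weights \<open>0, \<plusminus>\<kappa>\<close> span a proper invariant subspace, because \<open>2\<kappa>\<close> is not a weight.\<close>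

lemma irreducible_weight_one:
  assumes irr: "\<And>W :: (real^7) set. subspace W \<Longrightarrow> (\<And>w. w \<in> W \<Longrightarrow> K_p *v w \<in> W) \<Longrightarrow> (\<And>w. w \<in> W \<Longrightarrow> Y *v w \<in> W) \<Longrightarrow> W = {0} \<or> W = UNIV"
    and \<kappa>: "0 < \<kappa>" and Y: "lie_bracket K_p (lie_bracket K_p Y) = - (\<kappa>\<^sup>2 *\<^sub>R Y)"
  shows "\<kappa> = 1"
proof (rule ccontr)
  assume \<kappa>1: "\<kappa> \<noteq> 1"
  let ?S = "\<lambda>v. K_p *v (K_p *v v)"
  define W where "W = {x + y | x y. K_p *v x = 0 \<and> ?S y = - (\<kappa>\<^sup>2) *\<^sub>R y}"
  have eq: "?S (Y *v x) - 2 *\<^sub>R (K_p *v (Y *v (K_p *v x))) + Y *v ?S x = - (\<kappa>\<^sup>2 *\<^sub>R (Y *v x))" for x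
  proof -
    have "lie_bracket K_p (lie_bracket K_p Y) *v x = - (\<kappa>\<^sup>2 *\<^sub>R (Y *v x))"
      unfolding Y by (simp add: bounded_bilinear.minus_left[OF bounded_bilinear_mv] D_sum_apply)
    then show ?thesis by (simp add: lie_bracket_apply matrix_vector_mult_diff_distrib algebra_simps scaleR_2)
  qed
  have sub: "subspace W"
  proof (rule subspaceI)
    show "0 \<in> W" unfolding W_def by (rule CollectI, rule exI[of _ 0], rule exI[of _ 0]) simp
    show "u + v \<in> W" if "u \<in> W" "v \<in> W" for u v
    proof -
      from that obtain x y x' y' where "u = x + y" "K_p *v x = 0" "?S y = - (\<kappa>\<^sup>2) *\<^sub>R y"
        "v = x' + y'" "K_p *v x' = 0" "?S y' = - (\<kappa>\<^sup>2) *\<^sub>R y'" unfolding W_def by blast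
      then show ?thesis unfolding W_def
        by (intro CollectI exI[of _ "x + x'"] exI[of _ "y + y'"]) (simp add: matrix_vector_right_distrib algebra_simps)
    qed
    show "c *\<^sub>R u \<in> W" if "u \<in> W" for c u
    proof -
      from that obtain x y where "u = x + y" "K_p *v x = 0" "?S y = - (\<kappa>\<^sup>2) *\<^sub>R y" unfolding W_def by blast
      then show ?thesis unfolding W_def
        by (intro CollectI exI[of _ "c *\<^sub>R x"] exI[of _ "c *\<^sub>R y"]) (simp add: matrix_vector_mult_scaleR algebra_simps)
    qed
  qed
  have inW: "x \<in> W" if "K_p *v x = 0" for x
    unfolding W_def by (rule CollectI, rule exI[of _ x], rule exI[of _ 0]) (use that in simp)
  have inW': "y \<in> W" if "?S y = - (\<kappa>\<^sup>2) *\<^sub>R y" for y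
    unfolding W_def by (rule CollectI, rule exI[of _ 0], rule exI[of _ y]) (use that in simp)
  have KW: "K_p *v w \<in> W" if "w \<in> W" for w
  proof -
    from that obtain x y where w: "w = x + y" "K_p *v x = 0" "?S y = - (\<kappa>\<^sup>2) *\<^sub>R y" unfolding W_def by blast
    have "K_p *v ?S y = - (\<kappa>\<^sup>2) *\<^sub>R (K_p *v y)" unfolding w(3) by (simp add: matrix_vector_mult_scaleR linear_neg)
    then have "K_p *v y \<in> W" by (intro inW')
    then show ?thesis using w by (simp add: matrix_vector_right_distrib)
  qed
  have plane: "(\<kappa>\<^sup>2 - 1) * y$4 = 0 \<and> (\<kappa>\<^sup>2 - 1) * y$5 = 0 \<and> (\<kappa>\<^sup>2 - 4) * y$2 = 0 \<and> (\<kappa>\<^sup>2 - 4) * y$3 = 0 \<and>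
     (\<kappa>\<^sup>2 - 9) * y$6 = 0 \<and> (\<kappa>\<^sup>2 - 9) * y$7 = 0 \<and> \<kappa>\<^sup>2 * y$1 = 0" if "?S y = - (\<kappa>\<^sup>2) *\<^sub>R y" for y
    using that by (simp add: vec_eq_7 K_p_square_nth left_diff_distrib)
  have YW: "Y *v w \<in> W" if "w \<in> W" for w
  proof -
    from that obtain x y where w: "w = x + y" "K_p *v x = 0" "?S y = - (\<kappa>\<^sup>2) *\<^sub>R y" unfolding W_def by blast
    have "?S (Y *v x) = - (\<kappa>\<^sup>2) *\<^sub>R (Y *v x)" using eq[of x] w(2) by simp
    then have 1: "Y *v x \<in> W" by (rule inW')
    have "Y *v y \<in> W"
    proof (cases "y = 0")
      case True then show ?thesis using subspace_0[OF sub] by simp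
    next
      case False
      have "\<kappa> = 2 \<or> \<kappa> = 3"
      proof -
        have "\<kappa>\<^sup>2 = 1 \<or> \<kappa>\<^sup>2 = 4 \<or> \<kappa>\<^sup>2 = 9" using plane[OF w(3)] False \<kappa> by (auto simp: vec_eq_7)
        then have "\<kappa>\<^sup>2 = 1\<^sup>2 \<or> \<kappa>\<^sup>2 = 2\<^sup>2 \<or> \<kappa>\<^sup>2 = 3\<^sup>2" by simp
        then show ?thesis using \<kappa> \<kappa>1 by (simp only: power2_eq_iff) auto
      qed
      define u where "u = Y *v y"
      define t where "t = K_p *v (Y *v (K_p *v y))"
      have a: "?S u = 2 *\<^sub>R t"
        using eq[of y] unfolding w(3) u_def t_def by (simp add: matrix_vector_mult_scaleR linear_neg algebra_simps)
      have "K_p *v ?S y = - (\<kappa>\<^sup>2) *\<^sub>R (K_p *v y)" unfolding w(3) by (simp add: matrix_vector_mult_scaleR linear_neg)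
      then have b0: "?S (Y *v (K_p *v y)) = - (2 * \<kappa>\<^sup>2) *\<^sub>R (K_p *v u)"
        using eq[of "K_p *v y"] unfolding w(3) u_def
        by (simp add: matrix_vector_mult_scaleR linear_neg algebra_simps) (simp only: add_eq_0_iff2)
      have "?S (?S u) = 2 *\<^sub>R (K_p *v ?S (Y *v (K_p *v y)))" unfolding a t_def by (simp add: matrix_vector_mult_scaleR)
      also have "\<dots> = - (4 * \<kappa>\<^sup>2) *\<^sub>R ?S u" unfolding b0 by (simp add: matrix_vector_mult_scaleR linear_neg)
      finally have "?S (?S u) = - (4 * \<kappa>\<^sup>2) *\<^sub>R ?S u" .
      \<comment> \<open>For \<kappa> = 2 or 3 the number -4 times the square of \<kappa> is -16 or
        -36, which is no eigenvalue of the square of \<open>K_p\<close>; so \<open>u\<close> has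
        weight 0.\<close>
      then have "K_p *v u = 0"
        using \<open>\<kappa> = 2 \<or> \<kappa> = 3\<close> by (auto simp: vec_eq_7 K_p_square_nth K_p_nth)
      then show ?thesis unfolding u_def by (rule inW)
    qed
    then show ?thesis using 1 w(1) subspace_add[OF sub] by (simp add: matrix_vector_right_distrib)
  qed
  have "W = {0} \<or> W = UNIV" by (rule irr[OF sub KW YW])
  moreover have "axis 1 1 \<in> W" by (rule inW) (simp add: K_p_axis)
  moreover have "axis 1 1 \<noteq> (0::real^7)" by (simp add: axis_eq_0_iff)
  ultimately have "axis 4 1 \<in> W" by blast
  then obtain x y where w: "axis 4 1 = x + y" "K_p *v x = 0" "?S y = - (\<kappa>\<^sup>2) *\<^sub>R y" unfolding W_def by blast
  have "x$4 = 0" using arg_cong[OF w(2), of "\<lambda>v. v$5"] by (simp add: K_p_nth)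
  then have "y$4 = 1" using arg_cong[OF w(1), of "\<lambda>v. v$4"] by simp
  then have "\<kappa>\<^sup>2 = 1" using plane[OF w(3)] by simp
  then show False using \<kappa> \<kappa>1 by (simp add: power2_eq_1_iff)
qed

section \<open>The invariant trace form and the torus action on root components\<close>

lemma matrix_inner_trace: "A \<bullet> B = trace (transpose A ** B)" for A B :: "real^'n^'m"
  by (simp add: inner_vec_def trace_def matrix_matrix_mult_def transpose_def) (rule sum.swap)

text \<open>Cyclicity of the trace. With this invariance the bracket relations between
  \<open>K_p\<close> and \<open>Y\<close> become identities between norms.\<close>

lemma matrix_inner_lie_bracket:
  fixes X A B :: "real^'n^'n"
  assumes X: "transpose X = - X"
  shows "lie_bracket X A \<bullet> B = - (A \<bullet> lie_bracket X B)"
proof -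
  have t: "transpose (lie_bracket X A) = X ** transpose A - transpose A ** X"
    by (simp add: lie_bracket_def linear_diff[OF linear_transpose] matrix_transpose_mul X mm_minus)
  have "lie_bracket X A \<bullet> B = trace ((X ** transpose A) ** B) - trace ((transpose A ** X) ** B)"
    unfolding matrix_inner_trace t
    by (simp add: bounded_bilinear.diff_left[OF bounded_bilinear_mm] trace_sub)
  also have "trace ((X ** transpose A) ** B) = trace (transpose A ** (B ** X))"
    using trace_mul_sym[of X "transpose A ** B"] by (simp add: matrix_mul_assoc)
  also have "trace ((transpose A ** X) ** B) = trace (transpose A ** (X ** B))" by (simp add: matrix_mul_assoc)
  finally show ?thesis
    unfolding matrix_inner_trace lie_bracket_def
    by (simp add: bounded_bilinear.diff_right[OF bounded_bilinear_mm] trace_sub)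
qed

lemma matrix_inner_conj:
  assumes g: "g \<in> G2" shows "(g ** A ** transpose g) \<bullet> (g ** B ** transpose g) = A \<bullet> B"
proof -
  have "transpose (g ** A ** transpose g) = g ** transpose A ** transpose g"
    by (simp add: matrix_transpose_mul transpose_transpose matrix_mul_assoc)
  then have "(g ** A ** transpose g) \<bullet> (g ** B ** transpose g) = trace ((g ** transpose A ** transpose g) ** (g ** B ** transpose g))"
    by (simp add: matrix_inner_trace)
  also have "\<dots> = trace (g ** (transpose A ** B) ** transpose g)" by (rule arg_cong[OF conj_mult[OF g]])
  also have "\<dots> = trace (transpose g ** (g ** (transpose A ** B)))" by (rule trace_mul_sym)
  finally show ?thesis by (simp only: G2_cancel[OF g] matrix_inner_trace)
qed

lemma g2_transpose: assumes "Z \<in> g2" shows "transpose Z = - Z"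
proof -
  have h: "Z $ i $ j = - Z $ j $ i" for i j
    using g2_skew[OF assms, of "axis j 1" "axis i 1"]
    by (simp add: inner_axis inner_axis' matrix_vector_mult_basis column_def)
  show ?thesis
    unfolding vec_eq_iff by (intro allI) (simp only: transpose_def vec_lambda_beta vector_uminus_component, rule h)
qed

lemma K_p_nonzero: "K_p \<noteq> 0"
proof
  assume "K_p = 0"
  then have "(K_p *v axis 4 1)$5 = 0" by simp
  then show False by (simp add: K_p_nth)
qed

lemma tor_one: "tor 1 0 1 0 = mat 1"
  by (rule matrix_eqI) (simp add: vec_eq_7 tor_nth)

lemma C_p_G2: "u \<in> C_p \<Longrightarrow> u \<in> G2"
  by (simp add: C_p_def)

lemma C_p_conj_K: "u \<in> C_p \<Longrightarrow> u ** K_p ** transpose u = K_p"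
  by (auto simp: C_p_def Ad_def G2_matrix_inv)

lemma conj_K_C_p: "u \<in> G2 \<Longrightarrow> u ** K_p ** transpose u = K_p \<Longrightarrow> u \<in> C_p"
  by (auto simp: C_p_def Ad_def G2_matrix_inv)

lemma tor_conj_P:
  assumes "a\<^sup>2 + b\<^sup>2 = 1" "c\<^sup>2 + d\<^sup>2 = 1"
  shows "tor a b c d ** P_p ** transpose (tor a b c d) =
    wt1 (a * (sqrt6/2)) (b * (sqrt6/2)) ((a * c + b * d) * (sqrt10/2)) ((a * d - b * c) * (sqrt10/2))"
  unfolding P_p_eq tor_wt1[OF assms] by simp

text \<open>Fixing \<open>K_p\<close> puts \<open>S\<close> into the torus; fixing
  \<open>P_p\<close> makes both root characters equal to 1.\<close>

lemma centralizer_trivial: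
  assumes S: "S \<in> G2" "S ** K_p ** transpose S = K_p" "S ** P_p ** transpose S = P_p"
  shows "S = mat 1"
proof -
  obtain a b c d where *: "a\<^sup>2 + b\<^sup>2 = 1" "c\<^sup>2 + d\<^sup>2 = 1" "S = tor a b c d"
    using conj_K_C_p[OF S(1,2)] C_p_eq by blast
  have "wt1 (a * (sqrt6/2)) (b * (sqrt6/2)) ((a * c + b * d) * (sqrt10/2)) ((a * d - b * c) * (sqrt10/2)) = wt1 (sqrt6/2) 0 (sqrt10/2) 0"
    using S(3) tor_conj_P[OF *(1,2)] *(3) P_p_eq by simp
  then have r: "a = 1 \<and> b = 0 \<and> a * c + b * d = 1 \<and> a * d - b * c = 0"
    using sqrt6_10(3,4) by (auto simp: wt1_eq_iff)
  then have ab: "a = 1" "b = 0" by blast+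
  from r have "c = 1" "d = 0" unfolding ab by simp_all
  then show ?thesis using ab *(3) tor_one by simp
qed

lemma torus_transitive:
  assumes "p1\<^sup>2 + p2\<^sup>2 = 3/2" "q1\<^sup>2 + q2\<^sup>2 = 5/2"
  obtains u where "u \<in> C_p" "u ** P_p ** transpose u = wt1 p1 p2 q1 q2"
proof -
  define a where "a = p1 / (sqrt6/2)" define b where "b = p2 / (sqrt6/2)"
  define x where "x = q1 / (sqrt10/2)" define y where "y = q2 / (sqrt10/2)"
  \<comment> \<open>The long root sees w times the conjugate of z, so prescribing its phase x + i y
    requires w = z (x + i y).\<close>
  define c where "c = a * x - b * y" define d where "d = a * y + b * x"
  have s: "(sqrt6/2)\<^sup>2 = 3/2" "(sqrt10/2)\<^sup>2 = 5/2" using sqrt6_10 by (simp_all add: power2_eq_square)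
  have ab: "a\<^sup>2 + b\<^sup>2 = 1"
  proof -
    have "a\<^sup>2 + b\<^sup>2 = (p1\<^sup>2 + p2\<^sup>2) / (sqrt6/2)\<^sup>2"
      by (simp only: a_def b_def power_divide[of _ "sqrt6/2"] add_divide_distrib)
    then show ?thesis unfolding s assms by simp
  qed
  have xy: "x\<^sup>2 + y\<^sup>2 = 1"
  proof -
    have "x\<^sup>2 + y\<^sup>2 = (q1\<^sup>2 + q2\<^sup>2) / (sqrt10/2)\<^sup>2"
      by (simp only: x_def y_def power_divide[of _ "sqrt10/2"] add_divide_distrib)
    then show ?thesis unfolding s assms by simp
  qed
  have "c\<^sup>2 + d\<^sup>2 = (a\<^sup>2 + b\<^sup>2) * (x\<^sup>2 + y\<^sup>2)" by (simp add: c_def d_def power2_eq_square algebra_simps)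
  then have cd: "c\<^sup>2 + d\<^sup>2 = 1" by (simp add: ab xy)
  have "a * c + b * d = (a\<^sup>2 + b\<^sup>2) * x" "a * d - b * c = (a\<^sup>2 + b\<^sup>2) * y"
    by (simp_all add: c_def d_def power2_eq_square algebra_simps)
  then have "tor a b c d ** P_p ** transpose (tor a b c d) = wt1 (a * (sqrt6/2)) (b * (sqrt6/2)) (x * (sqrt10/2)) (y * (sqrt10/2))"
    unfolding tor_conj_P[OF ab cd] ab by simp
  also have "\<dots> = wt1 p1 p2 q1 q2" using sqrt6_10(3,4) by (simp add: a_def b_def x_def y_def)
  finally show ?thesis using that[of "tor a b c d"] C_p_eq ab cd by blast
qed

definition F_p :: "real^7^7 \<Rightarrow> real \<Rightarrow> real^7^7" where
  "F_p u \<theta> = u ** T_refl \<theta> ** transpose u"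

lemma F_p_reflection: "u \<in> C_p \<Longrightarrow> F_p u \<theta> \<in> reflections"
  unfolding F_p_def by (intro reflection_conj T_refl_reflection C_p_G2)

lemma F_p_conj_K:
  assumes u: "u \<in> C_p"
  shows "F_p u \<theta> ** K_p ** F_p u \<theta> = cos (2 * \<theta>) *\<^sub>R K_p + sin (2 * \<theta>) *\<^sub>R (u ** P_p ** transpose u)"
proof -
  have "F_p u \<theta> ** K_p ** F_p u \<theta> = F_p u \<theta> ** (u ** K_p ** transpose u) ** F_p u \<theta>" by (simp add: C_p_conj_K[OF u])
  also have "\<dots> = u ** (T_refl \<theta> ** K_p ** T_refl \<theta>) ** transpose u"
    unfolding F_p_def by (simp only: conj_mult[OF C_p_G2[OF u]])
  also have "\<dots> = cos (2 * \<theta>) *\<^sub>R (u ** K_p ** transpose u) + sin (2 * \<theta>) *\<^sub>R (u ** P_p ** transpose u)"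
    unfolding T_refl_conj_K linear_add[OF linear_matrix_conj] linear_scale[OF linear_matrix_conj] ..
  finally show ?thesis by (simp add: C_p_conj_K[OF u])
qed

lemma Q_p_eq: "Q_p = wt1 0 (sqrt6/2) 0 (sqrt10/2)"
  by (simp add: Q_p_def P_p_eq K_p_wt1)

text \<open>For \<open>s \<noteq> 0\<close> the two generators span the plane of \<open>K_p\<close>
  and \<open>P_p\<close>, so the generated algebra is always the span of \<open>K_p\<close>,
  \<open>P_p\<close>, \<open>Q_p\<close>.\<close>

lemma generated_principal:
  assumes s: "s \<noteq> 0"
  shows "principal_su2 (generated_lie_algebra K_p (c *\<^sub>R K_p + s *\<^sub>R P_p))"
proof -
  \<comment> \<open>The factor 2 makes the bracket agree with that of \<open>psi\<close>.\<close>
  define \<Phi> :: "real^3 \<Rightarrow> real^7^7" where "\<Phi> x = 2 *\<^sub>R ((x$1) *\<^sub>R K_p + (x$2) *\<^sub>R P_p + (x$3) *\<^sub>R Q_p)" for x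
  define L where "L = range \<Phi>"
  define K' where "K' = c *\<^sub>R K_p + s *\<^sub>R P_p"
  have lin: "linear \<Phi>" by (rule linearI) (simp_all add: \<Phi>_def algebra_simps)
  have Qb: "lie_bracket P_p K_p = - Q_p" "lie_bracket Q_p P_p = - K_p"
    using Q_p_brackets lie_bracket_anticommute[of P_p K_p] lie_bracket_anticommute[of Q_p P_p] by simp_all
  have br: "lie_bracket (\<Phi> x) (\<Phi> y) = 2 *\<^sub>R \<Phi> (cross3 x y)" for x y
    by (simp add: \<Phi>_def lie_bracket_simps Q_p_brackets Qb cross3_simps algebra_simps)
  have inj: "x = y" if "\<Phi> x = \<Phi> y" for x y
  proof -
    have eq: "(\<Phi> x *v v)$k = (\<Phi> y *v v)$k" for v k using that by simp
    have s6: "sqrt6 \<noteq> 0" using sqrt6_10(3) by simp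
    have "(\<Phi> z *v axis 2 1)$3 = 4 * z$1" "(\<Phi> z *v axis 1 1)$4 = 2 * sqrt6 * z$2" "(\<Phi> z *v axis 1 1)$5 = 2 * sqrt6 * z$3" for z
      by (simp_all add: \<Phi>_def D_sum_apply K_p_nth P_p_eq Q_p_eq wt1_nth axis_def)
    then show ?thesis using eq[of "axis 2 1" 3] eq[of "axis 1 1" 4] eq[of "axis 1 1" 5] s6
      by (simp add: vec_eq_iff[of x] forall_3)
  qed
  have L: "lie_subalgebra L"
    unfolding lie_subalgebra_def L_def
  proof (intro conjI ballI)
    show "subspace (range \<Phi>)" by (rule linear_subspace_image[OF lin subspace_UNIV])
    fix X Y assume "X \<in> range \<Phi>" "Y \<in> range \<Phi>"
    then obtain x y where "X = \<Phi> x" "Y = \<Phi> y" by blast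
    then have "lie_bracket X Y = \<Phi> (2 *\<^sub>R cross3 x y)" by (simp only: br linear_scale[OF lin])
    then show "lie_bracket X Y \<in> range \<Phi>" by blast
  qed
  have KL: "K_p \<in> L" unfolding L_def by (rule range_eqI[of _ _ "vector [1/2, 0, 0]"]) (simp add: \<Phi>_def vector_3)
  have PL: "P_p \<in> L" unfolding L_def by (rule range_eqI[of _ _ "vector [0, 1/2, 0]"]) (simp add: \<Phi>_def vector_3)
  have K'L: "K' \<in> L" unfolding K'_def
    by (rule lie_subalgebraD(2)[OF L lie_subalgebraD(4)[OF L KL KL] lie_subalgebraD(4)[OF L PL PL]])
  let ?G = "generated_lie_algebra K_p K'"
  have "?G = L"
  proof
    show "?G \<subseteq> L" by (rule generated_lie_algebra_props(4)[OF L KL K'L])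
    note G = generated_lie_algebra_props(1)[of K_p K']
    have K: "K_p \<in> ?G" "K' \<in> ?G" by (rule generated_lie_algebra_props)+
    have "P_p = (1/s) *\<^sub>R (K' - c *\<^sub>R K_p)" using s by (simp add: K'_def)
    moreover have "(1/s) *\<^sub>R (K' - c *\<^sub>R K_p) \<in> ?G"
      by (rule lie_subalgebraD(4)[OF G _ K(1)], rule lie_subalgebraD(3)[OF G K(2)], rule lie_subalgebraD(4)[OF G K(1,1)])
    ultimately have P: "P_p \<in> ?G" by simp
    have Q: "Q_p \<in> ?G" unfolding Q_p_def by (rule lie_subalgebraD(1)[OF G K(1) P])
    have sub: "subspace ?G" using G by (simp add: lie_subalgebra_def)
    show "L \<subseteq> ?G" unfolding L_def \<Phi>_def using K P Q by (auto intro!: subspace_scale[OF sub] subspace_add[OF sub])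
  qed
  moreover have "principal_su2 L"
    unfolding principal_su2_def
  proof (intro conjI L)
    show "L \<subseteq> g2" unfolding L_def \<Phi>_def
      using K_p_g2 P_p_g2 g2_lie_bracket[OF K_p_g2 P_p_g2]
      by (auto intro!: subspace_scale[OF subspace_g2] subspace_add[OF subspace_g2] simp: Q_p_def)
    define \<phi> :: "complex^2^2 \<Rightarrow> real^7^7" where "\<phi> X = \<Phi> (vector [Im (X$1$1), Re (X$1$2), Im (X$1$2)])" for X
    have \<phi>\<psi>: "\<phi> (psi x) = \<Phi> x" for x by (simp add: \<phi>_def psi_def \<Phi>_def vector_3)
    have "linear \<phi>" unfolding \<phi>_def \<Phi>_def by (rule linearI) (simp_all add: vector_3 algebra_simps)
    moreover have "bij_betw \<phi> su2 L"
      unfolding bij_betw_def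
    proof
      show "inj_on \<phi> su2" by (rule inj_onI) (metis \<phi>\<psi> inj psi_surj)
      show "\<phi> ` su2 = L" unfolding L_def using \<phi>\<psi> psi_su2 psi_surj by (smt (verit, best) image_iff rangeI subset_antisym subsetI imageE)
    qed
    moreover have "\<phi> (lie_bracket X Y) = lie_bracket (\<phi> X) (\<phi> Y)" if XY: "X \<in> su2" "Y \<in> su2" for X Y
    proof -
      obtain x y where "X = psi x" "Y = psi y" using psi_surj XY by blast
      then show ?thesis
        by (simp add: psi_bracket \<phi>\<psi> br linear_scale[OF \<open>linear \<phi>\<close>])
    qed
    ultimately show "isomorphic_to_su2 L" unfolding isomorphic_to_su2_def by blast
    show "acts_irreducibly L" unfolding acts_irreducibly_def using K_P_irreducible KL PL by blast
  qed
  ultimately show ?thesis by (simp add: K'_def)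
qed

lemma reflection_square_conj: "T \<in> reflections \<Longrightarrow> T ** (T ** X ** T) ** T = X"
proof -
  assume T: "T \<in> reflections"
  have "T ** (T ** X ** T) ** T = (T ** T) ** X ** (T ** T)" by (simp only: matrix_mul_assoc)
  then show ?thesis by (simp add: reflectionD(2)[OF T])
qed

lemma base_partners:
  "principal_partners K_p = {F_p u \<theta> | u \<theta>. u \<in> C_p \<and> 0 < \<theta> \<and> \<theta> < pi / 2}"
proof
  show "{F_p u \<theta> | u \<theta>. u \<in> C_p \<and> 0 < \<theta> \<and> \<theta> < pi / 2} \<subseteq> principal_partners K_p"
  proof
    fix T assume "T \<in> {F_p u \<theta> | u \<theta>. u \<in> C_p \<and> 0 < \<theta> \<and> \<theta> < pi / 2}"
    then obtain u \<theta> where T: "T = F_p u \<theta>" and u: "u \<in> C_p" and \<theta>: "0 < \<theta>" "\<theta> < pi / 2" by blast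
    have "sin (2 * \<theta>) \<noteq> 0" using sin_gt_zero[of "2 * \<theta>"] \<theta> by simp
    then have "principal_su2 ((\<lambda>X. u ** X ** transpose u) ` generated_lie_algebra K_p (cos (2 * \<theta>) *\<^sub>R K_p + sin (2 * \<theta>) *\<^sub>R P_p))"
      by (intro principal_su2_conj C_p_G2 u generated_principal)
    also have "(\<lambda>X. u ** X ** transpose u) ` generated_lie_algebra K_p (cos (2 * \<theta>) *\<^sub>R K_p + sin (2 * \<theta>) *\<^sub>R P_p)
      = generated_lie_algebra K_p (T ** K_p ** T)"
      unfolding generated_lie_algebra_conj[OF C_p_G2[OF u], symmetric] T F_p_conj_K[OF u]
        linear_add[OF linear_matrix_conj] linear_scale[OF linear_matrix_conj] C_p_conj_K[OF u] ..
    finally show "T \<in> principal_partners K_p" using F_p_reflection[OF u] T by (simp add: principal_partners_def)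
  qed
next
  show "principal_partners K_p \<subseteq> {F_p u \<theta> | u \<theta>. u \<in> C_p \<and> 0 < \<theta> \<and> \<theta> < pi / 2}"
  proof
    fix T assume "T \<in> principal_partners K_p"
    then have T: "T \<in> reflections" and pr: "principal_su2 (generated_lie_algebra K_p (T ** K_p ** T))"
      by (auto simp: principal_partners_def)
    define K' where "K' = T ** K_p ** T"
    have TT: "transpose T = T" "T \<in> G2" using reflectionD[OF T] by auto
    have iso: "isomorphic_to_su2 (generated_lie_algebra K_p K')" and irr: "acts_irreducibly (generated_lie_algebra K_p K')"
      using pr by (auto simp: principal_su2_def K'_def)
    have K'g2: "K' \<in> g2" using g2_conj[OF TT(2) K_p_g2] by (simp add: K'_def TT(1))
    obtain a \<kappa> \<eta> Y where K': "K' = a *\<^sub>R K_p + Y" and \<kappa>: "0 < \<kappa>" and \<eta>: "0 < \<eta>"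
      and b1: "lie_bracket K_p (lie_bracket K_p Y) = - (\<kappa>\<^sup>2 *\<^sub>R Y)" and b2: "lie_bracket Y (lie_bracket K_p Y) = \<eta>\<^sup>2 *\<^sub>R K_p"
      by (rule su2_decompose[OF iso refl K_p_nonzero])
    have "\<kappa> = 1"
    proof (rule irreducible_weight_one[OF _ \<kappa> b1])
      fix W :: "(real^7) set"
      assume W: "subspace W" "\<And>w. w \<in> W \<Longrightarrow> K_p *v w \<in> W" "\<And>w. w \<in> W \<Longrightarrow> Y *v w \<in> W"
      have "K' *v w \<in> W" if "w \<in> W" for w
        unfolding K' D_sum_apply using W that by (intro subspace_add subspace_scale) auto
      then have "generated_lie_algebra K_p K' \<subseteq> {X. \<forall>w\<in>W. X *v w \<in> W}"
        using W by (intro generated_lie_algebra_props(4) stabilizer_lie_subalgebra) auto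
      then show "W = {0} \<or> W = UNIV" using irr W(1) unfolding acts_irreducibly_def by blast
    qed
    then have b1: "lie_bracket K_p (lie_bracket K_p Y) = - Y" using b1 by simp
    have Yg2: "Y \<in> g2"
    proof -
      have "Y = K' - a *\<^sub>R K_p" by (simp add: K')
      then show ?thesis using subspace_diff[OF subspace_g2 K'g2 subspace_scale[OF subspace_g2 K_p_g2]] by simp
    qed
    \<comment> \<open>Division by \<eta> normalizes the bracket relations to those satisfied by
      \<open>P_p\<close>.\<close>
    define P' where "P' = (1/\<eta>) *\<^sub>R Y"
    have YP: "Y = \<eta> *\<^sub>R P'" using \<eta> by (simp add: P'_def)
    have P'g2: "P' \<in> g2" unfolding P'_def by (rule subspace_scale[OF subspace_g2 Yg2])
    have w1: "lie_bracket K_p (lie_bracket K_p P') = - P'" by (simp add: P'_def lie_bracket_simps b1)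
    have w2: "lie_bracket P' (lie_bracket K_p P') = K_p" using \<eta> by (simp add: P'_def lie_bracket_simps b2 power2_eq_square)
    obtain p1 p2 q1 q2 where P': "P' = wt1 p1 p2 q1 q2" by (rule weight_one[OF P'g2 w1])
    obtain u where u: "u \<in> C_p" and uP: "u ** P_p ** transpose u = P'"
      using torus_transitive[OF wt1_bracket_K_p[OF w2[unfolded P']]] P' by metis
    note KT = g2_transpose[OF K_p_g2]
    \<comment> \<open>\<open>Y\<close> lies in the image of \<open>ad K_p\<close>, which is
      orthogonal to \<open>K_p\<close> for the invariant form.\<close>
    have KY: "K_p \<bullet> Y = 0"
    proof -
      have "K_p \<bullet> Y = - (K_p \<bullet> lie_bracket K_p (lie_bracket K_p Y))" by (simp add: b1)
      also have "\<dots> = lie_bracket K_p K_p \<bullet> lie_bracket K_p Y" by (simp only: matrix_inner_lie_bracket[OF KT])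
      finally show ?thesis by simp
    qed
    \<comment> \<open>Invariance moves the brackets across, so the norm of \<open>Y\<close> is
      \<eta> times that of \<open>K_p\<close>.\<close>
    have YY: "Y \<bullet> Y = \<eta>\<^sup>2 * (K_p \<bullet> K_p)"
    proof -
      have "Y \<bullet> Y = - (Y \<bullet> lie_bracket K_p (lie_bracket K_p Y))" by (simp add: b1)
      also have "\<dots> = lie_bracket K_p Y \<bullet> lie_bracket K_p Y" by (simp only: matrix_inner_lie_bracket[OF KT])
      also have "\<dots> = - (lie_bracket Y K_p \<bullet> lie_bracket K_p Y)" by (subst lie_bracket_anticommute[of Y K_p]) simp
      also have "\<dots> = K_p \<bullet> lie_bracket Y (lie_bracket K_p Y)" by (simp add: matrix_inner_lie_bracket[OF g2_transpose[OF Yg2]])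
      finally show ?thesis by (simp add: b2)
    qed
    have KK: "K_p \<bullet> K_p \<noteq> 0" using K_p_nonzero by simp
    \<comment> \<open>Conjugation is isometric, so a and \<eta> are the cosine and sine of an angle;
      positivity of \<eta> confines its half to the open interval.\<close>
    have "K' \<bullet> K' = K_p \<bullet> K_p" using matrix_inner_conj[OF TT(2), of K_p K_p] by (simp add: K'_def TT(1))
    then have "a\<^sup>2 * (K_p \<bullet> K_p) + \<eta>\<^sup>2 * (K_p \<bullet> K_p) = K_p \<bullet> K_p"
      by (simp add: K' inner_add_left inner_add_right KY YY inner_commute[of Y K_p] power2_eq_square)
    then have "(a\<^sup>2 + \<eta>\<^sup>2) * (K_p \<bullet> K_p) = 1 * (K_p \<bullet> K_p)" by (simp add: algebra_simps)
    then have a\<eta>: "a\<^sup>2 + \<eta>\<^sup>2 = 1" using KK by (metis mult_cancel_right)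
    have "a\<^sup>2 < 1" using a\<eta> \<eta> by (smt (verit) zero_less_power)
    then have a1: "-1 < a" "a < 1" by (simp_all add: abs_square_less_1 abs_less_iff)
    define \<theta> where "\<theta> = arccos a / 2"
    have \<theta>: "0 < \<theta>" "\<theta> < pi / 2" using arccos_lt_bounded[OF a1] by (auto simp: \<theta>_def)
    have c: "cos (2 * \<theta>) = a" using a1 by (simp add: \<theta>_def)
    have "sin (2 * \<theta>) = sqrt (1 - a\<^sup>2)" using a1 by (simp add: \<theta>_def sin_arccos)
    also have "1 - a\<^sup>2 = \<eta>\<^sup>2" using a\<eta> by simp
    finally have s: "sin (2 * \<theta>) = \<eta>" using \<eta> by simp
    define T' where "T' = F_p u \<theta>"
    have T': "T' \<in> reflections" unfolding T'_def by (rule F_p_reflection[OF u])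
    have T'K: "T' ** K_p ** T' = K'" unfolding T'_def F_p_conj_K[OF u] uP c s K' YP ..
    \<comment> \<open>Both reflections exchange \<open>K_p\<close> and \<open>K'\<close>, so their
      product fixes each of them and hence \<open>P'\<close>.\<close>
    define S where "S = T' ** T"
    have S: "S \<in> G2" unfolding S_def by (intro G2_mult_closed reflectionD(1) T T')
    have St: "S ** X ** transpose S = T' ** (T ** X ** T) ** T'" for X
      by (simp add: S_def matrix_transpose_mul reflectionD(4)[OF T] reflectionD(4)[OF T'] matrix_mul_assoc)
    have SK: "S ** K_p ** transpose S = K_p"
      unfolding St K'_def[symmetric] unfolding T'K[symmetric] by (rule reflection_square_conj[OF T'])
    have SK': "S ** K' ** transpose S = K'"
      unfolding St by (simp only: K'_def reflection_square_conj[OF T]) (simp only: T'K K'_def[symmetric])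
    have SP': "S ** P' ** transpose S = P'"
    proof -
      have "P' = (1/\<eta>) *\<^sub>R (K' - a *\<^sub>R K_p)" by (simp add: P'_def K')
      then show ?thesis
        by (simp only: linear_scale[OF linear_matrix_conj] linear_diff[OF linear_matrix_conj] SK SK')
    qed
    \<comment> \<open>Moving back by \<open>u\<close> turns \<open>P'\<close> into
      \<open>P_p\<close>, where the trivial centralizer applies.\<close>
    define S0 where "S0 = transpose u ** S ** u"
    have uG: "u \<in> G2" by (rule C_p_G2[OF u])
    have S0: "S0 \<in> G2" unfolding S0_def by (intro G2_mult_closed G2_transpose uG S)
    have S0c: "S0 ** X ** transpose S0 = X" if "S ** (u ** X ** transpose u) ** transpose S = u ** X ** transpose u" for X
    proof -
      have "S0 ** X ** transpose S0 = transpose u ** (S ** (u ** X ** transpose u) ** transpose S) ** u"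
        by (simp add: S0_def matrix_transpose_mul transpose_transpose matrix_mul_assoc)
      then show ?thesis unfolding that by (simp only: transpose_conj_cancel(1)[OF uG])
    qed
    have "S0 = mat 1"
      by (rule centralizer_trivial[OF S0]; rule S0c) (simp_all only: C_p_conj_K[OF u] SK uP SP')
    then have "u ** (transpose u ** S ** u) ** transpose u = u ** mat 1 ** transpose u" by (simp add: S0_def)
    then have S1: "T' ** T = mat 1" by (simp add: transpose_conj_cancel(2)[OF uG] G2_transpose_right[OF uG] S_def)
    have "T' ** (T' ** T) = (T' ** T') ** T" by (simp only: matrix_mul_assoc)
    then have "T = T'" using S1 reflectionD(2)[OF T'] by simp
    then show "T \<in> {F_p u \<theta> | u \<theta>. u \<in> C_p \<and> 0 < \<theta> \<and> \<theta> < pi / 2}" using u \<theta> T'_def by blast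
  qed
qed

section \<open>The partners as an embedded submanifold\<close>

lemma matrix_entry: "(A::real^'n^'m) $ i $ j = (A *v axis j 1) $ i"
  by (simp add: matrix_vector_mult_basis column_def)

lemma tor_analytic:
  fixes a b c d :: "'a::euclidean_space \<Rightarrow> real"
  assumes "real_analytic_at a p" "real_analytic_at b p" "real_analytic_at c p" "real_analytic_at d p"
  shows "real_analytic_at (\<lambda>x. tor (a x) (b x) (c x) (d x)) p"
proof (rule real_analytic_at_mat)
  have ac: "real_analytic_at (\<lambda>x. a x * c x - b x * d x) p" "real_analytic_at (\<lambda>x. a x * d x + b x * c x) p"
    by (intro real_analytic_at_diff real_analytic_at_add real_analytic_at_mult_real assms)+
  have neg: "real_analytic_at (\<lambda>x. - f x) p" if "real_analytic_at f p" for f :: "'a \<Rightarrow> real"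
    using real_analytic_at_diff[OF real_analytic_at_const[of 0] that] by simp
  have mat: "\<forall>k l. real_analytic_at (\<lambda>x. (tor (a x) (b x) (c x) (d x) *v axis l 1) $ k) p"
    unfolding forall_7 tor_nth axis_def using assms ac neg[OF assms(2)] neg[OF assms(4)] neg[OF ac(2)]
    by (simp add: algebra_simps)
  then show "real_analytic_at (\<lambda>x. tor (a x) (b x) (c x) (d x) $ k $ l) p" for k l
    unfolding matrix_entry by blast
qed

lemma tor_entries: "tor a b c d $ 4 $ 4 = a" "tor a b c d $ 5 $ 4 = b" "tor a b c d $ 2 $ 2 = c" "tor a b c d $ 3 $ 2 = d"
  unfolding matrix_entry by (simp_all add: tor_nth axis_def)

lemma two_dim_torus_C_p: "two_dim_torus C_p"
proof -
  define \<phi> :: "complex^2 \<Rightarrow> real^7^7" where "\<phi> z = tor (Re (z$1)) (Im (z$1)) (Re (z$2)) (Im (z$2))" for z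
  define h :: "real^7^7 \<Rightarrow> complex^2" where "h A = (\<chi> i. if i = 1 then Complex (A$4$4) (A$5$4) else Complex (A$2$2) (A$3$2))" for A
  let ?S = "{z::complex^2. \<forall>i. cmod (z$i) = 1}"
  have S: "z \<in> ?S \<longleftrightarrow> (Re (z$1))\<^sup>2 + (Im (z$1))\<^sup>2 = 1 \<and> (Re (z$2))\<^sup>2 + (Im (z$2))\<^sup>2 = 1" for z
    by (simp add: forall_2 cmod_def)
  have "analytic_diffeomorphism \<phi> ?S C_p"
  proof (rule analytic_diffeomorphismI[where h=h])
    have "linear (\<lambda>z::complex^2. Re (z$i))" "linear (\<lambda>z::complex^2. Im (z$i))" for i
      by (auto intro!: linearI)
    then show "real_analytic_on \<phi> ?S" unfolding \<phi>_def[abs_def]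
      by (intro real_analytic_at_imp_on tor_analytic real_analytic_at_linear)
    have "linear h" by (rule linearI) (simp_all add: h_def vec_eq_iff forall_2 complex_eq_iff)
    then show "real_analytic_on h C_p" by (intro real_analytic_at_imp_on real_analytic_at_linear)
    show "\<phi> z \<in> C_p \<and> h (\<phi> z) = z" if "z \<in> ?S" for z
    proof
      show "\<phi> z \<in> C_p" using that unfolding S C_p_eq \<phi>_def by blast
      show "h (\<phi> z) = z" by (simp add: h_def \<phi>_def tor_entries vec_eq_iff forall_2)
    qed
    show "h u \<in> ?S \<and> \<phi> (h u) = u" if u: "u \<in> C_p" for u
    proof -
      obtain a b c d where "a\<^sup>2 + b\<^sup>2 = 1" "c\<^sup>2 + d\<^sup>2 = 1" "u = tor a b c d" using u C_p_eq by blast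
      then show ?thesis unfolding S by (simp add: h_def \<phi>_def tor_entries)
    qed
  qed
  moreover have "\<phi> (z * w) = \<phi> z ** \<phi> w" for z w
    by (rule matrix_eqI) (simp add: \<phi>_def vec_eq_7 tor_nth algebra_simps flip: matrix_vector_mul_assoc)
  ultimately show ?thesis unfolding two_dim_torus_def by blast
qed

section \<open>Analytic inverse of the parametrization\<close>

definition tKT :: "real^7^7 \<Rightarrow> real^7^7" where "tKT T = T ** K_p ** T"
definition cos_angle :: "real^7^7 \<Rightarrow> real" where "cos_angle T = (tKT T \<bullet> K_p) / (K_p \<bullet> K_p)"
text \<open>\<open>K_p\<close> vanishes at the entries used here and in \<open>sq\<close>, so on
  partners they show the root components alone, scaled by sin (2\<theta>): twice \<open>p\<close> in
  column 1, and \<open>q1\<close>, \<open>- q2\<close> in column 2.\<close>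

definition sp :: "real^7^7 \<Rightarrow> real" where "sp T = sqrt ((tKT T $ 4 $ 1)\<^sup>2 + (tKT T $ 5 $ 1)\<^sup>2)"
definition sq :: "real^7^7 \<Rightarrow> real" where "sq T = sqrt ((tKT T $ 4 $ 2)\<^sup>2 + (tKT T $ 5 $ 2)\<^sup>2)"

text \<open>\<open>rho\<close> inverts \<open>F_p\<close>: the weight one part of \<open>T K_p T\<close> is \<open>sin (2\<theta>) Ad\<^sub>u P_p\<close>, and the torus acts
  simply transitively on the pairs of arguments of its two root components.\<close>

definition rho :: "real^7^7 \<Rightarrow> (real^7^7) \<times> real" where
  "rho T = (let a = tKT T $ 4 $ 1 / sp T; b = tKT T $ 5 $ 1 / sp T; x = tKT T $ 4 $ 2 / sq T; y = - tKT T $ 5 $ 2 / sq T in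
     (tor a b (a * x - b * y) (a * y + b * x), (1/2) * arccos (cos_angle T)))"

text \<open>Positive radicands and an argument of \<open>arccos\<close> in the open interval: here
  every ingredient of \<open>rho\<close> is analytic as a function of an arbitrary matrix, not just
  of a reflection.\<close>

definition rho_dom :: "(real^7^7) set" where
  "rho_dom = {T. - 1 < cos_angle T \<and> cos_angle T < 1 \<and> 0 < (tKT T $ 4 $ 1)\<^sup>2 + (tKT T $ 5 $ 1)\<^sup>2 \<and> 0 < (tKT T $ 4 $ 2)\<^sup>2 + (tKT T $ 5 $ 2)\<^sup>2}"

lemma tKT_analytic: "real_analytic_at tKT p"
  unfolding tKT_def[abs_def] by (intro real_analytic_at_mm real_analytic_at_ident real_analytic_at_const)

lemma tKT_entry_analytic: "real_analytic_at (\<lambda>T. tKT T $ i $ j) p"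
  by (rule real_analytic_at_linear_compose[OF linear_vec_nth2 tKT_analytic])

lemma cos_angle_analytic: "real_analytic_at cos_angle p"
  unfolding cos_angle_def[abs_def]
  by (intro real_analytic_at_divide real_analytic_at_inner tKT_analytic real_analytic_at_const) (simp add: K_p_nonzero)

lemma sum_squares_analytic: "real_analytic_at (\<lambda>T. (tKT T $ i $ j)\<^sup>2 + (tKT T $ k $ l)\<^sup>2) p"
  unfolding power2_eq_square by (intro real_analytic_at_add real_analytic_at_mult_real tKT_entry_analytic)

lemma rho_analytic:
  assumes "p \<in> rho_dom" shows "real_analytic_at rho p"
proof -
  have sp: "real_analytic_at sp p" "sp p \<noteq> 0"
    unfolding sp_def[abs_def] using assms
    by (auto simp: rho_dom_def intro!: real_analytic_at_compose[OF sum_squares_analytic, of sqrt] real_analytic_at_sqrt)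
  have sq: "real_analytic_at sq p" "sq p \<noteq> 0"
    unfolding sq_def[abs_def] using assms
    by (auto simp: rho_dom_def intro!: real_analytic_at_compose[OF sum_squares_analytic, of sqrt] real_analytic_at_sqrt)
  have a: "real_analytic_at (\<lambda>T. tKT T $ 4 $ 1 / sp T) p" and b: "real_analytic_at (\<lambda>T. tKT T $ 5 $ 1 / sp T) p"
    by (intro real_analytic_at_divide tKT_entry_analytic sp)+
  have x: "real_analytic_at (\<lambda>T. tKT T $ 4 $ 2 / sq T) p"
    by (intro real_analytic_at_divide tKT_entry_analytic sq)
  have y0: "real_analytic_at (\<lambda>T. (0 - tKT T $ 5 $ 2) / sq T) p"
    by (intro real_analytic_at_divide real_analytic_at_diff real_analytic_at_const tKT_entry_analytic sq)
  then have y: "real_analytic_at (\<lambda>T. - tKT T $ 5 $ 2 / sq T) p" by simp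
  have "real_analytic_at (\<lambda>T. arccos (cos_angle T)) p"
    by (rule real_analytic_at_compose[OF cos_angle_analytic real_analytic_at_arccos]) (use assms in \<open>auto simp: rho_dom_def\<close>)
  then have h: "real_analytic_at (\<lambda>T. (1/2) * arccos (cos_angle T)) p"
    by (intro real_analytic_at_mult_real real_analytic_at_const)
  show ?thesis unfolding rho_def[abs_def] Let_def
    by (rule real_analytic_at_Pair[OF _ h])
      (intro tor_analytic real_analytic_at_add real_analytic_at_diff real_analytic_at_mult_real a b x y)
qed

lemma rho_F_p:
  assumes u: "u \<in> C_p" and \<theta>: "0 < \<theta>" "\<theta> < pi/2"
  shows "F_p u \<theta> \<in> rho_dom" "rho (F_p u \<theta>) = (u, \<theta>)"
proof -
  obtain a b c d where ab: "a\<^sup>2 + b\<^sup>2 = 1" and cd: "c\<^sup>2 + d\<^sup>2 = 1" and ut: "u = tor a b c d" using u C_p_eq by blast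
  define x where "x = a * c + b * d"
  define y where "y = a * d - b * c"
  define s where "s = sin (2 * \<theta>)"
  have s: "0 < s" unfolding s_def by (rule sin_gt_zero) (use \<theta> in auto)
  have K': "tKT (F_p u \<theta>) = cos (2 * \<theta>) *\<^sub>R K_p + s *\<^sub>R wt1 (a * (sqrt6/2)) (b * (sqrt6/2)) (x * (sqrt10/2)) (y * (sqrt10/2))"
    using F_p_conj_K[OF u, of \<theta>] tor_conj_P[OF ab cd] by (simp add: tKT_def s_def x_def y_def ut)
  have e: "tKT (F_p u \<theta>) $ 4 $ 1 = (s * sqrt6) * a" "tKT (F_p u \<theta>) $ 5 $ 1 = (s * sqrt6) * b"
    "tKT (F_p u \<theta>) $ 4 $ 2 = (s * sqrt10 / 2) * x" "tKT (F_p u \<theta>) $ 5 $ 2 = - ((s * sqrt10 / 2) * y)"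
    unfolding K' matrix_entry by (simp_all add: D_sum_apply K_p_nth wt1_nth axis_def)
  have xy: "x\<^sup>2 + y\<^sup>2 = 1"
  proof -
    have "x\<^sup>2 + y\<^sup>2 = (a\<^sup>2 + b\<^sup>2) * (c\<^sup>2 + d\<^sup>2)" by (simp add: x_def y_def power2_eq_square algebra_simps)
    then show ?thesis by (simp add: ab cd)
  qed
  have s6: "0 < s * sqrt6" "0 < s * sqrt10 / 2" using s sqrt6_10(3,4) by auto
  have q: "(tKT (F_p u \<theta>) $ 4 $ 1)\<^sup>2 + (tKT (F_p u \<theta>) $ 5 $ 1)\<^sup>2 = (s * sqrt6)\<^sup>2"
    "(tKT (F_p u \<theta>) $ 4 $ 2)\<^sup>2 + (tKT (F_p u \<theta>) $ 5 $ 2)\<^sup>2 = (s * sqrt10 / 2)\<^sup>2"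
  proof -
    have "(k * v)\<^sup>2 + (k * w)\<^sup>2 = k\<^sup>2 * (v\<^sup>2 + w\<^sup>2)" for k v w :: real by (simp add: power_mult_distrib algebra_simps)
    then show "(tKT (F_p u \<theta>) $ 4 $ 1)\<^sup>2 + (tKT (F_p u \<theta>) $ 5 $ 1)\<^sup>2 = (s * sqrt6)\<^sup>2"
      "(tKT (F_p u \<theta>) $ 4 $ 2)\<^sup>2 + (tKT (F_p u \<theta>) $ 5 $ 2)\<^sup>2 = (s * sqrt10 / 2)\<^sup>2"
      unfolding e power2_minus by (simp_all only: ab xy mult_1_right)
  qed
  have sp: "sp (F_p u \<theta>) = s * sqrt6" "sq (F_p u \<theta>) = s * sqrt10 / 2"
    unfolding sp_def sq_def q using s6 by (simp_all only: real_sqrt_unique[OF refl less_imp_le])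
  \<comment> \<open>Weight one elements lie in the image of \<open>ad K_p\<close>, so the inner
    product with \<open>K_p\<close> isolates the cosine.\<close>
  have "K_p \<bullet> wt1 p1 p2 q1 q2 = 0" for p1 p2 q1 q2
  proof -
    have "wt1 p1 p2 q1 q2 = - lie_bracket K_p (lie_bracket K_p (wt1 p1 p2 q1 q2))" by (simp add: K_p_wt1 wt1_minus)
    then have "K_p \<bullet> wt1 p1 p2 q1 q2 = - (K_p \<bullet> lie_bracket K_p (lie_bracket K_p (wt1 p1 p2 q1 q2)))" by (metis inner_minus_right)
    also have "\<dots> = lie_bracket K_p K_p \<bullet> lie_bracket K_p (wt1 p1 p2 q1 q2)"
      by (simp only: matrix_inner_lie_bracket[OF g2_transpose[OF K_p_g2]])
    finally show ?thesis by simp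
  qed
  then have ca: "cos_angle (F_p u \<theta>) = cos (2 * \<theta>)"
    unfolding cos_angle_def K' by (simp add: inner_add_left inner_commute[of "wt1 _ _ _ _"] K_p_nonzero)
  have "\<bar>cos (2 * \<theta>)\<bar> < 1"
  proof -
    have "(cos (2 * \<theta>))\<^sup>2 < 1" using s sin_cos_squared_add[of "2 * \<theta>"] unfolding s_def by (smt (verit) zero_less_power)
    then show ?thesis by (simp add: abs_square_less_1)
  qed
  then show "F_p u \<theta> \<in> rho_dom" unfolding rho_dom_def mem_Collect_eq ca q using s6 by (auto simp: abs_less_iff)
  have ar: "arccos (cos (2 * \<theta>)) = 2 * \<theta>" using \<theta> by (intro arccos_cos) auto
  \<comment> \<open>Multiplication by z undoes the conjugate of z in the long root
    character.\<close>
  have cx: "a * x - b * y = c" "a * y + b * x = d"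
  proof -
    have "a * x - b * y = (a\<^sup>2 + b\<^sup>2) * c" "a * y + b * x = (a\<^sup>2 + b\<^sup>2) * d"
      by (simp_all add: x_def y_def power2_eq_square algebra_simps)
    then show "a * x - b * y = c" "a * y + b * x = d" by (simp_all add: ab)
  qed
  have n0: "s * sqrt6 \<noteq> 0" "s * sqrt10 / 2 \<noteq> 0" using s6 by linarith+
  show "rho (F_p u \<theta>) = (u, \<theta>)"
    unfolding rho_def Let_def sp ca ar e minus_minus nonzero_mult_div_cancel_left[OF n0(1)] nonzero_mult_div_cancel_left[OF n0(2)] cx
    by (simp add: ut)
qed

text \<open>The transpose in place of the inverse makes this analytic on all pairs of a matrix and
  an angle, not just over the torus.\<close>

definition F_amb :: "real^7^7 \<Rightarrow> (real^7^7) \<times> real \<Rightarrow> real^7^7" where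
  "F_amb g p = g ** F_p (fst p) (snd p) ** transpose g"

lemma F_amb_analytic: "real_analytic_at (F_amb g) p"
proof -
  have f: "real_analytic_at (fst :: (real^7^7) \<times> real \<Rightarrow> _) p" and s: "real_analytic_at (snd :: (real^7^7) \<times> real \<Rightarrow> _) p"
    by (rule real_analytic_at_fst_snd[OF real_analytic_at_ident])+
  have "real_analytic_at (\<lambda>p. fst p ** T_refl (snd p) ** transpose (fst p)) p"
    by (intro real_analytic_at_mm f real_analytic_at_compose[OF s T_refl_analytic] real_analytic_at_linear_compose[OF linear_transpose f])
  then show ?thesis unfolding F_amb_def[abs_def] F_p_def
    by (rule real_analytic_at_linear_compose[OF linear_matrix_conj])
qed

definition partner_set :: "real^7^7 \<Rightarrow> (real^7^7) set" where
  "partner_set g = F_amb g ` (C_p \<times> {0<..<pi/2})"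

lemma rho_F_amb:
  assumes g: "g \<in> G2" and p: "p \<in> C_p \<times> {0<..<pi/2}"
  shows "rho (transpose g ** F_amb g p ** g) = p" "transpose g ** F_amb g p ** g \<in> rho_dom"
  using rho_F_p[of "fst p" "snd p"] p by (auto simp: F_amb_def transpose_conj_cancel(1)[OF g])

lemma conjugate_reflection_eq:
  "g \<in> G2 \<Longrightarrow> u \<in> C_p \<Longrightarrow> conjugate_reflection g u \<theta> = F_amb g (u, \<theta>)"
  by (simp add: conjugate_reflection_def F_amb_def F_p_def G2_matrix_inv C_p_G2 matrix_mul_assoc)

lemma linear_conj': "linear (\<lambda>T. transpose g ** T ** (g::real^7^7))"
  by (rule linear_matrix_conj)

lemma partner_diffeo:
  assumes g: "g \<in> G2"
  shows "analytic_diffeomorphism (\<lambda>(u, \<theta>). conjugate_reflection g u \<theta>) (C_p \<times> {0<..<pi/2}) (partner_set g)"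
proof (rule analytic_diffeomorphismI[where h="\<lambda>T. rho (transpose g ** T ** g)"])
  have "real_analytic_on (F_amb g) (C_p \<times> {0<..<pi/2})"
    by (intro real_analytic_at_imp_on F_amb_analytic)
  then show "real_analytic_on (\<lambda>(u, \<theta>). conjugate_reflection g u \<theta>) (C_p \<times> {0<..<pi/2})"
    by (rule real_analytic_on_cong) (auto simp: conjugate_reflection_eq[OF g])
  show "real_analytic_on (\<lambda>T. rho (transpose g ** T ** g)) (partner_set g)"
    by (rule real_analytic_at_imp_on, rule real_analytic_at_compose[OF real_analytic_at_linear[OF linear_conj'] rho_analytic])
      (auto simp: partner_set_def rho_F_amb[OF g])
  show "(case p of (u, \<theta>) \<Rightarrow> conjugate_reflection g u \<theta>) \<in> partner_set g \<and>
      rho (transpose g ** (case p of (u, \<theta>) \<Rightarrow> conjugate_reflection g u \<theta>) ** g) = p" if p: "p \<in> C_p \<times> {0<..<pi/2}" for p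
    using rho_F_amb[OF g p] p by (auto simp: partner_set_def conjugate_reflection_eq[OF g])
  show "rho (transpose g ** T ** g) \<in> C_p \<times> {0<..<pi/2} \<and>
      (case rho (transpose g ** T ** g) of (u, \<theta>) \<Rightarrow> conjugate_reflection g u \<theta>) = T" if "T \<in> partner_set g" for T
    using that rho_F_amb[OF g] by (auto simp: partner_set_def conjugate_reflection_eq[OF g])
qed

lemma partner_set_reflections: "g \<in> G2 \<Longrightarrow> partner_set g \<subseteq> reflections"
  using reflection_conj[OF F_p_reflection] by (auto simp: partner_set_def F_amb_def)

text \<open>Near a base point, the sines of the two torus angle differences together with \<theta>
  serve as three local coordinates. \<open>B\<close> reads them off through \<open>rho\<close>, and
  \<open>A\<close> rebuilds the reflection from them, which are the data \<open>slice_chart\<close>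
  asks for.\<close>

lemma partner_slice:
  assumes g: "g \<in> G2" and p: "p \<in> partner_set g"
  shows "\<exists>U (V :: (real^8) set) f W. openin (top_of_set reflections) U \<and> p \<in> U \<and> open V \<and>
      analytic_diffeomorphism f U V \<and> subspace W \<and> dim W = 3 \<and> f ` (U \<inter> partner_set g) = V \<inter> W"
proof -
  have pr: "p \<in> reflections" using p partner_set_reflections[OF g] by blast
  obtain U and V :: "(real^8) set" and f where ch: "openin (top_of_set reflections) U" "p \<in> U" "open V" "analytic_diffeomorphism f U V"
    using reflections_chart[OF pr] by blast
  obtain u0 \<theta>0 where u0: "u0 \<in> C_p" and \<theta>0: "0 < \<theta>0" "\<theta>0 < pi/2" and p0: "p = F_amb g (u0, \<theta>0)"
    using p by (auto simp: partner_set_def)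
  obtain a0 b0 c0 d0 where ab0: "a0\<^sup>2 + b0\<^sup>2 = 1" and cd0: "c0\<^sup>2 + d0\<^sup>2 = 1" and ut0: "u0 = tor a0 b0 c0 d0"
    using u0 C_p_eq by blast
  define r where "r T = rho (transpose g ** T ** g)" for T
  define ra rb rc rd where "ra T = fst (r T) $ 4 $ 4" and "rb T = fst (r T) $ 5 $ 4" and "rc T = fst (r T) $ 2 $ 2" and "rd T = fst (r T) $ 3 $ 2" for T
  \<comment> \<open>The first two entries are the imaginary parts of z and w times the conjugates of
    their base values: sines of angle differences.\<close>
  define B :: "real^7^7 \<Rightarrow> real^3" where "B T = (\<chi> i. if i = 1 then rb T * a0 - ra T * b0 else if i = 2 then rd T * c0 - rc T * d0 else snd (r T))" for T
  \<comment> \<open>Real and imaginary part of x + i y rotated by the angle between -\<pi>/2 and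
    \<pi>/2 whose sine is \<open>s\<close>.\<close>
  define ca cb where "ca x y s = x * sqrt (1 - s * s) - y * s" and "cb x y s = y * sqrt (1 - s * s) + x * s" for x y s :: real
  define tt where "tt s = tor (ca a0 b0 (s$1)) (cb a0 b0 (s$1)) (ca c0 d0 (s$2)) (cb c0 d0 (s$2))" for s :: "real^3"
  define A where "A s = F_amb g (tt s, s$3)" for s :: "real^3"
  have rF: "r (F_amb g q) = q" if "q \<in> C_p \<times> {0<..<pi/2}" for q using rho_F_amb[OF g that] by (simp add: r_def)
  have rp: "r p = (u0, \<theta>0)" unfolding p0 by (rule rF) (use u0 \<theta>0 in auto)
  have rat: "real_analytic_at r p"
    unfolding r_def[abs_def]
    by (rule real_analytic_at_compose[OF real_analytic_at_linear[OF linear_conj'] rho_analytic])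
      (use rho_F_amb(2)[OF g, of "(u0, \<theta>0)"] u0 \<theta>0 p0 in auto)
  have re: "real_analytic_at (\<lambda>T. fst (r T) $ i $ j) p" for i j
    by (rule real_analytic_at_linear_compose[OF linear_vec_nth2 real_analytic_at_fst_snd(1)[OF rat]])
  note rabcd = re[of 4 4, folded ra_def] re[of 5 4, folded rb_def] re[of 2 2, folded rc_def] re[of 3 2, folded rd_def]
  have Bat: "real_analytic_at B p"
  proof (rule real_analytic_at_vec)
    have "\<forall>k. real_analytic_at (\<lambda>T. B T $ k) p"
      unfolding forall_3 B_def
      by (simp, intro conjI real_analytic_at_diff real_analytic_at_mult_real real_analytic_at_const rabcd real_analytic_at_fst_snd(2)[OF rat])
    then show "real_analytic_at (\<lambda>T. B T $ k) p" for k by blast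
  qed
  have Bp: "B p = (\<chi> i. if i = 3 then \<theta>0 else 0)"
    by (simp add: vec_eq_iff forall_3 B_def ra_def rb_def rc_def rd_def rp ut0 tor_entries)
  have c1: "real_analytic_at (\<lambda>s::real^3. s $ k) q" for k q by (rule real_analytic_at_linear[OF linear_vec_nth])
  have Aat: "real_analytic_at A (B p)"
  proof -
    have sq: "real_analytic_at (\<lambda>s::real^3. sqrt (1 - s$k * s$k)) (B p)" if "k = 1 \<or> k = 2" for k
      by (rule real_analytic_at_compose[where g=sqrt])
        (use that in \<open>auto intro!: real_analytic_at_diff real_analytic_at_mult_real c1 real_analytic_at_sqrt simp: Bp\<close>)
    have "real_analytic_at (\<lambda>s::real^3. ca x y (s$k)) (B p)" "real_analytic_at (\<lambda>s::real^3. cb x y (s$k)) (B p)" if "k = 1 \<or> k = 2" for x y k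
      unfolding ca_def cb_def
      by (intro real_analytic_at_diff real_analytic_at_add real_analytic_at_mult_real real_analytic_at_const c1 sq[OF that])+
    then have "real_analytic_at (\<lambda>s. (tt s, s$3)) (B p)"
      unfolding tt_def[abs_def] by (intro real_analytic_at_Pair tor_analytic c1) auto
    then show ?thesis unfolding A_def[abs_def] by (rule real_analytic_at_compose[OF _ F_amb_analytic])
  qed
  define N :: "(real^3) set" where "N = {s. -1 < s$1 \<and> s$1 < 1 \<and> -1 < s$2 \<and> s$2 < 1 \<and> 0 < s$3 \<and> s$3 < pi/2}"
  have oN: "open N" unfolding N_def
    by (intro open_Collect_conj open_Collect_less continuous_intros)
  have BpN: "B p \<in> N" using \<theta>0 by (simp add: N_def Bp)
  have circ: "(ca x y s)\<^sup>2 + (cb x y s)\<^sup>2 = 1" "cb x y s * x - ca x y s * y = s" if "x\<^sup>2 + y\<^sup>2 = 1" "-1 < s" "s < 1" for x y s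
  proof -
    have "s * s \<le> 1" using that(2,3) abs_square_le_1[of s] by (simp add: power2_eq_square abs_le_iff)
    then have e: "(sqrt (1 - s * s))\<^sup>2 = 1 - s\<^sup>2" by (simp add: power2_eq_square)
    have "(ca x y s)\<^sup>2 + (cb x y s)\<^sup>2 = (x\<^sup>2 + y\<^sup>2) * ((sqrt (1 - s * s))\<^sup>2 + s\<^sup>2)"
      unfolding ca_def cb_def by (simp only: power2_eq_square) (simp add: algebra_simps)
    then show "(ca x y s)\<^sup>2 + (cb x y s)\<^sup>2 = 1" by (simp add: e that)
    have "cb x y s * x - ca x y s * y = (x\<^sup>2 + y\<^sup>2) * s"
      unfolding ca_def cb_def by (simp only: power2_eq_square) (simp add: algebra_simps)
    then show "cb x y s * x - ca x y s * y = s" by (simp add: that)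
  qed
  have circ': "ca x y (v * x - w * y) = w \<and> cb x y (v * x - w * y) = v" if "x\<^sup>2 + y\<^sup>2 = 1" "w\<^sup>2 + v\<^sup>2 = 1" "0 < w * x + v * y" for x y v w
  proof -
    have "(w * x + v * y)\<^sup>2 + (v * x - w * y)\<^sup>2 = (x\<^sup>2 + y\<^sup>2) * (w\<^sup>2 + v\<^sup>2)" by (simp add: power2_eq_square algebra_simps)
    then have "1 - (v * x - w * y) * (v * x - w * y) = (w * x + v * y)\<^sup>2" by (simp add: that power2_eq_square[of "v * x - w * y"])
    then have e: "sqrt (1 - (v * x - w * y) * (v * x - w * y)) = w * x + v * y" using that(3) by simp
    have "ca x y (v * x - w * y) = (x\<^sup>2 + y\<^sup>2) * w" "cb x y (v * x - w * y) = (x\<^sup>2 + y\<^sup>2) * v"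
      unfolding ca_def cb_def e by (simp_all add: power2_eq_square algebra_simps)
    then show ?thesis by (simp add: that)
  qed
  have AN: "A s \<in> partner_set g \<and> B (A s) = s" if s: "s \<in> N" for s
  proof -
    have tC: "tt s \<in> C_p" unfolding C_p_eq tt_def
      using circ(1)[OF ab0] circ(1)[OF cd0] s unfolding N_def by blast
    then have q: "(tt s, s$3) \<in> C_p \<times> {0<..<pi/2}" using s by (simp add: N_def)
    have rA: "r (A s) = (tt s, s$3)" unfolding A_def by (rule rF[OF q])
    have "B (A s) = s"
      using circ(2)[OF ab0, of "s$1"] circ(2)[OF cd0, of "s$2"] s
      by (simp add: vec_eq_iff forall_3 B_def ra_def rb_def rc_def rd_def rA tt_def tor_entries N_def)
    then show ?thesis using q by (auto simp: A_def partner_set_def)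
  qed
  have h1: "real_analytic_at (\<lambda>T. ra T * a0 + rb T * b0) p" and h2: "real_analytic_at (\<lambda>T. rc T * c0 + rd T * d0) p"
    by (intro real_analytic_at_add real_analytic_at_mult_real real_analytic_at_const rabcd)+
  \<comment> \<open>Positive cosines select the branch of the square root, so that the sine
    determines the rotation.\<close>
  have "0 < ra p * a0 + rb p * b0" "0 < rc p * c0 + rd p * d0"
    using ab0 cd0 by (simp_all add: ra_def rb_def rc_def rd_def rp ut0 tor_entries power2_eq_square)
  then obtain O1 O2 where O1: "open O1" "p \<in> O1" "\<And>T. T \<in> O1 \<Longrightarrow> ra T * a0 + rb T * b0 \<in> {0<..}"
    and O2: "open O2" "p \<in> O2" "\<And>T. T \<in> O2 \<Longrightarrow> rc T * c0 + rd T * d0 \<in> {0<..}"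
    using isCont_open_preimage[OF real_analytic_at_imp_continuous[OF h1], of "{0<..}"]
      isCont_open_preimage[OF real_analytic_at_imp_continuous[OF h2], of "{0<..}"] by (metis greaterThan_iff open_greaterThan)
  have AB: "A (B T) = T" if T: "T \<in> partner_set g" "T \<in> O1 \<inter> O2" for T
  proof -
    obtain u \<theta> where q: "(u, \<theta>) \<in> C_p \<times> {0<..<pi/2}" and Tq: "T = F_amb g (u, \<theta>)" using T(1) by (auto simp: partner_set_def)
    then obtain a b c d where ab: "a\<^sup>2 + b\<^sup>2 = 1" and cd: "c\<^sup>2 + d\<^sup>2 = 1" and ut: "u = tor a b c d" using C_p_eq by blast
    have rT: "r T = (u, \<theta>)" unfolding Tq by (rule rF[OF q])
    have rr: "ra T = a" "rb T = b" "rc T = c" "rd T = d" by (simp_all add: ra_def rb_def rc_def rd_def rT ut tor_entries)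
    have "0 < a * a0 + b * b0" "0 < c * c0 + d * d0" using O1(3)[of T] O2(3)[of T] T(2) by (simp_all add: rr)
    then have "tt (B T) = u" "B T $ 3 = \<theta>"
      using circ'[OF ab0 ab] circ'[OF cd0 cd] by (simp_all add: tt_def B_def rr rT ut)
    then show ?thesis by (simp add: A_def Tq)
  qed
  have "\<exists>U (V :: (real^8) set) f W. openin (top_of_set reflections) U \<and> p \<in> U \<and> open V \<and>
      analytic_diffeomorphism f U V \<and> subspace W \<and> dim W = DIM(real^3) \<and> f ` (U \<inter> partner_set g) = V \<inter> W"
    by (rule slice_chart[OF ch partner_set_reflections[OF g] p open_Int[OF O1(1) O2(1)] _ Bat Aat oN BpN AN AB])
      (use O1 O2 in auto)
  then show ?thesis by simp
qed

lemma partner_embedded: "g \<in> G2 \<Longrightarrow> embedded_analytic_submanifold TYPE(real^8) 3 5 reflections (partner_set g)"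
  unfolding embedded_analytic_submanifold_def
  using reflections_analytic_manifold partner_set_reflections partner_slice by simp

section \<open>Normal form of derivations with principal spectrum\<close>

lemma spectrum_real:
  fixes Z :: "real^'n^'n"
  assumes "\<i> * complex_of_real \<kappa> \<in> complex_spectrum Z"
  obtains a b where "a \<noteq> 0 \<or> b \<noteq> 0" "Z *v a = - (\<kappa> *\<^sub>R b)" "Z *v b = \<kappa> *\<^sub>R a"
proof -
  obtain v :: "complex^'n" where v: "v \<noteq> 0" "(\<chi> i j. complex_of_real (Z$i$j)) *v v = (\<i> * complex_of_real \<kappa>) *s v"
    using assms unfolding complex_spectrum_def by blast
  let ?a = "\<chi> i. Re (v$i)" and ?b = "\<chi> i. Im (v$i)"
  have e: "(\<Sum>j\<in>UNIV. complex_of_real (Z$i$j) * v$j) = \<i> * complex_of_real \<kappa> * v$i" for i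
    using arg_cong[OF v(2), of "\<lambda>w. w$i"] by (simp add: matrix_vector_mult_def)
  have "Re (\<Sum>j\<in>UNIV. complex_of_real (Z$i$j) * v$j) = - \<kappa> * Im (v$i)"
    "Im (\<Sum>j\<in>UNIV. complex_of_real (Z$i$j) * v$j) = \<kappa> * Re (v$i)" for i
    unfolding e by simp_all
  then have "Z *v ?a = - (\<kappa> *\<^sub>R ?b)" "Z *v ?b = \<kappa> *\<^sub>R ?a"
    by (simp_all add: vec_eq_iff matrix_vector_mult_def)
  moreover have "?a \<noteq> 0 \<or> ?b \<noteq> 0" using v(1) by (auto simp: vec_eq_iff complex_eq_iff)
  ultimately show ?thesis by (rule that[rotated])
qed

lemma normalize_vec:
  fixes x :: "'a::real_inner"
  assumes "x \<noteq> 0" obtains r where "r \<noteq> 0" "(r *\<^sub>R x) \<bullet> (r *\<^sub>R x) = 1"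
proof
  show "inverse (norm x) \<noteq> 0" using assms by simp
  show "(inverse (norm x) *\<^sub>R x) \<bullet> (inverse (norm x) *\<^sub>R x) = 1"
    using assms by (simp add: dot_square_norm power2_eq_square)
qed

lemma mv_simps:
  "(A::real^'n^'m) *v (x + y) = A *v x + A *v y" "A *v (x - y) = A *v x - A *v y" "A *v (r *\<^sub>R x) = r *\<^sub>R (A *v x)" "A *v (- x) = - (A *v x)"
  using linear_add[OF matrix_vector_mul_linear] linear_diff[OF matrix_vector_mul_linear]
    linear_scale[OF matrix_vector_mul_linear] linear_neg[OF matrix_vector_mul_linear] by auto

text \<open>Left multiplication by a unit vector \<open>f1\<close> of the kernel of \<open>Z\<close> is a complex structure on the orthogonal
  complement of \<open>f1\<close> commuting with \<open>Z\<close>.\<close>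

lemma complex_eigenvector:
  assumes Z: "Z \<in> g2" and f1: "f1 \<bullet> f1 = 1" "Z *v f1 = 0" and \<kappa>: "\<kappa> \<noteq> 0" "\<i> * complex_of_real \<kappa> \<in> complex_spectrum Z"
  obtains f \<tau> where "f \<bullet> f = 1" "f1 \<bullet> f = 0" "\<bar>\<tau>\<bar> = \<bar>\<kappa>\<bar>" "Z *v f = \<tau> *\<^sub>R (f1 \<star> f)"
proof -
  obtain a b where ab: "a \<noteq> 0 \<or> b \<noteq> 0" and Za: "Z *v a = - (\<kappa> *\<^sub>R b)" and Zb: "Z *v b = \<kappa> *\<^sub>R a"
    using spectrum_real[OF \<kappa>(2)] by blast
  have "\<kappa> * (f1 \<bullet> a) = 0" "\<kappa> * (f1 \<bullet> b) = 0"
    using g2_skew[OF Z, of f1 b] g2_skew[OF Z, of f1 a] by (simp_all add: f1 Za Zb)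
  then have o: "f1 \<bullet> a = 0" "f1 \<bullet> b = 0" using \<kappa>(1) by auto
  have L: "Z *v (f1 \<star> x) = f1 \<star> (Z *v x)" for x by (simp add: g2_der[OF Z] f1 imag_product_simps)
  note goal = that
  have fin: thesis if "p \<noteq> 0" "f1 \<bullet> p = 0" "Z *v p = \<tau> *\<^sub>R (f1 \<star> p)" "\<bar>\<tau>\<bar> = \<bar>\<kappa>\<bar>" for p \<tau>
  proof -
    obtain r where "(r *\<^sub>R p) \<bullet> (r *\<^sub>R p) = 1" using normalize_vec[OF \<open>p \<noteq> 0\<close>] by blast
    then show thesis
      by (rule goal[of _ \<tau>]) (use \<open>f1 \<bullet> p = 0\<close> \<open>Z *v p = _\<close> \<open>\<bar>\<tau>\<bar> = _\<close> in \<open>simp_all add: mv_simps imag_product_simps\<close>)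
  qed
  have LL: "f1 \<star> (f1 \<star> x) = - x" if "f1 \<bullet> x = 0" for x using that by (simp add: imag_product_left f1)
  \<comment> \<open>With \<open>f1\<close> acting as imaginary unit, \<open>a + f1 \<star> b\<close>
    and \<open>a - f1 \<star> b\<close> satisfy the eigenvector equation for \<kappa> and -\<kappa>;
    they cannot both vanish.\<close>
  show thesis
  proof (cases "a + f1 \<star> b = 0")
    case False
    show thesis
      by (rule fin[OF False, of \<kappa>]) (simp_all add: o inner_add_right mv_simps L Za Zb imag_product_simps LL algebra_simps)
  next
    case True
    have "a - f1 \<star> b \<noteq> 0"
    proof
      assume "a - f1 \<star> b = 0"
      with True have "2 *\<^sub>R a = 0" "2 *\<^sub>R (f1 \<star> b) = 0" by (simp_all add: scaleR_2)
      then have "a = 0" "f1 \<star> b = 0" by simp_all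
      with LL[OF o(2)] ab show False by (simp add: imag_product_simps)
    qed
    then show thesis
      by (rule fin[of _ "- \<kappa>"]) (simp_all add: o inner_diff_right mv_simps L Za Zb imag_product_simps LL algebra_simps)
  qed
qed

lemma g2_square_orthogonal:
  assumes Z: "Z \<in> g2" and x: "Z *v (Z *v x) = s *\<^sub>R x" and y: "Z *v (Z *v y) = t *\<^sub>R y" and st: "s \<noteq> t"
  shows "x \<bullet> y = 0"
proof -
  have "(Z *v (Z *v x)) \<bullet> y = x \<bullet> (Z *v (Z *v y))" by (simp add: g2_skew[OF Z])
  then have "s * (x \<bullet> y) = t * (x \<bullet> y)" by (simp add: x y)
  then show ?thesis using st by simp
qed

text \<open>Unit vectors of weights 0, 2 and 1 form a basic triple, as the square of
  \<open>Z\<close> separates their weight spaces. The resulting \<open>g\<close> takes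
  \<open>Z\<close> to a multiple of \<open>K_p\<close> once the relative sign of two weights is
  settled.\<close>

lemma principal_spectrum_conj:
  assumes Z: "Z \<in> g2" and spec: "principal_spectrum Z"
  shows "\<exists>c g. c \<noteq> 0 \<and> g \<in> G2 \<and> Z = c *\<^sub>R Ad g K_p"
proof -
  obtain l where l: "0 < l" and sp: "complex_spectrum Z =
      {0, \<i> * of_real l, - (\<i> * of_real l), 2 * \<i> * of_real l, - (2 * \<i> * of_real l), 3 * \<i> * of_real l, - (3 * \<i> * of_real l)}"
    using spec unfolding principal_spectrum_def by blast
  have sp1: "\<i> * complex_of_real 0 \<in> complex_spectrum Z" "\<i> * complex_of_real l \<in> complex_spectrum Z"
    "\<i> * complex_of_real (2 * l) \<in> complex_spectrum Z" "\<i> * complex_of_real (3 * l) \<in> complex_spectrum Z"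
    unfolding sp by (simp_all add: mult.assoc mult.left_commute)
  obtain a b where ab: "a \<noteq> 0 \<or> b \<noteq> 0" and Zab: "Z *v a = 0" "Z *v b = 0"
    using spectrum_real[OF sp1(1)] by (metis neg_equal_0_iff_equal scaleR_zero_left)
  have "\<exists>f1. f1 \<bullet> f1 = 1 \<and> Z *v f1 = 0"
  proof -
    obtain x where x: "x \<noteq> 0" "Z *v x = 0" using ab Zab by blast
    obtain r where "(r *\<^sub>R x) \<bullet> (r *\<^sub>R x) = 1" using normalize_vec[OF x(1)] by blast
    then show ?thesis using x(2) by (intro exI[of _ "r *\<^sub>R x"]) (simp add: mv_simps)
  qed
  then obtain f1 where f1: "f1 \<bullet> f1 = 1" "Z *v f1 = 0" by blast
  have l0: "l \<noteq> 0" "2 * l \<noteq> 0" "3 * l \<noteq> 0" using l by auto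
  obtain f4 t4 where f4: "f4 \<bullet> f4 = 1" "f1 \<bullet> f4 = 0" "\<bar>t4\<bar> = \<bar>l\<bar>" "Z *v f4 = t4 *\<^sub>R (f1 \<star> f4)"
    using complex_eigenvector[OF Z f1 l0(1) sp1(2)] by blast
  obtain f2 t2 where f2: "f2 \<bullet> f2 = 1" "f1 \<bullet> f2 = 0" "\<bar>t2\<bar> = \<bar>2 * l\<bar>" "Z *v f2 = t2 *\<^sub>R (f1 \<star> f2)"
    using complex_eigenvector[OF Z f1 l0(2) sp1(3)] by blast
  obtain f6 t6 where f6: "f6 \<bullet> f6 = 1" "f1 \<bullet> f6 = 0" "\<bar>t6\<bar> = \<bar>3 * l\<bar>" "Z *v f6 = t6 *\<^sub>R (f1 \<star> f6)"
    using complex_eigenvector[OF Z f1 l0(3) sp1(4)] by blast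
  have L: "Z *v (f1 \<star> x) = f1 \<star> (Z *v x)" for x by (simp add: g2_der[OF Z] f1 imag_product_simps)
  have LL: "f1 \<star> (f1 \<star> x) = - x" if "f1 \<bullet> x = 0" for x using that by (simp add: imag_product_left f1)
  have tt: "t4 * t4 = l * l" "t2 * t2 = 4 * (l * l)" "t6 * t6 = 9 * (l * l)" "l * l > 0"
    using f4(3) f2(3) f6(3) l abs_mult_self_eq[of t4] abs_mult_self_eq[of t2] abs_mult_self_eq[of t6] mult_pos_pos[OF l l] by simp_all
  have ZZ: "Z *v (Z *v f4) = (- (l * l)) *\<^sub>R f4" "Z *v (Z *v f2) = (- (4 * (l * l))) *\<^sub>R f2" "Z *v (Z *v f6) = (- (9 * (l * l))) *\<^sub>R f6"
    by (simp_all add: f4 f2 f6 mv_simps L imag_product_simps LL tt)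
  have ZZ2: "Z *v (Z *v (f1 \<star> f2)) = (- (4 * (l * l))) *\<^sub>R (f1 \<star> f2)" unfolding L ZZ by (simp add: imag_product_simps)
  have o: "f2 \<bullet> f4 = 0" "(f1 \<star> f2) \<bullet> f4 = 0"
    using g2_square_orthogonal[OF Z ZZ(2,1)] g2_square_orthogonal[OF Z ZZ2 ZZ(1)] tt(4) l0(1) by auto
  obtain g where g: "g \<in> G2" and ga: "g *v axis 1 1 = f1" "g *v axis 2 1 = f2" "g *v axis 3 1 = f1 \<star> f2" "g *v axis 4 1 = f4"
      "g *v axis 5 1 = f1 \<star> f4" "g *v axis 6 1 = f2 \<star> f4" "g *v axis 7 1 = (f1 \<star> f2) \<star> f4"
    using basic_triple[OF f1(1) f2(1) f4(1) f2(2) f4(2) o] by blast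
  define X where "X = transpose g ** Z ** g"
  have X: "X \<in> g2" using g2_conj[OF G2_transpose[OF g] Z] by (simp add: X_def)
  have Xe: "X *v x = transpose g *v (Z *v (g *v x))" for x by (simp add: X_def flip: matrix_vector_mul_assoc)
  have gt: "transpose g *v f1 = axis 1 1" "transpose g *v (f1 \<star> f2) = axis 3 1" "transpose g *v (f1 \<star> f4) = axis 5 1"
    using ga G2_cancel[OF g] by metis+
  have X124: "X *v axis 1 1 = 0" "X *v axis 2 1 = t2 *\<^sub>R axis 3 1" "X *v axis 4 1 = t4 *\<^sub>R axis 5 1"
    by (simp_all add: Xe ga f1 f2 f4 mv_simps gt)
  have L': "X *v (axis 1 1 \<star> x) = axis 1 1 \<star> (X *v x)" for x by (simp add: g2_der[OF X] X124 imag_product_simps)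
  have X35: "X *v axis 3 1 = - (t2 *\<^sub>R axis 2 1)" "X *v axis 5 1 = - (t4 *\<^sub>R axis 4 1)"
    using L'[of "axis 2 1"] L'[of "axis 4 1"] by (simp_all add: axis_product X124 imag_product_simps)
  have X6: "X *v axis 6 1 = (t2 + t4) *\<^sub>R axis 7 1"
    using g2_der[OF X, of "axis 2 1" "axis 4 1"] by (simp add: axis_product X124 imag_product_simps algebra_simps)
  have "- (X *v axis 7 1) = (t2 + t4) *\<^sub>R axis 6 1"
    using L'[of "axis 6 1"] by (simp add: axis_product X6 imag_product_simps mv_simps)
  then have X7: "X *v axis 7 1 = - ((t2 + t4) *\<^sub>R axis 6 1)" by (metis minus_minus)
  \<comment> \<open>Opposite signs would give e2 e4 the same weight as e4 up to sign, leaving no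
    eigenvalue \<open>- (9 * (l * l))\<close> for the square, although \<open>f6\<close> has
    it.\<close>
  have t24: "t2 = 2 * t4"
  proof (rule ccontr)
    assume "t2 \<noteq> 2 * t4"
    then have "t2 = - (2 * t4)" using f2(3) f4(3) by (auto simp: abs_if split: if_splits)
    then have "(t2 + t4) * (t2 + t4) = l * l" using tt(1) by simp
    then have XX: "X *v (X *v axis i 1) = (if i = 1 then 0 else if i = 2 \<or> i = 3 then - (4 * (l * l)) else - (l * l)) *\<^sub>R axis i 1" for i
      using forall_7[of "\<lambda>i. X *v (X *v axis i 1) = (if i = 1 then 0 else if i = 2 \<or> i = 3 then - (4 * (l * l)) else - (l * l)) *\<^sub>R axis i 1"]
      by (simp add: X124 X35 X6 X7 mv_simps tt)
    define w where "w = transpose g *v f6"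
    have gw: "g *v w = f6" by (simp add: w_def G2_cancel[OF g])
    have "X *v (X *v w) = (- (9 * (l * l))) *\<^sub>R w"
      by (simp only: Xe gw G2_cancel[OF g] ZZ) (simp add: mv_simps w_def)
    then have "axis i 1 \<bullet> w = 0" for i
      by (rule g2_square_orthogonal[OF X XX]) (use l in auto)
    then have "w = 0" by (simp add: vec_eq_iff inner_axis')
    then show False using gw f6(1) by simp
  qed
  have "X = t4 *\<^sub>R K_p"
  proof (rule g2_determined[OF X])
    show "t4 *\<^sub>R K_p \<in> g2" using K_p_g2 subspace_scale[OF subspace_g2] by blast
    show "X *v axis i 1 = (t4 *\<^sub>R K_p) *v axis i 1" if "i \<in> {1,2,4}" for i
      using that by (auto simp: X124 t24 D_sum_apply K_p_axis)
  qed
  moreover have "g ** X ** transpose g = Z" unfolding X_def by (rule transpose_conj_cancel(2)[OF g])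
  ultimately have "Z = t4 *\<^sub>R Ad g K_p"
    using linear_scale[OF linear_matrix_conj[of g "transpose g"], of t4 K_p] by (simp add: Ad_def G2_matrix_inv[OF g])
  moreover have "t4 \<noteq> 0" using tt(1,4) by auto
  ultimately show ?thesis using g by blast
qed

section \<open>Transport from \<open>K_p\<close> to a general element\<close>

lemma principal_su2_conj_iff:
  assumes g: "g \<in> G2"
  shows "principal_su2 ((\<lambda>X. g ** X ** transpose g) ` L) \<longleftrightarrow> principal_su2 L"
proof
  assume "principal_su2 ((\<lambda>X. g ** X ** transpose g) ` L)"
  then show "principal_su2 L"
    using principal_su2_conj[OF G2_transpose[OF g]] by (fastforce simp: image_image transpose_conj_cancel(1)[OF g])
qed (rule principal_su2_conj[OF g])

text \<open>Rescaling both generators does not change the generated algebra, and every notion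
  involved is invariant under conjugation by \<open>g\<close>.\<close>

lemma principal_partners_conj:
  assumes c: "c \<noteq> 0" and g: "g \<in> G2" and Z: "Z = c *\<^sub>R Ad g K_p"
  shows "principal_partners Z = partner_set g"
proof -
  have Zg: "Z = c *\<^sub>R (g ** K_p ** transpose g)" by (simp add: Z Ad_def G2_matrix_inv[OF g])
  have key: "g ** T ** transpose g \<in> principal_partners Z \<longleftrightarrow> T \<in> principal_partners K_p" for T
  proof -
    have "(g ** T ** transpose g) ** Z ** (g ** T ** transpose g) = c *\<^sub>R (g ** (T ** K_p ** T) ** transpose g)"
      unfolding Zg by (simp add: bounded_bilinear.scaleR_left[OF bounded_bilinear_mm] bounded_bilinear.scaleR_right[OF bounded_bilinear_mm] conj_mult[OF g])
    then have "generated_lie_algebra Z ((g ** T ** transpose g) ** Z ** (g ** T ** transpose g)) =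
        (\<lambda>X. g ** X ** transpose g) ` generated_lie_algebra K_p (T ** K_p ** T)"
      by (simp only: Zg generated_lie_algebra_scale[OF c] generated_lie_algebra_conj[OF g])
    moreover have "g ** T ** transpose g \<in> reflections \<longleftrightarrow> T \<in> reflections"
      using reflection_conj[of T g] reflection_conj[of "g ** T ** transpose g" "transpose g"] g
      by (auto simp: G2_transpose transpose_conj_cancel(1))
    ultimately show ?thesis by (simp add: principal_partners_def principal_su2_conj_iff[OF g])
  qed
  have "principal_partners Z = (\<lambda>T. g ** T ** transpose g) ` principal_partners K_p"
  proof
    show "(\<lambda>T. g ** T ** transpose g) ` principal_partners K_p \<subseteq> principal_partners Z" using key by blast
    show "principal_partners Z \<subseteq> (\<lambda>T. g ** T ** transpose g) ` principal_partners K_p"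
    proof
      fix T assume "T \<in> principal_partners Z"
      then have "g ** (transpose g ** T ** g) ** transpose g \<in> principal_partners Z" by (simp only: transpose_conj_cancel(2)[OF g])
      then show "T \<in> (\<lambda>T. g ** T ** transpose g) ` principal_partners K_p"
        unfolding key by (rule rev_image_eqI) (simp only: transpose_conj_cancel(2)[OF g])
    qed
  qed
  then show ?thesis unfolding base_partners partner_set_def F_amb_def by force
qed

text \<open>Otherwise \<open>Z\<close> and \<open>T ** Z ** T\<close> would both preserve the
  imaginary part of \<open>H_A\<close>, a proper nonzero subspace, against irreducibility.\<close>

lemma H_A_not_invariant:
  assumes Z: "Z \<in> k_A" and T: "T \<in> principal_partners Z"
  shows "aut_action T ` H_A \<noteq> H_A"
proof
  assume TH: "aut_action T ` H_A = H_A"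
  define W :: "(real^7) set" where "W = {v. (0, v) \<in> H_A}"
  have W: "v \<in> W \<longleftrightarrow> v$4 = 0 \<and> v$5 = 0 \<and> v$6 = 0 \<and> v$7 = 0" for v by (simp add: W_def H_A_iff)
  have sW: "subspace W" by (rule subspaceI) (auto simp: W)
  have TW: "T *v v \<in> W" if "v \<in> W" for v
  proof -
    have "aut_action T (0, v) \<in> H_A" using that TH by (auto simp: W_def)
    then show ?thesis by (simp add: W_def aut_action_def)
  qed
  have ZW: "Z *v v \<in> W" if "v \<in> W" for v
  proof -
    have "der_action Z (0, v) \<in> H_A" using that Z by (auto simp: W_def k_A_def)
    then show ?thesis by (simp add: W_def der_action_def)
  qed
  have "generated_lie_algebra Z (T ** Z ** T) \<subseteq> {X. \<forall>w\<in>W. X *v w \<in> W}"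
    by (rule generated_lie_algebra_props(4)[OF stabilizer_lie_subalgebra[OF sW]])
      (use ZW TW in \<open>auto simp flip: matrix_vector_mul_assoc\<close>)
  moreover have "acts_irreducibly (generated_lie_algebra Z (T ** Z ** T))"
    using T by (simp add: principal_partners_def principal_su2_def)
  ultimately have "W = {0} \<or> W = UNIV" using sW unfolding acts_irreducibly_def by blast
  moreover have "axis 1 1 \<in> W" "axis 1 (1::real) \<noteq> (0::real^7)" "axis 4 1 \<notin> W" by (simp_all add: W axis_def vec_eq_7)
  ultimately show False by blast
qed

theorem proposition6p7:
  shows "two_dim_torus C_p \<and>
    (\<forall>Z. Z \<in> g2 \<and> Z \<noteq> 0 \<and> principal_spectrum Z \<longrightarrow>
      (\<exists>c g. c \<noteq> 0 \<and> g \<in> G2 \<and> Z = c *\<^sub>R Ad g K_p) \<and>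
      (\<forall>c g. c \<noteq> 0 \<and> g \<in> G2 \<and> Z = c *\<^sub>R Ad g K_p \<longrightarrow>
        principal_partners Z =
          {conjugate_reflection g u \<theta> | u \<theta>.
             u \<in> C_p \<and> 0 < \<theta> \<and> \<theta> < pi / 2} \<and>
        (\<forall>T \<in> principal_partners Z.
           \<exists>!p. p \<in> C_p \<times> {0<..<pi/2} \<and> T = conjugate_reflection g (fst p) (snd p)) \<and>
        analytic_diffeomorphism
          (\<lambda>(u, \<theta>). conjugate_reflection g u \<theta>)
          (C_p \<times> {0<..<pi/2}) (principal_partners Z)) \<and>
      embedded_analytic_submanifold TYPE(real^8) 3 5 reflections (principal_partners Z) \<and>
      (Z \<in> k_A \<longrightarrow> (\<forall>T \<in> principal_partners Z. aut_action T ` H_A \<noteq> H_A)))"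
proof (intro conjI allI impI ballI)
  show "two_dim_torus C_p" by (rule two_dim_torus_C_p)
next
  fix Z assume "Z \<in> g2 \<and> Z \<noteq> 0 \<and> principal_spectrum Z"
  then have ex: "\<exists>c g. c \<noteq> 0 \<and> g \<in> G2 \<and> Z = c *\<^sub>R Ad g K_p" using principal_spectrum_conj by blast
  then show "\<exists>c g. c \<noteq> 0 \<and> g \<in> G2 \<and> Z = c *\<^sub>R Ad g K_p" .
  then obtain c g where "c \<noteq> 0" "g \<in> G2" "Z = c *\<^sub>R Ad g K_p" by blast
  then show "embedded_analytic_submanifold TYPE(real^8) 3 5 reflections (principal_partners Z)"
    by (simp add: principal_partners_conj partner_embedded)
next
  fix Z c g assume "c \<noteq> 0 \<and> g \<in> G2 \<and> Z = c *\<^sub>R Ad g K_p"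
  then have g: "g \<in> G2" and PZ: "principal_partners Z = partner_set g" using principal_partners_conj by blast+
  show "principal_partners Z = {conjugate_reflection g u \<theta> | u \<theta>. u \<in> C_p \<and> 0 < \<theta> \<and> \<theta> < pi / 2}"
  proof -
    have "{conjugate_reflection g u \<theta> | u \<theta>. u \<in> C_p \<and> 0 < \<theta> \<and> \<theta> < pi / 2}
        = (\<lambda>p. conjugate_reflection g (fst p) (snd p)) ` (C_p \<times> {0<..<pi/2})"
      by (fastforce simp: image_iff)
    also have "\<dots> = partner_set g"
      unfolding partner_set_def by (rule image_cong[OF refl]) (auto simp: conjugate_reflection_eq[OF g])
    finally show ?thesis by (simp only: PZ)
  qed
  show "analytic_diffeomorphism (\<lambda>(u, \<theta>). conjugate_reflection g u \<theta>) (C_p \<times> {0<..<pi/2}) (principal_partners Z)"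
    unfolding PZ by (rule partner_diffeo[OF g])
  fix T assume T: "T \<in> principal_partners Z"
  then obtain p where p: "p \<in> C_p \<times> {0<..<pi/2}" "T = F_amb g p" unfolding PZ partner_set_def by blast
  show "\<exists>!p. p \<in> C_p \<times> {0<..<pi/2} \<and> T = conjugate_reflection g (fst p) (snd p)"
  proof (rule ex1I[of _ p])
    show "p \<in> C_p \<times> {0<..<pi/2} \<and> T = conjugate_reflection g (fst p) (snd p)"
      using p by (auto simp: conjugate_reflection_eq[OF g])
    fix q assume q: "q \<in> C_p \<times> {0<..<pi/2} \<and> T = conjugate_reflection g (fst q) (snd q)"
    then have qC: "q \<in> C_p \<times> {0<..<pi/2}" and "F_amb g p = F_amb g q"
      unfolding p(2) by (auto simp: conjugate_reflection_eq[OF g])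
    then show "q = p" using rho_F_amb(1)[OF g qC] rho_F_amb(1)[OF g p(1)] by (simp only:)
  qed
next
  fix Z T assume "Z \<in> k_A" "T \<in> principal_partners Z"
  then show "aut_action T ` H_A \<noteq> H_A" by (rule H_A_not_invariant)
qed

end
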